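(* Assume that under $\mathbb P$ the associated random walk has $\mathbb E[X]=0$ and that the distribution of $X$ under $\mathbb P$ is nonlattice and belongs to the domain of attraction of a two-sided stable law with index $\alpha\in(1,2]$ (full setting, norming sequence $c_n$, measures $\mathbb P^+=\mathbb P^+_0$, $\mathbb P^-_x$, function $V$ and constant $K$ as in the context). Fix $0<\delta<1$ and write $\delta n$ for $\lfloor\delta n\rfloor$. Let $W_n:=w_n(F_1,\dots,F_{\delta n})$, $n\in\mathbb N$, be random variables with values in a Euclidean (or Polish) space $\mathcal W$ such that, as $n\to\infty$, $W_n\to W_\infty$ $\mathbb P^+$-a.s. for some $\mathcal W$-valued random variable $W_\infty$. Also let $T_n:=t_n(F_1,\dots,F_{\delta n})$, $n\ge1$, be random variables with values in a Euclidean (or Polish) space $\mathcal T$ such that, as $n\to\infty$, $T_n\to T_\infty$ $\mathbb P^-_x$-a.s. for all $x\le0$ and some $\mathcal T$-valued random variable $T_\infty$. Denote $\tilde T_n:=t_n(F_n,F_{n-1},\dots,F_{n-\delta n+1})$. Let, further, $\varphi:\mathcal W\times\mathcal T\times[0,\infty)\to\mathbb R$ be a continuous function such that $$\sup_{(u,v,z)\in\mathcal W\times\mathcal T\times[0,\infty)}|\varphi(u,v,z)|e^{\theta z}<\infty$$ for some $\theta>0$. Then $$\lim_{n\to\infty}nc_n\,\mathbb E[\varphi(W_n,\tilde T_n,S_n);\,L_n\ge0]=K\iiint_{\mathcal W\times\mathcal T\times(-\infty,0]}\varphi(u,v,-z)\,\mathbb P^+(W_\infty\in du)\,\mathbb P^-_z(T_\infty\in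 dv)\,V(z)\,dz .$$
   Context: Environment. $F$ is a random probability measure on $\mathbb N_0$ (random element of the Polish space $\Delta$ of such measures with the total variation metric), and $F_1,F_2,\dots$ are i.i.d. copies of $F$ under $\mathbf P$. Put $m(F)=\sum_{j\ge1}jF(\{j\})$, $X=\log m(F)$, $X_n=\log m(F_n)$, $S_n=S_0+X_1+\dots+X_n$. Standing assumptions: the generating function of $F$ is geometric with probability 1, i.e. $\sum_jF(\{j\})s^j=\frac1{1+e^X(1-s)}$; $-\infty<\mathbf E[X]<0$; and there is $\varkappa\in(0,1]$ with $\mathbf E[Xe^{\varkappa X}]=0$ ($\varkappa=1$: intermediate subcritical; $\varkappa=\beta<1$: weakly subcritical). Measure $\mathbb P$. With $\gamma=\mathbf E[e^{\varkappa X}]$, $\mathbb P$ is defined by $\mathbb E[\psi(F_1,\dots,F_n)]=\gamma^{-n}\mathbf E[\psi(F_1,\dots,F_n)e^{\varkappa(X_1+\dots+X_n)}]$ for all $n$ and bounded measurable $\psi$; under $\mathbb P$ the $F_n$ are i.i.d. and $\mathbb E[X]=0$. Write $\mathbb P_x$, $\mathbb E_x$ when $S_0=x$ (the environment having the same law as under $\mathbb P$); $\mathbb P=\mathbb P_0$. The domain-of-attraction assumption means that there is an increasing positive sequence $c_n=n^{1/\alpha}l_1(n)$, $l_1$ slowly varying, fixed from now on, such that $S_n/c_n$ converges in distribution under $\mathbb P$ to the two-sided (not concentrated on a half-line) stable law of index $\alpha$. Nonlattice means not concentrated on any $a+h\mathbb Z$, $h>0$. Notation. $M_n=\max(S_1,\dots,S_n)$,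 $L_n=\min(S_0,S_1,\dots,S_n)$; $\mathbb E[\,\cdot\,;A]=\mathbb E[\,\cdot\,I_A]$. $$U(x)=1+\sum_{n\ge1}\mathbb P(S_n\ge-x,\,M_n<0)\ (x\ge0),\quad U(x)=0\ (x<0),$$ $$V(x)=1+\sum_{n\ge1}\mathbb P(S_n<-x,\,L_n\ge0)\ (x\le0),\quad V(x)=0\ (x>0).$$ It is known that $\mathbb E[U(x+X);x+X\ge0]=U(x)$ for $x\ge0$ and $\mathbb E[V(x+X);x+X<0]=V(x)$ for $x\le0$. Hence there are probability measures $\mathbb P^+_x$ ($x\ge0$) and $\mathbb P^-_x$ ($x\le0$) on the environment sequences (with $S_0=x$) determined by $$\mathbb E^+_x[O_n]=\frac1{U(x)}\mathbb E_x[O_nU(S_n);L_n\ge0],\qquad \mathbb E^-_x[O_n]=\frac1{V(x)}\mathbb E_x[O_nV(S_n);M_n<0]$$ for all $n$ and all bounded random variables $O_n$ that are measurable functions of $F_1,\dots,F_n$. Write $\mathbb P^\pm=\mathbb P^\pm_0$. Constant $K$. It is known that if $\mathbb E[X]=0$ and the distribution of $X$ under $\mathbb P$ is nonlattice and belongs to the domain of attraction of a two-sided stable law with index $\alpha\in(1,2]$, with norming sequence $c_n$, then there is a constant $K>0$, independent of $\theta$ and $x$, such that for each $\theta>0$ and $x\ge0$, as $n\to\infty$, $$\mathbb E_x[e^{-\theta S_n};L_n\ge0]\sim\frac{K}{nc_n}\,U(x)\int_{-\infty}^0e^{\theta z}V(z)\,dz;$$ this is the constant $K$ in the claim. *)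

theory Defs
  imports "HOL-Probability.Probability" "HOL-Library.Landau_Symbols"
begin

section \<open>The space of offspring distributions\<close>

text \<open>Probability measures on the nonnegative integers are represented by the type \<open>nat pmf\<close>.\<close>

definition tv_dist :: "nat pmf \<Rightarrow> nat pmf \<Rightarrow> real" where
  "tv_dist p q = (SUP A. \<bar>measure (measure_pmf p) A - measure (measure_pmf q) A\<bar>)"

lemma tv_dist_upper:
  "\<bar>measure (measure_pmf p) A - measure (measure_pmf q) A\<bar> \<le> tv_dist p q"
proof -
  have "\<bar>measure (measure_pmf p) B - measure (measure_pmf q) B\<bar> \<le> 1" for B
  proof -
    have "measure (measure_pmf p) B \<le> 1" "measure (measure_pmf q) B \<le> 1"
      by (rule measure_pmf.prob_le_1)+
    moreover have "0 \<le> measure (measure_pmf p) B" "0 \<le> measure (measure_pmf q) B"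
      by (rule measure_nonneg)+
    ultimately show ?thesis by linarith
  qed
  then have "bdd_above (range (\<lambda>B. \<bar>measure (measure_pmf p) B - measure (measure_pmf q) B\<bar>))"
    by (intro bdd_aboveI[where M = 1]) blast
  then show ?thesis
    unfolding tv_dist_def by (rule cSUP_upper2[where x = A]) auto
qed

lemma Metric_space_tv_dist: "Metric_space UNIV tv_dist"
proof
  show nn: "0 \<le> tv_dist p q" for p q
    using tv_dist_upper[of p "{}" q] by simp
  show "tv_dist p q = tv_dist q p" for p q
    unfolding tv_dist_def by (simp add: abs_minus_commute)
  show "tv_dist p q = 0 \<longleftrightarrow> p = q" for p q
  proof
    assume *: "tv_dist p q = 0"
    have "pmf p k = pmf q k" for k
      using tv_dist_upper[of p "{k}" q] * by (simp add: measure_pmf_single)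
    then show "p = q" by (rule pmf_eqI)
  qed (simp add: tv_dist_def)
  show "tv_dist p r \<le> tv_dist p q + tv_dist q r" for p q r
  proof -
    have "\<bar>measure (measure_pmf p) A - measure (measure_pmf r) A\<bar> \<le> tv_dist p q + tv_dist q r" for A
      using tv_dist_upper[of p A q] tv_dist_upper[of q A r] by linarith
    then show ?thesis
      unfolding tv_dist_def[of p r] by (intro cSUP_least) auto
  qed
qed

definition Delta :: "nat pmf measure" where
  "Delta = sigma UNIV {G. openin (Metric_space.mtopology UNIV tv_dist) G}"

text \<open>For distributions with mean zero or infinity the value of \<open>log_mean\<close> is meaningless.
  Such distributions have probability zero whenever \<open>geometric_gf\<close> holds almost surely:
  for any real value of \<open>log_mean p\<close>, the right-hand side of \<open>geometric_gf\<close> is the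
  generating function of a distribution with positive finite mean.\<close>

definition offspring_mean :: "nat pmf \<Rightarrow> real" where
  "offspring_mean p = (\<Sum>j. real j * pmf p j)"

definition log_mean :: "nat pmf \<Rightarrow> real" where
  "log_mean p = ln (offspring_mean p)"

definition geometric_gf :: "nat pmf \<Rightarrow> bool" where
  "geometric_gf p \<longleftrightarrow>
     (\<forall>s\<in>{0..1}. (\<lambda>j. pmf p j * s ^ j) sums (1 / (1 + exp (log_mean p) * (1 - s))))"

section \<open>Environment sequences and the associated random walk\<close>

text \<open>Indices are shifted by one: the environment \<open>F\<^sub>i\<close>, \<open>i \<ge> 1\<close>, is the coordinate \<open>\<omega> (i - 1)\<close>.\<close>

type_synonym env = "nat \<Rightarrow> nat pmf"

definition env_space :: "env measure" where
  "env_space = (\<Pi>\<^sub>M i\<in>UNIV. Delta)"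

definition iid_env :: "nat pmf measure \<Rightarrow> env measure" where
  "iid_env Q = (\<Pi>\<^sub>M i\<in>UNIV. Q)"

text \<open>\<open>env_prefix k \<omega>\<close> is \<open>(F\<^sub>1, \<dots>, F\<^sub>k)\<close> and
  \<open>env_reversed n k \<omega>\<close> is \<open>(F\<^sub>n, F\<^sub>n\<^sub>-\<^sub>1, \<dots>, F\<^sub>n\<^sub>-\<^sub>k\<^sub>+\<^sub>1)\<close>.\<close>

definition env_prefix :: "nat \<Rightarrow> env \<Rightarrow> env" where
  "env_prefix k \<omega> = (\<lambda>i\<in>{..<k}. \<omega> i)"

definition env_reversed :: "nat \<Rightarrow> nat \<Rightarrow> env \<Rightarrow> env" where
  "env_reversed n k \<omega> = (\<lambda>i\<in>{..<k}. \<omega> (n - 1 - i))"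

abbreviation prefix_space :: "nat \<Rightarrow> env measure" where
  "prefix_space k \<equiv> (\<Pi>\<^sub>M i\<in>{..<k}. Delta)"

text \<open>The starting point \<open>S\<^sub>0 = x\<close> is a parameter of the walk, so that the expectation
  under \<open>P\<^sub>x\<close> is always an integral with respect to \<open>P\<close>.\<close>

definition walk :: "real \<Rightarrow> nat \<Rightarrow> env \<Rightarrow> real" where
  "walk x n \<omega> = x + (\<Sum>i<n. log_mean (\<omega> i))"

definition walk_min :: "real \<Rightarrow> nat \<Rightarrow> env \<Rightarrow> real" where
  "walk_min x n \<omega> = Min ((\<lambda>k. walk x k \<omega>) ` {0..n})"

definition walk_max :: "real \<Rightarrow> nat \<Rightarrow> env \<Rightarrow> real" where
  "walk_max x n \<omega> = Max ((\<lambda>k. walk x k \<omega>) ` {1..n})"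

section \<open>Changes of measure\<close>

definition tilted_env_law :: "nat pmf measure \<Rightarrow> real \<Rightarrow> env measure \<Rightarrow> bool" where
  "tilted_env_law Q \<kappa> P \<longleftrightarrow>
     prob_space P \<and> sets P = sets env_space \<and>
     (\<forall>n. \<forall>\<psi> \<in> borel_measurable (prefix_space n). bounded (\<psi> ` space (prefix_space n)) \<longrightarrow>
        (LINT \<omega>|P. \<psi> (env_prefix n \<omega>)) =
        (1 / (LINT p|Q. exp (\<kappa> * log_mean p)) ^ n) *
        (LINT \<omega>|iid_env Q. \<psi> (env_prefix n \<omega>) * exp (\<kappa> * (\<Sum>i<n. log_mean (\<omega> i)))))"

definition renewal_U :: "env measure \<Rightarrow> real \<Rightarrow> real" where
  "renewal_U P x = (if 0 \<le> x
     then 1 + (\<Sum>n. measure P {\<omega> \<in> space P. - x \<le> walk 0 (Suc n) \<omega> \<and> walk_max 0 (Suc n) \<omega> < 0})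
     else 0)"

definition renewal_V :: "env measure \<Rightarrow> real \<Rightarrow> real" where
  "renewal_V P x = (if x \<le> 0
     then 1 + (\<Sum>n. measure P {\<omega> \<in> space P. walk 0 (Suc n) \<omega> < - x \<and> 0 \<le> walk_min 0 (Suc n) \<omega>})
     else 0)"

text \<open>The case \<open>n = 0\<close>, where \<open>walk_max\<close> would be an empty maximum, is subsumed by \<open>n = 1\<close>.\<close>

definition conditioned_nonneg :: "env measure \<Rightarrow> real \<Rightarrow> env measure \<Rightarrow> bool" where
  "conditioned_nonneg P x P' \<longleftrightarrow>
     prob_space P' \<and> sets P' = sets env_space \<and>
     (\<forall>n\<ge>1. \<forall>\<psi> \<in> borel_measurable (prefix_space n). bounded (\<psi> ` space (prefix_space n)) \<longrightarrow>
        (LINT \<omega>|P'. \<psi> (env_prefix n \<omega>)) =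
        (1 / renewal_U P x) *
        (LINT \<omega>:{\<omega>. 0 \<le> walk_min x n \<omega>}|P. \<psi> (env_prefix n \<omega>) * renewal_U P (walk x n \<omega>)))"

definition conditioned_neg :: "env measure \<Rightarrow> real \<Rightarrow> env measure \<Rightarrow> bool" where
  "conditioned_neg P x P' \<longleftrightarrow>
     prob_space P' \<and> sets P' = sets env_space \<and>
     (\<forall>n\<ge>1. \<forall>\<psi> \<in> borel_measurable (prefix_space n). bounded (\<psi> ` space (prefix_space n)) \<longrightarrow>
        (LINT \<omega>|P'. \<psi> (env_prefix n \<omega>)) =
        (1 / renewal_V P x) *
        (LINT \<omega>:{\<omega>. walk_max x n \<omega> < 0}|P. \<psi> (env_prefix n \<omega>) * renewal_V P (walk x n \<omega>)))"

section \<open>Nonlattice laws and domains of attraction\<close>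

definition nonlattice :: "real measure \<Rightarrow> bool" where
  "nonlattice \<mu> \<longleftrightarrow> (\<forall>a h. h > 0 \<longrightarrow> \<not> (AE x in \<mu>. \<exists>k::int. x = a + h * of_int k))"

definition stable_law :: "real \<Rightarrow> real measure \<Rightarrow> bool" where
  "stable_law \<alpha> \<mu> \<longleftrightarrow>
     real_distribution \<mu> \<and> (\<forall>y. \<not> (AE x in \<mu>. x = y)) \<and>
     (\<forall>a>0. \<forall>b>0. \<exists>d.
        convolution (distr \<mu> borel (\<lambda>x. a * x)) (distr \<mu> borel (\<lambda>x. b * x)) =
        distr \<mu> borel (\<lambda>x. (a powr \<alpha> + b powr \<alpha>) powr (1 / \<alpha>) * x + d))"

definition two_sided :: "real measure \<Rightarrow> bool" where
  "two_sided \<mu> \<longleftrightarrow> (\<forall>a. \<not> (AE x in \<mu>. a \<le> x) \<and> \<not> (AE x in \<mu>. x \<le> a))"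

definition slowly_varying :: "(real \<Rightarrow> real) \<Rightarrow> bool" where
  "slowly_varying l \<longleftrightarrow>
     l \<in> borel_measurable borel \<and> (\<forall>\<^sub>F x in at_top. 0 < l x) \<and>
     (\<forall>r>0. ((\<lambda>x. l (r * x) / l x) \<longlongrightarrow> 1) at_top)"

definition stable_norming :: "real \<Rightarrow> (nat \<Rightarrow> real) \<Rightarrow> bool" where
  "stable_norming \<alpha> c \<longleftrightarrow>
     (\<forall>n\<ge>1. 0 < c n) \<and> mono_on {1..} c \<and>
     (\<exists>l. slowly_varying l \<and> (\<forall>n\<ge>1. c n = real n powr (1 / \<alpha>) * l (real n)))"

definition two_sided_stable_attraction :: "env measure \<Rightarrow> real \<Rightarrow> (nat \<Rightarrow> real) \<Rightarrow> bool" where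
  "two_sided_stable_attraction P \<alpha> c \<longleftrightarrow>
     stable_norming \<alpha> c \<and>
     (\<exists>\<mu>. stable_law \<alpha> \<mu> \<and> two_sided \<mu> \<and>
        weak_conv_m (\<lambda>n. distr P borel (\<lambda>\<omega>. walk 0 n \<omega> / c n)) \<mu>)"

definition is_constant_K :: "env measure \<Rightarrow> (nat \<Rightarrow> real) \<Rightarrow> real \<Rightarrow> bool" where
  "is_constant_K P c K \<longleftrightarrow> 0 < K \<and>
     (\<forall>\<theta>>0. \<forall>x\<ge>0.
        (\<lambda>n. LINT \<omega>:{\<omega>. 0 \<le> walk_min x n \<omega>}|P. exp (- \<theta> * walk x n \<omega>))
        \<sim>[sequentially]
        (\<lambda>n. K / (real n * c n) * renewal_U P x *
              (LINT z:{..0}|lborel. exp (\<theta> * z) * renewal_V P z)))"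

end

theory Submission
  imports Defs
begin

text \<open>Write \<open>D n = n c\<^sub>n\<close>. Splitting a path of length \<open>n\<close> into three pieces, of which the first stays
  nonnegative, the last one (read backwards) stays below \<open>y\<close>, and the middle one has to hit a unit
  interval, gives the uniform bound
  \<open>P\<^sub>x(L\<^sub>n \<ge> 0, y - 1 \<le> S\<^sub>n < y) \<le> C U(x) V(-y) / D n\<close>. Here the outer pieces are controlled by the
  decompositions at the first minimum and the last maximum, the middle one by a concentration
  inequality coming from the characteristic function of the stable limit. Consequently, on
  \<open>L\<^sub>n \<ge> 0\<close> and up to the factor \<open>D n\<close>, the law of the first \<open>\<delta>n\<close> steps is dominated by \<open>P\<^sup>+\<close> and
  that of the last \<open>\<delta>n\<close> steps, reversed, by a mixture of the \<open>P\<^sup>-\<^sub>z\<close>.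

  For functionals of a fixed number of first and last steps, the lower bound for the limit inferior
  follows from Fatou's lemma, the defining property of \<open>K\<close>, approximation of continuous functions by
  polynomials in \<open>exp (- z)\<close>, and duality under reversal of the increments. The domination allows
  replacing \<open>W\<^sub>n\<close>, \<open>T\<^sub>n\<close> by \<open>W\<^sub>k\<close>, \<open>T\<^sub>k\<close> with \<open>k\<close> large for Lipschitz functions, and Lipschitz
  functions approximate continuous ones from below by inf-convolution. Applying the lower bound to
  \<open>C \<plusminus> \<phi> e\<^bsup>\<theta>z\<^esup>\<close> yields the limit.\<close>

section \<open>Random walks and decompositions at extrema\<close>

definition rev_seq :: "nat \<Rightarrow> (nat \<Rightarrow> 'a) \<Rightarrow> nat \<Rightarrow> 'a" where
  "rev_seq k \<omega> = (\<lambda>i. if i < k then \<omega> (k - 1 - i) else \<omega> i)"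

lemma pred_le_real [measurable (raw)]:
  fixes f g :: "'a \<Rightarrow> real"
  assumes "f \<in> borel_measurable M" "g \<in> borel_measurable M"
  shows "Measurable.pred M (\<lambda>x. f x \<le> g x)"
  unfolding not_less[symmetric]
  by (intro pred_intros_logic borel_measurable_pred_less assms)

locale iid_walk = prob_space Q for Q :: "'a measure" +
  fixes X :: "'a \<Rightarrow> real"
  assumes X_measurable [measurable]: "X \<in> borel_measurable Q"
begin

sublocale seq: sequence_space Q
  by unfold_locales

abbreviation Pr :: "(nat \<Rightarrow> 'a) measure" where
  "Pr \<equiv> (\<Pi>\<^sub>M i\<in>UNIV. Q)"

definition S :: "nat \<Rightarrow> (nat \<Rightarrow> 'a) \<Rightarrow> real" where
  "S n \<omega> = (\<Sum>i<n. X (\<omega> i))"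

lemma S_measurable [measurable]: "S n \<in> borel_measurable Pr"
  unfolding S_def by measurable

lemma S_0 [simp]: "S 0 \<omega> = 0"
  by (simp add: S_def)

lemma rev_seq_measurable [measurable]: "rev_seq k \<in> Pr \<rightarrow>\<^sub>M Pr"
  unfolding rev_seq_def by (rule measurable_PiM_single') (auto simp: space_PiM PiE_iff)

lemma distr_rev_seq: "distr Pr Pr (rev_seq k) = Pr"
proof -
  define t where "t = (\<lambda>i. if i < k then k - 1 - i else i)"
  have *: "rev_seq k = (\<lambda>\<omega>. \<lambda>n\<in>UNIV. \<omega> (t n))"
    by (auto simp: rev_seq_def t_def fun_eq_iff)
  have "inj t"
    by (rule inj_onI) (auto simp: t_def split: if_splits)
  then show ?thesis
    unfolding * by (intro distr_PiM_reindex prob_space_axioms) auto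
qed

lemma S_comb_seq: "S (k + n) (comb_seq k \<omega> \<omega>') = S k \<omega> + S n \<omega>'"
proof -
  have "S (k + n) (comb_seq k \<omega> \<omega>') = (\<Sum>i<k. X (comb_seq k \<omega> \<omega>' i)) + (\<Sum>i=k..<k+n. X (comb_seq k \<omega> \<omega>' i))"
    unfolding S_def by (subst sum.atLeastLessThan_concat[of 0 k "k + n", symmetric, unfolded atLeast0LessThan]) auto
  also have "(\<Sum>i=k..<k+n. X (comb_seq k \<omega> \<omega>' i)) = S n \<omega>'"
    unfolding S_def by (rule sum.reindex_bij_witness[of _ "\<lambda>i. i + k" "\<lambda>i. i - k"]) (auto simp: comb_seq_def)
  also have "(\<Sum>i<k. X (comb_seq k \<omega> \<omega>' i)) = S k \<omega>"
    unfolding S_def by (rule sum.cong) (auto simp: comb_seq_def)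
  finally show ?thesis .
qed

lemma S_comb_seq_le: "j \<le> k \<Longrightarrow> S j (comb_seq k \<omega> \<omega>') = S j \<omega>"
  unfolding S_def by (rule sum.cong) (auto simp: comb_seq_def)

lemma S_comb_seq_ge: "k \<le> j \<Longrightarrow> S j (comb_seq k \<omega> \<omega>') = S k \<omega> + S (j - k) \<omega>'"
  using S_comb_seq[of k "j - k"] by simp

lemma S_rev_seq:
  assumes "j \<le> k"
  shows "S j (rev_seq k \<omega>) = S k \<omega> - S (k - j) \<omega>"
proof -
  have "S k \<omega> = (\<Sum>i<k-j. X (\<omega> i)) + (\<Sum>i=k-j..<k. X (\<omega> i))"
    unfolding S_def using assms
    by (subst sum.atLeastLessThan_concat[of 0 "k - j" k, symmetric, unfolded atLeast0LessThan]) auto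
  moreover have "(\<Sum>i=k-j..<k. X (\<omega> i)) = S j (rev_seq k \<omega>)"
    unfolding S_def using assms
    by (intro sum.reindex_bij_witness[of _ "\<lambda>i. k - 1 - i" "\<lambda>i. k - 1 - i"]) (auto simp: rev_seq_def)
  ultimately show ?thesis
    by (simp add: S_def)
qed

lemma S_rev_seq_self [simp]: "S k (rev_seq k \<omega>) = S k \<omega>"
  by (simp add: S_rev_seq)

lemma nn_integral_comb_seq:
  assumes [measurable]: "f \<in> borel_measurable Pr"
  shows "(\<integral>\<^sup>+\<omega>. f \<omega> \<partial>Pr) = (\<integral>\<^sup>+\<omega>. \<integral>\<^sup>+\<omega>'. f (comb_seq k \<omega> \<omega>') \<partial>Pr \<partial>Pr)"
proof -
  have "(\<integral>\<^sup>+\<omega>. f \<omega> \<partial>Pr) = (\<integral>\<^sup>+\<omega>. f \<omega> \<partial>(distr (Pr \<Otimes>\<^sub>M Pr) Pr (\<lambda>(\<omega>, \<omega>'). comb_seq k \<omega> \<omega>')))"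
    by (simp only: seq.PiM_comb_seq)
  also have "\<dots> = (\<integral>\<^sup>+x. f (comb_seq k (fst x) (snd x)) \<partial>(Pr \<Otimes>\<^sub>M Pr))"
    by (subst nn_integral_distr) (auto simp: split_beta')
  also have "\<dots> = (\<integral>\<^sup>+\<omega>. \<integral>\<^sup>+\<omega>'. f (comb_seq k \<omega> \<omega>') \<partial>Pr \<partial>Pr)"
    by (subst seq.P.nn_integral_fst[symmetric]) auto
  finally show ?thesis .
qed

lemma nn_integral_rev_seq:
  assumes [measurable]: "f \<in> borel_measurable Pr"
  shows "(\<integral>\<^sup>+\<omega>. f \<omega> \<partial>Pr) = (\<integral>\<^sup>+\<omega>. f (rev_seq k \<omega>) \<partial>Pr)"
proof -
  have "(\<integral>\<^sup>+\<omega>. f \<omega> \<partial>Pr) = (\<integral>\<^sup>+\<omega>. f \<omega> \<partial>distr Pr Pr (rev_seq k))"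
    by (simp only: distr_rev_seq)
  also have "\<dots> = (\<integral>\<^sup>+\<omega>. f (rev_seq k \<omega>) \<partial>Pr)"
    by (rule nn_integral_distr) auto
  finally show ?thesis .
qed

lemma ennreal_prob:
  assumes [measurable]: "Measurable.pred Pr A"
  shows "ennreal \<P>(\<omega> in Pr. A \<omega>) = (\<integral>\<^sup>+\<omega>. (if A \<omega> then 1 else 0) \<partial>Pr)"
proof -
  have "ennreal \<P>(\<omega> in Pr. A \<omega>) = (\<integral>\<^sup>+\<omega>. indicator {\<omega>\<in>space Pr. A \<omega>} \<omega> \<partial>Pr)"
    by (simp add: seq.P.emeasure_eq_measure)
  also have "\<dots> = (\<integral>\<^sup>+\<omega>. (if A \<omega> then 1 else 0) \<partial>Pr)"
    by (rule nn_integral_cong) auto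
  finally show ?thesis .
qed

lemma prob_comb_seq_le:
  assumes [measurable]: "Measurable.pred Pr A" "Measurable.pred Pr B"
    and imp: "\<And>\<omega> \<omega>'. A (comb_seq k \<omega> \<omega>') \<Longrightarrow> B \<omega>"
    and C: "\<And>\<omega>. B \<omega> \<Longrightarrow> \<P>(\<omega>' in Pr. A (comb_seq k \<omega> \<omega>')) \<le> C" and "0 \<le> C"
  shows "\<P>(\<omega> in Pr. A \<omega>) \<le> \<P>(\<omega> in Pr. B \<omega>) * C"
proof -
  have "ennreal \<P>(\<omega> in Pr. A \<omega>) = (\<integral>\<^sup>+\<omega>. \<integral>\<^sup>+\<omega>'. (if A (comb_seq k \<omega> \<omega>') then 1 else 0) \<partial>Pr \<partial>Pr)"
    unfolding ennreal_prob[OF assms(1)] by (subst nn_integral_comb_seq[where k = k]) auto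
  also have "\<dots> \<le> (\<integral>\<^sup>+\<omega>. (if B \<omega> then 1 else 0) * ennreal C \<partial>Pr)"
  proof (rule nn_integral_mono)
    fix \<omega> assume \<omega>[measurable]: "\<omega> \<in> space Pr"
    show "(\<integral>\<^sup>+\<omega>'. (if A (comb_seq k \<omega> \<omega>') then 1 else 0) \<partial>Pr) \<le> (if B \<omega> then 1 else 0) * ennreal C"
    proof (cases "B \<omega>")
      case True
      then show ?thesis
        using C[OF True] by (subst ennreal_prob[symmetric]) (auto intro: ennreal_leI)
    next
      case False
      then have "\<not> A (comb_seq k \<omega> \<omega>')" for \<omega>'
        using imp by blast
      then show ?thesis by simp
    qed
  qed
  also have "\<dots> = ennreal (\<P>(\<omega> in Pr. B \<omega>) * C)"
    by (subst nn_integral_multc) (auto simp: ennreal_prob[symmetric] ennreal_mult')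
  finally show ?thesis
    using \<open>0 \<le> C\<close> by (simp add: ennreal_le_iff)
qed

lemma prob_comb_seq:
  assumes [measurable]: "Measurable.pred Pr A" "Measurable.pred Pr B" "Measurable.pred Pr C"
    and eq: "\<And>\<omega> \<omega>'. A (comb_seq k \<omega> \<omega>') \<longleftrightarrow> B \<omega> \<and> C \<omega>'"
  shows "\<P>(\<omega> in Pr. A \<omega>) = \<P>(\<omega> in Pr. B \<omega>) * \<P>(\<omega> in Pr. C \<omega>)"
proof -
  have "ennreal \<P>(\<omega> in Pr. A \<omega>) = (\<integral>\<^sup>+\<omega>. \<integral>\<^sup>+\<omega>'. (if A (comb_seq k \<omega> \<omega>') then 1 else 0) \<partial>Pr \<partial>Pr)"
    unfolding ennreal_prob[OF assms(1)] by (subst nn_integral_comb_seq[where k = k]) auto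
  also have "\<dots> = (\<integral>\<^sup>+\<omega>. \<integral>\<^sup>+\<omega>'. (if B \<omega> then 1 else 0) * (if C \<omega>' then 1 else 0) \<partial>Pr \<partial>Pr)"
    by (intro nn_integral_cong) (auto simp: eq)
  also have "\<dots> = ennreal (\<P>(\<omega> in Pr. B \<omega>) * \<P>(\<omega> in Pr. C \<omega>))"
    by (simp add: nn_integral_cmult nn_integral_multc ennreal_prob[symmetric] ennreal_mult')
  finally show ?thesis by simp
qed

lemma prob_rev_seq:
  assumes [measurable]: "Measurable.pred Pr A"
  shows "\<P>(\<omega> in Pr. A \<omega>) = \<P>(\<omega> in Pr. A (rev_seq k \<omega>))"
proof -
  have "ennreal \<P>(\<omega> in Pr. A \<omega>) = ennreal \<P>(\<omega> in Pr. A (rev_seq k \<omega>))"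
    by (subst (1 2) ennreal_prob) (auto intro: nn_integral_rev_seq)
  then show ?thesis by simp
qed

definition stay_nonneg :: "real \<Rightarrow> nat \<Rightarrow> (nat \<Rightarrow> 'a) \<Rightarrow> bool" where
  "stay_nonneg x n \<omega> \<longleftrightarrow> (\<forall>j\<le>n. 0 \<le> x + S j \<omega>)"

definition stay_below :: "real \<Rightarrow> nat \<Rightarrow> (nat \<Rightarrow> 'a) \<Rightarrow> bool" where
  "stay_below y n \<omega> \<longleftrightarrow> (\<forall>j\<in>{1..n}. S j \<omega> < y)"

lemma stay_measurable [measurable]:
  "Measurable.pred Pr (stay_nonneg x n)" "Measurable.pred Pr (stay_below y n)"
  unfolding stay_nonneg_def[abs_def] stay_below_def[abs_def] by measurable

lemma stay_nonneg_comb_seq: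
  "stay_nonneg x (k + n) (comb_seq k \<omega> \<omega>') \<longleftrightarrow> stay_nonneg x k \<omega> \<and> stay_nonneg (x + S k \<omega>) n \<omega>'"
proof
  assume *: "stay_nonneg x (k + n) (comb_seq k \<omega> \<omega>')"
  have "0 \<le> x + S j \<omega>" if "j \<le> k" for j
    using * that by (auto simp: stay_nonneg_def S_comb_seq_le dest: spec[of _ j])
  moreover have "0 \<le> x + S k \<omega> + S j \<omega>'" if "j \<le> n" for j
    using * that by (auto simp: stay_nonneg_def S_comb_seq add.assoc dest: spec[of _ "k + j"])
  ultimately show "stay_nonneg x k \<omega> \<and> stay_nonneg (x + S k \<omega>) n \<omega>'"
    by (auto simp: stay_nonneg_def)
next
  assume *: "stay_nonneg x k \<omega> \<and> stay_nonneg (x + S k \<omega>) n \<omega>'"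
  show "stay_nonneg x (k + n) (comb_seq k \<omega> \<omega>')"
    unfolding stay_nonneg_def
  proof (intro allI impI)
    fix j assume "j \<le> k + n"
    then show "0 \<le> x + S j (comb_seq k \<omega> \<omega>')"
      using * by (cases "j \<le> k") (auto simp: stay_nonneg_def S_comb_seq_le S_comb_seq_ge add.assoc)
  qed
qed

lemma stay_mono:
  "m \<le> n \<Longrightarrow> stay_nonneg x n \<omega> \<Longrightarrow> stay_nonneg x m \<omega>"
  "m \<le> n \<Longrightarrow> stay_below y n \<omega> \<Longrightarrow> stay_below y m \<omega>"
  by (auto simp: stay_nonneg_def stay_below_def)

text \<open>The summands of \<open>renewal_U\<close> and \<open>renewal_V\<close>; the latter is reflected, i.e. a function
  of \<open>y = - x > 0\<close>.\<close>

definition u :: "real \<Rightarrow> nat \<Rightarrow> real" where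
  "u x k = \<P>(\<omega> in Pr. - x \<le> S k \<omega> \<and> stay_below 0 k \<omega>)"

definition v :: "real \<Rightarrow> nat \<Rightarrow> real" where
  "v y k = \<P>(\<omega> in Pr. S k \<omega> < y \<and> stay_nonneg 0 k \<omega>)"

lemma first_argmin:
  fixes s :: "nat \<Rightarrow> real"
  shows "\<exists>!k. k \<in> {..n} \<and> (\<forall>j<k. s k < s j) \<and> (\<forall>j\<le>n. k \<le> j \<longrightarrow> s k \<le> s j)"
proof -
  define m where "m = Min (s ` {..n})"
  define k where "k = (LEAST k. k \<le> n \<and> s k = m)"
  have "\<exists>k\<le>n. s k = m"
    using Min_in[of "s ` {..n}"] by (fastforce simp: m_def)
  then have k: "k \<le> n" "s k = m"
    unfolding k_def by (auto intro: LeastI2_ex)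
  have m: "m \<le> s j" if "j \<le> n" for j
    using that by (auto simp: m_def)
  have lt: "s k < s j" if "j < k" for j
    using not_less_Least[of j "\<lambda>k. k \<le> n \<and> s k = m"] that k m[of j] unfolding k_def[symmetric] by auto
  show ?thesis
  proof (rule ex1I[of _ k])
    fix i assume *: "i \<in> {..n} \<and> (\<forall>j<i. s i < s j) \<and> (\<forall>j\<le>n. i \<le> j \<longrightarrow> s i \<le> s j)"
    consider "i < k" | "i = k" | "k < i" by linarith
    then show "i = k"
    proof cases
      case 1
      with * k have "s i \<le> s k" by auto
      with 1 lt[of i] show ?thesis by simp
    next
      case 3
      with * have "s k > s i" by auto
      with * k m[of i] show ?thesis by simp
    qed
  qed (use lt k m in auto)
qed

lemma last_argmax:
  fixes s :: "nat \<Rightarrow> real"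
  shows "\<exists>!k. k \<in> {..n} \<and> (\<forall>j\<le>k. s j \<le> s k) \<and> (\<forall>j\<le>n. k < j \<longrightarrow> s j < s k)"
proof -
  define r where "r i = - s (n - i)" for i
  obtain k where k: "k \<le> n" "\<And>j. j < k \<Longrightarrow> r k < r j" "\<And>j. k \<le> j \<Longrightarrow> j \<le> n \<Longrightarrow> r k \<le> r j"
    using first_argmin[of n r] by auto
  have 1: "s j \<le> s (n - k)" if "j \<le> n - k" for j
    using k(3)[of "n - j"] that k(1) by (auto simp: r_def)
  have 2: "s j < s (n - k)" if "n - k < j" "j \<le> n" for j
    using k(2)[of "n - j"] that k(1) by (auto simp: r_def)
  show ?thesis
  proof (rule ex1I[of _ "n - k"])
    fix i assume *: "i \<in> {..n} \<and> (\<forall>j\<le>i. s j \<le> s i) \<and> (\<forall>j\<le>n. i < j \<longrightarrow> s j < s i)"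
    show "i = n - k"
    proof (cases "i < n - k")
      case True
      with * have "s (n - k) < s i" by auto
      with True 1[of i] show ?thesis by simp
    next
      case False
      with * have "s (n - k) \<le> s i" by auto
      with False * 2[of i] show ?thesis by (cases "i = n - k") auto
    qed
  qed (use 1 2 in auto)
qed

lemma prob_argmin:
  assumes [measurable]: "A \<in> sets borel"
  shows "\<P>(\<omega> in Pr. \<exists>k\<le>n. S k \<omega> \<in> A \<and> (\<forall>j<k. S k \<omega> < S j \<omega>) \<and> (\<forall>j\<le>n. k \<le> j \<longrightarrow> S k \<omega> \<le> S j \<omega>)) =
    (\<Sum>k\<le>n. \<P>(\<omega> in Pr. S k \<omega> \<in> A \<and> stay_below 0 k \<omega>) * \<P>(\<omega> in Pr. stay_nonneg 0 (n - k) \<omega>))"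
proof -
  define E where "E k \<omega> \<longleftrightarrow> S k \<omega> \<in> A \<and> (\<forall>j<k. S k \<omega> < S j \<omega>) \<and> (\<forall>j\<le>n. k \<le> j \<longrightarrow> S k \<omega> \<le> S j \<omega>)"
    for k and \<omega> :: "nat \<Rightarrow> 'a"
  have [measurable]: "Measurable.pred Pr (E k)" for k
    unfolding E_def[abs_def] by measurable
  have "\<P>(\<omega> in Pr. \<exists>k\<le>n. E k \<omega>) = (\<Sum>k\<le>n. \<P>(\<omega> in Pr. E k \<omega>))"
  proof (rule seq.P.prob_sum)
    have "(\<exists>k\<le>n. E k \<omega>) \<longrightarrow> (\<exists>!k. k \<in> {..n} \<and> E k \<omega>)" for \<omega>
      unfolding E_def using first_argmin[of n "\<lambda>i. S i \<omega>"] by auto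
    then show "AE \<omega> in Pr. (\<forall>k\<in>{..n}. E k \<omega> \<longrightarrow> (\<exists>k\<le>n. E k \<omega>)) \<and> ((\<exists>k\<le>n. E k \<omega>) \<longrightarrow> (\<exists>!k. k \<in> {..n} \<and> E k \<omega>))"
      by auto
  qed auto
  also have "\<P>(\<omega> in Pr. E k \<omega>) =
      \<P>(\<omega> in Pr. S k \<omega> \<in> A \<and> stay_below 0 k \<omega>) * \<P>(\<omega> in Pr. stay_nonneg 0 (n - k) \<omega>)" if "k \<le> n" for k
  proof -
    have "\<P>(\<omega> in Pr. E k \<omega>) =
        \<P>(\<omega> in Pr. S k \<omega> \<in> A \<and> (\<forall>j<k. S k \<omega> < S j \<omega>)) * \<P>(\<omega> in Pr. stay_nonneg 0 (n - k) \<omega>)"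
    proof (rule prob_comb_seq[where k = k])
      fix \<omega> \<omega>' :: "nat \<Rightarrow> 'a"
      have "(\<forall>j\<le>n. k \<le> j \<longrightarrow> S k \<omega> \<le> S j (comb_seq k \<omega> \<omega>')) \<longleftrightarrow> stay_nonneg 0 (n - k) \<omega>'"
        unfolding stay_nonneg_def
      proof safe
        fix j assume *: "\<forall>j\<le>n. k \<le> j \<longrightarrow> S k \<omega> \<le> S j (comb_seq k \<omega> \<omega>')" "j \<le> n - k"
        from *(1)[rule_format, of "k + j"] *(2) \<open>k \<le> n\<close> show "0 \<le> 0 + S j \<omega>'"
          by (simp add: S_comb_seq)
      qed (auto simp: S_comb_seq_ge)
      then show "E k (comb_seq k \<omega> \<omega>') \<longleftrightarrow> (S k \<omega> \<in> A \<and> (\<forall>j<k. S k \<omega> < S j \<omega>)) \<and> stay_nonneg 0 (n - k) \<omega>'"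
        by (auto simp: E_def S_comb_seq_le)
    qed auto
    also have "\<P>(\<omega> in Pr. S k \<omega> \<in> A \<and> (\<forall>j<k. S k \<omega> < S j \<omega>)) =
        \<P>(\<omega> in Pr. S k (rev_seq k \<omega>) \<in> A \<and> (\<forall>j<k. S k (rev_seq k \<omega>) < S j (rev_seq k \<omega>)))"
      by (rule prob_rev_seq) auto
    also have "\<dots> = \<P>(\<omega> in Pr. S k \<omega> \<in> A \<and> stay_below 0 k \<omega>)"
    proof -
      have "(\<forall>j<k. S k (rev_seq k \<omega>) < S j (rev_seq k \<omega>)) \<longleftrightarrow> stay_below 0 k \<omega>" for \<omega>
        unfolding stay_below_def
      proof safe
        fix j assume *: "\<forall>j<k. S k (rev_seq k \<omega>) < S j (rev_seq k \<omega>)" "j \<in> {1..k}"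
        with *(1)[rule_format, of "k - j"] show "S j \<omega> < 0"
          by (simp add: S_rev_seq)
      next
        fix j assume *: "\<forall>j\<in>{1..k}. S j \<omega> < 0" "j < k"
        with *(1)[rule_format, of "k - j"] show "S k (rev_seq k \<omega>) < S j (rev_seq k \<omega>)"
          by (simp add: S_rev_seq)
      qed
      then show ?thesis by simp
    qed
    finally show ?thesis .
  qed
  then have "(\<Sum>k\<le>n. \<P>(\<omega> in Pr. E k \<omega>)) = (\<Sum>k\<le>n. \<P>(\<omega> in Pr. S k \<omega> \<in> A \<and> stay_below 0 k \<omega>) *
      \<P>(\<omega> in Pr. stay_nonneg 0 (n - k) \<omega>))"
    by (intro sum.cong) auto
  finally show ?thesis
    by (simp add: E_def)
qed

lemma prob_argmax:
  "\<P>(\<omega> in Pr. stay_below y n \<omega> \<and> 0 < y) =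
    (\<Sum>k\<le>n. v y k * \<P>(\<omega> in Pr. stay_below 0 (n - k) \<omega>))"
proof -
  define E where "E k \<omega> \<longleftrightarrow> S k \<omega> < y \<and> (\<forall>j\<le>k. S j \<omega> \<le> S k \<omega>) \<and> (\<forall>j\<le>n. k < j \<longrightarrow> S j \<omega> < S k \<omega>)"
    for k and \<omega> :: "nat \<Rightarrow> 'a"
  have [measurable]: "Measurable.pred Pr (E k)" for k
    unfolding E_def[abs_def] by measurable
  have "\<P>(\<omega> in Pr. stay_below y n \<omega> \<and> 0 < y) = (\<Sum>k\<le>n. \<P>(\<omega> in Pr. E k \<omega>))"
  proof (rule seq.P.prob_sum)
    have "stay_below y n \<omega> \<and> 0 < y" if "k \<le> n" "E k \<omega>" for \<omega> k
    proof -
      have "S j \<omega> < y" if "j \<le> n" for j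
        using that \<open>E k \<omega>\<close> by (cases "j \<le> k") (auto simp: E_def intro: le_less_trans less_trans)
      from this[of 0] this show ?thesis
        by (auto simp: stay_below_def)
    qed
    moreover have "\<exists>!k. k \<in> {..n} \<and> E k \<omega>" if *: "stay_below y n \<omega> \<and> 0 < y" for \<omega>
    proof -
      have "S j \<omega> < y" if "j \<le> n" for j
        using * that by (cases "j = 0") (auto simp: stay_below_def)
      then have "(k \<in> {..n} \<and> E k \<omega>) \<longleftrightarrow>
          (k \<in> {..n} \<and> (\<forall>j\<le>k. S j \<omega> \<le> S k \<omega>) \<and> (\<forall>j\<le>n. k < j \<longrightarrow> S j \<omega> < S k \<omega>))" for k
        unfolding E_def by blast
      then show ?thesis
        using last_argmax[of n "\<lambda>i. S i \<omega>"] by simp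
    qed
    ultimately show "AE \<omega> in Pr. (\<forall>k\<in>{..n}. E k \<omega> \<longrightarrow> stay_below y n \<omega> \<and> 0 < y) \<and>
        (stay_below y n \<omega> \<and> 0 < y \<longrightarrow> (\<exists>!k. k \<in> {..n} \<and> E k \<omega>))"
      by auto
  qed auto
  also have "\<P>(\<omega> in Pr. E k \<omega>) = v y k * \<P>(\<omega> in Pr. stay_below 0 (n - k) \<omega>)" if "k \<le> n" for k
  proof -
    have "\<P>(\<omega> in Pr. E k \<omega>) =
        \<P>(\<omega> in Pr. S k \<omega> < y \<and> (\<forall>j\<le>k. S j \<omega> \<le> S k \<omega>)) * \<P>(\<omega> in Pr. stay_below 0 (n - k) \<omega>)"
    proof (rule prob_comb_seq[where k = k])
      fix \<omega> \<omega>' :: "nat \<Rightarrow> 'a"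
      have "(\<forall>j\<le>n. k < j \<longrightarrow> S j (comb_seq k \<omega> \<omega>') < S k \<omega>) \<longleftrightarrow> stay_below 0 (n - k) \<omega>'"
        unfolding stay_below_def
      proof safe
        fix j assume *: "\<forall>j\<le>n. k < j \<longrightarrow> S j (comb_seq k \<omega> \<omega>') < S k \<omega>" "j \<in> {1..n - k}"
        from *(1)[rule_format, of "k + j"] *(2) \<open>k \<le> n\<close> show "S j \<omega>' < 0"
          by (auto simp: S_comb_seq)
      qed (force simp: S_comb_seq_ge)
      then show "E k (comb_seq k \<omega> \<omega>') \<longleftrightarrow> (S k \<omega> < y \<and> (\<forall>j\<le>k. S j \<omega> \<le> S k \<omega>)) \<and> stay_below 0 (n - k) \<omega>'"
        by (auto simp: E_def S_comb_seq_le)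
    qed auto
    also have "\<P>(\<omega> in Pr. S k \<omega> < y \<and> (\<forall>j\<le>k. S j \<omega> \<le> S k \<omega>)) =
        \<P>(\<omega> in Pr. S k (rev_seq k \<omega>) < y \<and> (\<forall>j\<le>k. S j (rev_seq k \<omega>) \<le> S k (rev_seq k \<omega>)))"
      by (rule prob_rev_seq) auto
    also have "\<dots> = v y k"
    proof -
      have "(\<forall>j\<le>k. S j (rev_seq k \<omega>) \<le> S k (rev_seq k \<omega>)) \<longleftrightarrow> stay_nonneg 0 k \<omega>" for \<omega>
        unfolding stay_nonneg_def
      proof safe
        fix j assume *: "\<forall>j\<le>k. S j (rev_seq k \<omega>) \<le> S k (rev_seq k \<omega>)" "j \<le> k"
        with *(1)[rule_format, of "k - j"] show "0 \<le> 0 + S j \<omega>"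
          by (simp add: S_rev_seq)
      next
        fix j assume *: "\<forall>j\<le>k. 0 \<le> 0 + S j \<omega>" "j \<le> k"
        with *(1)[rule_format, of "k - j"] show "S j (rev_seq k \<omega>) \<le> S k (rev_seq k \<omega>)"
          by (simp add: S_rev_seq)
      qed
      then show ?thesis by (simp add: v_def)
    qed
    finally show ?thesis .
  qed
  then have "(\<Sum>k\<le>n. \<P>(\<omega> in Pr. E k \<omega>)) = (\<Sum>k\<le>n. v y k * \<P>(\<omega> in Pr. stay_below 0 (n - k) \<omega>))"
    by (intro sum.cong) auto
  finally show ?thesis .
qed

end

section \<open>Renewal functions\<close>

lemma sum_convolution_le:
  fixes f g :: "nat \<Rightarrow> real"
  assumes "\<And>i. 0 \<le> f i" "\<And>i. 0 \<le> g i"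
  shows "(\<Sum>j\<le>n. \<Sum>k\<le>j. f k * g (j - k)) \<le> (\<Sum>k\<le>n. f k) * (\<Sum>i\<le>n. g i)"
proof -
  have "(\<Sum>j\<le>n. \<Sum>k\<le>j. f k * g (j - k)) = (\<Sum>(i, j)\<in>{(i, j). i + j \<le> n}. f i * g j)"
    by (rule sum.triangle_reindex_eq[symmetric])
  also have "\<dots> \<le> (\<Sum>(i, j)\<in>{..n} \<times> {..n}. f i * g j)"
    by (rule sum_mono2) (auto simp: assms)
  also have "\<dots> = (\<Sum>k\<le>n. f k) * (\<Sum>i\<le>n. g i)"
    by (simp add: sum_product sum.cartesian_product)
  finally show ?thesis .
qed

lemma sum_mult_le_convolution:
  fixes f g :: "nat \<Rightarrow> real"
  assumes "\<And>i. 0 \<le> f i" "\<And>i. 0 \<le> g i"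
  shows "(\<Sum>k\<le>n. f k) * (\<Sum>i\<le>n. g i) \<le> (\<Sum>j\<le>2*n. \<Sum>k\<le>j. f k * g (j - k))"
proof -
  have "(\<Sum>k\<le>n. f k) * (\<Sum>i\<le>n. g i) = (\<Sum>(i, j)\<in>{..n} \<times> {..n}. f i * g j)"
    by (simp add: sum_product sum.cartesian_product)
  also have "\<dots> \<le> (\<Sum>(i, j)\<in>{(i, j). i + j \<le> 2*n}. f i * g j)"
  proof (rule sum_mono2)
    show "finite {(i, j). i + j \<le> 2 * n}"
      by (rule finite_subset[of _ "{..2*n} \<times> {..2*n}"]) auto
  qed (auto simp: assms)
  also have "\<dots> = (\<Sum>j\<le>2*n. \<Sum>k\<le>j. f k * g (j - k))"
    by (rule sum.triangle_reindex_eq)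
  finally show ?thesis .
qed

context iid_walk
begin

definition a :: "nat \<Rightarrow> real" where
  "a n = \<P>(\<omega> in Pr. stay_nonneg 0 n \<omega>)"

definition b :: "nat \<Rightarrow> real" where
  "b n = \<P>(\<omega> in Pr. stay_below 0 n \<omega>)"

lemma prob_mono:
  assumes "\<And>\<omega>. A \<omega> \<Longrightarrow> B \<omega>" and [measurable]: "Measurable.pred Pr B"
  shows "\<P>(\<omega> in Pr. A \<omega>) \<le> \<P>(\<omega> in Pr. B \<omega>)"
  using assms(1) by (intro seq.P.finite_measure_mono) auto

lemma uvab_nonneg [simp]: "0 \<le> u x k" "0 \<le> v y k" "0 \<le> a k" "0 \<le> b k"
  by (simp_all add: u_def v_def a_def b_def)

lemma prob_stay_antimono:
  assumes "m \<le> n"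
  shows "\<P>(\<omega> in Pr. stay_nonneg x n \<omega>) \<le> \<P>(\<omega> in Pr. stay_nonneg x m \<omega>)"
    "\<P>(\<omega> in Pr. stay_below y n \<omega>) \<le> \<P>(\<omega> in Pr. stay_below y m \<omega>)"
  by (rule prob_mono, erule stay_mono[OF assms], measurable)+

lemma prob_stay_nonneg: "\<P>(\<omega> in Pr. stay_nonneg x n \<omega>) = (\<Sum>k\<le>n. u x k * a (n - k))"
proof -
  have "stay_nonneg x n \<omega> \<longleftrightarrow> (\<exists>k\<le>n. S k \<omega> \<in> {-x..} \<and> (\<forall>j<k. S k \<omega> < S j \<omega>) \<and>
      (\<forall>j\<le>n. k \<le> j \<longrightarrow> S k \<omega> \<le> S j \<omega>))" for \<omega>
  proof
    assume *: "stay_nonneg x n \<omega>"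
    obtain k where "k \<le> n" "\<forall>j<k. S k \<omega> < S j \<omega>" "\<forall>j\<le>n. k \<le> j \<longrightarrow> S k \<omega> \<le> S j \<omega>"
      using first_argmin[of n "\<lambda>i. S i \<omega>"] by auto
    moreover have "S k \<omega> \<in> {-x..}"
      using * \<open>k \<le> n\<close> by (auto simp: stay_nonneg_def dest: spec[of _ k])
    ultimately show "\<exists>k\<le>n. S k \<omega> \<in> {-x..} \<and> (\<forall>j<k. S k \<omega> < S j \<omega>) \<and>
      (\<forall>j\<le>n. k \<le> j \<longrightarrow> S k \<omega> \<le> S j \<omega>)"
      by blast
  next
    assume "\<exists>k\<le>n. S k \<omega> \<in> {-x..} \<and> (\<forall>j<k. S k \<omega> < S j \<omega>) \<and>
      (\<forall>j\<le>n. k \<le> j \<longrightarrow> S k \<omega> \<le> S j \<omega>)"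
    then obtain k where k: "k \<le> n" "- x \<le> S k \<omega>" "\<And>j. j < k \<Longrightarrow> S k \<omega> < S j \<omega>"
      "\<And>j. j \<le> n \<Longrightarrow> k \<le> j \<Longrightarrow> S k \<omega> \<le> S j \<omega>"
      by auto
    have "S k \<omega> \<le> S j \<omega>" if "j \<le> n" for j
      using k(3)[of j] k(4)[of j] that by (cases "j < k") auto
    with k(2) show "stay_nonneg x n \<omega>"
      unfolding stay_nonneg_def by (smt (verit))
  qed
  then show ?thesis
    using prob_argmin[of "{-x..}" n] by (simp add: u_def a_def)
qed

lemma sum_b_a: "(\<Sum>k\<le>n. b k * a (n - k)) = 1"
proof -
  have "\<exists>k\<le>n. (\<forall>j<k. S k \<omega> < S j \<omega>) \<and> (\<forall>j\<le>n. k \<le> j \<longrightarrow> S k \<omega> \<le> S j \<omega>)" for \<omega>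
    using first_argmin[of n "\<lambda>i. S i \<omega>"] by auto
  then show ?thesis
    using prob_argmin[of UNIV n] by (simp add: b_def a_def seq.P.prob_space)
qed

lemma prob_stay_below: "0 < y \<Longrightarrow> \<P>(\<omega> in Pr. stay_below y n \<omega>) = (\<Sum>k\<le>n. v y k * b (n - k))"
  using prob_argmax[of y n] by (simp add: b_def)

lemma sum_a_sum_b_le: "(\<Sum>k\<le>n. a k) * (\<Sum>k\<le>n. b k) \<le> 2 * real n + 1"
  using sum_mult_le_convolution[of b a n] by (simp add: sum_b_a mult.commute)

lemma prob_stay_nonneg_Suc:
  assumes "0 \<le> x"
  shows "\<P>(\<omega> in Pr. e \<le> S 1 \<omega>) * \<P>(\<omega> in Pr. stay_nonneg (x + e) n \<omega>) \<le> \<P>(\<omega> in Pr. stay_nonneg x n \<omega>)"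
proof -
  have "\<P>(\<omega> in Pr. e \<le> S 1 \<omega>) * \<P>(\<omega> in Pr. stay_nonneg (x + e) n \<omega>) =
      \<P>(\<omega> in Pr. e \<le> S 1 \<omega> \<and> (\<forall>j\<le>n. 0 \<le> x + e + (S (1 + j) \<omega> - S 1 \<omega>)))"
  proof (rule prob_comb_seq[where k = 1, symmetric])
    show "e \<le> S 1 (comb_seq 1 \<omega> \<omega>') \<and>
       (\<forall>j\<le>n. 0 \<le> x + e + (S (1 + j) (comb_seq 1 \<omega> \<omega>') - S 1 (comb_seq 1 \<omega> \<omega>'))) \<longleftrightarrow>
       e \<le> S 1 \<omega> \<and> stay_nonneg (x + e) n \<omega>'" for \<omega> \<omega>'
      unfolding S_comb_seq S_comb_seq_le[OF order_refl] stay_nonneg_def by simp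
  qed auto
  also have "\<dots> \<le> \<P>(\<omega> in Pr. stay_nonneg x (Suc n) \<omega>)"
  proof (rule prob_mono)
    fix \<omega> assume *: "e \<le> S 1 \<omega> \<and> (\<forall>j\<le>n. 0 \<le> x + e + (S (1 + j) \<omega> - S 1 \<omega>))"
    show "stay_nonneg x (Suc n) \<omega>"
      unfolding stay_nonneg_def
    proof (intro allI impI)
      fix j assume "j \<le> Suc n"
      then show "0 \<le> x + S j \<omega>"
        using * assms by (cases j) (auto dest!: spec[of _ "j - 1"])
    qed
  qed auto
  also have "\<dots> \<le> \<P>(\<omega> in Pr. stay_nonneg x n \<omega>)"
    by (rule prob_stay_antimono) simp
  finally show ?thesis .
qed

lemma prob_stay_below_Suc:
  assumes "0 \<le> y" "0 < e"
  shows "\<P>(\<omega> in Pr. S 1 \<omega> \<le> - e) * \<P>(\<omega> in Pr. stay_below (y + e) n \<omega>) \<le> \<P>(\<omega> in Pr. stay_below y n \<omega>)"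
proof -
  have "\<P>(\<omega> in Pr. S 1 \<omega> \<le> - e) * \<P>(\<omega> in Pr. stay_below (y + e) n \<omega>) =
      \<P>(\<omega> in Pr. S 1 \<omega> \<le> - e \<and> (\<forall>j\<in>{1..n}. S (1 + j) \<omega> - S 1 \<omega> < y + e))"
  proof (rule prob_comb_seq[where k = 1, symmetric])
    show "S 1 (comb_seq 1 \<omega> \<omega>') \<le> - e \<and>
       (\<forall>j\<in>{1..n}. S (1 + j) (comb_seq 1 \<omega> \<omega>') - S 1 (comb_seq 1 \<omega> \<omega>') < y + e) \<longleftrightarrow>
       S 1 \<omega> \<le> - e \<and> stay_below (y + e) n \<omega>'" for \<omega> \<omega>'
      unfolding S_comb_seq S_comb_seq_le[OF order_refl] stay_below_def by simp
  qed auto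
  also have "\<dots> \<le> \<P>(\<omega> in Pr. stay_below y (Suc n) \<omega>)"
  proof (rule prob_mono)
    fix \<omega> assume *: "S 1 \<omega> \<le> - e \<and> (\<forall>j\<in>{1..n}. S (1 + j) \<omega> - S 1 \<omega> < y + e)"
    show "stay_below y (Suc n) \<omega>"
      unfolding stay_below_def
    proof
      fix j assume j: "j \<in> {1..Suc n}"
      show "S j \<omega> < y"
      proof (cases "j = 1")
        case True
        with * assms show ?thesis by simp
      next
        case False
        with j have "j - 1 \<in> {1..n}" "1 + (j - 1) = j" by auto
        with * have "S j \<omega> - S 1 \<omega> < y + e" by metis
        with * show ?thesis by simp
      qed
    qed
  qed auto
  also have "\<dots> \<le> \<P>(\<omega> in Pr. stay_below y n \<omega>)"
    by (rule prob_stay_antimono) simp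
  finally show ?thesis .
qed

end

locale oscillating_walk = iid_walk +
  fixes e :: real
  assumes e_pos: "0 < e"
    and up_pos: "0 < \<P>(\<omega> in Pr. e \<le> S 1 \<omega>)"
    and down_pos: "0 < \<P>(\<omega> in Pr. S 1 \<omega> \<le> - e)"
begin

lemma a_b_pos: "0 < a n" "0 < b n"
proof -
  have "\<P>(\<omega> in Pr. e \<le> S 1 \<omega>) ^ n \<le> a n"
  proof (induction n)
    case 0
    then show ?case by (simp add: a_def stay_nonneg_def seq.P.prob_space)
  next
    case (Suc n)
    have "\<P>(\<omega> in Pr. e \<le> S 1 \<omega>) * a n = \<P>(\<omega> in Pr. e \<le> S 1 \<omega> \<and> (\<forall>j\<le>n. 0 \<le> S (1 + j) \<omega> - S 1 \<omega>))"
      unfolding a_def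
    proof (rule prob_comb_seq[where k = 1, symmetric])
      show "e \<le> S 1 (comb_seq 1 \<omega> \<omega>') \<and>
         (\<forall>j\<le>n. 0 \<le> S (1 + j) (comb_seq 1 \<omega> \<omega>') - S 1 (comb_seq 1 \<omega> \<omega>')) \<longleftrightarrow>
         e \<le> S 1 \<omega> \<and> stay_nonneg 0 n \<omega>'" for \<omega> \<omega>'
        unfolding S_comb_seq S_comb_seq_le[OF order_refl] stay_nonneg_def by simp
    qed auto
    also have "\<dots> \<le> a (Suc n)"
      unfolding a_def
    proof (rule prob_mono)
      fix \<omega> assume *: "e \<le> S 1 \<omega> \<and> (\<forall>j\<le>n. 0 \<le> S (1 + j) \<omega> - S 1 \<omega>)"
      show "stay_nonneg 0 (Suc n) \<omega>"
        unfolding stay_nonneg_def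
      proof (intro allI impI)
        fix j assume "j \<le> Suc n"
        then show "0 \<le> 0 + S j \<omega>"
          using * e_pos by (cases j) (auto dest!: spec[of _ "j - 1"])
      qed
    qed auto
    finally show ?case
      using Suc mult_left_mono[of "\<P>(\<omega> in Pr. e \<le> S 1 \<omega>) ^ n" "a n" "\<P>(\<omega> in Pr. e \<le> S 1 \<omega>)"] by simp
  qed
  then show "0 < a n"
    using zero_less_power[OF up_pos, of n] by linarith
  have "\<P>(\<omega> in Pr. S 1 \<omega> \<le> - e) ^ n \<le> b n"
  proof (induction n)
    case 0
    then show ?case by (simp add: b_def stay_below_def seq.P.prob_space)
  next
    case (Suc n)
    have "\<P>(\<omega> in Pr. S 1 \<omega> \<le> - e) * b n = \<P>(\<omega> in Pr. S 1 \<omega> \<le> - e \<and> (\<forall>j\<in>{1..n}. S (1 + j) \<omega> - S 1 \<omega> < 0))"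
      unfolding b_def
    proof (rule prob_comb_seq[where k = 1, symmetric])
      show "S 1 (comb_seq 1 \<omega> \<omega>') \<le> - e \<and>
         (\<forall>j\<in>{1..n}. S (1 + j) (comb_seq 1 \<omega> \<omega>') - S 1 (comb_seq 1 \<omega> \<omega>') < 0) \<longleftrightarrow>
         S 1 \<omega> \<le> - e \<and> stay_below 0 n \<omega>'" for \<omega> \<omega>'
        unfolding S_comb_seq S_comb_seq_le[OF order_refl] stay_below_def by simp
    qed auto
    also have "\<dots> \<le> b (Suc n)"
      unfolding b_def
    proof (rule prob_mono)
      fix \<omega> assume *: "S 1 \<omega> \<le> - e \<and> (\<forall>j\<in>{1..n}. S (1 + j) \<omega> - S 1 \<omega> < 0)"
      show "stay_below 0 (Suc n) \<omega>"
        unfolding stay_below_def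
      proof
        fix j assume j: "j \<in> {1..Suc n}"
        show "S j \<omega> < 0"
        proof (cases "j = 1")
          case True
          with * e_pos show ?thesis by simp
        next
          case False
          with j have "j - 1 \<in> {1..n}" "1 + (j - 1) = j" by auto
          with * have "S j \<omega> - S 1 \<omega> < 0" by metis
          with * e_pos show ?thesis by simp
        qed
      qed
    qed auto
    finally show ?case
      using Suc mult_left_mono[of "\<P>(\<omega> in Pr. S 1 \<omega> \<le> - e) ^ n" "b n" "\<P>(\<omega> in Pr. S 1 \<omega> \<le> - e)"] by simp
  qed
  then show "0 < b n"
    using zero_less_power[OF down_pos, of n] by linarith
qed

lemma prob_stay_le:
  "\<exists>C. \<forall>n. \<P>(\<omega> in Pr. stay_nonneg x n \<omega>) \<le> C * a n \<and> \<P>(\<omega> in Pr. stay_below x n \<omega>) \<le> C * b n"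
proof -
  define p where "p = \<P>(\<omega> in Pr. e \<le> S 1 \<omega>)"
  define q where "q = \<P>(\<omega> in Pr. S 1 \<omega> \<le> - e)"
  have pq: "0 < p" "0 < q"
    using up_pos down_pos by (auto simp: p_def q_def)
  obtain m :: nat where m: "x \<le> real m * e"
    using reals_Archimedean3[OF e_pos] by (metis less_imp_le)
  have "p ^ j * \<P>(\<omega> in Pr. stay_nonneg (real j * e) n \<omega>) \<le> a n" for j n
  proof (induction j)
    case 0
    then show ?case by (simp add: a_def)
  next
    case (Suc j)
    have "p * \<P>(\<omega> in Pr. stay_nonneg (real j * e + e) n \<omega>) \<le> \<P>(\<omega> in Pr. stay_nonneg (real j * e) n \<omega>)"
      unfolding p_def using e_pos by (intro prob_stay_nonneg_Suc) simp
    then have "p ^ j * (p * \<P>(\<omega> in Pr. stay_nonneg (real j * e + e) n \<omega>)) \<le> p ^ j * \<P>(\<omega> in Pr. stay_nonneg (real j * e) n \<omega>)"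
      using pq by (intro mult_left_mono) auto
    with Suc show ?case by (simp add: algebra_simps)
  qed
  from this[of m] have "\<P>(\<omega> in Pr. stay_nonneg (real m * e) n \<omega>) \<le> a n / p ^ m" for n
    using pq by (simp add: pos_le_divide_eq mult.commute)
  moreover have "\<P>(\<omega> in Pr. stay_nonneg x n \<omega>) \<le> \<P>(\<omega> in Pr. stay_nonneg (real m * e) n \<omega>)" for n
    using m by (intro prob_mono) (force simp: stay_nonneg_def)+
  ultimately have 1: "\<P>(\<omega> in Pr. stay_nonneg x n \<omega>) \<le> a n / p ^ m" for n
    by (meson order_trans)
  have "q ^ j * \<P>(\<omega> in Pr. stay_below (real j * e) n \<omega>) \<le> b n" for j n
  proof (induction j)
    case 0
    then show ?case by (simp add: b_def)
  next
    case (Suc j)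
    have "q * \<P>(\<omega> in Pr. stay_below (real j * e + e) n \<omega>) \<le> \<P>(\<omega> in Pr. stay_below (real j * e) n \<omega>)"
      unfolding q_def using e_pos by (intro prob_stay_below_Suc) auto
    then have "q ^ j * (q * \<P>(\<omega> in Pr. stay_below (real j * e + e) n \<omega>)) \<le> q ^ j * \<P>(\<omega> in Pr. stay_below (real j * e) n \<omega>)"
      using pq by (intro mult_left_mono) auto
    with Suc show ?case by (simp add: algebra_simps)
  qed
  from this[of m] have "\<P>(\<omega> in Pr. stay_below (real m * e) n \<omega>) \<le> b n / q ^ m" for n
    using pq by (simp add: pos_le_divide_eq mult.commute)
  moreover have "\<P>(\<omega> in Pr. stay_below x n \<omega>) \<le> \<P>(\<omega> in Pr. stay_below (real m * e) n \<omega>)" for n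
    using m by (intro prob_mono) (force simp: stay_below_def)+
  ultimately have 2: "\<P>(\<omega> in Pr. stay_below x n \<omega>) \<le> b n / q ^ m" for n
    by (meson order_trans)
  show ?thesis
  proof (intro exI allI conjI)
    fix n
    have "a n / p ^ m \<le> (1 / p ^ m + 1 / q ^ m) * a n" "b n / q ^ m \<le> (1 / p ^ m + 1 / q ^ m) * b n"
      using pq by (auto simp: algebra_simps)
    with 1[of n] 2[of n] show "\<P>(\<omega> in Pr. stay_nonneg x n \<omega>) \<le> (1 / p ^ m + 1 / q ^ m) * a n"
      "\<P>(\<omega> in Pr. stay_below x n \<omega>) \<le> (1 / p ^ m + 1 / q ^ m) * b n"
      by linarith+
  qed
qed

lemma summable_u: "summable (u x)"
proof -
  obtain C where C: "\<forall>n. \<P>(\<omega> in Pr. stay_nonneg x n \<omega>) \<le> C * a n \<and> \<P>(\<omega> in Pr. stay_below x n \<omega>) \<le> C * b n"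
    using prob_stay_le[of x] ..
  have "(\<Sum>k\<le>n. u x k) \<le> C" for n
  proof -
    have "(\<Sum>k\<le>n. u x k) * a n \<le> (\<Sum>k\<le>n. u x k * a (n - k))"
      unfolding sum_distrib_right a_def
      by (intro sum_mono mult_left_mono prob_stay_antimono) auto
    also have "\<dots> \<le> C * a n"
      using C[rule_format, of n] by (simp add: prob_stay_nonneg)
    finally show "(\<Sum>k\<le>n. u x k) \<le> C"
      using a_b_pos(1)[of n] by simp
  qed
  then show ?thesis
    by (rule bounded_imp_summable[rotated]) simp
qed

lemma summable_v: "0 < y \<Longrightarrow> summable (v y)"
proof -
  assume "0 < y"
  obtain C where C: "\<forall>n. \<P>(\<omega> in Pr. stay_nonneg y n \<omega>) \<le> C * a n \<and> \<P>(\<omega> in Pr. stay_below y n \<omega>) \<le> C * b n"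
    using prob_stay_le[of y] ..
  have "(\<Sum>k\<le>n. v y k) \<le> C" for n
  proof -
    have "(\<Sum>k\<le>n. v y k) * b n \<le> (\<Sum>k\<le>n. v y k * b (n - k))"
      unfolding sum_distrib_right b_def
      by (intro sum_mono mult_left_mono prob_stay_antimono) auto
    also have "\<dots> \<le> C * b n"
      using C[rule_format, of n] \<open>0 < y\<close> by (simp add: prob_stay_below)
    finally show "(\<Sum>k\<le>n. v y k) \<le> C"
      using a_b_pos(2)[of n] by simp
  qed
  then show ?thesis
    by (rule bounded_imp_summable[rotated]) simp
qed

definition U :: "real \<Rightarrow> real" where "U x = (\<Sum>k. u x k)"

definition V :: "real \<Rightarrow> real" where "V y = (if 0 < y then \<Sum>k. v y k else 0)"

lemma sum_u_le: "(\<Sum>k\<le>n. u x k) \<le> U x"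
  unfolding U_def by (intro sum_le_suminf summable_u) auto

lemma sum_v_le: "0 < y \<Longrightarrow> (\<Sum>k\<le>n. v y k) \<le> V y"
  unfolding V_def by (auto intro!: sum_le_suminf summable_v)

lemma U_V_nonneg [simp]: "0 \<le> U x" "0 \<le> V y"
  unfolding U_def V_def by (auto intro!: suminf_nonneg summable_u summable_v)

lemma U_mono: "mono U"
proof
  fix x y :: real assume "x \<le> y"
  then have "u x k \<le> u y k" for k
    unfolding u_def by (intro prob_mono) auto
  then show "U x \<le> U y"
    unfolding U_def by (intro suminf_le summable_u)
qed

lemma V_mono: "mono V"
proof
  fix x y :: real assume "x \<le> y"
  then have "v x k \<le> v y k" for k
    unfolding v_def by (intro prob_mono) auto
  then have "0 < x \<Longrightarrow> (\<Sum>k. v x k) \<le> (\<Sum>k. v y k)"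
    using \<open>x \<le> y\<close> by (intro suminf_le summable_v) auto
  with \<open>x \<le> y\<close> show "V x \<le> V y"
    by (auto simp: V_def intro: suminf_nonneg summable_v)
qed

lemma U_V_measurable [measurable]: "U \<in> borel_measurable borel" "V \<in> borel_measurable borel"
  using U_mono V_mono by (auto intro: borel_measurable_mono)

lemma one_le_U: "0 \<le> x \<Longrightarrow> 1 \<le> U x"
  using sum_u_le[of x 0] by (simp add: u_def stay_below_def seq.P.prob_space)

lemma one_le_V: "0 < y \<Longrightarrow> 1 \<le> V y"
  using sum_v_le[of y 0] by (simp add: v_def stay_nonneg_def seq.P.prob_space)

text \<open>Both probabilities are antitone in \<open>n\<close>, so they are at most their averages over \<open>{0..n}\<close>;
  these are controlled by the renewal functions, and \<open>sum_b_a\<close> evaluates the product.\<close>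

lemma prob_stay_nonneg_times_stay_below:
  assumes "0 < y"
  shows "\<P>(\<omega> in Pr. stay_nonneg x n \<omega>) * \<P>(\<omega> in Pr. stay_below y n \<omega>) \<le> 2 * U x * V y / (real n + 1)"
proof -
  define A where "A = (\<Sum>k\<le>n. a k)"
  define B where "B = (\<Sum>k\<le>n. b k)"
  have AB: "0 \<le> A" "0 \<le> B" "A * B \<le> 2 * real n + 1"
    using sum_a_sum_b_le[of n] by (auto simp: A_def B_def intro!: sum_nonneg)
  have "(real n + 1) * \<P>(\<omega> in Pr. stay_nonneg x n \<omega>) = (\<Sum>j\<le>n. \<P>(\<omega> in Pr. stay_nonneg x n \<omega>))"
    by (simp add: algebra_simps)
  also have "\<dots> \<le> (\<Sum>j\<le>n. \<P>(\<omega> in Pr. stay_nonneg x j \<omega>))"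
    by (intro sum_mono prob_stay_antimono) auto
  also have "\<dots> \<le> (\<Sum>k\<le>n. u x k) * A"
    unfolding prob_stay_nonneg A_def by (rule sum_convolution_le) auto
  also have "\<dots> \<le> U x * A"
    using AB by (intro mult_right_mono sum_u_le) auto
  finally have 1: "(real n + 1) * \<P>(\<omega> in Pr. stay_nonneg x n \<omega>) \<le> U x * A" .
  have "(real n + 1) * \<P>(\<omega> in Pr. stay_below y n \<omega>) = (\<Sum>j\<le>n. \<P>(\<omega> in Pr. stay_below y n \<omega>))"
    by (simp add: algebra_simps)
  also have "\<dots> \<le> (\<Sum>j\<le>n. \<P>(\<omega> in Pr. stay_below y j \<omega>))"
    by (intro sum_mono prob_stay_antimono) auto
  also have "\<dots> \<le> (\<Sum>k\<le>n. v y k) * B"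
    unfolding prob_stay_below[OF assms] B_def by (rule sum_convolution_le) auto
  also have "\<dots> \<le> V y * B"
    using AB assms by (intro mult_right_mono sum_v_le) auto
  finally have 2: "(real n + 1) * \<P>(\<omega> in Pr. stay_below y n \<omega>) \<le> V y * B" .
  have "((real n + 1) * \<P>(\<omega> in Pr. stay_nonneg x n \<omega>)) * ((real n + 1) * \<P>(\<omega> in Pr. stay_below y n \<omega>)) \<le>
      (U x * A) * (V y * B)"
    using AB by (intro mult_mono 1 2) auto
  also have "\<dots> = (U x * V y) * (A * B)" by (simp add: algebra_simps)
  also have "\<dots> \<le> (U x * V y) * (2 * (real n + 1))"
    using AB by (intro mult_left_mono) auto
  finally have "(real n + 1) * ((real n + 1) * (\<P>(\<omega> in Pr. stay_nonneg x n \<omega>) * \<P>(\<omega> in Pr. stay_below y n \<omega>))) \<le>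
      (real n + 1) * (2 * U x * V y)"
    by (simp add: algebra_simps)
  then have "(real n + 1) * (\<P>(\<omega> in Pr. stay_nonneg x n \<omega>) * \<P>(\<omega> in Pr. stay_below y n \<omega>)) \<le> 2 * U x * V y"
    by (rule mult_left_le_imp_le) simp
  then show ?thesis
    by (simp add: pos_le_divide_eq mult.commute)
qed

text \<open>The first \<open>k\<close> steps stay nonnegative, the last \<open>k\<close> steps read backwards stay below \<open>y\<close>,
  and the middle piece must hit an interval of unit length.\<close>

lemma prob_stay_nonneg_local:
  assumes "0 < y" "0 \<le> C" and conc: "\<And>z. \<P>(\<omega> in Pr. z \<le> S l \<omega> \<and> S l \<omega> < z + 1) \<le> C"
  shows "\<P>(\<omega> in Pr. stay_nonneg x (k + (k + l)) \<omega> \<and> y - 1 \<le> x + S (k + (k + l)) \<omega> \<and> x + S (k + (k + l)) \<omega> < y)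
    \<le> 2 * U x * V y / (real k + 1) * C"
proof -
  have inner: "\<P>(\<omega> in Pr. stay_nonneg x (k + l) \<omega> \<and> y - 1 \<le> x + S (k + l) \<omega> \<and> x + S (k + l) \<omega> < y) \<le>
      \<P>(\<omega> in Pr. stay_below y k \<omega>) * C" for x
  proof -
    have "\<P>(\<omega> in Pr. stay_nonneg x (k + l) \<omega> \<and> y - 1 \<le> x + S (k + l) \<omega> \<and> x + S (k + l) \<omega> < y) =
      \<P>(\<omega> in Pr. stay_nonneg x (k + l) (rev_seq (k + l) \<omega>) \<and> y - 1 \<le> x + S (k + l) (rev_seq (k + l) \<omega>) \<and>
        x + S (k + l) (rev_seq (k + l) \<omega>) < y)"
      by (rule prob_rev_seq) measurable
    also have "\<dots> \<le> \<P>(\<omega> in Pr. stay_below y k \<omega> \<and> y - 1 - x \<le> S (k + l) \<omega> \<and> S (k + l) \<omega> < y - x)"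
    proof (rule prob_mono)
      fix \<omega> assume *: "stay_nonneg x (k + l) (rev_seq (k + l) \<omega>) \<and> y - 1 \<le> x + S (k + l) (rev_seq (k + l) \<omega>) \<and>
        x + S (k + l) (rev_seq (k + l) \<omega>) < y"
      have "S j \<omega> < y" if "j \<le> k" for j
      proof -
        have "0 \<le> x + S (k + l - j) (rev_seq (k + l) \<omega>)"
          using * by (auto simp: stay_nonneg_def)
        with * that show ?thesis
          by (simp add: S_rev_seq)
      qed
      with * show "stay_below y k \<omega> \<and> y - 1 - x \<le> S (k + l) \<omega> \<and> S (k + l) \<omega> < y - x"
        by (auto simp: stay_below_def)
    qed measurable
    also have "\<dots> \<le> \<P>(\<omega> in Pr. stay_below y k \<omega>) * C"
    proof (rule prob_comb_seq_le[where k = k])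
      fix \<omega> \<omega>'
      show "stay_below y k \<omega>"
        if "stay_below y k (comb_seq k \<omega> \<omega>') \<and> y - 1 - x \<le> S (k + l) (comb_seq k \<omega> \<omega>') \<and> S (k + l) (comb_seq k \<omega> \<omega>') < y - x"
        using that by (auto simp: stay_below_def S_comb_seq_le)
      have "\<P>(\<omega>' in Pr. stay_below y k (comb_seq k \<omega> \<omega>') \<and> y - 1 - x \<le> S (k + l) (comb_seq k \<omega> \<omega>') \<and> S (k + l) (comb_seq k \<omega> \<omega>') < y - x)
        \<le> \<P>(\<omega>' in Pr. (y - 1 - x - S k \<omega>) \<le> S l \<omega>' \<and> S l \<omega>' < (y - 1 - x - S k \<omega>) + 1)"
        by (rule prob_mono) (auto simp: S_comb_seq)
      also have "\<dots> \<le> C"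
        by (rule conc)
      finally show "\<P>(\<omega>' in Pr. stay_below y k (comb_seq k \<omega> \<omega>') \<and> y - 1 - x \<le> S (k + l) (comb_seq k \<omega> \<omega>') \<and> S (k + l) (comb_seq k \<omega> \<omega>') < y - x) \<le> C" .
    qed (use \<open>0 \<le> C\<close> in auto)
    finally show ?thesis .
  qed
  have "\<P>(\<omega> in Pr. stay_nonneg x (k + (k + l)) \<omega> \<and> y - 1 \<le> x + S (k + (k + l)) \<omega> \<and> x + S (k + (k + l)) \<omega> < y)
    \<le> \<P>(\<omega> in Pr. stay_nonneg x k \<omega>) * (\<P>(\<omega> in Pr. stay_below y k \<omega>) * C)"
  proof (rule prob_comb_seq_le[where k = k])
    fix \<omega>
    show "stay_nonneg x k \<omega>" if "stay_nonneg x (k + (k + l)) (comb_seq k \<omega> \<omega>') \<and>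
        y - 1 \<le> x + S (k + (k + l)) (comb_seq k \<omega> \<omega>') \<and> x + S (k + (k + l)) (comb_seq k \<omega> \<omega>') < y" for \<omega>'
      using that by (simp add: stay_nonneg_comb_seq)
    have "\<P>(\<omega>' in Pr. stay_nonneg x (k + (k + l)) (comb_seq k \<omega> \<omega>') \<and>
        y - 1 \<le> x + S (k + (k + l)) (comb_seq k \<omega> \<omega>') \<and> x + S (k + (k + l)) (comb_seq k \<omega> \<omega>') < y) \<le>
      \<P>(\<omega>' in Pr. stay_nonneg (x + S k \<omega>) (k + l) \<omega>' \<and> y - 1 \<le> (x + S k \<omega>) + S (k + l) \<omega>' \<and> (x + S k \<omega>) + S (k + l) \<omega>' < y)"
      unfolding S_comb_seq[of k "k + l"] stay_nonneg_comb_seq by (rule prob_mono) auto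
    also have "\<dots> \<le> \<P>(\<omega> in Pr. stay_below y k \<omega>) * C"
      by (rule inner)
    finally show "\<P>(\<omega>' in Pr. stay_nonneg x (k + (k + l)) (comb_seq k \<omega> \<omega>') \<and>
        y - 1 \<le> x + S (k + (k + l)) (comb_seq k \<omega> \<omega>') \<and> x + S (k + (k + l)) (comb_seq k \<omega> \<omega>') < y) \<le>
        \<P>(\<omega> in Pr. stay_below y k \<omega>) * C" .
  qed (use \<open>0 \<le> C\<close> in auto)
  also have "\<dots> = \<P>(\<omega> in Pr. stay_nonneg x k \<omega>) * \<P>(\<omega> in Pr. stay_below y k \<omega>) * C"
    by simp
  also have "\<dots> \<le> 2 * U x * V y / (real k + 1) * C"
    using assms by (intro mult_right_mono prob_stay_nonneg_times_stay_below) auto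
  finally show ?thesis .
qed

end

section \<open>Concentration for walks attracted to a stable law\<close>

lemma (in prob_space) abs_integral_le_1:
  fixes f :: "'a \<Rightarrow> real"
  assumes "f \<in> borel_measurable M" "\<And>x. \<bar>f x\<bar> \<le> 1"
  shows "\<bar>\<integral>x. f x \<partial>M\<bar> \<le> 1"
proof -
  have "integrable M f"
    using assms by (intro integrable_const_bound[of _ 1]) auto
  then have "(\<integral>x. \<bar>f x\<bar> \<partial>M) \<le> 1"
    using assms by (intro integral_le_const) auto
  with integral_abs_bound[of M f] show ?thesis by linarith
qed

lemma one_plus_cos_nonneg: "0 \<le> 1 + cos (x :: real)"
  using cos_ge_minus_one[of x] by linarith

lemma (in real_distribution) cmod_char_power2:
  "(cmod (char M t))\<^sup>2 = (\<integral>x. \<integral>y. cos (t * (x - y)) \<partial>M \<partial>M)"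
proof -
  have [simp]: "integrable M (\<lambda>x. cos (t * x))" "integrable M (\<lambda>x. sin (t * x))"
    by (auto intro!: integrable_const_bound[of _ 1])
  have "(\<integral>x. \<integral>y. cos (t * (x - y)) \<partial>M \<partial>M) =
      (\<integral>x. \<integral>y. cos (t * x) * cos (t * y) + sin (t * x) * sin (t * y) \<partial>M \<partial>M)"
    by (simp add: right_diff_distrib cos_diff)
  also have "\<dots> = (\<integral>x. cos (t * x) \<partial>M)\<^sup>2 + (\<integral>x. sin (t * x) \<partial>M)\<^sup>2"
    by (simp add: power2_eq_square)
  also have "(\<integral>x. cos (t * x) \<partial>M) = Re (char M t)"
    unfolding char_def by (subst integral_Re[symmetric]) (auto simp: Re_exp intro!: integrable_iexp)
  also have "(\<integral>x. sin (t * x) \<partial>M) = Im (char M t)"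
    unfolding char_def by (subst integral_Im[symmetric]) (auto simp: Im_exp intro!: integrable_iexp)
  finally show ?thesis
    by (simp add: cmod_power2)
qed

lemma (in real_distribution) cmod_char_minus: "cmod (char M (- t)) = cmod (char M t)"
proof -
  have "(cmod (char M (- t)))\<^sup>2 = (cmod (char M t))\<^sup>2"
    unfolding cmod_char_power2 by simp
  then show ?thesis by simp
qed

lemma (in real_distribution) cmod_char_not_all_1:
  assumes nondeg: "\<And>y. \<not> (AE x in M. x = y)" and r: "\<And>n::nat. 0 < r n" "r \<longlonglongrightarrow> 0"
    and one: "\<And>n. cmod (char M (r n)) = 1"
  shows False
proof -
  have "AE x in M. AE y in M. \<forall>n. cos (r n * (x - y)) = 1"
  proof -
    have "AE x in M. AE y in M. cos (r n * (x - y)) = 1" for n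
    proof -
      have int1: "integrable M (\<lambda>y. cos (r n * (x - y)))" for x
        by (auto intro!: integrable_const_bound[of _ 1])
      have bnd: "norm (\<integral>y. cos (r n * (x - y)) \<partial>M) \<le> 1" for x
        unfolding real_norm_def by (rule abs_integral_le_1) auto
      have int2: "integrable M (\<lambda>x. \<integral>y. cos (r n * (x - y)) \<partial>M)"
        using bnd by (intro integrable_const_bound[of _ 1]) (auto intro!: borel_measurable_lebesgue_integral)
      have "(\<integral>x. (1 - (\<integral>y. cos (r n * (x - y)) \<partial>M)) \<partial>M) = 0"
        using cmod_char_power2[of "r n"] one[of n] int2 by (simp add: prob_space[simplified])
      moreover have "0 \<le> 1 - (\<integral>y. cos (r n * (x - y)) \<partial>M)" for x
        using bnd[of x] by (simp add: abs_le_iff)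
      ultimately have "AE x in M. 1 - (\<integral>y. cos (r n * (x - y)) \<partial>M) = 0"
        using int2 by (subst (asm) integral_nonneg_eq_0_iff_AE) auto
      then show ?thesis
      proof eventually_elim
        fix x assume "1 - (\<integral>y. cos (r n * (x - y)) \<partial>M) = 0"
        then have "(\<integral>y. 1 - cos (r n * (x - y)) \<partial>M) = 0"
          using int1[of x] by (simp add: prob_space[simplified])
        then have "AE y in M. 1 - cos (r n * (x - y)) = 0"
          using int1[of x] by (subst (asm) integral_nonneg_eq_0_iff_AE) auto
        then show "AE y in M. cos (r n * (x - y)) = 1" by simp
      qed
    qed
    then have "AE x in M. \<forall>n. AE y in M. cos (r n * (x - y)) = 1"
      by (simp add: AE_all_countable)
    then show ?thesis
      by (simp add: AE_all_countable)
  qed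
  moreover have "AE x in M. True" by simp
  ultimately obtain x where x: "AE y in M. \<forall>n. cos (r n * (x - y)) = 1"
    using eventually_happens[of _ "ae_filter M"] prob_space ae_filter_eq_bot_iff emeasure_space_1 by fastforce
  have "AE y in M. y = x"
    using x
  proof eventually_elim
    fix y assume cos1: "\<forall>n. cos (r n * (x - y)) = 1"
    show "y = x"
    proof (rule ccontr)
      assume "y \<noteq> x"
      have "(\<lambda>n. \<bar>r n * (x - y)\<bar>) \<longlonglongrightarrow> \<bar>0 * (x - y)\<bar>"
        by (intro tendsto_intros r)
      then have "eventually (\<lambda>n. \<bar>r n * (x - y)\<bar> < 1) sequentially"
        by (rule order_tendstoD) simp
      then obtain n where n: "\<bar>r n * (x - y)\<bar> < 1"
        by (auto simp: eventually_sequentially)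
      have "cos \<bar>r n * (x - y)\<bar> < cos 0"
        using n \<open>y \<noteq> x\<close> r(1)[of n] pi_gt3 by (intro cos_monotone_0_pi) auto
      then show False
        using cos1 by simp
    qed
  qed
  with nondeg show False by blast
qed

lemma char_convolution:
  assumes "real_distribution M" "real_distribution N"
  shows "char (convolution M N) t = char M t * char N t"
proof -
  interpret M: real_distribution M by fact
  interpret N: real_distribution N by fact
  interpret MN: pair_prob_space M N ..
  have int: "integrable (M \<Otimes>\<^sub>M N) (\<lambda>z. iexp (t * (fst z + snd z)))"
    by (intro MN.P.integrable_iexp) auto
  have "char (convolution M N) t = (CLINT z|M \<Otimes>\<^sub>M N. iexp (t * (fst z + snd z)))"
    unfolding char_def convolution_def by (subst integral_distr) (auto simp: split_beta')
  also have "\<dots> = (CLINT x|M. CLINT y|N. iexp (t * (x + y)))"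
    using MN.integral_fst'[OF int] by simp
  also have "\<dots> = (CLINT x|M. CLINT y|N. iexp (t * x) * iexp (t * y))"
    by (simp add: exp_add distrib_left)
  also have "\<dots> = char M t * char N t"
    unfolding char_def by simp
  finally show ?thesis .
qed

lemma char_distr_affine:
  assumes "real_distribution M"
  shows "cmod (char (distr M borel (\<lambda>x. a * x + d)) t) = cmod (char M (a * t))"
proof -
  interpret real_distribution M by fact
  have "char (distr M borel (\<lambda>x. a * x + d)) t = (CLINT x|M. iexp (t * (a * x + d)))"
    unfolding char_def by (subst integral_distr) auto
  also have "\<dots> = (CLINT x|M. iexp (t * d) * iexp (a * t * x))"
    by (simp add: exp_add[symmetric] algebra_simps)
  also have "\<dots> = iexp (t * d) * char M (a * t)"
    unfolding char_def by simp
  finally show ?thesis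
    by (simp add: norm_mult del: of_real_mult)
qed

lemma stable_law_cmod_char_less_1:
  assumes "stable_law \<alpha> \<mu>" "0 < \<alpha>" "0 < t"
  shows "cmod (char \<mu> t) < 1"
proof (rule ccontr)
  assume not: "\<not> cmod (char \<mu> t) < 1"
  from assms interpret real_distribution \<mu>
    by (simp add: stable_law_def)
  have one: "cmod (char \<mu> t) = 1"
    using not cmod_char_le_1[of t] by simp
  have *: "cmod (char \<mu> (a * t)) = 1" if a: "0 < a" "a < 1" for a
  proof -
    have "a powr \<alpha> < 1 powr \<alpha>"
      using a assms by (intro powr_less_mono2) auto
    then have lt: "a powr \<alpha> < 1" by simp
    define b where "b = (1 - a powr \<alpha>) powr (1 / \<alpha>)"
    have b: "0 < b" "b powr \<alpha> = 1 - a powr \<alpha>"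
      using lt assms by (auto simp: b_def powr_powr)
    obtain d where d: "convolution (distr \<mu> borel (\<lambda>x. a * x)) (distr \<mu> borel (\<lambda>x. b * x)) =
        distr \<mu> borel (\<lambda>x. (a powr \<alpha> + b powr \<alpha>) powr (1 / \<alpha>) * x + d)"
      using assms(1) a b(1) unfolding stable_law_def by blast
    have "cmod (char \<mu> (1 * t)) = cmod (char (convolution (distr \<mu> borel (\<lambda>x. a * x)) (distr \<mu> borel (\<lambda>x. b * x))) t)"
      unfolding d b(2) using char_distr_affine[OF real_distribution_axioms, of 1 d t] by simp
    also have "\<dots> = cmod (char \<mu> (a * t)) * cmod (char \<mu> (b * t))"
      using char_distr_affine[OF real_distribution_axioms, of a 0 t] char_distr_affine[OF real_distribution_axioms, of b 0 t]
      by (subst char_convolution) (auto simp: norm_mult intro!: real_distribution_distr)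
    finally have "1 \<le> cmod (char \<mu> (a * t)) * cmod (char \<mu> (b * t))"
      using one by simp
    also have "\<dots> \<le> cmod (char \<mu> (a * t)) * 1"
      by (intro mult_left_mono cmod_char_le_1) auto
    finally show ?thesis
      using cmod_char_le_1[of "a * t"] by simp
  qed
  have "(\<lambda>n. inverse (real (Suc n)) * (t / 2)) \<longlonglongrightarrow> 0 * (t / 2)"
    by (intro tendsto_intros LIMSEQ_inverse_real_of_nat)
  then show False
  proof (rule_tac cmod_char_not_all_1[of "\<lambda>n. inverse (real (Suc n)) * (t / 2)"])
    fix n
    have "0 < inverse (real (Suc n)) / 2" "inverse (real (Suc n)) / 2 < 1"
      by (auto simp: field_simps)
    from *[OF this] show "cmod (char \<mu> (inverse (real (Suc n)) * (t / 2))) = 1"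
      by (simp add: mult.assoc)
  qed (use assms in \<open>auto simp: stable_law_def\<close>)
qed

lemma weak_conv_m_char_seq:
  assumes "\<And>n. real_distribution (\<mu> n)" "real_distribution M" "weak_conv_m \<mu> M"
    and r: "strict_mono (r :: nat \<Rightarrow> nat)" and t: "t \<longlonglongrightarrow> t0"
  shows "(\<lambda>n. char (\<mu> (r n)) (t n)) \<longlonglongrightarrow> char M t0"
proof -
  obtain \<Omega> :: "real measure" and Y_seq Y where "prob_space \<Omega>"
    and [measurable]: "\<And>n. Y_seq n \<in> measurable \<Omega> borel" and Y_seq: "\<And>n. distr \<Omega> borel (Y_seq n) = \<mu> n"
    and Y_meas: "Y \<in> measurable \<Omega> lborel" and Y: "distr \<Omega> borel Y = M"
    and lim: "\<And>x. x \<in> space \<Omega> \<Longrightarrow> (\<lambda>n. Y_seq n x) \<longlonglongrightarrow> Y x"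
    using Skorohod[OF assms(1-3)] by blast
  have [measurable]: "Y \<in> measurable \<Omega> borel"
    using Y_meas by simp
  interpret \<Omega>: prob_space \<Omega> by fact
  have "(\<lambda>n. CLINT x|\<Omega>. iexp (t n * Y_seq (r n) x)) \<longlonglongrightarrow> (CLINT x|\<Omega>. iexp (t0 * Y x))"
  proof (rule integral_dominated_convergence[where w = "\<lambda>_. 1"])
    show "AE x in \<Omega>. (\<lambda>n. iexp (t n * Y_seq (r n) x)) \<longlonglongrightarrow> iexp (t0 * Y x)"
    proof (rule AE_I2)
      fix x assume "x \<in> space \<Omega>"
      from LIMSEQ_subseq_LIMSEQ[OF lim[OF this] r]
      have "(\<lambda>n. Y_seq (r n) x) \<longlonglongrightarrow> Y x" by (simp add: o_def)
      then show "(\<lambda>n. iexp (t n * Y_seq (r n) x)) \<longlonglongrightarrow> iexp (t0 * Y x)"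
        by (intro tendsto_intros t)
    qed
  qed auto
  then show ?thesis
    unfolding char_def Y_seq[symmetric] Y[symmetric] by (simp add: integral_distr)
qed

lemma weak_conv_m_cmod_char_le:
  assumes \<mu>: "\<And>n. real_distribution (\<mu> n)" and M: "real_distribution M" and conv: "weak_conv_m \<mu> M"
    and C: "compact C" "C \<noteq> {}" and less: "\<And>t. t \<in> C \<Longrightarrow> cmod (char M t) < 1"
  obtains q where "0 \<le> q" "q < 1" "eventually (\<lambda>n. \<forall>t\<in>C. cmod (char (\<mu> n) t) \<le> q) sequentially"
proof -
  interpret M: real_distribution M by fact
  have "continuous_on C (\<lambda>t. cmod (char M t))"
    by (intro continuous_intros continuous_at_imp_continuous_on ballI M.isCont_char)
  from continuous_attains_sup[OF C this] obtain t0 where t0: "t0 \<in> C" "\<And>t. t \<in> C \<Longrightarrow> cmod (char M t) \<le> cmod (char M t0)"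
    by auto
  define q where "q = (1 + cmod (char M t0)) / 2"
  have q: "0 \<le> q" "q < 1" "cmod (char M t0) < q"
    using less[OF t0(1)] by (auto simp: q_def)
  have "eventually (\<lambda>n. \<forall>t\<in>C. cmod (char (\<mu> n) t) \<le> q) sequentially"
  proof (rule ccontr)
    assume "\<not> ?thesis"
    from not_eventually_sequentiallyD[OF this] obtain r :: "nat \<Rightarrow> nat" where
      r: "strict_mono r" "\<And>n. \<exists>t\<in>C. q < cmod (char (\<mu> (r n)) t)"
      by (auto simp: not_le)
    then obtain s where s: "\<And>n. s n \<in> C" "\<And>n. q < cmod (char (\<mu> (r n)) (s n))"
      by metis
    from C(1) s(1) obtain t r' where t: "t \<in> C" "strict_mono r'" "(s \<circ> r') \<longlonglongrightarrow> t"
      unfolding compact_def by metis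
    have "(\<lambda>n. char (\<mu> ((r \<circ> r') n)) ((s \<circ> r') n)) \<longlonglongrightarrow> char M t"
      using r(1) t by (intro weak_conv_m_char_seq[OF \<mu> M conv] strict_mono_o)
    then have "(\<lambda>n. cmod (char (\<mu> ((r \<circ> r') n)) ((s \<circ> r') n))) \<longlonglongrightarrow> cmod (char M t)"
      by (rule tendsto_norm)
    then have "q \<le> cmod (char M t)"
      by (rule LIMSEQ_le_const) (auto intro!: exI[of _ 0] less_imp_le s)
    with t0(2)[OF t(1)] q(3) show False by simp
  qed
  with q(1,2) show thesis by (rule that)
qed

text \<open>With \<open>N\<close> uniform on \<open>[0, \<tau>]\<close>, the kernel \<open>\<integral>\<integral> cos ((s - t) x) N(ds) N(dt)\<close> is nonnegative,
  and at least \<open>1/2\<close> for \<open>\<bar>x\<bar> \<le> 1/\<tau>\<close>.\<close>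

lemma (in real_distribution) prob_interval_le_integral_char:
  assumes "0 < \<tau>"
  shows "ennreal (prob {x. \<bar>x - z\<bar> \<le> 1 / \<tau>}) \<le> ennreal (2 / \<tau>) * (\<integral>\<^sup>+t. ennreal (cmod (char M t)) * indicator {-\<tau>..\<tau>} t \<partial>lborel)"
proof -
  define N where "N = uniform_measure lborel {0..\<tau>}"
  have emN: "emeasure lborel {0..\<tau>} = ennreal \<tau>"
    using assms by simp
  interpret N: prob_space N
    unfolding N_def using assms by (intro prob_space_uniform_measure) auto
  interpret MN: pair_sigma_finite M N ..
  have [measurable_cong]: "sets N = sets borel"
    by (simp add: N_def)
  have AE_N: "AE s in N. 0 \<le> s \<and> s \<le> \<tau>"
    unfolding N_def using assms by (intro AE_uniform_measureI) auto
  define I where "I = (\<integral>\<^sup>+t. ennreal (cmod (char M t)) * indicator {-\<tau>..\<tau>} t \<partial>lborel)"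
  have inner: "(\<integral>\<^sup>+s. ennreal (cmod (char M (s - t))) \<partial>N) \<le> I / ennreal \<tau>" if "0 \<le> t" "t \<le> \<tau>" for t
  proof -
    have "(\<integral>\<^sup>+s. ennreal (cmod (char M (s - t))) \<partial>N) =
        (\<integral>\<^sup>+s. ennreal (cmod (char M (s - t))) * indicator {0..\<tau>} s \<partial>lborel) / ennreal \<tau>"
      unfolding N_def by (subst nn_integral_uniform_measure) (auto simp: emN)
    also have "(\<integral>\<^sup>+s. ennreal (cmod (char M (s - t))) * indicator {0..\<tau>} s \<partial>lborel) =
        (\<integral>\<^sup>+s. ennreal (cmod (char M s)) * indicator {0..\<tau>} (t + 1 * s) \<partial>lborel)"
      by (subst nn_integral_real_affine[where c = 1 and t = t]) auto
    also have "\<dots> \<le> I"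
      unfolding I_def using that by (intro nn_integral_mono) (auto simp: indicator_def)
    finally show ?thesis
      by (simp add: divide_right_mono_ennreal)
  qed
  define F where "F x = (\<integral>\<^sup>+s. \<integral>\<^sup>+t. ennreal (1 + cos ((s - t) * (x - z))) \<partial>N \<partial>N)" for x
  have F_eq: "F x = ennreal (1 + ((\<integral>s. cos (s * (x - z)) \<partial>N)\<^sup>2 + (\<integral>s. sin (s * (x - z)) \<partial>N)\<^sup>2))" for x
  proof -
    have i: "integrable N (\<lambda>s. cos (s * (x - z)))" "integrable N (\<lambda>s. sin (s * (x - z)))"
      by (auto intro!: N.integrable_const_bound[of _ 1])
    have bd: "integrable N (\<lambda>t. 1 + cos ((s - t) * (x - z)))" for s
      by (intro N.integrable_const_bound[of _ 2]) (auto simp: one_plus_cos_nonneg)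
    have G: "(\<integral>t. 1 + cos ((s - t) * (x - z)) \<partial>N) =
       1 + (cos (s * (x - z)) * (\<integral>s. cos (s * (x - z)) \<partial>N) + sin (s * (x - z)) * (\<integral>s. sin (s * (x - z)) \<partial>N))" for s
    proof -
      have "(\<integral>t. 1 + cos ((s - t) * (x - z)) \<partial>N) =
          (\<integral>t. 1 + (cos (s * (x - z)) * cos (t * (x - z)) + sin (s * (x - z)) * sin (t * (x - z))) \<partial>N)"
        by (simp add: left_diff_distrib cos_diff)
      also have "\<dots> = 1 + (cos (s * (x - z)) * (\<integral>s. cos (s * (x - z)) \<partial>N) + sin (s * (x - z)) * (\<integral>s. sin (s * (x - z)) \<partial>N))"
        using i by (simp add: N.prob_space)
      finally show ?thesis .
    qed
    have "F x = (\<integral>\<^sup>+s. ennreal (\<integral>t. 1 + cos ((s - t) * (x - z)) \<partial>N) \<partial>N)"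
      unfolding F_def by (intro nn_integral_cong nn_integral_eq_integral bd) (simp add: one_plus_cos_nonneg)
    also have "\<dots> = ennreal (\<integral>s. (\<integral>t. 1 + cos ((s - t) * (x - z)) \<partial>N) \<partial>N)"
    proof (rule nn_integral_eq_integral)
      show "AE s in N. 0 \<le> (\<integral>t. 1 + cos ((s - t) * (x - z)) \<partial>N)"
        by (intro AE_I2 integral_nonneg) (simp add: one_plus_cos_nonneg)
      show "integrable N (\<lambda>s. \<integral>t. 1 + cos ((s - t) * (x - z)) \<partial>N)"
        unfolding G using i by auto
    qed
    also have "\<dots> = ennreal (1 + ((\<integral>s. cos (s * (x - z)) \<partial>N)\<^sup>2 + (\<integral>s. sin (s * (x - z)) \<partial>N)\<^sup>2))"
      unfolding G using i by (simp add: N.prob_space power2_eq_square)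
    finally show ?thesis .
  qed
  have F_ge: "1 + ennreal (1/2) * indicator {x. \<bar>x - z\<bar> \<le> 1 / \<tau>} x \<le> F x" for x
  proof (cases "\<bar>x - z\<bar> \<le> 1 / \<tau>")
    case False
    then show ?thesis
      unfolding F_eq using ennreal_leI[of 1 "1 + ((\<integral>s. cos (s * (x - z)) \<partial>N)\<^sup>2 + (\<integral>s. sin (s * (x - z)) \<partial>N)\<^sup>2)"] by simp
  next
    case True
    have c: "3 / 2 \<le> 1 + cos ((s - t) * (x - z))" if "0 \<le> s" "s \<le> \<tau>" "0 \<le> t" "t \<le> \<tau>" for s t
    proof -
      have "\<bar>(s - t) * (x - z)\<bar> \<le> \<tau> * (1 / \<tau>)"
        unfolding abs_mult using that True by (intro mult_mono) auto
      then have "\<bar>(s - t) * (x - z)\<bar> \<le> pi / 3"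
        using assms pi_gt3 by simp
      then have "cos (pi / 3) \<le> cos \<bar>(s - t) * (x - z)\<bar>"
        by (intro cos_monotone_0_pi_le) auto
      then show ?thesis
        by (simp add: cos_60)
    qed
    have "ennreal (3 / 2) = (\<integral>\<^sup>+s. \<integral>\<^sup>+t. ennreal (3 / 2) \<partial>N \<partial>N)"
      by (simp add: N.emeasure_space_1)
    also have "\<dots> \<le> F x"
      unfolding F_def using AE_N
      by (intro nn_integral_mono_AE, elim eventually_mono, intro nn_integral_mono_AE)
        (use AE_N in \<open>elim eventually_mono, auto intro!: ennreal_leI c\<close>)
    also have "ennreal (3 / 2) = 1 + ennreal (1 / 2)"
      by (subst ennreal_1[symmetric], subst ennreal_plus[symmetric]) auto
    finally show ?thesis
      using True by simp
  qed
  have "1 + ennreal (1/2) * emeasure M {x. \<bar>x - z\<bar> \<le> 1 / \<tau>} = (\<integral>\<^sup>+x. 1 + ennreal (1/2) * indicator {x. \<bar>x - z\<bar> \<le> 1 / \<tau>} x \<partial>M)"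
    by (simp add: nn_integral_add nn_integral_cmult emeasure_space_1[simplified])
  also have "\<dots> \<le> (\<integral>\<^sup>+x. F x \<partial>M)"
    by (intro nn_integral_mono F_ge)
  also have "\<dots> = (\<integral>\<^sup>+s. \<integral>\<^sup>+x. \<integral>\<^sup>+t. ennreal (1 + cos ((s - t) * (x - z))) \<partial>N \<partial>M \<partial>N)"
    unfolding F_def by (subst MN.Fubini') auto
  also have "\<dots> = (\<integral>\<^sup>+s. \<integral>\<^sup>+t. \<integral>\<^sup>+x. ennreal (1 + cos ((s - t) * (x - z))) \<partial>M \<partial>N \<partial>N)"
    by (intro nn_integral_cong MN.Fubini'[symmetric]) auto
  also have "\<dots> \<le> (\<integral>\<^sup>+s. \<integral>\<^sup>+t. 1 + ennreal (cmod (char M (s - t))) \<partial>N \<partial>N)"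
  proof (intro nn_integral_mono)
    fix s t
    have "(\<integral>\<^sup>+x. ennreal (1 + cos ((s - t) * (x - z))) \<partial>M) = ennreal (\<integral>x. 1 + cos ((s - t) * (x - z)) \<partial>M)"
      by (intro nn_integral_eq_integral integrable_const_bound[of _ 2])
        (auto simp: one_plus_cos_nonneg)
    also have "(\<integral>x. 1 + cos ((s - t) * (x - z)) \<partial>M) = 1 + (\<integral>x. cos ((s - t) * (x - z)) \<partial>M)"
      by (subst Bochner_Integration.integral_add) (auto simp: prob_space[simplified] intro!: integrable_const_bound[of _ 1])
    also have "(\<integral>x. cos ((s - t) * (x - z)) \<partial>M) = Re (iexp (- ((s - t) * z)) * char M (s - t))"
    proof -
      have "iexp (- ((s - t) * z)) * char M (s - t) = (CLINT x|M. iexp (- ((s - t) * z)) * iexp ((s - t) * x))"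
        unfolding char_def by simp
      also have "\<dots> = (CLINT x|M. iexp ((s - t) * (x - z)))"
        by (simp add: exp_add[symmetric] algebra_simps)
      finally have "Re (iexp (- ((s - t) * z)) * char M (s - t)) = Re (CLINT x|M. iexp ((s - t) * (x - z)))"
        by (rule arg_cong)
      also have "\<dots> = (\<integral>x. Re (iexp ((s - t) * (x - z))) \<partial>M)"
        by (rule integral_Re[symmetric]) (auto intro!: integrable_iexp)
      also have "\<dots> = (\<integral>x. cos ((s - t) * (x - z)) \<partial>M)"
        by (simp add: Re_exp)
      finally show ?thesis by simp
    qed
    also have "1 + \<dots> \<le> 1 + cmod (char M (s - t))"
      using complex_Re_le_cmod[of "iexp (- ((s - t) * z)) * char M (s - t)"] by (simp add: norm_mult del: of_real_mult of_real_minus)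
    finally show "(\<integral>\<^sup>+x. ennreal (1 + cos ((s - t) * (x - z))) \<partial>M) \<le> 1 + ennreal (cmod (char M (s - t)))"
      by (simp add: ennreal_leI ennreal_plus[symmetric] ennreal_1[symmetric] del: ennreal_plus ennreal_1)
  qed
  also have "\<dots> = (\<integral>\<^sup>+t. \<integral>\<^sup>+s. 1 + ennreal (cmod (char M (s - t))) \<partial>N \<partial>N)"
  proof -
    interpret NN: pair_sigma_finite N N ..
    show ?thesis by (rule NN.Fubini') auto
  qed
  also have "\<dots> \<le> (\<integral>\<^sup>+t. 1 + I / ennreal \<tau> \<partial>N)"
  proof (rule nn_integral_mono_AE)
    show "AE t in N. (\<integral>\<^sup>+s. 1 + ennreal (cmod (char M (s - t))) \<partial>N) \<le> 1 + I / ennreal \<tau>"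
      using AE_N
    proof eventually_elim
      fix t assume "0 \<le> t \<and> t \<le> \<tau>"
      then show "(\<integral>\<^sup>+s. 1 + ennreal (cmod (char M (s - t))) \<partial>N) \<le> 1 + I / ennreal \<tau>"
        by (subst nn_integral_add) (auto simp: N.emeasure_space_1 intro!: add_left_mono inner)
    qed
  qed
  also have "\<dots> = 1 + I / ennreal \<tau>"
    by (simp add: N.emeasure_space_1)
  finally have "1 + ennreal (1/2) * emeasure M {x. \<bar>x - z\<bar> \<le> 1 / \<tau>} \<le> 1 + I / ennreal \<tau>" .
  then have "ennreal (1/2) * emeasure M {x. \<bar>x - z\<bar> \<le> 1 / \<tau>} \<le> I / ennreal \<tau>"
    by (subst (asm) ennreal_add_left_cancel_le) auto
  then have "ennreal 2 * (ennreal (1/2) * emeasure M {x. \<bar>x - z\<bar> \<le> 1 / \<tau>}) \<le> ennreal 2 * (I / ennreal \<tau>)"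
    by (rule mult_left_mono) simp
  moreover have "ennreal 2 * (ennreal (1/2) * emeasure M {x. \<bar>x - z\<bar> \<le> 1 / \<tau>}) = emeasure M {x. \<bar>x - z\<bar> \<le> 1 / \<tau>}"
    by (subst mult.assoc[symmetric], subst ennreal_mult[symmetric]) simp_all
  moreover have "ennreal 2 * (I / ennreal \<tau>) = ennreal (2 / \<tau>) * I"
  proof -
    have "ennreal 2 * (I / ennreal \<tau>) = (ennreal 2 * ennreal (inverse \<tau>)) * I"
      unfolding divide_ennreal_def inverse_ennreal[OF assms] by (simp only: ac_simps)
    also have "ennreal 2 * ennreal (inverse \<tau>) = ennreal (2 / \<tau>)"
      using assms by (subst ennreal_mult[symmetric]) (simp_all add: divide_inverse)
    finally show ?thesis .
  qed
  ultimately show ?thesis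
    unfolding I_def[symmetric] emeasure_eq_measure by simp
qed

lemma stable_norming_pos: "stable_norming \<alpha> c \<Longrightarrow> 1 \<le> n \<Longrightarrow> 0 < c n"
  by (simp add: stable_norming_def)

lemma stable_norming_mono:
  assumes "stable_norming \<alpha> c" "1 \<le> m" "m \<le> n"
  shows "c m \<le> c n"
proof -
  have "mono_on {1..} c"
    using assms(1) by (simp add: stable_norming_def)
  then show ?thesis
    by (rule mono_onD) (use assms in auto)
qed

lemma stable_norming_dyadic:
  assumes c: "stable_norming \<alpha> c" and \<alpha>: "1 < \<alpha>" "\<alpha> \<le> 2"
  shows "eventually (\<lambda>j. c (2 ^ Suc j) \<le> 2 * c (2 ^ j) \<and> 6 / 5 * c (2 ^ j) \<le> c (2 ^ Suc j)) sequentially"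
proof -
  obtain l where l: "slowly_varying l" and cl: "\<And>n. 1 \<le> n \<Longrightarrow> c n = real n powr (1 / \<alpha>) * l (real n)"
    using c by (auto simp: stable_norming_def)
  have lim: "((\<lambda>x. l (2 * x) / l x) \<longlongrightarrow> 1) at_top"
    using l by (simp add: slowly_varying_def)
  have "filterlim (\<lambda>j::nat. (2::real) ^ j) at_top sequentially"
    by (rule filterlim_at_top_mono[OF filterlim_real_sequentially])
      (auto intro!: always_eventually less_imp_le of_nat_less_two_power)
  from filterlim_compose[OF lim this] have "(\<lambda>j. l (2 * 2 ^ j) / l (2 ^ j)) \<longlonglongrightarrow> 1" .
  then have "(\<lambda>j. 2 powr (1 / \<alpha>) * (l (2 * 2 ^ j) / l (2 ^ j))) \<longlonglongrightarrow> 2 powr (1 / \<alpha>) * 1"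
    by (intro tendsto_intros)
  moreover have "2 powr (1 / \<alpha>) * (l (2 * 2 ^ j) / l (2 ^ j)) = c (2 ^ Suc j) / c (2 ^ j)" for j
    using cl[of "2 ^ j"] cl[of "2 ^ Suc j"] by (simp add: powr_mult)
  ultimately have lim: "(\<lambda>j. c (2 ^ Suc j) / c (2 ^ j)) \<longlonglongrightarrow> 2 powr (1 / \<alpha>)"
    by simp
  have "(2::real) powr (1 / \<alpha>) < 2 powr 1"
    using \<alpha> by (intro powr_less_mono) auto
  then have "eventually (\<lambda>j. c (2 ^ Suc j) / c (2 ^ j) < 2) sequentially"
    using order_tendstoD(2)[OF lim, of 2] by simp
  moreover have "6 / 5 < (2::real) powr (1 / \<alpha>)"
  proof -
    have "6 / 5 < sqrt (2::real)"
      by (rule real_less_rsqrt) (simp add: power2_eq_square)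
    also have "\<dots> = 2 powr (1 / 2)"
      by (simp add: powr_half_sqrt)
    also have "\<dots> \<le> 2 powr (1 / \<alpha>)"
      using \<alpha> by (intro powr_mono) (auto simp: field_simps)
    finally show ?thesis .
  qed
  then have "eventually (\<lambda>j. 6 / 5 < c (2 ^ Suc j) / c (2 ^ j)) sequentially"
    by (rule order_tendstoD(1)[OF lim])
  ultimately show ?thesis
  proof eventually_elim
    fix j assume "c (2 ^ Suc j) / c (2 ^ j) < 2" "6 / 5 < c (2 ^ Suc j) / c (2 ^ j)"
    moreover have "0 < c (2 ^ j)"
      by (rule stable_norming_pos[OF c]) simp
    ultimately show "c (2 ^ Suc j) \<le> 2 * c (2 ^ j) \<and> 6 / 5 * c (2 ^ j) \<le> c (2 ^ Suc j)"
      by (simp add: field_simps)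
  qed
qed

lemma stable_norming_scale:
  assumes c: "stable_norming \<alpha> c" and \<alpha>: "1 < \<alpha>" "\<alpha> \<le> 2"
  shows "\<exists>N::nat. \<forall>k\<ge>N. \<forall>n. 1 \<le> n \<longrightarrow> n \<le> 2 ^ p * k \<longrightarrow> c n \<le> 4 ^ p * c k"
proof -
  obtain J where J: "\<And>j. J \<le> j \<Longrightarrow> c (2 ^ Suc j) \<le> 2 * c (2 ^ j)"
    using stable_norming_dyadic[OF assms] by (auto simp: eventually_sequentially)
  have double: "c (2 * k) \<le> 4 * c k" if k: "2 ^ J \<le> k" for k :: nat
  proof -
    have "1 \<le> k" using k one_le_power[of "2::nat" J] by linarith
    then obtain j where j: "2 ^ j \<le> k" "k < 2 ^ (j + 1)"
      using ex_power_ivl1[of 2 k] by auto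
    have "(2::nat) ^ J < 2 ^ (j + 1)" using j k by linarith
    then have "J < j + 1"
      by (rule power_less_imp_less_exp[rotated]) simp
    then have "J \<le> j" by simp
    have "c (2 * k) \<le> c (2 ^ Suc (Suc j))"
      using j \<open>1 \<le> k\<close> by (intro stable_norming_mono[OF c]) auto
    also have "\<dots> \<le> 2 * (2 * c (2 ^ j))"
      using J[of j] J[of "Suc j"] \<open>J \<le> j\<close> by simp
    also have "\<dots> \<le> 4 * c k"
      using stable_norming_mono[OF c _ j(1)] by simp
    finally show ?thesis .
  qed
  have pow: "c (2 ^ p * k) \<le> 4 ^ p * c k" if k: "2 ^ J \<le> k" for k :: nat
  proof (induction p)
    case (Suc p)
    have "k \<le> 2 ^ p * k" by simp
    with k have "2 ^ J \<le> 2 ^ p * k" by linarith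
    from double[OF this] Suc show ?case by (simp add: mult.assoc)
  qed simp
  show ?thesis
  proof (intro exI[of _ "2 ^ J"] allI impI)
    fix k n :: nat assume "2 ^ J \<le> k" "1 \<le> n" "n \<le> 2 ^ p * k"
    with pow[of k] stable_norming_mono[OF c, of n "2 ^ p * k"] show "c n \<le> 4 ^ p * c k"
      by simp
  qed
qed

lemma summable_power_double_exp:
  fixes q :: real
  assumes "0 \<le> q" "q < 1"
  shows "summable (\<lambda>i. 2 ^ i * q ^ (2 ^ i))"
proof -
  have "(\<lambda>n. q ^ n) \<longlonglongrightarrow> 0"
    using assms by (intro LIMSEQ_realpow_zero)
  moreover have "strict_mono (\<lambda>i::nat. (2::nat) ^ i)"
    by (intro strict_monoI) simp
  ultimately have "(\<lambda>i. q ^ (2 ^ i)) \<longlonglongrightarrow> 0"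
    using LIMSEQ_subseq_LIMSEQ[of "\<lambda>n. q ^ n" 0 "\<lambda>i. 2 ^ i"] by (simp add: o_def)
  then have "eventually (\<lambda>i. q ^ (2 ^ i) < 1 / 4) sequentially"
    by (rule order_tendstoD) simp
  then obtain N where N: "\<And>i. N \<le> i \<Longrightarrow> q ^ (2 ^ i) < 1 / 4"
    by (auto simp: eventually_sequentially)
  show ?thesis
  proof (rule summable_ratio_test[of "1/2" N])
    fix i assume i: "N \<le> i"
    have "q ^ 2 ^ Suc i = q ^ 2 ^ i * q ^ 2 ^ i"
      by (simp add: mult_2 power_add)
    then have "2 ^ Suc i * q ^ (2 ^ Suc i) = 2 ^ i * q ^ (2 ^ i) * (2 * q ^ (2 ^ i))"
      by simp
    also have "\<dots> \<le> 2 ^ i * q ^ (2 ^ i) * (1 / 2)"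
      using N[OF i] assms by (intro mult_left_mono) auto
    finally show "norm (2 ^ Suc i * q ^ 2 ^ Suc i) \<le> 1 / 2 * norm (2 ^ i * q ^ 2 ^ i)"
      using assms by simp
  qed simp
qed

context iid_walk
begin

lemma real_distribution_S: "real_distribution (distr Pr borel (S n))"
  by (rule seq.P.real_distribution_distr) measurable

lemma distr_S_add: "distr Pr borel (S (k + n)) = convolution (distr Pr borel (S k)) (distr Pr borel (S n))"
proof -
  interpret Sn: real_distribution "distr Pr borel (S n)" by (rule real_distribution_S)
  have "convolution (distr Pr borel (S k)) (distr Pr borel (S n)) =
      distr (Pr \<Otimes>\<^sub>M Pr) borel (\<lambda>(\<omega>, \<omega>'). S k \<omega> + S n \<omega>')"
    unfolding convolution_def
    by (subst pair_measure_distr) (auto simp: distr_distr o_def split_beta' intro: Sn.sigma_finite_measure_axioms)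
  also have "\<dots> = distr (distr (Pr \<Otimes>\<^sub>M Pr) Pr (\<lambda>(\<omega>, \<omega>'). comb_seq k \<omega> \<omega>')) borel (S (k + n))"
    by (subst distr_distr) (auto simp: o_def split_beta' S_comb_seq)
  finally show ?thesis
    unfolding seq.PiM_comb_seq by simp
qed

lemma char_S: "char (distr Pr borel (S n)) t = char (distr Pr borel (S 1)) t ^ n"
proof (induction n)
  case 0
  show ?case
    unfolding char_def by (subst integral_distr) (auto simp: seq.P.prob_space)
next
  case (Suc n)
  show ?case
    using distr_S_add[of 1 n] Suc by (simp add: char_convolution real_distribution_S)
qed

lemma prob_S_local_le:
  assumes c: "stable_norming \<alpha> c" and \<alpha>: "1 < \<alpha>" "\<alpha> \<le> 2" and \<mu>: "stable_law \<alpha> \<mu>"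
    and conv: "weak_conv_m (\<lambda>n. distr Pr borel (\<lambda>\<omega>. S n \<omega> / c n)) \<mu>"
  shows "\<exists>C N. 0 \<le> C \<and> (\<forall>n\<ge>N. \<forall>z. \<P>(\<omega> in Pr. z \<le> S n \<omega> \<and> S n \<omega> < z + 1) \<le> C / c n)"
proof -
  define f where "f t = cmod (char (distr Pr borel (S 1)) t)" for t
  define d where "d j = c (2 ^ j)" for j
  interpret S1: real_distribution "distr Pr borel (S 1)" by (rule real_distribution_S)
  have f_meas [measurable]: "f \<in> borel_measurable borel"
    unfolding f_def[abs_def] by measurable
  have f: "0 \<le> f t" "f t \<le> 1" "f \<bar>t\<bar> = f t" for t
    using S1.cmod_char_le_1[of t] S1.cmod_char_minus[of t] by (auto simp: f_def abs_real_def)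
  have d_pos: "0 < d j" for j
    unfolding d_def by (rule stable_norming_pos[OF c]) simp
  have char_scaled: "cmod (char (distr Pr borel (\<lambda>\<omega>. S n \<omega> / c n)) t) = f (t / c n) ^ n" for n t
  proof -
    have *: "distr Pr borel (\<lambda>\<omega>. S n \<omega> / c n) = distr (distr Pr borel (S n)) borel (\<lambda>x. (1 / c n) * x + 0)"
      by (subst distr_distr) (auto simp: o_def)
    have "cmod (char (distr Pr borel (\<lambda>\<omega>. S n \<omega> / c n)) t) = cmod (char (distr Pr borel (S n)) (1 / c n * t))"
      unfolding * by (rule char_distr_affine[OF real_distribution_S])
    then show ?thesis
      by (simp add: char_S[of n] f_def norm_power)
  qed
  have lt1: "cmod (char \<mu> t) < 1" if "t \<in> {1/2..1}" for t
    using that \<alpha> by (intro stable_law_cmod_char_less_1[OF \<mu>]) auto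
  have rd: "real_distribution \<mu>"
    using \<mu> by (simp add: stable_law_def)
  have rdn: "real_distribution (distr Pr borel (\<lambda>\<omega>. S n \<omega> / c n))" for n
    by (rule seq.P.real_distribution_distr) measurable
  have ne: "{1/2..1::real} \<noteq> {}" by simp
  obtain q where q: "0 \<le> q" "q < 1"
    "eventually (\<lambda>n. \<forall>t\<in>{1/2..1}. cmod (char (distr Pr borel (\<lambda>\<omega>. S n \<omega> / c n)) t) \<le> q) sequentially"
    by (rule weak_conv_m_cmod_char_le[OF rdn rd conv compact_Icc ne lt1])
  have "filterlim (\<lambda>j. 2 ^ j :: nat) at_top sequentially"
    by (rule filterlim_subseq) (auto intro!: strict_monoI)
  from eventually_compose_filterlim[OF q(3) this]
  have "eventually (\<lambda>j. \<forall>t\<in>{1/2..1}. f (t / d j) ^ (2 ^ j) \<le> q) sequentially"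
    unfolding char_scaled d_def .
  with stable_norming_dyadic[OF c \<alpha>]
  have "eventually (\<lambda>j. d (Suc j) \<le> 2 * d j \<and> 6 / 5 * d j \<le> d (Suc j) \<and>
      (\<forall>t\<in>{1/2..1}. f (t / d j) ^ (2 ^ j) \<le> q)) sequentially"
    unfolding d_def by eventually_elim auto
  then obtain J0 where J0: "\<And>j. J0 \<le> j \<Longrightarrow> d (Suc j) \<le> 2 * d j" "\<And>j. J0 \<le> j \<Longrightarrow> 6 / 5 * d j \<le> d (Suc j)"
    "\<And>j t. J0 \<le> j \<Longrightarrow> t \<in> {1/2..1} \<Longrightarrow> f (t / d j) ^ (2 ^ j) \<le> q"
    unfolding eventually_sequentially by blast
  have grow: "(6 / 5) ^ i * d J0 \<le> d (J0 + i)" for i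
  proof (induction i)
    case (Suc i)
    have "(6 / 5) ^ Suc i * d J0 = 6 / 5 * ((6 / 5) ^ i * d J0)" by simp
    also have "\<dots> \<le> 6 / 5 * d (J0 + i)" using Suc by (intro mult_left_mono) auto
    also have "\<dots> \<le> d (Suc (J0 + i))" by (rule J0(2)) simp
    finally show ?case by simp
  qed simp
  obtain i0 where "1 / d J0 < (6 / 5) ^ i0"
    using real_arch_pow[of "6 / 5" "1 / d J0"] by auto
  then have "1 < (6 / 5) ^ i0 * d J0"
    using d_pos[of J0] by (simp add: field_simps)
  with grow[of i0] have dJ: "1 \<le> d (J0 + i0)" by linarith
  define J where "J = J0 + i0"
  have J: "d (Suc j) \<le> 2 * d j" "t \<in> {1/2..1} \<Longrightarrow> f (t / d j) ^ (2 ^ j) \<le> q" if "J \<le> j" for j t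
    using J0(1,3) that by (auto simp: J_def)
  have d_ratio: "d (j + i) \<le> 2 ^ i * d j" if "J \<le> j" for i j
  proof (induction i)
    case (Suc i)
    with J(1)[of "j + i"] that show ?case by simp
  qed simp
  define g where "g i = (\<Sum>k<i. 2 ^ Suc k * q ^ (2 ^ Suc k))" for i
  define G where "G = (\<Sum>i. 2 ^ i * q ^ (2 ^ i))"
  have gG: "g i \<le> G" for i
  proof -
    have "g i = (\<Sum>k\<in>{1..i}. 2 ^ k * q ^ (2 ^ k))"
      unfolding g_def by (rule sum.reindex_bij_witness[of _ "\<lambda>k. k - 1" Suc]) auto
    also have "\<dots> \<le> G"
      unfolding G_def using q by (intro sum_le_suminf summable_power_double_exp) auto
    finally show ?thesis .
  qed
  have int: "(\<integral>\<^sup>+t. ennreal (f t ^ 2 ^ (j + i)) * indicator {-(1 / d j)..1 / d j} t \<partial>lborel) \<le> ennreal (2 / d (j + i) * (1 + g i))"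
    if "J \<le> j" for i j
    using that
  proof (induction i arbitrary: j)
    case 0
    have "(\<integral>\<^sup>+t. ennreal (f t ^ 2 ^ j) * indicator {-(1 / d j)..1 / d j} t \<partial>lborel) \<le>
        (\<integral>\<^sup>+t. indicator {-(1 / d j)..1 / d j} t \<partial>lborel)"
      using f by (intro nn_integral_mono) (auto simp: indicator_def power_le_one)
    also have "\<dots> = ennreal (2 / d j)"
      using d_pos[of j] by (simp add: emeasure_lborel_Icc_eq)
    finally show ?case by (simp add: g_def)
  next
    case (Suc i)
    have split: "ennreal (f t ^ 2 ^ (j + Suc i)) * indicator {-(1 / d j)..1 / d j} t \<le>
        ennreal (f t ^ 2 ^ (Suc j + i)) * indicator {-(1 / d (Suc j))..1 / d (Suc j)} t +
        ennreal (q ^ 2 ^ Suc i) * indicator {-(1 / d j)..1 / d j} t" for t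
    proof (cases "\<bar>t\<bar> \<le> 1 / d (Suc j) \<or> \<not> \<bar>t\<bar> \<le> 1 / d j")
      case True
      then show ?thesis by (auto simp: indicator_def abs_le_iff)
    next
      case False
      have "1 / (2 * d j) \<le> 1 / d (Suc j)"
        using J(1)[OF Suc.prems] d_pos[of "Suc j"] d_pos[of j] by (intro divide_left_mono) auto
      with False have "1 / (2 * d j) \<le> \<bar>t\<bar>" "\<bar>t\<bar> \<le> 1 / d j"
        by auto
      then have "\<bar>t\<bar> * d j \<in> {1/2..1}"
        using d_pos[of j] by (simp add: field_simps)
      from J(2)[OF Suc.prems this] have "f t ^ 2 ^ j \<le> q"
        using d_pos[of j] f(3)[of t] by simp
      then have "(f t ^ 2 ^ j) ^ 2 ^ Suc i \<le> q ^ 2 ^ Suc i"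
        using f by (intro power_mono) auto
      then have "f t ^ 2 ^ (j + Suc i) \<le> q ^ 2 ^ Suc i"
        by (simp only: power_mult[symmetric] power_add[symmetric])
      then show ?thesis
        by (auto simp: indicator_def intro!: ennreal_leI add_increasing)
    qed
    have "(\<integral>\<^sup>+t. ennreal (f t ^ 2 ^ (j + Suc i)) * indicator {-(1 / d j)..1 / d j} t \<partial>lborel) \<le>
        (\<integral>\<^sup>+t. ennreal (f t ^ 2 ^ (Suc j + i)) * indicator {-(1 / d (Suc j))..1 / d (Suc j)} t +
        ennreal (q ^ 2 ^ Suc i) * indicator {-(1 / d j)..1 / d j} t \<partial>lborel)"
      by (intro nn_integral_mono split)
    also have "\<dots> = (\<integral>\<^sup>+t. ennreal (f t ^ 2 ^ (Suc j + i)) * indicator {-(1 / d (Suc j))..1 / d (Suc j)} t \<partial>lborel) +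
        ennreal (q ^ 2 ^ Suc i) * ennreal (2 / d j)"
      using d_pos[of j] by (subst nn_integral_add) (auto simp: nn_integral_cmult emeasure_lborel_Icc_eq)
    also have "\<dots> \<le> ennreal (2 / d (Suc j + i) * (1 + g i)) + ennreal (q ^ 2 ^ Suc i * (2 * 2 ^ Suc i / d (j + Suc i)))"
    proof (intro add_mono)
      show "(\<integral>\<^sup>+t. ennreal (f t ^ 2 ^ (Suc j + i)) * indicator {-(1 / d (Suc j))..1 / d (Suc j)} t \<partial>lborel)
          \<le> ennreal (2 / d (Suc j + i) * (1 + g i))"
        using Suc.prems by (intro Suc.IH) auto
      have "2 / d j \<le> 2 * 2 ^ Suc i / d (j + Suc i)"
        using d_ratio[OF Suc.prems, of "Suc i"] d_pos[of j] d_pos[of "j + Suc i"] by (simp add: field_simps)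
      then have "q ^ 2 ^ Suc i * (2 / d j) \<le> q ^ 2 ^ Suc i * (2 * 2 ^ Suc i / d (j + Suc i))"
        using q(1) by (intro mult_left_mono) simp_all
      then show "ennreal (q ^ 2 ^ Suc i) * ennreal (2 / d j) \<le> ennreal (q ^ 2 ^ Suc i * (2 * 2 ^ Suc i / d (j + Suc i)))"
        using q(1) d_pos[of j] by (subst ennreal_mult[symmetric]) (simp_all only: ennreal_leI zero_le_power divide_nonneg_pos zero_le_numeral)
    qed
    also have "\<dots> = ennreal (2 / d (j + Suc i) * (1 + g (Suc i)))"
    proof (subst ennreal_plus[symmetric])
      have "0 \<le> g i" using q by (auto simp: g_def intro!: sum_nonneg)
      then show "0 \<le> 2 / d (Suc j + i) * (1 + g i)"
        using d_pos[of "Suc j + i"] by (auto intro!: mult_nonneg_nonneg divide_nonneg_nonneg)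
      show "0 \<le> q ^ 2 ^ Suc i * (2 * 2 ^ Suc i / d (j + Suc i))"
        using q d_pos[of "j + Suc i"] by (auto intro!: mult_nonneg_nonneg divide_nonneg_nonneg)
      have "2 / d (Suc j + i) * (1 + g i) + q ^ 2 ^ Suc i * (2 * 2 ^ Suc i / d (j + Suc i)) = 2 / d (j + Suc i) * (1 + g (Suc i))"
        by (simp add: g_def algebra_simps)
      then show "ennreal (2 / d (Suc j + i) * (1 + g i) + q ^ 2 ^ Suc i * (2 * 2 ^ Suc i / d (j + Suc i))) =
          ennreal (2 / d (j + Suc i) * (1 + g (Suc i)))" by simp
    qed
    finally show ?case .
  qed
  define C where "C = 8 * d J * (1 + G)"
  have "0 \<le> G"
    using gG[of 0] by (simp add: g_def)
  have "0 \<le> C"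
    using \<open>0 \<le> G\<close> d_pos[of J] by (simp add: C_def)
  moreover have "\<P>(\<omega> in Pr. z \<le> S n \<omega> \<and> S n \<omega> < z + 1) \<le> C / c n" if n: "2 ^ J \<le> n" for n z
  proof -
    have "1 \<le> n" using n one_le_power[of "2::nat" J] by linarith
    then obtain m where m: "2 ^ m \<le> n" "n < 2 ^ (m + 1)"
      using ex_power_ivl1[of 2 n] by auto
    have "(2::nat) ^ J < 2 ^ (m + 1)" using m n by linarith
    then have "J < m + 1"
      by (rule power_less_imp_less_exp[rotated]) simp
    then have "J \<le> m" by simp
    interpret Sn: real_distribution "distr Pr borel (S n)" by (rule real_distribution_S)
    have char_f: "cmod (char (distr Pr borel (S n)) t) = f t ^ n" for t
      by (simp only: char_S[of n] norm_power f_def)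
    have "\<P>(\<omega> in Pr. z \<le> S n \<omega> \<and> S n \<omega> < z + 1) \<le> \<P>(\<omega> in Pr. \<bar>S n \<omega> - z\<bar> \<le> 1 / (1 / d J))"
      using dJ by (intro prob_mono) (auto simp: J_def)
    also have "\<dots> = measure (distr Pr borel (S n)) {x. \<bar>x - z\<bar> \<le> 1 / (1 / d J)}"
      by (subst measure_distr) (auto intro!: arg_cong[where f = "measure Pr"])
    finally have "ennreal \<P>(\<omega> in Pr. z \<le> S n \<omega> \<and> S n \<omega> < z + 1) \<le> ennreal \<dots>"
      by (rule ennreal_leI)
    also have "\<dots> \<le> ennreal (2 / (1 / d J)) * (\<integral>\<^sup>+t. ennreal (cmod (char (distr Pr borel (S n)) t)) * indicator {-(1 / d J)..1 / d J} t \<partial>lborel)"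
      using d_pos[of J] by (intro Sn.prob_interval_le_integral_char) simp
    also have "(\<integral>\<^sup>+t. ennreal (cmod (char (distr Pr borel (S n)) t)) * indicator {-(1 / d J)..1 / d J} t \<partial>lborel) \<le>
        (\<integral>\<^sup>+t. ennreal (f t ^ 2 ^ (J + (m - J))) * indicator {-(1 / d J)..1 / d J} t \<partial>lborel)"
      using m(1) f \<open>J \<le> m\<close> by (intro nn_integral_mono mult_right_mono ennreal_leI)
        (auto simp: char_f intro!: power_decreasing)
    also have "\<dots> \<le> ennreal (2 / d (J + (m - J)) * (1 + g (m - J)))"
      by (rule int) simp
    also have "\<dots> \<le> ennreal (4 / c n * (1 + G))"
    proof (intro ennreal_leI mult_mono)
      have "c n \<le> d (Suc m)"
        unfolding d_def using m \<open>1 \<le> n\<close> by (intro stable_norming_mono[OF c]) auto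
      also have "\<dots> \<le> 2 * d m" by (rule J(1)) fact
      finally show "2 / d (J + (m - J)) \<le> 4 / c n"
        using \<open>J \<le> m\<close> d_pos[of m] stable_norming_pos[OF c \<open>1 \<le> n\<close>] by (simp add: field_simps)
      show "0 \<le> 1 + g (m - J)"
        using q by (auto simp: g_def intro!: add_nonneg_nonneg sum_nonneg)
    qed (use gG stable_norming_pos[OF c \<open>1 \<le> n\<close>] in auto)
    finally have "ennreal \<P>(\<omega> in Pr. z \<le> S n \<omega> \<and> S n \<omega> < z + 1) \<le> ennreal (2 / (1 / d J)) * ennreal (4 / c n * (1 + G))"
      by (simp only: mult_left_mono zero_le)
    also have "\<dots> = ennreal (C / c n)"
      using d_pos[of J] by (subst ennreal_mult'[symmetric]) (auto simp: C_def algebra_simps)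
    finally show ?thesis
      using \<open>0 \<le> C\<close> stable_norming_pos[OF c \<open>1 \<le> n\<close>] by (simp add: ennreal_le_iff)
  qed
  ultimately show ?thesis by blast
qed

end

section \<open>Domination of the first and last steps\<close>

definition depends_on_first :: "nat \<Rightarrow> ((nat \<Rightarrow> 'a) \<Rightarrow> 'b) \<Rightarrow> bool" where
  "depends_on_first m f \<longleftrightarrow> (\<forall>\<omega> \<omega>'. (\<forall>i<m. \<omega> i = \<omega>' i) \<longrightarrow> f \<omega> = f \<omega>')"

lemma depends_on_first_comb_seq: "depends_on_first m f \<Longrightarrow> f (comb_seq m \<omega> \<omega>') = f \<omega>"
  unfolding depends_on_first_def by (auto simp: comb_seq_def)

lemma depends_on_first_rev_comb_seq:
  assumes "depends_on_first m f" "m \<le> n"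
  shows "f (rev_seq (k + n) (comb_seq k \<omega> \<omega>')) = f (rev_seq n \<omega>')"
  by (rule assms(1)[unfolded depends_on_first_def, rule_format])
    (use assms(2) in \<open>auto simp: comb_seq_def rev_seq_def\<close>)

context oscillating_walk
begin

lemma prob_stay_nonneg_local_le:
  assumes c: "stable_norming \<alpha> c" and \<alpha>: "1 < \<alpha>" "\<alpha> \<le> 2" and \<mu>: "stable_law \<alpha> \<mu>"
    and conv: "weak_conv_m (\<lambda>n. distr Pr borel (\<lambda>\<omega>. S n \<omega> / c n)) \<mu>"
  shows "\<exists>C N. 0 \<le> C \<and> 1 \<le> N \<and> (\<forall>n\<ge>N. \<forall>x. \<forall>y.
    \<P>(\<omega> in Pr. stay_nonneg x n \<omega> \<and> y - 1 \<le> x + S n \<omega> \<and> x + S n \<omega> < y) \<le> C * U x * V y / (real n * c n))"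
proof -
  obtain C0 N0 where C0: "0 \<le> C0"
    "\<And>n z. N0 \<le> n \<Longrightarrow> \<P>(\<omega> in Pr. z \<le> S n \<omega> \<and> S n \<omega> < z + 1) \<le> C0 / c n"
    using prob_S_local_le[OF assms] by blast
  obtain N1 :: nat where N1: "\<And>k n. N1 \<le> k \<Longrightarrow> 1 \<le> n \<Longrightarrow> n \<le> 2 ^ 2 * k \<Longrightarrow> c n \<le> 4 ^ 2 * c k"
    using stable_norming_scale[OF c \<alpha>, of 2] by blast
  define C where "C = 96 * C0"
  show ?thesis
  proof (intro exI[of _ C] exI[of _ "3 * N0 + 3 * N1 + 1"] conjI allI impI)
    fix n x y assume n: "3 * N0 + 3 * N1 + 1 \<le> n"
    define k where "k = n div 3"
    define l where "l = n - 2 * k"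
    have nkl: "n = k + (k + l)" "N0 \<le> l" "N1 \<le> l" "1 \<le> l" "n \<le> 2 ^ 2 * l" "1 \<le> n"
      using n by (auto simp: k_def l_def)
    have cpos: "0 < c n" "0 < c l"
      using nkl by (auto intro!: stable_norming_pos[OF c])
    have "C0 / c l \<le> 16 * C0 / c n"
    proof -
      have "c n \<le> 16 * c l" using N1[of l n] nkl by simp
      then have "C0 * c n \<le> C0 * (16 * c l)" using C0(1) by (rule mult_left_mono)
      then show ?thesis using cpos by (simp add: field_simps)
    qed
    have k3: "real n / 3 \<le> real k + 1"
    proof -
      have "n \<le> 3 * (k + 1)" unfolding k_def by presburger
      then have "real n \<le> real (3 * (k + 1))" by (simp only: of_nat_le_iff)
      then show ?thesis by simp
    qed
    show "\<P>(\<omega> in Pr. stay_nonneg x n \<omega> \<and> y - 1 \<le> x + S n \<omega> \<and> x + S n \<omega> < y) \<le> C * U x * V y / (real n * c n)"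
    proof (cases "0 < y")
      case False
      then have "\<not> (stay_nonneg x n \<omega> \<and> x + S n \<omega> < y)" for \<omega>
        by (auto simp: stay_nonneg_def not_less dest!: spec[of _ n])
      then have "{\<omega> \<in> space Pr. stay_nonneg x n \<omega> \<and> y - 1 \<le> x + S n \<omega> \<and> x + S n \<omega> < y} = {}" by blast
      moreover have "0 \<le> C * U x * V y / (real n * c n)"
        using C0(1) cpos by (auto simp: C_def intro!: divide_nonneg_nonneg mult_nonneg_nonneg)
      ultimately show ?thesis by (simp only: measure_empty)
    next
      case True
      have "\<P>(\<omega> in Pr. stay_nonneg x n \<omega> \<and> y - 1 \<le> x + S n \<omega> \<and> x + S n \<omega> < y) \<le>
          2 * U x * V y / (real k + 1) * (C0 / c l)"
        unfolding nkl(1) using True C0 nkl(2) cpos by (intro prob_stay_nonneg_local) auto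
      also have "\<dots> \<le> 2 * U x * V y / (real n / 3) * (16 * C0 / c n)"
        using \<open>C0 / c l \<le> _\<close> k3 C0(1) cpos nkl(6)
        by (intro mult_mono divide_left_mono) (auto intro!: mult_nonneg_nonneg divide_nonneg_nonneg mult_pos_pos)
      also have "\<dots> = C * U x * V y / (real n * c n)"
        by (simp add: C_def)
      finally show ?thesis .
    qed
  qed (use C0 in \<open>auto simp: C_def\<close>)
qed

text \<open>Reversing the increments moves the weight \<open>V\<close> from the starting point of the walk to its end point.\<close>

lemma nn_integral_duality:
  assumes H [measurable]: "(\<lambda>(\<omega>, s). H \<omega> s) \<in> borel_measurable (Pr \<Otimes>\<^sub>M borel)"
  shows "(\<integral>\<^sup>+y. ennreal (V y) * (\<integral>\<^sup>+\<omega>. (if \<forall>j\<le>m. 0 < y + S j \<omega> then H (rev_seq m \<omega>) (y + S m \<omega>) else 0) \<partial>Pr) \<partial>lborel) =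
    (\<integral>\<^sup>+s. (\<integral>\<^sup>+\<omega>. (if \<forall>j\<le>m. S j \<omega> < s then H \<omega> s * ennreal (V (s - S m \<omega>)) else 0) \<partial>Pr) \<partial>lborel)"
proof -
  interpret pair_sigma_finite Pr lborel ..
  have "(\<integral>\<^sup>+y. ennreal (V y) * (\<integral>\<^sup>+\<omega>. (if \<forall>j\<le>m. 0 < y + S j \<omega> then H (rev_seq m \<omega>) (y + S m \<omega>) else 0) \<partial>Pr) \<partial>lborel) =
      (\<integral>\<^sup>+y. (\<integral>\<^sup>+\<omega>. ennreal (V y) * (if \<forall>j\<le>m. 0 < y + S j \<omega> then H (rev_seq m \<omega>) (y + S m \<omega>) else 0) \<partial>Pr) \<partial>lborel)"
    by (intro nn_integral_cong nn_integral_cmult[symmetric]) measurable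
  also have "\<dots> = (\<integral>\<^sup>+y. (\<integral>\<^sup>+\<omega>. ennreal (V y) * (if \<forall>j\<le>m. 0 < y + S j (rev_seq m \<omega>) then H (rev_seq m (rev_seq m \<omega>)) (y + S m (rev_seq m \<omega>)) else 0) \<partial>Pr) \<partial>lborel)"
    by (intro nn_integral_cong nn_integral_rev_seq) measurable
  also have "\<dots> = (\<integral>\<^sup>+y. (\<integral>\<^sup>+\<omega>. (if \<forall>j\<le>m. S j \<omega> < y + S m \<omega> then H \<omega> (y + S m \<omega>) * ennreal (V y) else 0) \<partial>Pr) \<partial>lborel)"
  proof (intro nn_integral_cong)
    fix y \<omega>
    have iff: "(\<forall>j\<le>m. 0 < y + S j (rev_seq m \<omega>)) \<longleftrightarrow> (\<forall>j\<le>m. S j \<omega> < y + S m \<omega>)"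
    proof safe
      fix j assume *: "\<forall>j\<le>m. 0 < y + S j (rev_seq m \<omega>)" "j \<le> m"
      from *(1)[rule_format, of "m - j"] *(2) show "S j \<omega> < y + S m \<omega>"
        by (simp add: S_rev_seq)
    next
      fix j assume *: "\<forall>j\<le>m. S j \<omega> < y + S m \<omega>" "j \<le> m"
      from *(1)[rule_format, of "m - j"] *(2) show "0 < y + S j (rev_seq m \<omega>)"
        by (simp add: S_rev_seq)
    qed
    have rev_rev: "rev_seq m (rev_seq m \<omega>) = \<omega>"
      by (auto simp: rev_seq_def)
    have if_mult: "r * (if B then t else 0) = (if B then t * r else 0)" for r t :: ennreal and B
      by (simp add: mult.commute)
    show "ennreal (V y) * (if \<forall>j\<le>m. 0 < y + S j (rev_seq m \<omega>) then H (rev_seq m (rev_seq m \<omega>)) (y + S m (rev_seq m \<omega>)) else 0) =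
        (if \<forall>j\<le>m. S j \<omega> < y + S m \<omega> then H \<omega> (y + S m \<omega>) * ennreal (V y) else 0)"
      unfolding iff rev_rev S_rev_seq_self by (rule if_mult)
  qed
  also have "\<dots> = (\<integral>\<^sup>+\<omega>. (\<integral>\<^sup>+y. (if \<forall>j\<le>m. S j \<omega> < y + S m \<omega> then H \<omega> (y + S m \<omega>) * ennreal (V y) else 0) \<partial>lborel) \<partial>Pr)"
    by (rule Fubini') measurable
  also have "\<dots> = (\<integral>\<^sup>+\<omega>. (\<integral>\<^sup>+s. (if \<forall>j\<le>m. S j \<omega> < s then H \<omega> s * ennreal (V (s - S m \<omega>)) else 0) \<partial>lborel) \<partial>Pr)"
  proof (rule nn_integral_cong)
    fix \<omega> assume [measurable]: "\<omega> \<in> space Pr"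
    have [measurable]: "(\<lambda>s. H \<omega> s) \<in> borel_measurable borel"
      using measurable_compose[OF measurable_Pair1'[OF \<open>\<omega> \<in> space Pr\<close>] H] by simp
    show "(\<integral>\<^sup>+y. (if \<forall>j\<le>m. S j \<omega> < y + S m \<omega> then H \<omega> (y + S m \<omega>) * ennreal (V y) else 0) \<partial>lborel) =
        (\<integral>\<^sup>+s. (if \<forall>j\<le>m. S j \<omega> < s then H \<omega> s * ennreal (V (s - S m \<omega>)) else 0) \<partial>lborel)"
      by (subst nn_integral_real_affine[where c = 1 and t = "- S m \<omega>"]) (auto simp: algebra_simps cong: if_cong)
  qed
  also have "\<dots> = (\<integral>\<^sup>+s. (\<integral>\<^sup>+\<omega>. (if \<forall>j\<le>m. S j \<omega> < s then H \<omega> s * ennreal (V (s - S m \<omega>)) else 0) \<partial>Pr) \<partial>lborel)"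
    by (rule Fubini'[symmetric]) measurable
  finally show ?thesis .
qed

end

locale stable_walk = oscillating_walk +
  fixes c :: "nat \<Rightarrow> real" and \<alpha> K :: real and \<mu> :: "real measure"
  assumes norming: "stable_norming \<alpha> c" and \<alpha>: "1 < \<alpha>" "\<alpha> \<le> 2"
    and stable: "stable_law \<alpha> \<mu>"
    and attracted: "weak_conv_m (\<lambda>n. distr Pr borel (\<lambda>\<omega>. S n \<omega> / c n)) \<mu>"
    and K_pos: "0 < K"
    and integrable_exp_V: "\<And>\<theta>. 0 < \<theta> \<Longrightarrow> integrable lborel (\<lambda>y. exp (- \<theta> * y) * V y)"
    and K_lim: "\<And>\<theta> x. 0 < \<theta> \<Longrightarrow> 0 \<le> x \<Longrightarrow>
      (\<lambda>n. real n * c n * (\<integral>\<omega>. (if stay_nonneg x n \<omega> then exp (- \<theta> * (x + S n \<omega>)) else 0) \<partial>Pr))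
        \<longlonglongrightarrow> K * U x * (\<integral>y. exp (- \<theta> * y) * V y \<partial>lborel)"
begin

definition D :: "nat \<Rightarrow> real" where "D n = real n * c n"

lemma D_pos: "1 \<le> n \<Longrightarrow> 0 < D n"
  using stable_norming_pos[OF norming, of n] by (simp add: D_def)

lemma D_mono: "1 \<le> m \<Longrightarrow> m \<le> n \<Longrightarrow> D m \<le> D n"
  unfolding D_def using stable_norming_mono[OF norming, of m n] stable_norming_pos[OF norming, of m]
  by (intro mult_mono) auto

definition J :: "real \<Rightarrow> ennreal" where
  "J \<theta> = (\<integral>\<^sup>+y. ennreal (exp (- \<theta> * y) * V y) \<partial>lborel)"

lemma J_finite: "0 < \<theta> \<Longrightarrow> J \<theta> < \<infinity>"
  using integrable_exp_V[of \<theta>] by (simp add: J_def integrable_iff_bounded)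

lemma nn_integral_window_le:
  "\<exists>C N. 0 \<le> C \<and> 1 \<le> N \<and> (\<forall>n\<ge>N. \<forall>x. \<forall>q \<in> borel_measurable borel.
    (\<integral>\<^sup>+\<omega>. (if stay_nonneg x n \<omega> then \<integral>\<^sup>+y. q y * indicator {x + S n \<omega> <.. x + S n \<omega> + 1} y \<partial>lborel else 0) \<partial>Pr)
      \<le> ennreal (C * U x / D n) * (\<integral>\<^sup>+y. q y * ennreal (V y) \<partial>lborel))"
proof -
  interpret pair_sigma_finite Pr lborel ..
  obtain C N where C: "0 \<le> C" "1 \<le> N" "\<And>n x y. N \<le> n \<Longrightarrow>
    \<P>(\<omega> in Pr. stay_nonneg x n \<omega> \<and> y - 1 \<le> x + S n \<omega> \<and> x + S n \<omega> < y) \<le> C * U x * V y / (real n * c n)"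
    using prob_stay_nonneg_local_le[OF norming \<alpha> stable attracted] by blast
  show ?thesis
  proof (intro exI[of _ C] exI[of _ N] conjI allI impI ballI C)
    fix n x and q :: "real \<Rightarrow> ennreal" assume n: "N \<le> n" and q [measurable]: "q \<in> borel_measurable borel"
    have "(\<integral>\<^sup>+\<omega>. (if stay_nonneg x n \<omega> then \<integral>\<^sup>+y. q y * indicator {x + S n \<omega> <.. x + S n \<omega> + 1} y \<partial>lborel else 0) \<partial>Pr) =
      (\<integral>\<^sup>+\<omega>. \<integral>\<^sup>+y. q y * (if stay_nonneg x n \<omega> \<and> y - 1 \<le> x + S n \<omega> \<and> x + S n \<omega> < y then 1 else 0) \<partial>lborel \<partial>Pr)"
      by (intro nn_integral_cong) (auto simp: indicator_def intro!: nn_integral_cong)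
    also have "\<dots> = (\<integral>\<^sup>+y. \<integral>\<^sup>+\<omega>. q y * (if stay_nonneg x n \<omega> \<and> y - 1 \<le> x + S n \<omega> \<and> x + S n \<omega> < y then 1 else 0) \<partial>Pr \<partial>lborel)"
      by (rule Fubini'[symmetric]) measurable
    also have "\<dots> = (\<integral>\<^sup>+y. q y * ennreal \<P>(\<omega> in Pr. stay_nonneg x n \<omega> \<and> y - 1 \<le> x + S n \<omega> \<and> x + S n \<omega> < y) \<partial>lborel)"
      by (intro nn_integral_cong) (subst nn_integral_cmult, measurable, subst ennreal_prob, auto)
    also have "\<dots> \<le> (\<integral>\<^sup>+y. q y * ennreal (C * U x * V y / (real n * c n)) \<partial>lborel)"
      using C(3)[OF n] by (intro nn_integral_mono mult_left_mono ennreal_leI) auto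
    also have "\<dots> = (\<integral>\<^sup>+y. ennreal (C * U x / D n) * (q y * ennreal (V y)) \<partial>lborel)"
    proof (intro nn_integral_cong)
      fix y
      have eq: "C * U x * V y / (real n * c n) = C * U x / D n * V y"
        by (simp add: D_def)
      have "0 \<le> C * U x / D n"
        using C D_pos[of n] n by (auto intro!: divide_nonneg_nonneg)
      then have "ennreal (C * U x * V y / (real n * c n)) = ennreal (C * U x / D n) * ennreal (V y)"
        unfolding eq by (intro ennreal_mult) simp_all
      then show "q y * ennreal (C * U x * V y / (real n * c n)) = ennreal (C * U x / D n) * (q y * ennreal (V y))"
        by (simp only: mult_ac)
    qed
    also have "\<dots> = ennreal (C * U x / D n) * (\<integral>\<^sup>+y. q y * ennreal (V y) \<partial>lborel)"
      by (rule nn_integral_cmult) measurable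
    finally show "(\<integral>\<^sup>+\<omega>. (if stay_nonneg x n \<omega> then \<integral>\<^sup>+y. q y * indicator {x + S n \<omega> <.. x + S n \<omega> + 1} y \<partial>lborel else 0) \<partial>Pr)
      \<le> ennreal (C * U x / D n) * (\<integral>\<^sup>+y. q y * ennreal (V y) \<partial>lborel)" .
  qed
qed

lemma exp_le_window:
  assumes "0 < \<theta>"
  shows "ennreal (exp (- \<theta> * s)) \<le> ennreal (exp \<theta>) * (\<integral>\<^sup>+y. ennreal (exp (- \<theta> * y)) * indicator {s<..s+1} y \<partial>lborel)"
proof -
  have "ennreal (exp (- \<theta> * s)) = ennreal (exp \<theta>) * (\<integral>\<^sup>+y. ennreal (exp (- \<theta> * (s + 1))) * indicator {s<..s+1} y \<partial>lborel)"
    by (subst nn_integral_cmult_indicator) (auto simp: ennreal_mult'[symmetric] exp_add[symmetric] algebra_simps)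
  also have "\<dots> \<le> ennreal (exp \<theta>) * (\<integral>\<^sup>+y. ennreal (exp (- \<theta> * y)) * indicator {s<..s+1} y \<partial>lborel)"
    using assms by (intro mult_left_mono nn_integral_mono) (auto simp: indicator_def intro!: ennreal_leI)
  finally show ?thesis .
qed

lemma nn_integral_prefix_le:
  assumes "0 < \<theta>"
  shows "\<exists>C N. 0 \<le> C \<and> (\<forall>m. \<forall>n\<ge>m + N. \<forall>f\<in>borel_measurable Pr. depends_on_first m f \<longrightarrow>
    (\<integral>\<^sup>+\<omega>. (if stay_nonneg 0 n \<omega> then f \<omega> * ennreal (exp (- \<theta> * S n \<omega>)) else 0) \<partial>Pr)
      \<le> ennreal (C / D (n - m)) * (\<integral>\<^sup>+\<omega>. (if stay_nonneg 0 m \<omega> then f \<omega> * ennreal (U (S m \<omega>)) else 0) \<partial>Pr))"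
proof -
  obtain C N where C: "0 \<le> C" "1 \<le> N" "\<And>n x q. N \<le> n \<Longrightarrow> q \<in> borel_measurable borel \<Longrightarrow>
    (\<integral>\<^sup>+\<omega>. (if stay_nonneg x n \<omega> then \<integral>\<^sup>+y. q y * indicator {x + S n \<omega> <.. x + S n \<omega> + 1} y \<partial>lborel else 0) \<partial>Pr)
      \<le> ennreal (C * U x / D n) * (\<integral>\<^sup>+y. q y * ennreal (V y) \<partial>lborel)"
    using nn_integral_window_le by blast
  obtain j where j: "J \<theta> = ennreal j" "0 \<le> j"
    using J_finite[OF assms] by (cases "J \<theta>") auto
  have psi: "(\<integral>\<^sup>+\<omega>. (if stay_nonneg x n \<omega> then ennreal (exp (- \<theta> * (x + S n \<omega>))) else 0) \<partial>Pr)
      \<le> ennreal (exp \<theta> * C * j / D n) * ennreal (U x)" if n: "N \<le> n" for n x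
  proof -
    have "(\<integral>\<^sup>+\<omega>. (if stay_nonneg x n \<omega> then ennreal (exp (- \<theta> * (x + S n \<omega>))) else 0) \<partial>Pr) \<le>
      (\<integral>\<^sup>+\<omega>. ennreal (exp \<theta>) * (if stay_nonneg x n \<omega> then
        \<integral>\<^sup>+y. ennreal (exp (- \<theta> * y)) * indicator {x + S n \<omega> <.. x + S n \<omega> + 1} y \<partial>lborel else 0) \<partial>Pr)"
      using exp_le_window[OF assms] by (intro nn_integral_mono) auto
    also have "\<dots> = ennreal (exp \<theta>) * (\<integral>\<^sup>+\<omega>. (if stay_nonneg x n \<omega> then
        \<integral>\<^sup>+y. ennreal (exp (- \<theta> * y)) * indicator {x + S n \<omega> <.. x + S n \<omega> + 1} y \<partial>lborel else 0) \<partial>Pr)"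
    proof (rule nn_integral_cmult)
      have "(\<lambda>\<omega>. \<integral>\<^sup>+y. ennreal (exp (- \<theta> * y)) * (if x + S n \<omega> < y \<and> y \<le> x + S n \<omega> + 1 then 1 else 0) \<partial>lborel) \<in> borel_measurable Pr"
        by measurable
      then have [measurable]: "(\<lambda>\<omega>. \<integral>\<^sup>+y. ennreal (exp (- \<theta> * y)) * indicator {x + S n \<omega> <.. x + S n \<omega> + 1} y \<partial>lborel) \<in> borel_measurable Pr"
        by (rule measurable_cong[THEN iffD1, rotated]) (auto simp: indicator_def intro!: nn_integral_cong)
      show "(\<lambda>\<omega>. if stay_nonneg x n \<omega> then
        \<integral>\<^sup>+y. ennreal (exp (- \<theta> * y)) * indicator {x + S n \<omega> <.. x + S n \<omega> + 1} y \<partial>lborel else 0) \<in> borel_measurable Pr"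
        by measurable
    qed
    also have "\<dots> \<le> ennreal (exp \<theta>) * (ennreal (C * U x / D n) * J \<theta>)"
      unfolding J_def using C(3)[OF n, of "\<lambda>y. ennreal (exp (- \<theta> * y))" x]
      by (intro mult_left_mono) (auto simp: ennreal_mult')
    also have "\<dots> = ennreal (exp \<theta> * C * j / D n) * ennreal (U x)"
      using C j D_pos[of n] n by (simp add: j(1) ennreal_mult[symmetric] mult_ac)
    finally show ?thesis .
  qed
  show ?thesis
  proof (intro exI[of _ "exp \<theta> * C * j"] exI[of _ N] conjI allI impI ballI)
    fix m n and f :: "(nat \<Rightarrow> 'a) \<Rightarrow> ennreal"
    assume n: "m + N \<le> n" and f [measurable]: "f \<in> borel_measurable Pr" and dep: "depends_on_first m f"
    have n_eq: "n = m + (n - m)" using n by simp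
    have "(\<integral>\<^sup>+\<omega>. (if stay_nonneg 0 n \<omega> then f \<omega> * ennreal (exp (- \<theta> * S n \<omega>)) else 0) \<partial>Pr) =
      (\<integral>\<^sup>+\<omega>. \<integral>\<^sup>+\<omega>'. (if stay_nonneg 0 n (comb_seq m \<omega> \<omega>') then f (comb_seq m \<omega> \<omega>') * ennreal (exp (- \<theta> * S n (comb_seq m \<omega> \<omega>'))) else 0) \<partial>Pr \<partial>Pr)"
      by (rule nn_integral_comb_seq) measurable
    also have "\<dots> = (\<integral>\<^sup>+\<omega>. \<integral>\<^sup>+\<omega>'. (if stay_nonneg 0 m \<omega> then f \<omega> else 0) *
        (if stay_nonneg (S m \<omega>) (n - m) \<omega>' then ennreal (exp (- \<theta> * (S m \<omega> + S (n - m) \<omega>'))) else 0) \<partial>Pr \<partial>Pr)"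
      by (subst n_eq, subst n_eq, intro nn_integral_cong)
        (simp add: stay_nonneg_comb_seq S_comb_seq depends_on_first_comb_seq[OF dep])
    also have "\<dots> = (\<integral>\<^sup>+\<omega>. (if stay_nonneg 0 m \<omega> then f \<omega> else 0) * (\<integral>\<^sup>+\<omega>'.
        (if stay_nonneg (S m \<omega>) (n - m) \<omega>' then ennreal (exp (- \<theta> * (S m \<omega> + S (n - m) \<omega>'))) else 0) \<partial>Pr) \<partial>Pr)"
      by (intro nn_integral_cong nn_integral_cmult) measurable
    also have "\<dots> \<le> (\<integral>\<^sup>+\<omega>. (if stay_nonneg 0 m \<omega> then f \<omega> else 0) * (ennreal (exp \<theta> * C * j / D (n - m)) * ennreal (U (S m \<omega>))) \<partial>Pr)"
      using n by (intro nn_integral_mono mult_left_mono psi) auto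
    also have "\<dots> = (\<integral>\<^sup>+\<omega>. ennreal (exp \<theta> * C * j / D (n - m)) * (if stay_nonneg 0 m \<omega> then f \<omega> * ennreal (U (S m \<omega>)) else 0) \<partial>Pr)"
      by (intro nn_integral_cong) (auto simp: mult_ac)
    also have "\<dots> = ennreal (exp \<theta> * C * j / D (n - m)) * (\<integral>\<^sup>+\<omega>. (if stay_nonneg 0 m \<omega> then f \<omega> * ennreal (U (S m \<omega>)) else 0) \<partial>Pr)"
      by (rule nn_integral_cmult) measurable
    finally show "(\<integral>\<^sup>+\<omega>. (if stay_nonneg 0 n \<omega> then f \<omega> * ennreal (exp (- \<theta> * S n \<omega>)) else 0) \<partial>Pr)
      \<le> ennreal (exp \<theta> * C * j / D (n - m)) * (\<integral>\<^sup>+\<omega>. (if stay_nonneg 0 m \<omega> then f \<omega> * ennreal (U (S m \<omega>)) else 0) \<partial>Pr)" .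
  qed (use C j in auto)
qed

lemma nn_integral_suffix_le:
  assumes "0 < \<theta>"
  shows "\<exists>C N. 0 \<le> C \<and> (\<forall>m. \<forall>n\<ge>m + N. \<forall>f\<in>borel_measurable Pr. depends_on_first m f \<longrightarrow>
    (\<integral>\<^sup>+\<omega>. (if stay_nonneg 0 n \<omega> then f (rev_seq n \<omega>) * ennreal (exp (- \<theta> * S n \<omega>)) else 0) \<partial>Pr)
      \<le> ennreal (C / D (n - m)) * (\<integral>\<^sup>+s. \<integral>\<^sup>+\<omega>. (if \<forall>j\<le>m. S j \<omega> < s then f \<omega> * ennreal (exp (- \<theta> * s)) * ennreal (V (s - S m \<omega>)) else 0) \<partial>Pr \<partial>lborel))"
proof -
  interpret pair_sigma_finite Pr lborel ..
  obtain C N where C: "0 \<le> C" "1 \<le> N" "\<And>n x q. N \<le> n \<Longrightarrow> q \<in> borel_measurable borel \<Longrightarrow>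
    (\<integral>\<^sup>+\<omega>. (if stay_nonneg x n \<omega> then \<integral>\<^sup>+y. q y * indicator {x + S n \<omega> <.. x + S n \<omega> + 1} y \<partial>lborel else 0) \<partial>Pr)
      \<le> ennreal (C * U x / D n) * (\<integral>\<^sup>+y. q y * ennreal (V y) \<partial>lborel)"
    using nn_integral_window_le by blast
  show ?thesis
  proof (intro exI[of _ "C * U 0 * exp \<theta>"] exI[of _ N] conjI allI impI ballI)
    fix m n and f :: "(nat \<Rightarrow> 'a) \<Rightarrow> ennreal"
    assume n: "m + N \<le> n" and f [measurable]: "f \<in> borel_measurable Pr" and dep: "depends_on_first m f"
    define k where "k = n - m"
    have n_eq: "n = k + m" "N \<le> k" using n by (auto simp: k_def)
    define q where "q y = (\<integral>\<^sup>+\<omega>. (if \<forall>j\<le>m. 0 < y + S j \<omega> then f (rev_seq m \<omega>) * ennreal (exp (- \<theta> * (y + S m \<omega>))) else 0) \<partial>Pr)" for y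
    have q_meas [measurable]: "q \<in> borel_measurable borel"
      unfolding q_def[abs_def] by measurable
    have q: "(\<integral>\<^sup>+\<omega>. (if stay_nonneg x m \<omega> then f (rev_seq m \<omega>) * ennreal (exp (- \<theta> * (x + S m \<omega>))) else 0) \<partial>Pr)
        \<le> ennreal (exp \<theta>) * (\<integral>\<^sup>+y. q y * indicator {x<..x+1} y \<partial>lborel)" for x
    proof -
      have "(\<integral>\<^sup>+\<omega>. (if stay_nonneg x m \<omega> then f (rev_seq m \<omega>) * ennreal (exp (- \<theta> * (x + S m \<omega>))) else 0) \<partial>Pr) \<le>
        (\<integral>\<^sup>+\<omega>. ennreal (exp \<theta>) * (\<integral>\<^sup>+y. (if \<forall>j\<le>m. 0 < y + S j \<omega> then f (rev_seq m \<omega>) * ennreal (exp (- \<theta> * (y + S m \<omega>))) else 0) * indicator {x<..x+1} y \<partial>lborel) \<partial>Pr)"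
      proof (intro nn_integral_mono)
        fix \<omega>
        show "(if stay_nonneg x m \<omega> then f (rev_seq m \<omega>) * ennreal (exp (- \<theta> * (x + S m \<omega>))) else 0) \<le>
          ennreal (exp \<theta>) * (\<integral>\<^sup>+y. (if \<forall>j\<le>m. 0 < y + S j \<omega> then f (rev_seq m \<omega>) * ennreal (exp (- \<theta> * (y + S m \<omega>))) else 0) * indicator {x<..x+1} y \<partial>lborel)"
        proof (cases "stay_nonneg x m \<omega>")
          case True
          have "f (rev_seq m \<omega>) * ennreal (exp (- \<theta> * (x + S m \<omega>))) =
              f (rev_seq m \<omega>) * ennreal (exp (- \<theta> * S m \<omega>)) * ennreal (exp (- \<theta> * x))"
            by (simp add: ennreal_mult'[symmetric] exp_add[symmetric] algebra_simps mult.assoc)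
          also have "\<dots> \<le> f (rev_seq m \<omega>) * ennreal (exp (- \<theta> * S m \<omega>)) * (ennreal (exp \<theta>) * (\<integral>\<^sup>+y. ennreal (exp (- \<theta> * y)) * indicator {x<..x+1} y \<partial>lborel))"
            by (intro mult_left_mono exp_le_window assms) auto
          also have "\<dots> = ennreal (exp \<theta>) * (f (rev_seq m \<omega>) * ennreal (exp (- \<theta> * S m \<omega>)) * (\<integral>\<^sup>+y. ennreal (exp (- \<theta> * y)) * indicator {x<..x+1} y \<partial>lborel))"
            by (simp add: mult_ac)
          also have "f (rev_seq m \<omega>) * ennreal (exp (- \<theta> * S m \<omega>)) * (\<integral>\<^sup>+y. ennreal (exp (- \<theta> * y)) * indicator {x<..x+1} y \<partial>lborel) =
              (\<integral>\<^sup>+y. f (rev_seq m \<omega>) * ennreal (exp (- \<theta> * S m \<omega>)) * (ennreal (exp (- \<theta> * y)) * indicator {x<..x+1} y) \<partial>lborel)"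
            by (rule nn_integral_cmult[symmetric]) measurable
          also have "\<dots> = (\<integral>\<^sup>+y. (if \<forall>j\<le>m. 0 < y + S j \<omega> then f (rev_seq m \<omega>) * ennreal (exp (- \<theta> * (y + S m \<omega>))) else 0) * indicator {x<..x+1} y \<partial>lborel)"
          proof (intro nn_integral_cong)
            fix y
            show "f (rev_seq m \<omega>) * ennreal (exp (- \<theta> * S m \<omega>)) * (ennreal (exp (- \<theta> * y)) * indicator {x<..x+1} y) =
              (if \<forall>j\<le>m. 0 < y + S j \<omega> then f (rev_seq m \<omega>) * ennreal (exp (- \<theta> * (y + S m \<omega>))) else 0) * indicator {x<..x+1} y"
            proof (cases "x < y")
              case xy: True
              have "\<forall>j\<le>m. 0 < y + S j \<omega>"
                using True xy by (auto simp: stay_nonneg_def intro: le_less_trans)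
              moreover have "ennreal (exp (- \<theta> * (y + S m \<omega>))) = ennreal (exp (- \<theta> * S m \<omega>)) * ennreal (exp (- \<theta> * y))"
                by (simp add: ennreal_mult'[symmetric] exp_add[symmetric] algebra_simps)
              ultimately show ?thesis by (simp add: mult_ac)
            qed simp
          qed
          finally show ?thesis using True by simp
        qed simp
      qed
      also have "\<dots> = ennreal (exp \<theta>) * (\<integral>\<^sup>+\<omega>. (\<integral>\<^sup>+y. (if \<forall>j\<le>m. 0 < y + S j \<omega> then f (rev_seq m \<omega>) * ennreal (exp (- \<theta> * (y + S m \<omega>))) else 0) * indicator {x<..x+1} y \<partial>lborel) \<partial>Pr)"
        by (rule nn_integral_cmult) measurable
      also have "(\<integral>\<^sup>+\<omega>. (\<integral>\<^sup>+y. (if \<forall>j\<le>m. 0 < y + S j \<omega> then f (rev_seq m \<omega>) * ennreal (exp (- \<theta> * (y + S m \<omega>))) else 0) * indicator {x<..x+1} y \<partial>lborel) \<partial>Pr) =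
          (\<integral>\<^sup>+y. (\<integral>\<^sup>+\<omega>. (if \<forall>j\<le>m. 0 < y + S j \<omega> then f (rev_seq m \<omega>) * ennreal (exp (- \<theta> * (y + S m \<omega>))) else 0) * indicator {x<..x+1} y \<partial>Pr) \<partial>lborel)"
        by (rule Fubini'[symmetric]) measurable
      also have "\<dots> = (\<integral>\<^sup>+y. q y * indicator {x<..x+1} y \<partial>lborel)"
        unfolding q_def by (intro nn_integral_cong nn_integral_multc) measurable
      finally show ?thesis .
    qed
    have "(\<integral>\<^sup>+\<omega>. (if stay_nonneg 0 n \<omega> then f (rev_seq n \<omega>) * ennreal (exp (- \<theta> * S n \<omega>)) else 0) \<partial>Pr) =
      (\<integral>\<^sup>+\<omega>. \<integral>\<^sup>+\<omega>'. (if stay_nonneg 0 n (comb_seq k \<omega> \<omega>') then f (rev_seq n (comb_seq k \<omega> \<omega>')) * ennreal (exp (- \<theta> * S n (comb_seq k \<omega> \<omega>'))) else 0) \<partial>Pr \<partial>Pr)"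
      by (rule nn_integral_comb_seq) measurable
    also have "\<dots> = (\<integral>\<^sup>+\<omega>. (if stay_nonneg 0 k \<omega> then \<integral>\<^sup>+\<omega>'.
        (if stay_nonneg (S k \<omega>) m \<omega>' then f (rev_seq m \<omega>') * ennreal (exp (- \<theta> * (S k \<omega> + S m \<omega>'))) else 0) \<partial>Pr else 0) \<partial>Pr)"
      unfolding n_eq(1) by (intro nn_integral_cong)
        (simp add: stay_nonneg_comb_seq S_comb_seq depends_on_first_rev_comb_seq[OF dep] cong: if_cong)
    also have "\<dots> \<le> (\<integral>\<^sup>+\<omega>. ennreal (exp \<theta>) * (if stay_nonneg 0 k \<omega> then
        (\<integral>\<^sup>+y. q y * indicator {0 + S k \<omega> <.. 0 + S k \<omega> + 1} y \<partial>lborel) else 0) \<partial>Pr)"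
      using q by (intro nn_integral_mono) auto
    also have "\<dots> = ennreal (exp \<theta>) * (\<integral>\<^sup>+\<omega>. (if stay_nonneg 0 k \<omega> then
        (\<integral>\<^sup>+y. q y * indicator {0 + S k \<omega> <.. 0 + S k \<omega> + 1} y \<partial>lborel) else 0) \<partial>Pr)"
    proof (rule nn_integral_cmult)
      have "(\<lambda>\<omega>. \<integral>\<^sup>+y. q y * (if 0 + S k \<omega> < y \<and> y \<le> 0 + S k \<omega> + 1 then 1 else 0) \<partial>lborel) \<in> borel_measurable Pr"
        by measurable
      then have [measurable]: "(\<lambda>\<omega>. \<integral>\<^sup>+y. q y * indicator {0 + S k \<omega> <.. 0 + S k \<omega> + 1} y \<partial>lborel) \<in> borel_measurable Pr"
        by (rule measurable_cong[THEN iffD1, rotated]) (auto simp: indicator_def intro!: nn_integral_cong)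
      show "(\<lambda>\<omega>. if stay_nonneg 0 k \<omega> then
        \<integral>\<^sup>+y. q y * indicator {0 + S k \<omega> <.. 0 + S k \<omega> + 1} y \<partial>lborel else 0) \<in> borel_measurable Pr"
        by measurable
    qed
    also have "\<dots> \<le> ennreal (exp \<theta>) * (ennreal (C * U 0 / D k) * (\<integral>\<^sup>+y. q y * ennreal (V y) \<partial>lborel))"
      using n_eq by (intro mult_left_mono C) auto
    also have "(\<integral>\<^sup>+y. q y * ennreal (V y) \<partial>lborel) =
        (\<integral>\<^sup>+y. ennreal (V y) * (\<integral>\<^sup>+\<omega>. (if \<forall>j\<le>m. 0 < y + S j \<omega> then f (rev_seq m \<omega>) * ennreal (exp (- \<theta> * (y + S m \<omega>))) else 0) \<partial>Pr) \<partial>lborel)"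
      unfolding q_def by (simp add: mult.commute)
    also have "\<dots> = (\<integral>\<^sup>+s. \<integral>\<^sup>+\<omega>. (if \<forall>j\<le>m. S j \<omega> < s then f \<omega> * ennreal (exp (- \<theta> * s)) * ennreal (V (s - S m \<omega>)) else 0) \<partial>Pr \<partial>lborel)"
      by (rule nn_integral_duality) measurable
    also have "ennreal (exp \<theta>) * (ennreal (C * U 0 / D k) * Z) = ennreal (C * U 0 * exp \<theta> / D (n - m)) * Z" for Z
    proof -
      have "ennreal (exp \<theta>) * ennreal (C * U 0 / D k) = ennreal (C * U 0 * exp \<theta> / D (n - m))"
        unfolding k_def[symmetric] by (subst ennreal_mult'[symmetric]) (simp_all add: mult_ac)
      then show ?thesis by (simp only: mult.assoc[symmetric])
    qed
    finally show "(\<integral>\<^sup>+\<omega>. (if stay_nonneg 0 n \<omega> then f (rev_seq n \<omega>) * ennreal (exp (- \<theta> * S n \<omega>)) else 0) \<partial>Pr)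
      \<le> ennreal (C * U 0 * exp \<theta> / D (n - m)) * (\<integral>\<^sup>+s. \<integral>\<^sup>+\<omega>. (if \<forall>j\<le>m. S j \<omega> < s then f \<omega> * ennreal (exp (- \<theta> * s)) * ennreal (V (s - S m \<omega>)) else 0) \<partial>Pr \<partial>lborel)" .
  qed (use C in auto)
qed

end

section \<open>Functionals of finitely many steps\<close>

lemma inf_convolution_approx:
  fixes f :: "'a::metric_space \<Rightarrow> real"
  assumes nonneg: "\<And>x. 0 \<le> f x"
    and lsc: "\<And>x s. s \<longlonglongrightarrow> x \<Longrightarrow> ennreal (f x) \<le> liminf (\<lambda>n. ennreal (f (s n)))"
  shows "\<exists>F. (\<forall>j x. 0 \<le> F j x \<and> F j x \<le> f x) \<and> (\<forall>j x y. \<bar>F j x - F j y\<bar> \<le> real j * dist x y) \<and>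
    (\<forall>j x. F j x \<le> F (Suc j) x) \<and> (\<forall>x. (\<lambda>j. F j x) \<longlonglongrightarrow> f x)"
proof -
  define F where "F j x = (INF y. f y + real j * dist x y)" for j x
  have bdd: "bdd_below (range (\<lambda>y. f y + real j * dist x y))" for j x
    using nonneg by (intro bdd_belowI[of _ 0]) auto
  have le: "F j x \<le> f y + real j * dist x y" for j x y
    unfolding F_def by (rule cINF_lower[OF bdd]) simp
  have ge: "r \<le> F j x" if "\<And>y. r \<le> f y + real j * dist x y" for r j x
    unfolding F_def using that by (intro cINF_greatest) auto
  have F_nonneg: "0 \<le> F j x" for j x
    using nonneg by (intro ge) simp
  have F_le: "F j x \<le> f x" for j x
    using le[of j x x] by simp
  have lip: "F j x - F j y \<le> real j * dist x y" for j x y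
  proof -
    have "F j x - real j * dist x y \<le> F j y"
    proof (rule ge)
      fix z
      have "real j * dist x z \<le> real j * (dist x y + dist y z)"
        by (intro mult_left_mono dist_triangle) auto
      with le[of j x z] show "F j x - real j * dist x y \<le> f z + real j * dist y z"
        by (simp add: algebra_simps)
    qed
    then show ?thesis by simp
  qed
  have mono: "F j x \<le> F (Suc j) x" for j x
  proof (rule ge)
    fix y
    have "f y + real j * dist x y \<le> f y + real (Suc j) * dist x y"
      by (intro add_left_mono mult_right_mono) auto
    with le[of j x y] show "F j x \<le> f y + real (Suc j) * dist x y" by simp
  qed
  have lim: "(\<lambda>j. F j x) \<longlonglongrightarrow> f x" for x
  proof -
    have "\<exists>y. f y + real j * dist x y < F j x + inverse (real (Suc j))" for j
    proof (rule ccontr)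
      assume "\<not> ?thesis"
      then have "F j x + inverse (real (Suc j)) \<le> F j x"
        by (intro ge) (auto simp: not_less)
      then show False by simp
    qed
    then obtain s where s: "\<And>j. f (s j) + real j * dist x (s j) < F j x + inverse (real (Suc j))"
      by metis
    have "incseq (\<lambda>j. F j x)"
      by (rule incseq_SucI) (rule mono)
    moreover have "\<forall>j. F j x \<le> f x"
      using F_le by simp
    ultimately obtain l where l: "(\<lambda>j. F j x) \<longlonglongrightarrow> l"
      by (rule incseq_convergent)
    have "s \<longlonglongrightarrow> x"
    proof (rule tendsto_dist_iff[THEN iffD2])
      have bnd: "dist (s j) x \<le> (f x + 1) * inverse (real j)" if "1 \<le> j" for j
      proof -
        have "inverse (real (Suc j)) \<le> 1" by (simp add: field_simps)
        then have "real j * dist x (s j) \<le> f x + 1"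
          using s[of j] F_le[of j x] nonneg[of "s j"] by linarith
        then show ?thesis
          using that by (simp add: field_simps dist_commute)
      qed
      have "(\<lambda>j. (f x + 1) * inverse (real j)) \<longlonglongrightarrow> (f x + 1) * 0"
        by (intro tendsto_mult tendsto_const lim_inverse_n)
      then have lim0: "(\<lambda>j. (f x + 1) * inverse (real j)) \<longlonglongrightarrow> 0" by simp
      show "(\<lambda>j. dist (s j) x) \<longlonglongrightarrow> 0"
        by (rule tendsto_sandwich[OF _ _ tendsto_const lim0])
          (simp, rule eventually_sequentiallyI[of 1], rule bnd)
    qed
    from lsc[OF this] have "ennreal (f x) \<le> liminf (\<lambda>j. ennreal (f (s j)))" .
    also have "\<dots> \<le> liminf (\<lambda>j. ennreal (F j x + inverse (real (Suc j))))"
    proof (intro Liminf_mono always_eventually allI ennreal_leI)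
      fix j
      have "0 \<le> real j * dist x (s j)" by simp
      with s[of j] show "f (s j) \<le> F j x + inverse (real (Suc j))" by linarith
    qed
    also have "\<dots> = ennreal (l + 0)"
      by (intro lim_imp_Liminf tendsto_ennrealI tendsto_add l LIMSEQ_inverse_real_of_nat) simp
    finally have "f x \<le> l"
      using LIMSEQ_le_const[OF l, of 0] F_nonneg by (auto simp: ennreal_le_iff)
    moreover have "l \<le> f x"
      using l F_le by (intro LIMSEQ_le_const2) auto
    ultimately show ?thesis using l by simp
  qed
  have "\<bar>F j x - F j y\<bar> \<le> real j * dist x y" for j x y
    using lip[of j x y] lip[of j y x] by (auto simp: dist_commute abs_le_iff)
  with F_nonneg F_le mono lim show ?thesis by blast
qed

lemma exp_polynomial_approx:
  fixes h :: "real \<Rightarrow> real"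
  assumes cont: "continuous_on UNIV h" and zero: "\<And>y. R \<le> y \<Longrightarrow> h y = 0" and "0 < R" "0 < \<epsilon>"
  shows "\<exists>a N. \<forall>s\<ge>0. \<bar>h s - (\<Sum>i\<le>N. a i * exp (- real (Suc i) * s))\<bar> \<le> \<epsilon> * exp (- s)"
proof -
  define H where "H r = (if r \<le> 0 then 0 else h (- ln r) / r)" for r
  have small: "H r = 0" if "r \<le> exp (- R)" for r
  proof (cases "r \<le> 0")
    case False
    then have "ln r \<le> ln (exp (- R))"
      using that by (subst ln_le_cancel_iff) auto
    then show ?thesis by (simp add: H_def zero)
  qed (simp add: H_def)
  have "continuous_on ({0..exp (- R)} \<union> {exp (- R)..1}) H"
  proof (rule continuous_on_closed_Un)
    show "continuous_on {0..exp (- R)} H"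
      by (rule continuous_on_eq[of _ "\<lambda>_. 0"]) (auto simp: small)
    show "continuous_on {exp (- R)..1} H"
    proof (rule continuous_on_eq[of _ "\<lambda>r. h (- ln r) / r"])
      show "continuous_on {exp (- R)..1} (\<lambda>r. h (- ln r) / r)"
        by (intro continuous_intros continuous_on_compose2[OF cont]) (auto simp: not_le[symmetric] intro: less_le_trans[OF exp_gt_zero])
      show "h (- ln r) / r = H r" if "r \<in> {exp (- R)..1}" for r
        using that less_le_trans[OF exp_gt_zero, of "- R" r] by (auto simp: H_def)
    qed
  qed auto
  moreover have "{0..exp (- R)} \<union> {exp (- R)..1} = {0..1}"
  proof -
    have "0 \<le> exp (- R)" "exp (- R) \<le> 1" using \<open>0 < R\<close> by auto
    then show ?thesis by (simp add: ivl_disj_un_two_touch)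
  qed
  ultimately have "continuous_on {0..1} H" by simp
  from Stone_Weierstrass_real_polynomial_function[OF compact_Icc this \<open>0 < \<epsilon>\<close>]
  obtain p where p: "real_polynomial_function p" "\<And>r. r \<in> {0..1} \<Longrightarrow> \<bar>H r - p r\<bar> < \<epsilon>"
    by blast
  obtain a N where pa: "p = (\<lambda>x. \<Sum>i\<le>N. a i * x ^ i)"
    using p(1) unfolding real_polynomial_function_iff_sum by blast
  show ?thesis
  proof (intro exI[of _ a] exI[of _ N] allI impI)
    fix s :: real assume "0 \<le> s"
    have "\<bar>H (exp (- s)) - p (exp (- s))\<bar> \<le> \<epsilon>"
      using \<open>0 \<le> s\<close> by (intro less_imp_le p(2)) auto
    then have "exp (- s) * \<bar>H (exp (- s)) - p (exp (- s))\<bar> \<le> exp (- s) * \<epsilon>"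
      by (intro mult_left_mono) auto
    also have "exp (- s) * \<bar>H (exp (- s)) - p (exp (- s))\<bar> = \<bar>exp (- s) * H (exp (- s)) - exp (- s) * p (exp (- s))\<bar>"
      by (simp add: abs_mult right_diff_distrib[symmetric])
    also have "exp (- s) * H (exp (- s)) = h s"
      by (simp add: H_def)
    also have "exp (- s) * p (exp (- s)) = (\<Sum>i\<le>N. a i * exp (- real (Suc i) * s))"
      unfolding pa sum_distrib_left
    proof (rule sum.cong)
      fix i
      have "exp (- real (Suc i) * s) = exp (- s) * exp (- s) ^ i"
        by (simp add: exp_of_nat_mult[symmetric] exp_add[symmetric] algebra_simps)
      then show "exp (- s) * (a i * exp (- s) ^ i) = a i * exp (- real (Suc i) * s)" by simp
    qed simp
    finally show "\<bar>h s - (\<Sum>i\<le>N. a i * exp (- real (Suc i) * s))\<bar> \<le> \<epsilon> * exp (- s)"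
      by (simp add: mult.commute)
  qed
qed

lemma measurable_compose_triple:
  assumes "(\<lambda>(x, y, z). G x y z) \<in> A \<Otimes>\<^sub>M B \<Otimes>\<^sub>M C \<rightarrow>\<^sub>M N" "f \<in> M \<rightarrow>\<^sub>M A" "g \<in> M \<rightarrow>\<^sub>M B" "h \<in> M \<rightarrow>\<^sub>M C"
  shows "(\<lambda>w. G (f w) (g w) (h w)) \<in> M \<rightarrow>\<^sub>M N"
  using measurable_compose[OF measurable_Pair[OF assms(2) measurable_Pair[OF assms(3,4)]] assms(1)] by simp

context stable_walk
begin

lemma integrable_stay:
  assumes [measurable]: "g \<in> borel_measurable borel" and B: "\<And>s. 0 \<le> s \<Longrightarrow> \<bar>g s\<bar> \<le> B"
  shows "integrable Pr (\<lambda>\<omega>. if stay_nonneg x n \<omega> then g (x + S n \<omega>) else (0::real))"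
proof (rule seq.P.integrable_const_bound[of _ "max B 0"])
  have "\<bar>if stay_nonneg x n \<omega> then g (x + S n \<omega>) else 0\<bar> \<le> max B 0" for \<omega>
    using B[of "x + S n \<omega>"] by (auto simp: stay_nonneg_def dest!: spec[of _ n])
  then show "AE \<omega> in Pr. norm (if stay_nonneg x n \<omega> then g (x + S n \<omega>) else 0) \<le> max B 0"
    by simp
qed measurable

lemma exp_sum_V_integrable:
  "integrable lborel (\<lambda>y. (\<Sum>i\<le>N. a' i * exp (- real (Suc i) * y)) * V y)"
proof -
  have "integrable lborel (\<lambda>y. \<Sum>i\<le>N. a' i * (exp (- real (Suc i) * y) * V y))"
    by (intro Bochner_Integration.integrable_sum integrable_mult_right integrable_exp_V) auto
  then show ?thesis
    by (simp add: sum_distrib_right mult.assoc)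
qed

lemma V_nonpos: "y \<le> 0 \<Longrightarrow> V y = 0"
  by (simp add: V_def)

lemma compact_support_lim:
  fixes h :: "real \<Rightarrow> real"
  assumes cont: "continuous_on UNIV h" and zero: "\<And>y. R \<le> y \<Longrightarrow> h y = 0" and "0 < R" and x: "0 \<le> x"
  shows "integrable lborel (\<lambda>y. h y * V y)"
    "(\<lambda>n. D n * (\<integral>\<omega>. (if stay_nonneg x n \<omega> then h (x + S n \<omega>) else 0) \<partial>Pr)) \<longlonglongrightarrow> K * U x * (\<integral>y. h y * V y \<partial>lborel)"
proof -
  have [measurable]: "h \<in> borel_measurable borel"
    using cont by (rule borel_measurable_continuous_onI)
  have int1: "integrable lborel (\<lambda>y. exp (- y) * V y)"
    using integrable_exp_V[of 1] by simp
  obtain Bh where Bh: "\<And>s. 0 \<le> s \<Longrightarrow> \<bar>h s\<bar> \<le> Bh" "0 \<le> Bh"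
  proof -
    have "compact (h ` {0..R})"
      by (intro compact_continuous_image compact_Icc continuous_on_subset[OF cont]) auto
    then obtain B where B: "\<And>s. s \<in> {0..R} \<Longrightarrow> \<bar>h s\<bar> \<le> B"
      using compact_imp_bounded[THEN bounded_iff[THEN iffD1]] by fastforce
    have "\<bar>h s\<bar> \<le> max B 0" if "0 \<le> s" for s
      using B[of s] zero[of s] that by (cases "s \<le> R") auto
    then show thesis by (intro that[of "max B 0"]) auto
  qed
  have hV_bound: "\<bar>h y * V y\<bar> \<le> Bh * exp R * (exp (- y) * V y)" for y
  proof (cases "0 < y \<and> y < R")
    case True
    then have "1 \<le> exp R * exp (- y)" by (simp add: exp_add[symmetric])
    with Bh(1)[of y] True Bh(2) have "\<bar>h y\<bar> \<le> Bh * (exp R * exp (- y))"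
      by (metis less_imp_le mult.right_neutral mult_left_mono order_trans)
    then have "\<bar>h y\<bar> * V y \<le> Bh * (exp R * exp (- y)) * V y"
      by (intro mult_right_mono) auto
    then show ?thesis by (simp add: abs_mult mult_ac)
  next
    case False
    then show ?thesis
      using zero[of y] V_nonpos[of y] Bh(2) by auto
  qed
  show hV: "integrable lborel (\<lambda>y. h y * V y)"
    by (rule Bochner_Integration.integrable_bound[OF integrable_mult_right[OF int1, of "Bh * exp R"]])
      (auto intro!: AE_I2 order_trans[OF hV_bound abs_ge_self] simp del: abs_mult)
  define E where "E n g = D n * (\<integral>\<omega>. (if stay_nonneg x n \<omega> then g (x + S n \<omega>) else 0) \<partial>Pr)" for n and g :: "real \<Rightarrow> real"
  define L where "L g = K * U x * (\<integral>y. g y * V y \<partial>lborel)" for g :: "real \<Rightarrow> real"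
  define e1 where "e1 s = exp (- s)" for s :: real
  have E_exp: "(\<lambda>n. E n (\<lambda>s. exp (- real (Suc i) * s))) \<longlonglongrightarrow> L (\<lambda>s. exp (- real (Suc i) * s))" for i
    unfolding E_def L_def D_def by (rule K_lim) (use x in auto)
  have E_e1: "(\<lambda>n. E n e1) \<longlonglongrightarrow> L e1"
    using E_exp[of 0] by (simp add: e1_def[abs_def])
  have KU: "0 \<le> K * U x" using K_pos by simp
  have "(\<lambda>n. E n h) \<longlonglongrightarrow> L h"
  proof (rule LIMSEQ_I)
    fix r :: real assume "0 < r"
    have Le1: "0 \<le> L e1"
      unfolding L_def e1_def using K_pos by (intro mult_nonneg_nonneg integral_nonneg) auto
    define \<epsilon> where "\<epsilon> = r / (2 * L e1 + 4)"
    have eps: "0 < \<epsilon>" "\<epsilon> * (2 * L e1 + 3) < r"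
    proof -
      show "0 < \<epsilon>" using \<open>0 < r\<close> Le1 by (simp add: \<epsilon>_def)
      have "\<epsilon> * (2 * L e1 + 3) < \<epsilon> * (2 * L e1 + 4)"
        using \<open>0 < \<epsilon>\<close> by (intro mult_strict_left_mono) auto
      also have "\<dots> = r" using Le1 by (simp add: \<epsilon>_def)
      finally show "\<epsilon> * (2 * L e1 + 3) < r" .
    qed
    obtain a' N where aN: "\<And>s. 0 \<le> s \<Longrightarrow> \<bar>h s - (\<Sum>i\<le>N. a' i * exp (- real (Suc i) * s))\<bar> \<le> \<epsilon> * exp (- s)"
      using exp_polynomial_approx[OF cont zero \<open>0 < R\<close> \<open>0 < \<epsilon>\<close>] by blast
    define p where "p s = (\<Sum>i\<le>N. a' i * exp (- real (Suc i) * s))" for s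
    have p_meas [measurable]: "p \<in> borel_measurable borel"
      unfolding p_def[abs_def] by measurable
    have intE: "integrable Pr (\<lambda>\<omega>. if stay_nonneg x n \<omega> then exp (- real (Suc i) * (x + S n \<omega>)) else 0)" for n i
      by (rule integrable_stay[of "\<lambda>s. exp (- real (Suc i) * s)" 1]) (auto simp: mult_nonpos_nonneg)
    have inte1: "integrable Pr (\<lambda>\<omega>. if stay_nonneg x n \<omega> then e1 (x + S n \<omega>) else 0)" for n
      by (rule integrable_stay[of e1 1]) (auto simp: e1_def[abs_def])
    have p_sum: "(if B then p s else 0) = (\<Sum>i\<le>N. a' i * (if B then exp (- real (Suc i) * s) else 0))" for B s
      by (cases B) (simp_all add: p_def)
    have intp: "integrable Pr (\<lambda>\<omega>. if stay_nonneg x n \<omega> then p (x + S n \<omega>) else 0)" for n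
      unfolding p_sum by (intro Bochner_Integration.integrable_sum integrable_mult_right intE)
    have inth: "integrable Pr (\<lambda>\<omega>. if stay_nonneg x n \<omega> then h (x + S n \<omega>) else 0)" for n
      by (rule integrable_stay[OF _ Bh(1)]) auto
    have E_p: "E n p = (\<Sum>i\<le>N. a' i * E n (\<lambda>s. exp (- real (Suc i) * s)))" for n
      unfolding E_def p_sum using intE
      by (subst Bochner_Integration.integral_sum) (auto simp: sum_distrib_left mult_ac)
    have L_p: "L p = (\<Sum>i\<le>N. a' i * L (\<lambda>s. exp (- real (Suc i) * s)))"
    proof -
      have "(\<integral>y. p y * V y \<partial>lborel) = (\<integral>y. (\<Sum>i\<le>N. a' i * (exp (- real (Suc i) * y) * V y)) \<partial>lborel)"
        by (simp add: p_def sum_distrib_right mult.assoc)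
      also have "\<dots> = (\<Sum>i\<le>N. a' i * (\<integral>y. exp (- real (Suc i) * y) * V y \<partial>lborel))"
        by (subst Bochner_Integration.integral_sum)
          (simp_all only: integral_mult_right_zero, intro integrable_mult_right integrable_exp_V, simp)
      finally show ?thesis
        by (simp add: L_def sum_distrib_left mult_ac)
    qed
    have "(\<lambda>n. E n p) \<longlonglongrightarrow> L p"
      unfolding E_p L_p by (intro tendsto_sum tendsto_mult tendsto_const E_exp)
    from LIMSEQ_D[OF this eps(1)] obtain n1 where n1: "\<And>n. n1 \<le> n \<Longrightarrow> \<bar>E n p - L p\<bar> < \<epsilon>"
      by auto
    from LIMSEQ_D[OF E_e1 zero_less_one] obtain n2 where n2: "\<And>n. n2 \<le> n \<Longrightarrow> \<bar>E n e1 - L e1\<bar> < 1"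
      by auto
    have Lh: "\<bar>L h - L p\<bar> \<le> \<epsilon> * L e1"
    proof -
      have ip: "integrable lborel (\<lambda>y. p y * V y)"
        unfolding p_def by (rule exp_sum_V_integrable)
      have "\<bar>(\<integral>y. h y * V y \<partial>lborel) - (\<integral>y. p y * V y \<partial>lborel)\<bar> = \<bar>\<integral>y. h y * V y - p y * V y \<partial>lborel\<bar>"
        using hV ip by simp
      also have "\<dots> \<le> (\<integral>y. \<bar>h y * V y - p y * V y\<bar> \<partial>lborel)"
        by (rule integral_abs_bound)
      also have "\<dots> \<le> (\<integral>y. \<epsilon> * (exp (- y) * V y) \<partial>lborel)"
      proof (rule integral_mono)
        fix y
        show "\<bar>h y * V y - p y * V y\<bar> \<le> \<epsilon> * (exp (- y) * V y)"
        proof (cases "0 < y")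
          case True
          then have "\<bar>h y - p y\<bar> * V y \<le> \<epsilon> * exp (- y) * V y"
            using aN[of y] by (intro mult_right_mono) (auto simp: p_def)
          then show ?thesis by (simp add: left_diff_distrib[symmetric] abs_mult mult.assoc)
        qed (simp add: V_nonpos)
      qed (use hV ip int1 in auto)
      finally have "\<bar>(\<integral>y. h y * V y \<partial>lborel) - (\<integral>y. p y * V y \<partial>lborel)\<bar> \<le> \<epsilon> * (\<integral>y. exp (- y) * V y \<partial>lborel)"
        by simp
      then have "K * U x * \<bar>(\<integral>y. h y * V y \<partial>lborel) - (\<integral>y. p y * V y \<partial>lborel)\<bar> \<le> K * U x * (\<epsilon> * (\<integral>y. exp (- y) * V y \<partial>lborel))"
        using KU by (rule mult_left_mono)
      moreover have "\<bar>L h - L p\<bar> = K * U x * \<bar>(\<integral>y. h y * V y \<partial>lborel) - (\<integral>y. p y * V y \<partial>lborel)\<bar>"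
        unfolding L_def right_diff_distrib[symmetric] abs_mult[of "K * U x"] using KU by simp
      ultimately show ?thesis
        by (simp add: L_def e1_def mult_ac)
    qed
    have Eh: "\<bar>E n h - E n p\<bar> \<le> \<epsilon> * E n e1" if "1 \<le> n" for n
    proof -
      let ?I = "\<lambda>g \<omega>. if stay_nonneg x n \<omega> then g (x + S n \<omega>) else (0::real)"
      have "\<bar>(\<integral>\<omega>. ?I h \<omega> \<partial>Pr) - (\<integral>\<omega>. ?I p \<omega> \<partial>Pr)\<bar> = \<bar>\<integral>\<omega>. ?I h \<omega> - ?I p \<omega> \<partial>Pr\<bar>"
        using inth intp by simp
      also have "\<dots> \<le> (\<integral>\<omega>. \<bar>?I h \<omega> - ?I p \<omega>\<bar> \<partial>Pr)"
        by (rule integral_abs_bound)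
      also have "\<dots> \<le> (\<integral>\<omega>. \<epsilon> * ?I e1 \<omega> \<partial>Pr)"
      proof (rule integral_mono)
        fix \<omega>
        show "\<bar>?I h \<omega> - ?I p \<omega>\<bar> \<le> \<epsilon> * ?I e1 \<omega>"
        proof (cases "stay_nonneg x n \<omega>")
          case True
          then have "0 \<le> x + S n \<omega>" by (auto simp: stay_nonneg_def)
          from aN[OF this, folded p_def] True show ?thesis by (simp add: e1_def)
        qed simp
      qed (use inth intp inte1 in \<open>auto intro!: integrable_abs Bochner_Integration.integrable_diff integrable_mult_right\<close>)
      finally have "\<bar>(\<integral>\<omega>. ?I h \<omega> \<partial>Pr) - (\<integral>\<omega>. ?I p \<omega> \<partial>Pr)\<bar> \<le> \<epsilon> * (\<integral>\<omega>. ?I e1 \<omega> \<partial>Pr)"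
        by simp
      then have "D n * \<bar>(\<integral>\<omega>. ?I h \<omega> \<partial>Pr) - (\<integral>\<omega>. ?I p \<omega> \<partial>Pr)\<bar> \<le> D n * (\<epsilon> * (\<integral>\<omega>. ?I e1 \<omega> \<partial>Pr))"
        using D_pos[OF that] by (intro mult_left_mono) auto
      moreover have "\<bar>E n h - E n p\<bar> = D n * \<bar>(\<integral>\<omega>. ?I h \<omega> \<partial>Pr) - (\<integral>\<omega>. ?I p \<omega> \<partial>Pr)\<bar>"
        unfolding E_def right_diff_distrib[symmetric] abs_mult[of "D n"] using D_pos[OF that] by simp
      ultimately show ?thesis by (simp add: E_def mult_ac)
    qed
    show "\<exists>no. \<forall>n\<ge>no. norm (E n h - L h) < r"
    proof (intro exI allI impI)
      fix n assume n: "max 1 (max n1 n2) \<le> n"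
      have "\<epsilon> * E n e1 \<le> \<epsilon> * (L e1 + 1)"
        using n2[of n] n eps by (intro mult_left_mono) auto
      moreover have "\<bar>E n h - E n p\<bar> \<le> \<epsilon> * E n e1" "\<bar>E n p - L p\<bar> < \<epsilon>"
        using Eh[of n] n1[of n] n by auto
      ultimately have "\<bar>E n h - L h\<bar> < \<epsilon> * (L e1 + 1) + \<epsilon> + \<epsilon> * L e1 + \<epsilon>"
        using Lh eps(1) by linarith
      also have "\<dots> = \<epsilon> * (2 * L e1 + 3)" by (simp add: algebra_simps)
      also have "\<dots> < r" by (rule eps)
      finally show "norm (E n h - L h) < r" by simp
    qed
  qed
  then show "(\<lambda>n. D n * (\<integral>\<omega>. (if stay_nonneg x n \<omega> then h (x + S n \<omega>) else 0) \<partial>Pr)) \<longlonglongrightarrow> K * U x * (\<integral>y. h y * V y \<partial>lborel)"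
    by (simp add: E_def L_def)
qed

lemma liminf_lsc:
  fixes g :: "real \<Rightarrow> real"
  assumes nonneg: "\<And>y. 0 \<le> g y" and x: "0 \<le> x"
    and lsc: "\<And>y s. s \<longlonglongrightarrow> y \<Longrightarrow> ennreal (g y) \<le> liminf (\<lambda>n. ennreal (g (s n)))"
  shows "ennreal (K * U x) * (\<integral>\<^sup>+y. ennreal (g y) * ennreal (V y) \<partial>lborel) \<le>
    liminf (\<lambda>n. ennreal (D n) * (\<integral>\<^sup>+\<omega>. (if stay_nonneg x n \<omega> then ennreal (g (x + S n \<omega>)) else 0) \<partial>Pr))"
proof -
  obtain F where F: "\<And>j y. 0 \<le> F j y" "\<And>j y. F j y \<le> g y" "\<And>j y z. \<bar>F j y - F j z\<bar> \<le> real j * dist y z"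
    "\<And>j y. F j y \<le> F (Suc j) y" "\<And>y. (\<lambda>j. F j y) \<longlonglongrightarrow> g y"
    using inf_convolution_approx[of g, OF nonneg lsc] by blast
  define h where "h j y = F j y * max 0 (min 1 (real (Suc j) - y))" for j y
  have "continuous_on UNIV (F j)" for j
  proof (rule lipschitz_on_continuous_on[of "real j"])
    show "(real j)-lipschitz_on UNIV (F j)"
      using F(3) by (intro lipschitz_onI) (auto simp: dist_real_def)
  qed
  then have h_cont: "continuous_on UNIV (h j)" for j
    unfolding h_def[abs_def] by (intro continuous_intros)
  then have h_meas [measurable]: "h j \<in> borel_measurable borel" for j
    by (rule borel_measurable_continuous_onI)
  have h_nonneg: "0 \<le> h j y" and h_le: "h j y \<le> g y" for j y
    using F(1,2)[of j y] by (auto simp: h_def intro: order_trans[OF mult_left_mono[of _ 1]])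
  have h_zero: "h j y = 0" if "real (Suc j) \<le> y" for j y
    using that by (simp add: h_def max_def)
  have lim: "ennreal (K * U x) * (\<integral>\<^sup>+y. ennreal (h j y) * ennreal (V y) \<partial>lborel) \<le>
    liminf (\<lambda>n. ennreal (D n) * (\<integral>\<^sup>+\<omega>. (if stay_nonneg x n \<omega> then ennreal (g (x + S n \<omega>)) else 0) \<partial>Pr))" for j
  proof -
    note cl = compact_support_lim[of "h j" "real (Suc j)" x, OF h_cont h_zero _ x]
    have KU: "0 \<le> K * U x" using K_pos by simp
    have "ennreal (K * U x) * (\<integral>\<^sup>+y. ennreal (h j y) * ennreal (V y) \<partial>lborel) = ennreal (K * U x) * ennreal (\<integral>y. h j y * V y \<partial>lborel)"
      using cl(1) h_nonneg by (subst nn_integral_eq_integral[symmetric]) (auto simp: ennreal_mult)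
    also have "\<dots> = ennreal (K * U x * (\<integral>y. h j y * V y \<partial>lborel))"
      using h_nonneg KU by (intro ennreal_mult[symmetric] integral_nonneg) auto
    also have "\<dots> = liminf (\<lambda>n. ennreal (D n * (\<integral>\<omega>. (if stay_nonneg x n \<omega> then h j (x + S n \<omega>) else 0) \<partial>Pr)))"
      using cl(2) by (intro lim_imp_Liminf[symmetric] tendsto_ennrealI) auto
    also have "\<dots> \<le> liminf (\<lambda>n. ennreal (D n) * (\<integral>\<^sup>+\<omega>. (if stay_nonneg x n \<omega> then ennreal (g (x + S n \<omega>)) else 0) \<partial>Pr))"
    proof (intro Liminf_mono eventually_sequentiallyI[of 1])
      fix n :: nat assume "1 \<le> n"
      have "ennreal (D n * (\<integral>\<omega>. (if stay_nonneg x n \<omega> then h j (x + S n \<omega>) else 0) \<partial>Pr)) =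
          ennreal (D n) * ennreal (\<integral>\<omega>. (if stay_nonneg x n \<omega> then h j (x + S n \<omega>) else 0) \<partial>Pr)"
        using D_pos[OF \<open>1 \<le> n\<close>] h_nonneg by (intro ennreal_mult integral_nonneg) auto
      also have "\<dots> \<le> ennreal (D n) * (\<integral>\<^sup>+\<omega>. ennreal (if stay_nonneg x n \<omega> then h j (x + S n \<omega>) else 0) \<partial>Pr)"
      proof (cases "integrable Pr (\<lambda>\<omega>. if stay_nonneg x n \<omega> then h j (x + S n \<omega>) else 0)")
        case True
        then show ?thesis
          using h_nonneg by (subst nn_integral_eq_integral) auto
      qed (simp add: not_integrable_integral_eq)
      also have "\<dots> \<le> ennreal (D n) * (\<integral>\<^sup>+\<omega>. (if stay_nonneg x n \<omega> then ennreal (g (x + S n \<omega>)) else 0) \<partial>Pr)"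
        using h_le by (intro mult_left_mono nn_integral_mono) (auto intro!: ennreal_leI)
      finally show "ennreal (D n * (\<integral>\<omega>. (if stay_nonneg x n \<omega> then h j (x + S n \<omega>) else 0) \<partial>Pr)) \<le>
          ennreal (D n) * (\<integral>\<^sup>+\<omega>. (if stay_nonneg x n \<omega> then ennreal (g (x + S n \<omega>)) else 0) \<partial>Pr)" .
    qed
    finally show ?thesis .
  qed
  have "(\<lambda>j. \<integral>\<^sup>+y. ennreal (h j y) * ennreal (V y) \<partial>lborel) \<longlonglongrightarrow> (\<integral>\<^sup>+y. ennreal (g y) * ennreal (V y) \<partial>lborel)"
  proof (rule nn_integral_LIMSEQ)
    show "incseq (\<lambda>j y. ennreal (h j y) * ennreal (V y))"
    proof (rule incseq_SucI, rule le_funI)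
      fix j y
      have "h j y \<le> h (Suc j) y"
        unfolding h_def using F(1,4) by (intro mult_mono) auto
      then show "ennreal (h j y) * ennreal (V y) \<le> ennreal (h (Suc j) y) * ennreal (V y)"
        by (intro mult_right_mono ennreal_leI) auto
    qed
    show "(\<lambda>j. ennreal (h j y) * ennreal (V y)) \<longlonglongrightarrow> ennreal (g y) * ennreal (V y)" for y
    proof -
      have "eventually (\<lambda>j. F j y = h j y) sequentially"
      proof (rule eventually_sequentiallyI[of "nat \<lceil>y\<rceil>"])
        fix j assume "nat \<lceil>y\<rceil> \<le> j"
        then have "1 \<le> real (Suc j) - y" by linarith
        then show "F j y = h j y" by (simp add: h_def max_def min_def)
      qed
      then have "(\<lambda>j. h j y) \<longlonglongrightarrow> g y"
        by (rule Lim_transform_eventually[OF F(5)])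
      then have "(\<lambda>j. ennreal (h j y * V y)) \<longlonglongrightarrow> ennreal (g y * V y)"
        by (intro tendsto_intros)
      then show ?thesis
        using h_nonneg nonneg by (simp add: ennreal_mult)
    qed
  qed measurable
  then have "(\<lambda>j. ennreal (K * U x) * (\<integral>\<^sup>+y. ennreal (h j y) * ennreal (V y) \<partial>lborel)) \<longlonglongrightarrow>
      ennreal (K * U x) * (\<integral>\<^sup>+y. ennreal (g y) * ennreal (V y) \<partial>lborel)"
    by (intro ennreal_tendsto_cmult) simp
  then show ?thesis
    by (rule LIMSEQ_le_const2) (auto intro: lim)
qed

lemma liminf_joint:
  fixes G :: "(nat \<Rightarrow> 'a) \<Rightarrow> (nat \<Rightarrow> 'a) \<Rightarrow> real \<Rightarrow> real"
  assumes G_meas [measurable]: "(\<lambda>(\<omega>, \<omega>', s). G \<omega> \<omega>' s) \<in> borel_measurable (Pr \<Otimes>\<^sub>M Pr \<Otimes>\<^sub>M borel)"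
    and B: "\<And>\<omega> \<omega>' s. 0 \<le> s \<Longrightarrow> G \<omega> \<omega>' s \<le> B"
    and dep1: "\<And>\<omega>' s. depends_on_first k (\<lambda>\<omega>. G \<omega> \<omega>' s)"
    and dep2: "\<And>\<omega> s. depends_on_first k (\<lambda>\<omega>'. G \<omega> \<omega>' s)"
    and cont: "\<And>\<omega> \<omega>' s. isCont (G \<omega> \<omega>') s"
  shows "ennreal K * (\<integral>\<^sup>+\<omega>. (if stay_nonneg 0 k \<omega> then ennreal (U (S k \<omega>)) *
      (\<integral>\<^sup>+s. \<integral>\<^sup>+\<omega>'. (if \<forall>j\<le>k. S j \<omega>' < s then ennreal (G \<omega> \<omega>' s) * ennreal (V (s - S k \<omega>')) else 0) \<partial>Pr \<partial>lborel) else 0) \<partial>Pr)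
    \<le> liminf (\<lambda>n. ennreal (D n) * (\<integral>\<^sup>+\<omega>. (if stay_nonneg 0 n \<omega> then ennreal (G \<omega> (rev_seq n \<omega>) (S n \<omega>)) else 0) \<partial>Pr))"
proof -
  note [measurable] = measurable_compose_triple[OF G_meas]
  define g where "g \<omega> y = (\<integral>\<^sup>+\<omega>'. (if \<forall>j\<le>k. 0 < y + S j \<omega>' then ennreal (G \<omega> (rev_seq k \<omega>') (y + S k \<omega>')) else 0) \<partial>Pr)" for \<omega> y
  have g_le: "g \<omega> y \<le> ennreal B" for \<omega> y
  proof -
    have "g \<omega> y \<le> (\<integral>\<^sup>+\<omega>'. ennreal B \<partial>Pr)"
      unfolding g_def
    proof (rule nn_integral_mono)
      fix \<omega>'
      have "\<forall>j\<le>k. 0 < y + S j \<omega>' \<Longrightarrow> 0 \<le> y + S k \<omega>'" by (auto intro: less_imp_le)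
      then show "(if \<forall>j\<le>k. 0 < y + S j \<omega>' then ennreal (G \<omega> (rev_seq k \<omega>') (y + S k \<omega>')) else 0) \<le> ennreal B"
        using B[of "y + S k \<omega>'" \<omega> "rev_seq k \<omega>'"] by (simp add: ennreal_leI)
    qed
    then show ?thesis by (simp add: seq.P.emeasure_space_1)
  qed
  have g_real: "ennreal (enn2real (g \<omega> y)) = g \<omega> y" for \<omega> y
    using g_le[of \<omega> y] by (intro ennreal_enn2real) (auto intro: le_less_trans)
  have lsc: "g \<omega> y \<le> liminf (\<lambda>n. g \<omega> (s n))" if "s \<longlonglongrightarrow> y" and \<omega>: "\<omega> \<in> space Pr" for \<omega> s y
  proof -
    note [measurable] = \<omega>
    let ?h = "\<lambda>y \<omega>'. if \<forall>j\<le>k. 0 < y + S j \<omega>' then ennreal (G \<omega> (rev_seq k \<omega>') (y + S k \<omega>')) else 0"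
    have "g \<omega> y \<le> (\<integral>\<^sup>+\<omega>'. liminf (\<lambda>n. ?h (s n) \<omega>') \<partial>Pr)"
      unfolding g_def
    proof (rule nn_integral_mono)
      fix \<omega>'
      show "?h y \<omega>' \<le> liminf (\<lambda>n. ?h (s n) \<omega>')"
      proof (cases "\<forall>j\<le>k. 0 < y + S j \<omega>'")
        case True
        have "eventually (\<lambda>n. \<forall>j\<in>{..k}. 0 < s n + S j \<omega>') sequentially"
        proof (intro eventually_ball_finite ballI)
          fix j assume "j \<in> {..k}"
          have "(\<lambda>n. s n + S j \<omega>') \<longlonglongrightarrow> y + S j \<omega>'"
            by (intro tendsto_intros that)
          then show "eventually (\<lambda>n. 0 < s n + S j \<omega>') sequentially"
            by (rule order_tendstoD) (use True \<open>j \<in> {..k}\<close> in auto)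
        qed simp
        then have ev: "eventually (\<lambda>n. ennreal (G \<omega> (rev_seq k \<omega>') (s n + S k \<omega>')) = ?h (s n) \<omega>') sequentially"
          by eventually_elim auto
        have "(\<lambda>n. G \<omega> (rev_seq k \<omega>') (s n + S k \<omega>')) \<longlonglongrightarrow> G \<omega> (rev_seq k \<omega>') (y + S k \<omega>')"
          by (intro isCont_tendsto_compose[OF cont] tendsto_intros that)
        then have "(\<lambda>n. ?h (s n) \<omega>') \<longlonglongrightarrow> ennreal (G \<omega> (rev_seq k \<omega>') (y + S k \<omega>'))"
          by (intro Lim_transform_eventually[OF _ ev] tendsto_ennrealI)
        then have "liminf (\<lambda>n. ?h (s n) \<omega>') = ennreal (G \<omega> (rev_seq k \<omega>') (y + S k \<omega>'))"
          by (intro lim_imp_Liminf) auto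
        with True show ?thesis by simp
      next
        case False
        show ?thesis unfolding if_not_P[OF False] by simp
      qed
    qed
    also have "\<dots> \<le> liminf (\<lambda>n. \<integral>\<^sup>+\<omega>'. ?h (s n) \<omega>' \<partial>Pr)"
      by (rule nn_integral_liminf) measurable
    finally show ?thesis
      by (simp add: g_def)
  qed
  define A where "A n \<omega> = ennreal (D n) * (\<integral>\<^sup>+\<omega>'. (if stay_nonneg (S k \<omega>) n \<omega>' then g \<omega> (S k \<omega> + S n \<omega>') else 0) \<partial>Pr)" for n \<omega>
  have g_meas [measurable]: "(\<lambda>z. g (fst z) (S k (fst z) + S n (snd z))) \<in> borel_measurable (Pr \<Otimes>\<^sub>M Pr)" for n
    unfolding g_def by measurable
  have A_meas [measurable]: "A n \<in> borel_measurable Pr" for n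
  proof -
    have "(\<lambda>z. if \<forall>j\<le>n. 0 \<le> S k (fst z) + S j (snd z) then g (fst z) (S k (fst z) + S n (snd z)) else 0) \<in> borel_measurable (Pr \<Otimes>\<^sub>M Pr)"
      by measurable
    from seq.P.borel_measurable_nn_integral_fst[OF this] show ?thesis
      unfolding A_def[abs_def] stay_nonneg_def by simp
  qed
  have key: "ennreal K * (ennreal (U (S k \<omega>)) *
      (\<integral>\<^sup>+s. \<integral>\<^sup>+\<omega>'. (if \<forall>j\<le>k. S j \<omega>' < s then ennreal (G \<omega> \<omega>' s) * ennreal (V (s - S k \<omega>')) else 0) \<partial>Pr \<partial>lborel))
      \<le> liminf (\<lambda>n. A n \<omega>)" if \<omega>: "\<omega> \<in> space Pr" "stay_nonneg 0 k \<omega>" for \<omega>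
  proof -
    note [measurable] = \<omega>(1)
    have x: "0 \<le> S k \<omega>"
      using \<omega>(2) by (auto simp: stay_nonneg_def)
    have "(\<integral>\<^sup>+s. \<integral>\<^sup>+\<omega>'. (if \<forall>j\<le>k. S j \<omega>' < s then ennreal (G \<omega> \<omega>' s) * ennreal (V (s - S k \<omega>')) else 0) \<partial>Pr \<partial>lborel) =
        (\<integral>\<^sup>+y. ennreal (V y) * g \<omega> y \<partial>lborel)"
      unfolding g_def by (rule nn_integral_duality[symmetric]) measurable
    also have "\<dots> = (\<integral>\<^sup>+y. ennreal (enn2real (g \<omega> y)) * ennreal (V y) \<partial>lborel)"
      by (simp add: g_real mult.commute)
    finally have eq: "(\<integral>\<^sup>+s. \<integral>\<^sup>+\<omega>'. (if \<forall>j\<le>k. S j \<omega>' < s then ennreal (G \<omega> \<omega>' s) * ennreal (V (s - S k \<omega>')) else 0) \<partial>Pr \<partial>lborel) = \<dots>" .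
    have "ennreal (K * U (S k \<omega>)) * (\<integral>\<^sup>+y. ennreal (enn2real (g \<omega> y)) * ennreal (V y) \<partial>lborel) \<le>
      liminf (\<lambda>n. ennreal (D n) * (\<integral>\<^sup>+\<omega>'. (if stay_nonneg (S k \<omega>) n \<omega>' then ennreal (enn2real (g \<omega> (S k \<omega> + S n \<omega>'))) else 0) \<partial>Pr))"
      using x lsc[OF _ \<omega>(1)] by (intro liminf_lsc) (auto simp: g_real)
    then show ?thesis
      unfolding eq g_real A_def using K_pos by (simp add: ennreal_mult' mult.assoc)
  qed
  have "ennreal K * (\<integral>\<^sup>+\<omega>. (if stay_nonneg 0 k \<omega> then ennreal (U (S k \<omega>)) *
      (\<integral>\<^sup>+s. \<integral>\<^sup>+\<omega>'. (if \<forall>j\<le>k. S j \<omega>' < s then ennreal (G \<omega> \<omega>' s) * ennreal (V (s - S k \<omega>')) else 0) \<partial>Pr \<partial>lborel) else 0) \<partial>Pr) =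
    (\<integral>\<^sup>+\<omega>. ennreal K * (if stay_nonneg 0 k \<omega> then ennreal (U (S k \<omega>)) *
      (\<integral>\<^sup>+s. \<integral>\<^sup>+\<omega>'. (if \<forall>j\<le>k. S j \<omega>' < s then ennreal (G \<omega> \<omega>' s) * ennreal (V (s - S k \<omega>')) else 0) \<partial>Pr \<partial>lborel) else 0) \<partial>Pr)"
    by (rule nn_integral_cmult[symmetric]) measurable
  also have "\<dots> \<le> (\<integral>\<^sup>+\<omega>. liminf (\<lambda>n. if stay_nonneg 0 k \<omega> then A n \<omega> else 0) \<partial>Pr)"
    using key by (intro nn_integral_mono) auto
  also have "\<dots> \<le> liminf (\<lambda>n. \<integral>\<^sup>+\<omega>. (if stay_nonneg 0 k \<omega> then A n \<omega> else 0) \<partial>Pr)"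
    by (rule nn_integral_liminf) measurable
  also have "\<dots> \<le> liminf (\<lambda>n. ennreal (D (n + 2 * k)) * (\<integral>\<^sup>+\<omega>. (if stay_nonneg 0 (n + 2 * k) \<omega> then ennreal (G \<omega> (rev_seq (n + 2 * k) \<omega>) (S (n + 2 * k) \<omega>)) else 0) \<partial>Pr))"
  proof (intro Liminf_mono eventually_sequentiallyI[of 1])
    fix n :: nat assume n: "1 \<le> n"
    define N where "N = n + 2 * k"
    have N: "N = k + (n + k)" by (simp add: N_def)
    have inner: "(\<integral>\<^sup>+\<omega>'. (if stay_nonneg x n \<omega>' then g \<omega> (x + S n \<omega>') else 0) \<partial>Pr) \<le>
        (\<integral>\<^sup>+\<omega>'. (if stay_nonneg x (n + k) \<omega>' then ennreal (G \<omega> (rev_seq (n + k) \<omega>') (x + S (n + k) \<omega>')) else 0) \<partial>Pr)"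
      if [measurable]: "\<omega> \<in> space Pr" for \<omega> x
    proof -
      have "(\<integral>\<^sup>+\<omega>'. (if stay_nonneg x (n + k) \<omega>' then ennreal (G \<omega> (rev_seq (n + k) \<omega>') (x + S (n + k) \<omega>')) else 0) \<partial>Pr) =
        (\<integral>\<^sup>+\<omega>'. \<integral>\<^sup>+\<omega>''. (if stay_nonneg x (n + k) (comb_seq n \<omega>' \<omega>'') then ennreal (G \<omega> (rev_seq (n + k) (comb_seq n \<omega>' \<omega>'')) (x + S (n + k) (comb_seq n \<omega>' \<omega>''))) else 0) \<partial>Pr \<partial>Pr)"
        by (rule nn_integral_comb_seq) measurable
      also have "\<dots> \<ge> (\<integral>\<^sup>+\<omega>'. (if stay_nonneg x n \<omega>' then g \<omega> (x + S n \<omega>') else 0) \<partial>Pr)"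
      proof (rule nn_integral_mono)
        fix \<omega>'
        show "(if stay_nonneg x n \<omega>' then g \<omega> (x + S n \<omega>') else 0) \<le>
          (\<integral>\<^sup>+\<omega>''. (if stay_nonneg x (n + k) (comb_seq n \<omega>' \<omega>'') then ennreal (G \<omega> (rev_seq (n + k) (comb_seq n \<omega>' \<omega>'')) (x + S (n + k) (comb_seq n \<omega>' \<omega>''))) else 0) \<partial>Pr)"
        proof (cases "stay_nonneg x n \<omega>'")
          case True
          have "stay_nonneg (x + S n \<omega>') k \<omega>''" if "\<forall>j\<le>k. 0 < x + S n \<omega>' + S j \<omega>''" for \<omega>''
            using that by (auto simp: stay_nonneg_def intro: less_imp_le)
          moreover have "G \<omega> (rev_seq (n + k) (comb_seq n \<omega>' \<omega>'')) r = G \<omega> (rev_seq k \<omega>'') r" for \<omega>'' r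
            by (rule depends_on_first_rev_comb_seq[OF dep2]) simp
          ultimately show ?thesis
            using True unfolding g_def stay_nonneg_comb_seq S_comb_seq
            by (auto intro!: nn_integral_mono simp: add.assoc)
        qed simp
      qed
      finally show ?thesis .
    qed
    have "(\<integral>\<^sup>+\<omega>. (if stay_nonneg 0 N \<omega> then ennreal (G \<omega> (rev_seq N \<omega>) (S N \<omega>)) else 0) \<partial>Pr) =
      (\<integral>\<^sup>+\<omega>. \<integral>\<^sup>+\<omega>'. (if stay_nonneg 0 N (comb_seq k \<omega> \<omega>') then ennreal (G (comb_seq k \<omega> \<omega>') (rev_seq N (comb_seq k \<omega> \<omega>')) (S N (comb_seq k \<omega> \<omega>'))) else 0) \<partial>Pr \<partial>Pr)"
      by (rule nn_integral_comb_seq) measurable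
    also have "\<dots> = (\<integral>\<^sup>+\<omega>. (if stay_nonneg 0 k \<omega> then \<integral>\<^sup>+\<omega>'. (if stay_nonneg (S k \<omega>) (n + k) \<omega>' then
        ennreal (G \<omega> (rev_seq (n + k) \<omega>') (S k \<omega> + S (n + k) \<omega>')) else 0) \<partial>Pr else 0) \<partial>Pr)"
    proof -
      have "G (comb_seq k \<omega> \<omega>') (rev_seq N (comb_seq k \<omega> \<omega>')) r = G \<omega> (rev_seq (n + k) \<omega>') r" for \<omega> \<omega>' r
        unfolding N using depends_on_first_comb_seq[OF dep1] depends_on_first_rev_comb_seq[OF dep2, of "n + k"] by simp
      then show ?thesis
        unfolding N by (intro nn_integral_cong) (simp add: stay_nonneg_comb_seq S_comb_seq cong: if_cong)
    qed
    also have "\<dots> \<ge> (\<integral>\<^sup>+\<omega>. (if stay_nonneg 0 k \<omega> then \<integral>\<^sup>+\<omega>'. (if stay_nonneg (S k \<omega>) n \<omega>' then g \<omega> (S k \<omega> + S n \<omega>') else 0) \<partial>Pr else 0) \<partial>Pr)"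
      using inner by (intro nn_integral_mono) auto
    finally have le: "(\<integral>\<^sup>+\<omega>. (if stay_nonneg 0 k \<omega> then \<integral>\<^sup>+\<omega>'. (if stay_nonneg (S k \<omega>) n \<omega>' then g \<omega> (S k \<omega> + S n \<omega>') else 0) \<partial>Pr else 0) \<partial>Pr) \<le>
      (\<integral>\<^sup>+\<omega>. (if stay_nonneg 0 N \<omega> then ennreal (G \<omega> (rev_seq N \<omega>) (S N \<omega>)) else 0) \<partial>Pr)" .
    have "(\<integral>\<^sup>+\<omega>. (if stay_nonneg 0 k \<omega> then A n \<omega> else 0) \<partial>Pr) =
        (\<integral>\<^sup>+\<omega>. ennreal (D n) * (if stay_nonneg 0 k \<omega> then \<integral>\<^sup>+\<omega>'. (if stay_nonneg (S k \<omega>) n \<omega>' then g \<omega> (S k \<omega> + S n \<omega>') else 0) \<partial>Pr else 0) \<partial>Pr)"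
      unfolding A_def by (intro nn_integral_cong) auto
    also have "\<dots> = ennreal (D n) * (\<integral>\<^sup>+\<omega>. (if stay_nonneg 0 k \<omega> then \<integral>\<^sup>+\<omega>'. (if stay_nonneg (S k \<omega>) n \<omega>' then g \<omega> (S k \<omega> + S n \<omega>') else 0) \<partial>Pr else 0) \<partial>Pr)"
    proof (rule nn_integral_cmult)
      have "(\<lambda>z. if \<forall>j\<le>n. 0 \<le> S k (fst z) + S j (snd z) then g (fst z) (S k (fst z) + S n (snd z)) else 0) \<in> borel_measurable (Pr \<Otimes>\<^sub>M Pr)"
        by measurable
      from seq.P.borel_measurable_nn_integral_fst[OF this]
      have [measurable]: "(\<lambda>\<omega>. \<integral>\<^sup>+\<omega>'. (if stay_nonneg (S k \<omega>) n \<omega>' then g \<omega> (S k \<omega> + S n \<omega>') else 0) \<partial>Pr) \<in> borel_measurable Pr"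
        unfolding stay_nonneg_def by simp
      show "(\<lambda>\<omega>. if stay_nonneg 0 k \<omega> then \<integral>\<^sup>+\<omega>'. (if stay_nonneg (S k \<omega>) n \<omega>' then g \<omega> (S k \<omega> + S n \<omega>') else 0) \<partial>Pr else 0) \<in> borel_measurable Pr"
        by measurable
    qed
    also have "\<dots> \<le> ennreal (D N) * (\<integral>\<^sup>+\<omega>. (if stay_nonneg 0 N \<omega> then ennreal (G \<omega> (rev_seq N \<omega>) (S N \<omega>)) else 0) \<partial>Pr)"
      using n by (intro mult_mono ennreal_leI D_mono le) (auto simp: N_def)
    finally show "(\<integral>\<^sup>+\<omega>. (if stay_nonneg 0 k \<omega> then A n \<omega> else 0) \<partial>Pr) \<le>
      ennreal (D (n + 2 * k)) * (\<integral>\<^sup>+\<omega>. (if stay_nonneg 0 (n + 2 * k) \<omega> then ennreal (G \<omega> (rev_seq (n + 2 * k) \<omega>) (S (n + 2 * k) \<omega>)) else 0) \<partial>Pr)"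
      by (simp only: N_def)
  qed
  also have "\<dots> = liminf (\<lambda>n. ennreal (D n) * (\<integral>\<^sup>+\<omega>. (if stay_nonneg 0 n \<omega> then ennreal (G \<omega> (rev_seq n \<omega>) (S n \<omega>)) else 0) \<partial>Pr))"
    by (rule liminf_shift_k)
  finally show ?thesis .
qed

end

section \<open>Convergent functionals\<close>

lemma depends_on_first_le: "depends_on_first m f \<Longrightarrow> m \<le> n \<Longrightarrow> depends_on_first n f"
  unfolding depends_on_first_def by auto

lemma depends_on_first_map: "depends_on_first m f \<Longrightarrow> depends_on_first m (\<lambda>\<omega>. h (f \<omega>))"
  unfolding depends_on_first_def by metis

lemma depends_on_first_map2:
  "depends_on_first m f \<Longrightarrow> depends_on_first m g \<Longrightarrow> depends_on_first m (\<lambda>\<omega>. h (f \<omega>) (g \<omega>))"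
  unfolding depends_on_first_def by metis

locale conditioned_limits = stable_walk Q X e c \<alpha> K \<mu>
  for Q :: "'a measure" and X e c \<alpha> K \<mu> +
  fixes Pp :: "(nat \<Rightarrow> 'a) measure" and Pm :: "real \<Rightarrow> (nat \<Rightarrow> 'a) measure"
    and \<theta> :: real and mm :: "nat \<Rightarrow> nat"
    and W :: "nat \<Rightarrow> (nat \<Rightarrow> 'a) \<Rightarrow> 'w::polish_space" and Winf :: "(nat \<Rightarrow> 'a) \<Rightarrow> 'w"
    and T :: "nat \<Rightarrow> (nat \<Rightarrow> 'a) \<Rightarrow> 't::polish_space" and Tinf :: "(nat \<Rightarrow> 'a) \<Rightarrow> 't"
  assumes \<theta>: "0 < \<theta>"
    and Pp_prob: "prob_space Pp" and Pp_sets [measurable_cong]: "sets Pp = sets (\<Pi>\<^sub>M i\<in>UNIV. Q)"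
    and Pp_eq: "\<And>m f B. 1 \<le> m \<Longrightarrow> f \<in> borel_measurable Pr \<Longrightarrow> depends_on_first m f \<Longrightarrow> (\<And>\<omega>. f \<omega> \<le> ennreal B) \<Longrightarrow>
      (\<integral>\<^sup>+\<omega>. f \<omega> \<partial>Pp) = (\<integral>\<^sup>+\<omega>. (if stay_nonneg 0 m \<omega> then f \<omega> * ennreal (U (S m \<omega>)) else 0) \<partial>Pr)"
    and Pm_prob: "\<And>s. 0 < s \<Longrightarrow> prob_space (Pm s)" and Pm_sets: "\<And>s. 0 < s \<Longrightarrow> sets (Pm s) = sets (\<Pi>\<^sub>M i\<in>UNIV. Q)"
    and Pm_eq: "\<And>s m f B. 0 < s \<Longrightarrow> 1 \<le> m \<Longrightarrow> f \<in> borel_measurable Pr \<Longrightarrow> depends_on_first m f \<Longrightarrow> (\<And>\<omega>. f \<omega> \<le> ennreal B) \<Longrightarrow>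
      ennreal (V s) * (\<integral>\<^sup>+\<omega>. f \<omega> \<partial>Pm s) = (\<integral>\<^sup>+\<omega>. (if \<forall>j\<le>m. S j \<omega> < s then f \<omega> * ennreal (V (s - S m \<omega>)) else 0) \<partial>Pr)"
    and mm_mono: "mono mm" and mm_pos: "eventually (\<lambda>n. 1 \<le> mm n) sequentially"
    and mm_le: "\<exists>p. eventually (\<lambda>n. n \<le> 2 ^ p * (n - mm n)) sequentially"
    and W_meas [measurable]: "\<And>n. W n \<in> borel_measurable Pr" and Winf_meas [measurable]: "Winf \<in> borel_measurable Pr"
    and W_dep: "\<And>n. depends_on_first (mm n) (W n)"
    and W_lim: "AE \<omega> in Pp. (\<lambda>n. W n \<omega>) \<longlonglongrightarrow> Winf \<omega>"
    and T_meas [measurable]: "\<And>n. T n \<in> borel_measurable Pr" and Tinf_meas [measurable]: "Tinf \<in> borel_measurable Pr"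
    and T_dep: "\<And>n. depends_on_first (mm n) (T n)"
    and T_lim: "\<And>s. 0 < s \<Longrightarrow> AE \<omega> in Pm s. (\<lambda>n. T n \<omega>) \<longlonglongrightarrow> Tinf \<omega>"
begin

sublocale Pp: prob_space Pp by (rule Pp_prob)

lemma Pm_integral_measurable:
  assumes m: "1 \<le> m" and [measurable]: "(\<lambda>(\<omega>, s). f \<omega> s) \<in> borel_measurable (Pr \<Otimes>\<^sub>M borel)"
    and dep: "\<And>s. depends_on_first m (\<lambda>\<omega>. f \<omega> s)" and B: "\<And>\<omega> s. f \<omega> s \<le> ennreal B"
  shows "(\<lambda>s. ennreal (V s) * (\<integral>\<^sup>+\<omega>. f \<omega> s \<partial>Pm s)) =
      (\<lambda>s. \<integral>\<^sup>+\<omega>. (if \<forall>j\<le>m. S j \<omega> < s then f \<omega> s * ennreal (V (s - S m \<omega>)) else 0) \<partial>Pr)"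
    and "(\<lambda>s. ennreal (V s) * (\<integral>\<^sup>+\<omega>. f \<omega> s \<partial>Pm s)) \<in> borel_measurable borel"
proof -
  show eq: "(\<lambda>s. ennreal (V s) * (\<integral>\<^sup>+\<omega>. f \<omega> s \<partial>Pm s)) =
      (\<lambda>s. \<integral>\<^sup>+\<omega>. (if \<forall>j\<le>m. S j \<omega> < s then f \<omega> s * ennreal (V (s - S m \<omega>)) else 0) \<partial>Pr)"
  proof
    fix s
    show "ennreal (V s) * (\<integral>\<^sup>+\<omega>. f \<omega> s \<partial>Pm s) =
      (\<integral>\<^sup>+\<omega>. (if \<forall>j\<le>m. S j \<omega> < s then f \<omega> s * ennreal (V (s - S m \<omega>)) else 0) \<partial>Pr)"
    proof (cases "0 < s")
      case True
      have "(\<lambda>\<omega>. f \<omega> s) \<in> borel_measurable Pr" by measurable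
      from Pm_eq[OF True m this dep B] show ?thesis .
    next
      case False
      then have "\<not> (\<forall>j\<le>m. S j \<omega> < s)" for \<omega>
        by (auto intro!: exI[of _ 0])
      then have "(\<integral>\<^sup>+\<omega>. (if \<forall>j\<le>m. S j \<omega> < s then f \<omega> s * ennreal (V (s - S m \<omega>)) else 0) \<partial>Pr) = 0"
        by (simp only: if_False nn_integral_const mult_zero_left)
      with False show ?thesis by (simp only: V_nonpos not_less ennreal_0 mult_zero_left)
    qed
  qed
  show "(\<lambda>s. ennreal (V s) * (\<integral>\<^sup>+\<omega>. f \<omega> s \<partial>Pm s)) \<in> borel_measurable borel"
    unfolding eq by measurable
qed

lemma D_ratio: "\<exists>C. 0 \<le> C \<and> eventually (\<lambda>n. D n \<le> C * D (n - mm n)) sequentially"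
proof -
  obtain p where p: "eventually (\<lambda>n. n \<le> 2 ^ p * (n - mm n)) sequentially"
    using mm_le by blast
  obtain N :: nat where N: "\<And>k n. N \<le> k \<Longrightarrow> 1 \<le> n \<Longrightarrow> n \<le> 2 ^ p * k \<Longrightarrow> c n \<le> 4 ^ p * c k"
    using stable_norming_scale[OF norming \<alpha>, of p] by blast
  show ?thesis
  proof (intro exI[of _ "2 ^ p * 4 ^ p"] conjI)
    show "eventually (\<lambda>n. D n \<le> 2 ^ p * 4 ^ p * D (n - mm n)) sequentially"
      using p eventually_ge_at_top[of "2 ^ p * N + 1"]
    proof eventually_elim
      fix n assume n: "n \<le> 2 ^ p * (n - mm n)" "2 ^ p * N + 1 \<le> n"
      then have "2 ^ p * N < 2 ^ p * (n - mm n)" by linarith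
      then have "N \<le> n - mm n" by simp
      from N[OF this _ n(1)] n(2) have "c n \<le> 4 ^ p * c (n - mm n)" by simp
      moreover have "real n \<le> real (2 ^ p * (n - mm n))"
        using n(1) by (simp only: of_nat_le_iff)
      then have "real n \<le> 2 ^ p * real (n - mm n)"
        by (simp only: of_nat_mult of_nat_power of_nat_numeral)
      moreover have "0 \<le> c n"
        using stable_norming_pos[OF norming, of n] n(2) by simp
      ultimately have "real n * c n \<le> (2 ^ p * real (n - mm n)) * (4 ^ p * c (n - mm n))"
        by (intro mult_mono) simp_all
      then show "D n \<le> 2 ^ p * 4 ^ p * D (n - mm n)"
        by (simp add: D_def mult_ac)
    qed
  qed simp
qed

definition weighted :: "((nat \<Rightarrow> 'a) \<Rightarrow> nat \<Rightarrow> ennreal) \<Rightarrow> nat \<Rightarrow> ennreal" where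
  "weighted f n = ennreal (D n) * (\<integral>\<^sup>+\<omega>. (if stay_nonneg 0 n \<omega> then f \<omega> n * ennreal (exp (- \<theta> * S n \<omega>)) else 0) \<partial>Pr)"

definition Rint :: "((nat \<Rightarrow> 'a) \<Rightarrow> (nat \<Rightarrow> 'a) \<Rightarrow> real \<Rightarrow> ennreal) \<Rightarrow> ennreal" where
  "Rint f = (\<integral>\<^sup>+s. ennreal (V s) * (\<integral>\<^sup>+\<omega>'. (\<integral>\<^sup>+\<omega>. f \<omega> \<omega>' s \<partial>Pp) * ennreal (exp (- \<theta> * s)) \<partial>Pm s) \<partial>lborel)"

lemma Rint_finite_coordinates:
  fixes f :: "(nat \<Rightarrow> 'a) \<Rightarrow> (nat \<Rightarrow> 'a) \<Rightarrow> real \<Rightarrow> ennreal"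
  assumes m: "1 \<le> m" and f_meas: "(\<lambda>(\<omega>, \<omega>', s). f \<omega> \<omega>' s) \<in> borel_measurable (Pr \<Otimes>\<^sub>M Pr \<Otimes>\<^sub>M borel)"
    and dep: "\<And>\<omega> s. depends_on_first m (\<lambda>\<omega>'. f \<omega> \<omega>' s)" and B: "\<And>\<omega> \<omega>' s. f \<omega> \<omega>' s \<le> ennreal B"
  shows "Rint f = (\<integral>\<^sup>+s. \<integral>\<^sup>+\<omega>'. (if \<forall>j\<le>m. S j \<omega>' < s then (\<integral>\<^sup>+\<omega>. f \<omega> \<omega>' s \<partial>Pp) * ennreal (exp (- \<theta> * s)) * ennreal (V (s - S m \<omega>')) else 0) \<partial>Pr \<partial>lborel)"
    and "(\<lambda>s. ennreal (V s) * (\<integral>\<^sup>+\<omega>'. (\<integral>\<^sup>+\<omega>. f \<omega> \<omega>' s \<partial>Pp) * ennreal (exp (- \<theta> * s)) \<partial>Pm s)) \<in> borel_measurable borel"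
proof -
  have swap: "(\<lambda>((\<omega>', s), \<omega>). f \<omega> \<omega>' s) \<in> borel_measurable ((Pr \<Otimes>\<^sub>M borel) \<Otimes>\<^sub>M Pr)"
  proof -
    have "(\<lambda>z. (snd z, fst (fst z), snd (fst z))) \<in> (Pr \<Otimes>\<^sub>M borel) \<Otimes>\<^sub>M Pr \<rightarrow>\<^sub>M Pr \<Otimes>\<^sub>M Pr \<Otimes>\<^sub>M (borel :: real measure)"
      by measurable
    from measurable_compose[OF this f_meas] show ?thesis
      by (simp add: split_beta')
  qed
  have F_meas [measurable]: "(\<lambda>(\<omega>', s). \<integral>\<^sup>+\<omega>. f \<omega> \<omega>' s \<partial>Pp) \<in> borel_measurable (Pr \<Otimes>\<^sub>M borel)"
  proof -
    have *: "sets ((Pr \<Otimes>\<^sub>M (borel :: real measure)) \<Otimes>\<^sub>M Pr) = sets ((Pr \<Otimes>\<^sub>M borel) \<Otimes>\<^sub>M Pp)"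
      using Pp_sets by (intro sets_pair_measure_cong) auto
    show ?thesis
      using Pp.borel_measurable_nn_integral_fst[OF swap[unfolded measurable_cong_sets[OF * refl]]]
      by (simp add: split_beta')
  qed
  have inner_le: "(\<integral>\<^sup>+\<omega>. f \<omega> \<omega>' s \<partial>Pp) \<le> ennreal B" for \<omega>' s
    using nn_integral_mono[of Pp "\<lambda>\<omega>. f \<omega> \<omega>' s" "\<lambda>_. ennreal B"] B by (simp add: Pp.emeasure_space_1)
  note Pm_int = Pm_integral_measurable[OF m, of "\<lambda>\<omega>' s. (\<integral>\<^sup>+\<omega>. f \<omega> \<omega>' s \<partial>Pp) * ennreal (exp (- \<theta> * max 0 s))" B]
  have prem: "(\<lambda>(\<omega>', s). (\<integral>\<^sup>+\<omega>. f \<omega> \<omega>' s \<partial>Pp) * ennreal (exp (- \<theta> * max 0 s))) \<in> borel_measurable (Pr \<Otimes>\<^sub>M borel)"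
    "\<And>s. depends_on_first m (\<lambda>\<omega>'. (\<integral>\<^sup>+\<omega>. f \<omega> \<omega>' s \<partial>Pp) * ennreal (exp (- \<theta> * max 0 s)))"
    "\<And>\<omega>' s. (\<integral>\<^sup>+\<omega>. f \<omega> \<omega>' s \<partial>Pp) * ennreal (exp (- \<theta> * max 0 s)) \<le> ennreal B"
  proof -
    have "(\<lambda>z. (\<integral>\<^sup>+\<omega>. f \<omega> (fst z) (snd z) \<partial>Pp) * ennreal (exp (- \<theta> * max 0 (snd z)))) \<in> borel_measurable (Pr \<Otimes>\<^sub>M borel)"
      using F_meas unfolding split_beta' by measurable
    then show "(\<lambda>(\<omega>', s). (\<integral>\<^sup>+\<omega>. f \<omega> \<omega>' s \<partial>Pp) * ennreal (exp (- \<theta> * max 0 s))) \<in> borel_measurable (Pr \<Otimes>\<^sub>M borel)"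
      by (simp add: split_beta')
    show "depends_on_first m (\<lambda>\<omega>'. (\<integral>\<^sup>+\<omega>. f \<omega> \<omega>' s \<partial>Pp) * ennreal (exp (- \<theta> * max 0 s)))" for s
      unfolding depends_on_first_def
    proof (intro allI impI)
      fix \<omega>1 \<omega>2 :: "nat \<Rightarrow> 'a" assume "\<forall>i<m. \<omega>1 i = \<omega>2 i"
      then have "f \<omega> \<omega>1 s = f \<omega> \<omega>2 s" for \<omega>
        using dep[of \<omega> s] unfolding depends_on_first_def by blast
      then show "(\<integral>\<^sup>+\<omega>. f \<omega> \<omega>1 s \<partial>Pp) * ennreal (exp (- \<theta> * max 0 s)) = (\<integral>\<^sup>+\<omega>. f \<omega> \<omega>2 s \<partial>Pp) * ennreal (exp (- \<theta> * max 0 s))"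
        by simp
    qed
    show "(\<integral>\<^sup>+\<omega>. f \<omega> \<omega>' s \<partial>Pp) * ennreal (exp (- \<theta> * max 0 s)) \<le> ennreal B" for \<omega>' s
    proof -
      have "(\<integral>\<^sup>+\<omega>. f \<omega> \<omega>' s \<partial>Pp) * ennreal (exp (- \<theta> * max 0 s)) \<le> ennreal B * ennreal 1"
        using \<theta> by (intro mult_mono inner_le ennreal_leI) auto
      then show ?thesis by simp
    qed
  qed
  have max_eq: "ennreal (V s) * (\<integral>\<^sup>+\<omega>'. (\<integral>\<^sup>+\<omega>. f \<omega> \<omega>' s \<partial>Pp) * ennreal (exp (- \<theta> * max 0 s)) \<partial>Pm s) =
      ennreal (V s) * (\<integral>\<^sup>+\<omega>'. (\<integral>\<^sup>+\<omega>. f \<omega> \<omega>' s \<partial>Pp) * ennreal (exp (- \<theta> * s)) \<partial>Pm s)" for s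
    by (cases "0 < s") (simp_all add: V_nonpos max_def)
  show "(\<lambda>s. ennreal (V s) * (\<integral>\<^sup>+\<omega>'. (\<integral>\<^sup>+\<omega>. f \<omega> \<omega>' s \<partial>Pp) * ennreal (exp (- \<theta> * s)) \<partial>Pm s)) \<in> borel_measurable borel"
    using Pm_int(2)[OF prem] unfolding max_eq .
  show "Rint f = (\<integral>\<^sup>+s. \<integral>\<^sup>+\<omega>'. (if \<forall>j\<le>m. S j \<omega>' < s then (\<integral>\<^sup>+\<omega>. f \<omega> \<omega>' s \<partial>Pp) * ennreal (exp (- \<theta> * s)) * ennreal (V (s - S m \<omega>')) else 0) \<partial>Pr \<partial>lborel)"
    unfolding Rint_def
  proof (intro nn_integral_cong)
    fix s :: real
    have "ennreal (V s) * (\<integral>\<^sup>+\<omega>'. (\<integral>\<^sup>+\<omega>. f \<omega> \<omega>' s \<partial>Pp) * ennreal (exp (- \<theta> * s)) \<partial>Pm s) =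
      (\<integral>\<^sup>+\<omega>'. (if \<forall>j\<le>m. S j \<omega>' < s then (\<integral>\<^sup>+\<omega>. f \<omega> \<omega>' s \<partial>Pp) * ennreal (exp (- \<theta> * max 0 s)) * ennreal (V (s - S m \<omega>')) else 0) \<partial>Pr)"
      using fun_cong[OF Pm_int(1)[OF prem], of s] unfolding max_eq .
    also have "\<dots> = (\<integral>\<^sup>+\<omega>'. (if \<forall>j\<le>m. S j \<omega>' < s then (\<integral>\<^sup>+\<omega>. f \<omega> \<omega>' s \<partial>Pp) * ennreal (exp (- \<theta> * s)) * ennreal (V (s - S m \<omega>')) else 0) \<partial>Pr)"
    proof (intro nn_integral_cong if_cong refl)
      fix \<omega>' assume "\<forall>j\<le>m. S j \<omega>' < s"
      then have "0 < s" by (auto dest: spec[of _ 0])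
      then show "(\<integral>\<^sup>+\<omega>. f \<omega> \<omega>' s \<partial>Pp) * ennreal (exp (- \<theta> * max 0 s)) * ennreal (V (s - S m \<omega>')) =
          (\<integral>\<^sup>+\<omega>. f \<omega> \<omega>' s \<partial>Pp) * ennreal (exp (- \<theta> * s)) * ennreal (V (s - S m \<omega>'))"
        by (simp add: max_def)
    qed
    finally show "ennreal (V s) * (\<integral>\<^sup>+\<omega>'. (\<integral>\<^sup>+\<omega>. f \<omega> \<omega>' s \<partial>Pp) * ennreal (exp (- \<theta> * s)) \<partial>Pm s) =
      (\<integral>\<^sup>+\<omega>'. (if \<forall>j\<le>m. S j \<omega>' < s then (\<integral>\<^sup>+\<omega>. f \<omega> \<omega>' s \<partial>Pp) * ennreal (exp (- \<theta> * s)) * ennreal (V (s - S m \<omega>')) else 0) \<partial>Pr)" .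
  qed
qed

text \<open>Up to time \<open>\<delta>n\<close>, the walk weighted by \<open>exp (- \<theta> S\<^sub>n)\<close> is dominated by \<open>P\<^sup>+\<close> forwards and,
  backwards, by the mixture of the \<open>P\<^sup>-\<^sub>z\<close>.\<close>

lemma weighted_domination:
  "\<exists>C. 0 \<le> C \<and> eventually (\<lambda>n. \<forall>f. f \<in> borel_measurable Pr \<longrightarrow> depends_on_first (mm n) f \<longrightarrow> (\<forall>\<omega>. f \<omega> \<le> 1) \<longrightarrow>
    weighted (\<lambda>\<omega> n. f \<omega>) n \<le> ennreal C * (\<integral>\<^sup>+\<omega>. f \<omega> \<partial>Pp) \<and>
    weighted (\<lambda>\<omega> n. f (rev_seq n \<omega>)) n \<le> ennreal C * Rint (\<lambda>\<omega> \<omega>' s. f \<omega>')) sequentially"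
proof -
  obtain C1 N1 where C1: "0 \<le> C1" "\<And>m n f. m + N1 \<le> n \<Longrightarrow> f \<in> borel_measurable Pr \<Longrightarrow> depends_on_first m f \<Longrightarrow>
    (\<integral>\<^sup>+\<omega>. (if stay_nonneg 0 n \<omega> then f \<omega> * ennreal (exp (- \<theta> * S n \<omega>)) else 0) \<partial>Pr)
      \<le> ennreal (C1 / D (n - m)) * (\<integral>\<^sup>+\<omega>. (if stay_nonneg 0 m \<omega> then f \<omega> * ennreal (U (S m \<omega>)) else 0) \<partial>Pr)"
    using nn_integral_prefix_le[OF \<theta>] by blast
  obtain C2 N2 where C2: "0 \<le> C2" "\<And>m n f. m + N2 \<le> n \<Longrightarrow> f \<in> borel_measurable Pr \<Longrightarrow> depends_on_first m f \<Longrightarrow>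
    (\<integral>\<^sup>+\<omega>. (if stay_nonneg 0 n \<omega> then f (rev_seq n \<omega>) * ennreal (exp (- \<theta> * S n \<omega>)) else 0) \<partial>Pr)
      \<le> ennreal (C2 / D (n - m)) * (\<integral>\<^sup>+s. \<integral>\<^sup>+\<omega>. (if \<forall>j\<le>m. S j \<omega> < s then f \<omega> * ennreal (exp (- \<theta> * s)) * ennreal (V (s - S m \<omega>)) else 0) \<partial>Pr \<partial>lborel)"
    using nn_integral_suffix_le[OF \<theta>] by blast
  obtain C3 where C3: "0 \<le> C3" "eventually (\<lambda>n. D n \<le> C3 * D (n - mm n)) sequentially"
    using D_ratio by blast
  obtain p where p: "eventually (\<lambda>n. n \<le> 2 ^ p * (n - mm n)) sequentially"
    using mm_le by blast
  define C where "C = C3 * (C1 + C2)"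
  have "eventually (\<lambda>n. \<forall>f. f \<in> borel_measurable Pr \<longrightarrow> depends_on_first (mm n) f \<longrightarrow> (\<forall>\<omega>. f \<omega> \<le> 1) \<longrightarrow>
    weighted (\<lambda>\<omega> n. f \<omega>) n \<le> ennreal C * (\<integral>\<^sup>+\<omega>. f \<omega> \<partial>Pp) \<and>
    weighted (\<lambda>\<omega> n. f (rev_seq n \<omega>)) n \<le> ennreal C * Rint (\<lambda>\<omega> \<omega>' s. f \<omega>')) sequentially"
    using C3(2) p mm_pos eventually_ge_at_top[of "2 ^ p * (N1 + N2 + 1)"]
  proof eventually_elim
    fix n assume n: "D n \<le> C3 * D (n - mm n)" "n \<le> 2 ^ p * (n - mm n)" "1 \<le> mm n" "2 ^ p * (N1 + N2 + 1) \<le> n"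
    from n(2,4) have "2 ^ p * (N1 + N2 + 1) \<le> 2 ^ p * (n - mm n)" by linarith
    then have N: "N1 + N2 + 1 \<le> n - mm n" by (rule mult_left_le_imp_le) simp
    have Dp: "0 < D (n - mm n)" "0 < D n"
      using N by (auto intro!: D_pos)
    have scale: "ennreal (D n) * (ennreal (C' / D (n - mm n)) * Z) \<le> ennreal C * Z" if "0 \<le> C'" "C' \<le> C1 + C2" for C' Z
    proof -
      have "D n * (C' / D (n - mm n)) \<le> C3 * D (n - mm n) * (C' / D (n - mm n))"
        using n(1) Dp that by (intro mult_right_mono) auto
      also have "\<dots> = C3 * C'" using Dp by simp
      also have "\<dots> \<le> C" unfolding C_def using that C3(1) by (intro mult_left_mono) auto
      finally have "ennreal (D n * (C' / D (n - mm n))) \<le> ennreal C" by (rule ennreal_leI)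
      then have "ennreal (D n * (C' / D (n - mm n))) * Z \<le> ennreal C * Z" by (rule mult_right_mono) simp
      moreover have "ennreal (D n * (C' / D (n - mm n))) = ennreal (D n) * ennreal (C' / D (n - mm n))"
        using Dp by (intro ennreal_mult') simp
      ultimately show ?thesis
        by (simp only: mult.assoc)
    qed
    show "\<forall>f. f \<in> borel_measurable Pr \<longrightarrow> depends_on_first (mm n) f \<longrightarrow> (\<forall>\<omega>. f \<omega> \<le> 1) \<longrightarrow>
      weighted (\<lambda>\<omega> n. f \<omega>) n \<le> ennreal C * (\<integral>\<^sup>+\<omega>. f \<omega> \<partial>Pp) \<and>
      weighted (\<lambda>\<omega> n. f (rev_seq n \<omega>)) n \<le> ennreal C * Rint (\<lambda>\<omega> \<omega>' s. f \<omega>')"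
    proof (intro allI impI conjI)
      fix f :: "(nat \<Rightarrow> 'a) \<Rightarrow> ennreal"
      assume f [measurable]: "f \<in> borel_measurable Pr" and dep: "depends_on_first (mm n) f" and f1: "\<forall>\<omega>. f \<omega> \<le> 1"
      have f1': "f \<omega> \<le> ennreal 1" for \<omega> using f1 by simp
      have "weighted (\<lambda>\<omega> n. f \<omega>) n \<le> ennreal (D n) * (ennreal (C1 / D (n - mm n)) * (\<integral>\<^sup>+\<omega>. f \<omega> \<partial>Pp))"
        unfolding weighted_def Pp_eq[OF n(3) f dep f1'] using N by (intro mult_left_mono C1 f dep) auto
      also have "\<dots> \<le> ennreal C * (\<integral>\<^sup>+\<omega>. f \<omega> \<partial>Pp)"
        using C1 C2 by (intro scale) auto
      finally show "weighted (\<lambda>\<omega> n. f \<omega>) n \<le> ennreal C * (\<integral>\<^sup>+\<omega>. f \<omega> \<partial>Pp)" .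
      have R: "Rint (\<lambda>\<omega> \<omega>' s. f \<omega>') =
          (\<integral>\<^sup>+s. \<integral>\<^sup>+\<omega>. (if \<forall>j\<le>mm n. S j \<omega> < s then f \<omega> * ennreal (exp (- \<theta> * s)) * ennreal (V (s - S (mm n) \<omega>)) else 0) \<partial>Pr \<partial>lborel)"
        using Rint_finite_coordinates(1)[OF n(3), of "\<lambda>\<omega> \<omega>' s. f \<omega>'" 1] dep f1'
        by (simp add: Pp.emeasure_space_1 cong: if_cong)
      have "weighted (\<lambda>\<omega> n. f (rev_seq n \<omega>)) n \<le> ennreal (D n) * (ennreal (C2 / D (n - mm n)) * Rint (\<lambda>\<omega> \<omega>' s. f \<omega>'))"
        unfolding weighted_def R using N by (intro mult_left_mono C2 f dep) auto
      also have "\<dots> \<le> ennreal C * Rint (\<lambda>\<omega> \<omega>' s. f \<omega>')"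
        using C1 C2 by (intro scale) auto
      finally show "weighted (\<lambda>\<omega> n. f (rev_seq n \<omega>)) n \<le> ennreal C * Rint (\<lambda>\<omega> \<omega>' s. f \<omega>')" .
    qed
  qed
  moreover have "0 \<le> C" using C1 C2 C3 by (simp add: C_def)
  ultimately show ?thesis by blast
qed

text \<open>The outer integrands are only known to be measurable for functionals of finitely many
  coordinates; the last assumption and conclusion let this pass to limits.\<close>

lemma Rint_lim:
  fixes f :: "nat \<Rightarrow> (nat \<Rightarrow> 'a) \<Rightarrow> (nat \<Rightarrow> 'a) \<Rightarrow> real \<Rightarrow> ennreal"
  assumes f_meas: "\<And>k s. (\<lambda>(\<omega>', \<omega>). f k \<omega> \<omega>' s) \<in> borel_measurable (Pr \<Otimes>\<^sub>M Pr)"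
    and B: "\<And>k \<omega> \<omega>' s. f k \<omega> \<omega>' s \<le> ennreal B"
    and lim: "\<And>s. 0 < s \<Longrightarrow> AE \<omega>' in Pm s. AE \<omega> in Pp. (\<lambda>k. f k \<omega> \<omega>' s) \<longlonglongrightarrow> f' \<omega> \<omega>' s"
    and f'_meas: "\<And>s. (\<lambda>(\<omega>', \<omega>). f' \<omega> \<omega>' s) \<in> borel_measurable (Pr \<Otimes>\<^sub>M Pr)"
    and meas: "eventually (\<lambda>k. (\<lambda>s. ennreal (V s) * (\<integral>\<^sup>+\<omega>'. (\<integral>\<^sup>+\<omega>. f k \<omega> \<omega>' s \<partial>Pp) * ennreal (exp (- \<theta> * s)) \<partial>Pm s)) \<in> borel_measurable borel) sequentially"
  shows "(\<lambda>k. Rint (f k)) \<longlonglongrightarrow> Rint f'"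
    and "(\<lambda>s. ennreal (V s) * (\<integral>\<^sup>+\<omega>'. (\<integral>\<^sup>+\<omega>. f' \<omega> \<omega>' s \<partial>Pp) * ennreal (exp (- \<theta> * s)) \<partial>Pm s)) \<in> borel_measurable borel"
proof -
  define h where "h k s = ennreal (V s) * (\<integral>\<^sup>+\<omega>'. (\<integral>\<^sup>+\<omega>. f k \<omega> \<omega>' s \<partial>Pp) * ennreal (exp (- \<theta> * s)) \<partial>Pm s)" for k s
  define h' where "h' s = ennreal (V s) * (\<integral>\<^sup>+\<omega>'. (\<integral>\<^sup>+\<omega>. f' \<omega> \<omega>' s \<partial>Pp) * ennreal (exp (- \<theta> * s)) \<partial>Pm s)" for s
  have inner_le: "(\<integral>\<^sup>+\<omega>. f k \<omega> \<omega>' s \<partial>Pp) \<le> ennreal B" for k \<omega>' s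
    using nn_integral_mono[of Pp "\<lambda>\<omega>. f k \<omega> \<omega>' s" "\<lambda>_. ennreal B"] B by (simp add: Pp.emeasure_space_1)
  have h_lim: "(\<lambda>k. h k s) \<longlonglongrightarrow> h' s" for s
  proof (cases "0 < s")
    case True
    interpret Pms: prob_space "Pm s" by (rule Pm_prob[OF True])
    note Pms_sets [measurable_cong] = Pm_sets[OF True]
    have mf [measurable]: "(\<lambda>\<omega>. f k \<omega> \<omega>' s) \<in> borel_measurable Pp" "(\<lambda>\<omega>. f' \<omega> \<omega>' s) \<in> borel_measurable Pp"
      if "\<omega>' \<in> space Pr" for k \<omega>'
      using measurable_compose[OF measurable_Pair1'[OF that] f_meas[of k s]] measurable_compose[OF measurable_Pair1'[OF that] f'_meas[of s]]
      by (simp_all add: measurable_cong_sets[OF Pp_sets refl])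
    have mp: "(\<lambda>\<omega>'. \<integral>\<^sup>+\<omega>. f k \<omega> \<omega>' s \<partial>Pp) \<in> borel_measurable (Pm s)" "(\<lambda>\<omega>'. \<integral>\<^sup>+\<omega>. f' \<omega> \<omega>' s \<partial>Pp) \<in> borel_measurable (Pm s)" for k
    proof -
      have *: "sets (Pr \<Otimes>\<^sub>M Pr) = sets (Pm s \<Otimes>\<^sub>M Pp)"
        using Pms_sets Pp_sets by (intro sets_pair_measure_cong) auto
      show "(\<lambda>\<omega>'. \<integral>\<^sup>+\<omega>. f k \<omega> \<omega>' s \<partial>Pp) \<in> borel_measurable (Pm s)"
        using Pp.borel_measurable_nn_integral_fst[of "\<lambda>(\<omega>', \<omega>). f k \<omega> \<omega>' s" "Pm s"] f_meas[of k s]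
        by (simp add: measurable_cong_sets[OF * refl])
      show "(\<lambda>\<omega>'. \<integral>\<^sup>+\<omega>. f' \<omega> \<omega>' s \<partial>Pp) \<in> borel_measurable (Pm s)"
        using Pp.borel_measurable_nn_integral_fst[of "\<lambda>(\<omega>', \<omega>). f' \<omega> \<omega>' s" "Pm s"] f'_meas[of s]
        by (simp add: measurable_cong_sets[OF * refl])
    qed
    note [measurable] = mp
    have "(\<lambda>k. \<integral>\<^sup>+\<omega>'. (\<integral>\<^sup>+\<omega>. f k \<omega> \<omega>' s \<partial>Pp) * ennreal (exp (- \<theta> * s)) \<partial>Pm s) \<longlonglongrightarrow>
        (\<integral>\<^sup>+\<omega>'. (\<integral>\<^sup>+\<omega>. f' \<omega> \<omega>' s \<partial>Pp) * ennreal (exp (- \<theta> * s)) \<partial>Pm s)"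
    proof (rule nn_integral_dominated_convergence[where w = "\<lambda>_. ennreal B * ennreal (exp (- \<theta> * s))"])
      show "(\<integral>\<^sup>+\<omega>'. ennreal B * ennreal (exp (- \<theta> * s)) \<partial>Pm s) < \<infinity>"
        by (simp add: Pms.emeasure_space_1 ennreal_mult_less_top)
      show "AE \<omega>' in Pm s. (\<integral>\<^sup>+\<omega>. f k \<omega> \<omega>' s \<partial>Pp) * ennreal (exp (- \<theta> * s)) \<le> ennreal B * ennreal (exp (- \<theta> * s))" for k
        using inner_le by (intro AE_I2 mult_right_mono) auto
      have sp: "AE \<omega>' in Pm s. \<omega>' \<in> space Pr"
        using sets_eq_imp_space_eq[OF Pms_sets] by (intro AE_I2) simp
      show "AE \<omega>' in Pm s. (\<lambda>k. (\<integral>\<^sup>+\<omega>. f k \<omega> \<omega>' s \<partial>Pp) * ennreal (exp (- \<theta> * s))) \<longlonglongrightarrow> (\<integral>\<^sup>+\<omega>. f' \<omega> \<omega>' s \<partial>Pp) * ennreal (exp (- \<theta> * s))"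
        using lim[OF True] sp
      proof eventually_elim
        fix \<omega>' assume "AE \<omega> in Pp. (\<lambda>k. f k \<omega> \<omega>' s) \<longlonglongrightarrow> f' \<omega> \<omega>' s" "\<omega>' \<in> space Pr"
        then have "(\<lambda>k. \<integral>\<^sup>+\<omega>. f k \<omega> \<omega>' s \<partial>Pp) \<longlonglongrightarrow> (\<integral>\<^sup>+\<omega>. f' \<omega> \<omega>' s \<partial>Pp)"
          using B mf[of \<omega>'] by (intro nn_integral_dominated_convergence[where w = "\<lambda>_. ennreal B"]) (auto simp: Pp.emeasure_space_1)
        then show "(\<lambda>k. (\<integral>\<^sup>+\<omega>. f k \<omega> \<omega>' s \<partial>Pp) * ennreal (exp (- \<theta> * s))) \<longlonglongrightarrow> (\<integral>\<^sup>+\<omega>. f' \<omega> \<omega>' s \<partial>Pp) * ennreal (exp (- \<theta> * s))"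
          by (subst (1 2) mult.commute) (intro ennreal_tendsto_cmult, simp)
      qed
    qed measurable
    then show ?thesis
      unfolding h_def h'_def by (intro ennreal_tendsto_cmult) simp
  next
    case False
    then show ?thesis by (simp add: h_def h'_def V_nonpos)
  qed
  have "eventually (\<lambda>k. h k \<in> borel_measurable borel) sequentially"
    using meas unfolding h_def[abs_def] .
  then obtain k0 where k0: "\<And>k. k0 \<le> k \<Longrightarrow> h k \<in> borel_measurable borel"
    unfolding eventually_sequentially by blast
  have hk0: "h (k + k0) \<in> borel_measurable borel" for k
    by (rule k0) simp
  have lim_k0: "(\<lambda>k. h (k + k0) s) \<longlonglongrightarrow> h' s" for s
    using h_lim[of s] by (rule LIMSEQ_ignore_initial_segment)
  have h'_meas: "h' \<in> borel_measurable borel"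
    by (rule borel_measurable_LIMSEQ_order[OF lim_k0 hk0])
  then show "(\<lambda>s. ennreal (V s) * (\<integral>\<^sup>+\<omega>'. (\<integral>\<^sup>+\<omega>. f' \<omega> \<omega>' s \<partial>Pp) * ennreal (exp (- \<theta> * s)) \<partial>Pm s)) \<in> borel_measurable borel"
    unfolding h'_def[abs_def] .
  have "(\<lambda>k. \<integral>\<^sup>+s. h (k + k0) s \<partial>lborel) \<longlonglongrightarrow> (\<integral>\<^sup>+s. h' s \<partial>lborel)"
  proof (rule nn_integral_dominated_convergence[where w = "\<lambda>s. ennreal B * ennreal (exp (- \<theta> * s) * V s)"])
    show "(\<integral>\<^sup>+s. ennreal B * ennreal (exp (- \<theta> * s) * V s) \<partial>lborel) < \<infinity>"
      using J_finite[OF \<theta>] unfolding J_def by (subst nn_integral_cmult) (auto simp: ennreal_mult_less_top)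
    show "AE s in lborel. h (k + k0) s \<le> ennreal B * ennreal (exp (- \<theta> * s) * V s)" for k
    proof (rule AE_I2)
      fix s :: real
      show "h (k + k0) s \<le> ennreal B * ennreal (exp (- \<theta> * s) * V s)"
      proof (cases "0 < s")
        case True
        interpret Pms: prob_space "Pm s" by (rule Pm_prob[OF True])
        have "h (k + k0) s \<le> ennreal (V s) * (\<integral>\<^sup>+\<omega>'. ennreal B * ennreal (exp (- \<theta> * s)) \<partial>Pm s)"
          unfolding h_def by (intro mult_left_mono nn_integral_mono mult_right_mono inner_le) auto
        also have "\<dots> = ennreal B * ennreal (exp (- \<theta> * s) * V s)"
          by (simp add: Pms.emeasure_space_1 ennreal_mult mult_ac)
        finally show ?thesis .
      qed (simp add: h_def V_nonpos)
    qed
  qed (use hk0 h'_meas lim_k0 in auto)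
  then have "(\<lambda>k. \<integral>\<^sup>+s. h k s \<partial>lborel) \<longlonglongrightarrow> (\<integral>\<^sup>+s. h' s \<partial>lborel)"
    by (rule LIMSEQ_offset)
  then show "(\<lambda>k. Rint (f k)) \<longlonglongrightarrow> Rint f'"
    unfolding Rint_def h_def h'_def .
qed

end

definition cdist :: "'b::metric_space \<Rightarrow> 'b \<Rightarrow> real" where
  "cdist x y = min 1 (dist x y)"

lemma cdist_bounds: "0 \<le> cdist x y" "cdist x y \<le> 1"
  by (auto simp: cdist_def)

lemma tendsto_cdist [tendsto_intros]:
  assumes "f \<longlonglongrightarrow> a" "g \<longlonglongrightarrow> b"
  shows "(\<lambda>n. cdist (f n) (g n)) \<longlonglongrightarrow> cdist a b"
  unfolding cdist_def by (intro tendsto_intros assms)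

context conditioned_limits
begin

lemma liminf_fixed_functionals:
  fixes \<Phi> :: "'w \<times> 't \<times> real \<Rightarrow> real"
  assumes k: "1 \<le> mm k" and cont: "continuous_on UNIV \<Phi>" and nonneg: "\<And>z. 0 \<le> \<Phi> z" and B: "\<And>z. \<Phi> z \<le> B"
  shows "ennreal K * Rint (\<lambda>\<omega> \<omega>' s. ennreal (\<Phi> (W k \<omega>, T k \<omega>', s))) \<le>
    liminf (weighted (\<lambda>\<omega> n. ennreal (\<Phi> (W k \<omega>, T k (rev_seq n \<omega>), S n \<omega>))))"
proof -
  define m where "m = mm k"
  have [measurable]: "\<Phi> \<in> borel_measurable borel"
    using cont by (rule borel_measurable_continuous_onI)
  define G where "G \<omega> \<omega>' s = \<Phi> (W k \<omega>, T k \<omega>', s) * exp (- \<theta> * s)" for \<omega> \<omega>' s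
  have G_meas: "(\<lambda>(\<omega>, \<omega>', s). G \<omega> \<omega>' s) \<in> borel_measurable (Pr \<Otimes>\<^sub>M Pr \<Otimes>\<^sub>M borel)"
    unfolding G_def split_beta' by measurable
  have "0 \<le> B" using nonneg B order_trans by blast
  have G_le: "G \<omega> \<omega>' s \<le> B" if "0 \<le> s" for \<omega> \<omega>' s
  proof -
    have "G \<omega> \<omega>' s \<le> B * 1"
      unfolding G_def using that \<theta> \<open>0 \<le> B\<close> by (intro mult_mono B nonneg) auto
    then show ?thesis by simp
  qed
  have W_dep': "W k \<omega>1 = W k \<omega>2" "T k \<omega>1 = T k \<omega>2" if "\<forall>i<m. \<omega>1 i = \<omega>2 i" for \<omega>1 \<omega>2
    using that W_dep[of k] T_dep[of k] unfolding depends_on_first_def m_def by auto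
  have dep1: "depends_on_first m (\<lambda>\<omega>. G \<omega> \<omega>' s)" for \<omega>' s
    using W_dep' unfolding depends_on_first_def G_def by metis
  have dep2: "depends_on_first m (\<lambda>\<omega>'. G \<omega> \<omega>' s)" for \<omega> s
    using W_dep' unfolding depends_on_first_def G_def by metis
  have G_cont: "isCont (G \<omega> \<omega>') s" for \<omega> \<omega>' s
  proof -
    have "isCont (\<lambda>s. \<Phi> (W k \<omega>, T k \<omega>', s)) s"
      using continuous_on_compose2[OF cont, of UNIV "\<lambda>s. (W k \<omega>, T k \<omega>', s)"]
      by (auto intro!: continuous_intros simp: continuous_on_eq_continuous_at)
    then show ?thesis
      unfolding G_def[abs_def] by (intro continuous_intros)
  qed
  define f where "f \<omega> \<omega>' s = ennreal (\<Phi> (W k \<omega>, T k \<omega>', s))" for \<omega> \<omega>' s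
  have f_meas: "(\<lambda>(\<omega>, \<omega>', s). f \<omega> \<omega>' s) \<in> borel_measurable (Pr \<Otimes>\<^sub>M Pr \<Otimes>\<^sub>M borel)"
    unfolding f_def split_beta' by measurable
  have f_dep: "depends_on_first m (\<lambda>\<omega>'. f \<omega> \<omega>' s)" "depends_on_first m (\<lambda>\<omega>. f \<omega> \<omega>'' s)" for \<omega> \<omega>'' s
    using W_dep' unfolding depends_on_first_def f_def by metis+
  have f_le: "f \<omega> \<omega>' s \<le> ennreal B" for \<omega> \<omega>' s
    unfolding f_def by (intro ennreal_leI B)
  have f_comp [measurable]: "(\<lambda>x. f (g1 x) (g2 x) (g3 x)) \<in> borel_measurable M"
    if "g1 \<in> M \<rightarrow>\<^sub>M Pr" "g2 \<in> M \<rightarrow>\<^sub>M Pr" "g3 \<in> borel_measurable M" for M :: "'b measure" and g1 g2 g3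
    using measurable_compose[OF measurable_Pair[OF that(1) measurable_Pair[OF that(2,3)]] f_meas] by simp
  define uu where "uu \<omega> = (if stay_nonneg 0 m \<omega> then ennreal (U (S m \<omega>)) else 0)" for \<omega>
  define \<kappa> where "\<kappa> s \<omega> = (if \<forall>j\<le>m. S j \<omega> < s then ennreal (exp (- \<theta> * s)) * ennreal (V (s - S m \<omega>)) else 0)" for s \<omega>
  have uu_meas [measurable]: "uu \<in> borel_measurable Pr"
    unfolding uu_def[abs_def] by measurable
  have \<kappa>_meas [measurable]: "(\<lambda>z. \<kappa> (fst z) (snd z)) \<in> borel_measurable (borel \<Otimes>\<^sub>M Pr)"
    unfolding \<kappa>_def by measurable
  have \<kappa>_meas' [measurable (raw)]: "(\<lambda>x. \<kappa> (g1 x) (g2 x)) \<in> borel_measurable M"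
    if "g1 \<in> borel_measurable M" "g2 \<in> M \<rightarrow>\<^sub>M Pr" for M :: "'c measure" and g1 g2
    using measurable_compose[OF measurable_Pair[OF that] \<kappa>_meas] by simp
  have "(\<integral>\<^sup>+\<omega>. (if stay_nonneg 0 m \<omega> then ennreal (U (S m \<omega>)) *
      (\<integral>\<^sup>+s. \<integral>\<^sup>+\<omega>'. (if \<forall>j\<le>m. S j \<omega>' < s then ennreal (G \<omega> \<omega>' s) * ennreal (V (s - S m \<omega>')) else 0) \<partial>Pr \<partial>lborel) else 0) \<partial>Pr) =
    (\<integral>\<^sup>+\<omega>. uu \<omega> * (\<integral>\<^sup>+s. \<integral>\<^sup>+\<omega>'. f \<omega> \<omega>' s * \<kappa> s \<omega>' \<partial>Pr \<partial>lborel) \<partial>Pr)"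
  proof (rule nn_integral_cong)
    fix \<omega>
    have "(\<integral>\<^sup>+s. \<integral>\<^sup>+\<omega>'. (if \<forall>j\<le>m. S j \<omega>' < s then ennreal (G \<omega> \<omega>' s) * ennreal (V (s - S m \<omega>')) else 0) \<partial>Pr \<partial>lborel) =
        (\<integral>\<^sup>+s. \<integral>\<^sup>+\<omega>'. f \<omega> \<omega>' s * \<kappa> s \<omega>' \<partial>Pr \<partial>lborel)"
    proof (intro nn_integral_cong)
      fix s \<omega>'
      show "(if \<forall>j\<le>m. S j \<omega>' < s then ennreal (G \<omega> \<omega>' s) * ennreal (V (s - S m \<omega>')) else 0) = f \<omega> \<omega>' s * \<kappa> s \<omega>'"
        unfolding \<kappa>_def G_def f_def using nonneg
        by (cases "\<forall>j\<le>m. S j \<omega>' < s") (simp_all only: if_True if_False if_P if_not_P mult_zero_right ennreal_mult' mult.assoc not_False_eq_True)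
    qed
    then show "(if stay_nonneg 0 m \<omega> then ennreal (U (S m \<omega>)) *
      (\<integral>\<^sup>+s. \<integral>\<^sup>+\<omega>'. (if \<forall>j\<le>m. S j \<omega>' < s then ennreal (G \<omega> \<omega>' s) * ennreal (V (s - S m \<omega>')) else 0) \<partial>Pr \<partial>lborel) else 0) =
      uu \<omega> * (\<integral>\<^sup>+s. \<integral>\<^sup>+\<omega>'. f \<omega> \<omega>' s * \<kappa> s \<omega>' \<partial>Pr \<partial>lborel)"
      by (simp add: uu_def)
  qed
  also have "\<dots> = (\<integral>\<^sup>+\<omega>. (\<integral>\<^sup>+s. \<integral>\<^sup>+\<omega>'. uu \<omega> * (f \<omega> \<omega>' s * \<kappa> s \<omega>') \<partial>Pr \<partial>lborel) \<partial>Pr)"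
    by (rule nn_integral_cong, subst nn_integral_cmult[symmetric]) (auto simp: nn_integral_cmult intro!: nn_integral_cong)
  also have "\<dots> = (\<integral>\<^sup>+s. (\<integral>\<^sup>+\<omega>. \<integral>\<^sup>+\<omega>'. uu \<omega> * (f \<omega> \<omega>' s * \<kappa> s \<omega>') \<partial>Pr \<partial>Pr) \<partial>lborel)"
  proof -
    interpret pair_sigma_finite Pr lborel ..
    show ?thesis by (rule Fubini'[symmetric]) measurable
  qed
  also have "\<dots> = (\<integral>\<^sup>+s. (\<integral>\<^sup>+\<omega>'. \<integral>\<^sup>+\<omega>. uu \<omega> * (f \<omega> \<omega>' s * \<kappa> s \<omega>') \<partial>Pr \<partial>Pr) \<partial>lborel)"
  proof (rule nn_integral_cong)
    fix s :: real
    interpret pair_sigma_finite Pr Pr ..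
    show "(\<integral>\<^sup>+\<omega>. \<integral>\<^sup>+\<omega>'. uu \<omega> * (f \<omega> \<omega>' s * \<kappa> s \<omega>') \<partial>Pr \<partial>Pr) = (\<integral>\<^sup>+\<omega>'. \<integral>\<^sup>+\<omega>. uu \<omega> * (f \<omega> \<omega>' s * \<kappa> s \<omega>') \<partial>Pr \<partial>Pr)"
      by (rule Fubini'[symmetric]) measurable
  qed
  also have "\<dots> = (\<integral>\<^sup>+s. \<integral>\<^sup>+\<omega>'. (if \<forall>j\<le>m. S j \<omega>' < s then (\<integral>\<^sup>+\<omega>. f \<omega> \<omega>' s \<partial>Pp) * ennreal (exp (- \<theta> * s)) * ennreal (V (s - S m \<omega>')) else 0) \<partial>Pr \<partial>lborel)"
  proof (rule nn_integral_cong, rule nn_integral_cong)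
    fix s :: real and \<omega>' assume [measurable]: "\<omega>' \<in> space Pr"
    have "(\<integral>\<^sup>+\<omega>. uu \<omega> * (f \<omega> \<omega>' s * \<kappa> s \<omega>') \<partial>Pr) = (\<integral>\<^sup>+\<omega>. (if stay_nonneg 0 m \<omega> then f \<omega> \<omega>' s * ennreal (U (S m \<omega>)) else 0) * \<kappa> s \<omega>' \<partial>Pr)"
      by (intro nn_integral_cong) (auto simp: uu_def mult_ac)
    also have "\<dots> = (\<integral>\<^sup>+\<omega>. (if stay_nonneg 0 m \<omega> then f \<omega> \<omega>' s * ennreal (U (S m \<omega>)) else 0) \<partial>Pr) * \<kappa> s \<omega>'"
      by (rule nn_integral_multc) measurable
    also have "(\<integral>\<^sup>+\<omega>. (if stay_nonneg 0 m \<omega> then f \<omega> \<omega>' s * ennreal (U (S m \<omega>)) else 0) \<partial>Pr) = (\<integral>\<^sup>+\<omega>. f \<omega> \<omega>' s \<partial>Pp)"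
      using k by (intro Pp_eq[symmetric, of _ _ B] f_dep f_le) (simp_all add: m_def)
    also have "(\<integral>\<^sup>+\<omega>. f \<omega> \<omega>' s \<partial>Pp) * \<kappa> s \<omega>' = (if \<forall>j\<le>m. S j \<omega>' < s then (\<integral>\<^sup>+\<omega>. f \<omega> \<omega>' s \<partial>Pp) * ennreal (exp (- \<theta> * s)) * ennreal (V (s - S m \<omega>')) else 0)"
      unfolding \<kappa>_def
      by (cases "\<forall>j\<le>m. S j \<omega>' < s") (simp_all only: if_P if_not_P mult_zero_right mult.assoc not_False_eq_True)
    finally show "(\<integral>\<^sup>+\<omega>. uu \<omega> * (f \<omega> \<omega>' s * \<kappa> s \<omega>') \<partial>Pr) = \<dots>" .
  qed
  also have "\<dots> = Rint f"
    using k by (intro Rint_finite_coordinates(1)[symmetric, OF _ f_meas f_dep(1) f_le]) (simp add: m_def)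
  finally have eq: "(\<integral>\<^sup>+\<omega>. (if stay_nonneg 0 m \<omega> then ennreal (U (S m \<omega>)) *
      (\<integral>\<^sup>+s. \<integral>\<^sup>+\<omega>'. (if \<forall>j\<le>m. S j \<omega>' < s then ennreal (G \<omega> \<omega>' s) * ennreal (V (s - S m \<omega>')) else 0) \<partial>Pr \<partial>lborel) else 0) \<partial>Pr) = Rint f" .
  from liminf_joint[OF G_meas G_le dep1 dep2 G_cont]
  have "ennreal K * Rint f \<le> liminf (\<lambda>n. ennreal (D n) * (\<integral>\<^sup>+\<omega>. (if stay_nonneg 0 n \<omega> then ennreal (G \<omega> (rev_seq n \<omega>) (S n \<omega>)) else 0) \<partial>Pr))"
    unfolding eq .
  also have "(\<lambda>n. ennreal (D n) * (\<integral>\<^sup>+\<omega>. (if stay_nonneg 0 n \<omega> then ennreal (G \<omega> (rev_seq n \<omega>) (S n \<omega>)) else 0) \<partial>Pr)) =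
      weighted (\<lambda>\<omega> n. ennreal (\<Phi> (W k \<omega>, T k (rev_seq n \<omega>), S n \<omega>)))"
    unfolding weighted_def G_def by (simp add: nonneg ennreal_mult' cong: if_cong)
  finally show ?thesis
    unfolding f_def .
qed

lemma weighted_mono:
  assumes "\<And>\<omega>. stay_nonneg 0 n \<omega> \<Longrightarrow> f \<omega> n \<le> g \<omega> n"
  shows "weighted f n \<le> weighted g n"
  unfolding weighted_def using assms by (intro mult_left_mono nn_integral_mono) (auto intro!: mult_right_mono)

lemma weighted_add:
  assumes [measurable]: "(\<lambda>\<omega>. f \<omega> n) \<in> borel_measurable Pr" "(\<lambda>\<omega>. g \<omega> n) \<in> borel_measurable Pr"
  shows "weighted (\<lambda>\<omega> n. f \<omega> n + g \<omega> n) n = weighted f n + weighted g n"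
proof -
  have "(\<integral>\<^sup>+\<omega>. (if stay_nonneg 0 n \<omega> then (f \<omega> n + g \<omega> n) * ennreal (exp (- \<theta> * S n \<omega>)) else 0) \<partial>Pr) =
    (\<integral>\<^sup>+\<omega>. (if stay_nonneg 0 n \<omega> then f \<omega> n * ennreal (exp (- \<theta> * S n \<omega>)) else 0) +
      (if stay_nonneg 0 n \<omega> then g \<omega> n * ennreal (exp (- \<theta> * S n \<omega>)) else 0) \<partial>Pr)"
    by (intro nn_integral_cong) (auto simp: distrib_right)
  also have "\<dots> = (\<integral>\<^sup>+\<omega>. (if stay_nonneg 0 n \<omega> then f \<omega> n * ennreal (exp (- \<theta> * S n \<omega>)) else 0) \<partial>Pr) +
      (\<integral>\<^sup>+\<omega>. (if stay_nonneg 0 n \<omega> then g \<omega> n * ennreal (exp (- \<theta> * S n \<omega>)) else 0) \<partial>Pr)"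
    by (rule nn_integral_add) measurable
  finally show ?thesis
    by (simp add: weighted_def distrib_left)
qed

lemma weighted_cmult:
  assumes [measurable]: "(\<lambda>\<omega>. f \<omega> n) \<in> borel_measurable Pr"
  shows "weighted (\<lambda>\<omega> n. r * f \<omega> n) n = r * weighted f n"
proof -
  have "(\<integral>\<^sup>+\<omega>. (if stay_nonneg 0 n \<omega> then r * f \<omega> n * ennreal (exp (- \<theta> * S n \<omega>)) else 0) \<partial>Pr) =
    (\<integral>\<^sup>+\<omega>. r * (if stay_nonneg 0 n \<omega> then f \<omega> n * ennreal (exp (- \<theta> * S n \<omega>)) else 0) \<partial>Pr)"
    by (intro nn_integral_cong) (auto simp: mult.assoc)
  also have "\<dots> = r * (\<integral>\<^sup>+\<omega>. (if stay_nonneg 0 n \<omega> then f \<omega> n * ennreal (exp (- \<theta> * S n \<omega>)) else 0) \<partial>Pr)"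
    by (rule nn_integral_cmult) measurable
  finally show ?thesis
    by (simp add: weighted_def mult_ac)
qed

lemma W_cdist_lim: "(\<lambda>n. \<integral>\<^sup>+\<omega>. ennreal (cdist (W n \<omega>) (W k \<omega>)) \<partial>Pp) \<longlonglongrightarrow> (\<integral>\<^sup>+\<omega>. ennreal (cdist (Winf \<omega>) (W k \<omega>)) \<partial>Pp)"
  "(\<lambda>k. \<integral>\<^sup>+\<omega>. ennreal (cdist (Winf \<omega>) (W k \<omega>)) \<partial>Pp) \<longlonglongrightarrow> 0"
proof -
  have meas [measurable]: "(\<lambda>\<omega>. cdist (W n \<omega>) (W k \<omega>)) \<in> borel_measurable Pr" "(\<lambda>\<omega>. cdist (Winf \<omega>) (W k \<omega>)) \<in> borel_measurable Pr" for n k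
    unfolding cdist_def by measurable
  show "(\<lambda>n. \<integral>\<^sup>+\<omega>. ennreal (cdist (W n \<omega>) (W k \<omega>)) \<partial>Pp) \<longlonglongrightarrow> (\<integral>\<^sup>+\<omega>. ennreal (cdist (Winf \<omega>) (W k \<omega>)) \<partial>Pp)"
  proof (rule nn_integral_dominated_convergence[where w = "\<lambda>_. 1"])
    show "AE \<omega> in Pp. (\<lambda>n. ennreal (cdist (W n \<omega>) (W k \<omega>))) \<longlonglongrightarrow> ennreal (cdist (Winf \<omega>) (W k \<omega>))"
      using W_lim by eventually_elim (intro tendsto_ennrealI tendsto_cdist tendsto_const)
  qed (auto simp: cdist_bounds Pp.emeasure_space_1)
  have "(\<lambda>k. \<integral>\<^sup>+\<omega>. ennreal (cdist (Winf \<omega>) (W k \<omega>)) \<partial>Pp) \<longlonglongrightarrow> (\<integral>\<^sup>+\<omega>. ennreal (cdist (Winf \<omega>) (Winf \<omega>)) \<partial>Pp)"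
  proof (rule nn_integral_dominated_convergence[where w = "\<lambda>_. 1"])
    show "AE \<omega> in Pp. (\<lambda>k. ennreal (cdist (Winf \<omega>) (W k \<omega>))) \<longlonglongrightarrow> ennreal (cdist (Winf \<omega>) (Winf \<omega>))"
      using W_lim by eventually_elim (intro tendsto_ennrealI tendsto_cdist tendsto_const)
  qed (auto simp: cdist_bounds Pp.emeasure_space_1 cdist_def)
  then show "(\<lambda>k. \<integral>\<^sup>+\<omega>. ennreal (cdist (Winf \<omega>) (W k \<omega>)) \<partial>Pp) \<longlonglongrightarrow> 0"
    by (simp add: cdist_def)
qed

lemma T_cdist_meas:
  assumes "1 \<le> max (mm n) (mm k)"
  shows "(\<lambda>s. ennreal (V s) * (\<integral>\<^sup>+\<omega>'. (\<integral>\<^sup>+\<omega>. ennreal (cdist (T n \<omega>') (T k \<omega>')) \<partial>Pp) * ennreal (exp (- \<theta> * s)) \<partial>Pm s)) \<in> borel_measurable borel"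
proof (rule Rint_finite_coordinates(2)[where m = "max (mm n) (mm k)" and B = 1 and f = "\<lambda>\<omega> \<omega>' s. ennreal (cdist (T n \<omega>') (T k \<omega>'))"])
  show "depends_on_first (max (mm n) (mm k)) (\<lambda>\<omega>'. ennreal (cdist (T n \<omega>') (T k \<omega>')))"
    by (intro depends_on_first_map2[where h = "\<lambda>x y. ennreal (cdist x y)"] depends_on_first_le[OF T_dep]) auto
  show "(\<lambda>(\<omega>, \<omega>', s). ennreal (cdist (T n \<omega>') (T k \<omega>'))) \<in> borel_measurable (Pr \<Otimes>\<^sub>M Pr \<Otimes>\<^sub>M borel)"
    unfolding split_beta' cdist_def by measurable
qed (use assms in \<open>auto simp: cdist_bounds\<close>)

lemma T_cdist_lim:
  "(\<lambda>n. Rint (\<lambda>\<omega> \<omega>' s. ennreal (cdist (T n \<omega>') (T k \<omega>')))) \<longlonglongrightarrow> Rint (\<lambda>\<omega> \<omega>' s. ennreal (cdist (Tinf \<omega>') (T k \<omega>')))"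
  "(\<lambda>k. Rint (\<lambda>\<omega> \<omega>' s. ennreal (cdist (Tinf \<omega>') (T k \<omega>')))) \<longlonglongrightarrow> 0"
proof -
  have lim1: "AE \<omega>' in Pm s. AE \<omega> in Pp. (\<lambda>n. ennreal (cdist (T n \<omega>') (T k \<omega>'))) \<longlonglongrightarrow> ennreal (cdist (Tinf \<omega>') (T k \<omega>'))" if "0 < s" for s k
    using T_lim[OF that] by eventually_elim (intro AE_I2 tendsto_ennrealI tendsto_cdist tendsto_const)
  have lim2: "AE \<omega>' in Pm s. AE \<omega> in Pp. (\<lambda>k. ennreal (cdist (Tinf \<omega>') (T k \<omega>'))) \<longlonglongrightarrow> ennreal (cdist (Tinf \<omega>') (Tinf \<omega>'))" if "0 < s" for s
    using T_lim[OF that] by eventually_elim (intro AE_I2 tendsto_ennrealI tendsto_cdist tendsto_const)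
  have meas: "(\<lambda>(\<omega>', \<omega>). ennreal (cdist (T n \<omega>') (T k \<omega>'))) \<in> borel_measurable (Pr \<Otimes>\<^sub>M Pr)"
    "(\<lambda>(\<omega>', \<omega>). ennreal (cdist (Tinf \<omega>') (T k \<omega>'))) \<in> borel_measurable (Pr \<Otimes>\<^sub>M Pr)"
    "(\<lambda>(\<omega>', \<omega>). ennreal (cdist (Tinf \<omega>') (Tinf \<omega>'))) \<in> borel_measurable (Pr \<Otimes>\<^sub>M Pr)" for n k
    unfolding split_beta' cdist_def by measurable
  have ev: "eventually (\<lambda>n. (\<lambda>s. ennreal (V s) * (\<integral>\<^sup>+\<omega>'. (\<integral>\<^sup>+\<omega>. ennreal (cdist (T n \<omega>') (T k \<omega>')) \<partial>Pp) * ennreal (exp (- \<theta> * s)) \<partial>Pm s)) \<in> borel_measurable borel) sequentially" for k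
    using mm_pos by eventually_elim (rule T_cdist_meas, simp)
  have le1: "ennreal (cdist x y) \<le> ennreal 1" for x y :: 't
    by (intro ennreal_leI cdist_bounds)
  show "(\<lambda>n. Rint (\<lambda>\<omega> \<omega>' s. ennreal (cdist (T n \<omega>') (T k \<omega>')))) \<longlonglongrightarrow> Rint (\<lambda>\<omega> \<omega>' s. ennreal (cdist (Tinf \<omega>') (T k \<omega>')))"
    by (rule Rint_lim(1)[OF meas(1) le1 lim1 meas(2) ev])
  have "(\<lambda>k. Rint (\<lambda>\<omega> \<omega>' s. ennreal (cdist (Tinf \<omega>') (T k \<omega>')))) \<longlonglongrightarrow> Rint (\<lambda>\<omega> \<omega>' s. ennreal (cdist (Tinf \<omega>') (Tinf \<omega>')))"
  proof (rule Rint_lim(1)[OF meas(2) le1 lim2 meas(3)])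
    show "eventually (\<lambda>k. (\<lambda>s. ennreal (V s) * (\<integral>\<^sup>+\<omega>'. (\<integral>\<^sup>+\<omega>. ennreal (cdist (Tinf \<omega>') (T k \<omega>')) \<partial>Pp) * ennreal (exp (- \<theta> * s)) \<partial>Pm s)) \<in> borel_measurable borel) sequentially"
      by (intro always_eventually allI Rint_lim(2)[OF meas(1) le1 lim1 meas(2) ev])
  qed
  then show "(\<lambda>k. Rint (\<lambda>\<omega> \<omega>' s. ennreal (cdist (Tinf \<omega>') (T k \<omega>')))) \<longlonglongrightarrow> 0"
    by (simp add: Rint_def cdist_def)
qed

lemma Rint_functionals_lim:
  fixes \<Phi> :: "'w \<times> 't \<times> real \<Rightarrow> real"
  assumes cont: "continuous_on UNIV \<Phi>" and B: "\<And>z. \<Phi> z \<le> B"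
  shows "(\<lambda>k. Rint (\<lambda>\<omega> \<omega>' s. ennreal (\<Phi> (W k \<omega>, T k \<omega>', s)))) \<longlonglongrightarrow> Rint (\<lambda>\<omega> \<omega>' s. ennreal (\<Phi> (Winf \<omega>, Tinf \<omega>', s)))"
    and "(\<lambda>s. ennreal (V s) * (\<integral>\<^sup>+\<omega>'. (\<integral>\<^sup>+\<omega>. ennreal (\<Phi> (Winf \<omega>, Tinf \<omega>', s)) \<partial>Pp) * ennreal (exp (- \<theta> * s)) \<partial>Pm s)) \<in> borel_measurable borel"
proof -
  have [measurable]: "\<Phi> \<in> borel_measurable borel"
    using cont by (rule borel_measurable_continuous_onI)
  have m1: "(\<lambda>(\<omega>', \<omega>). ennreal (\<Phi> (W k \<omega>, T k \<omega>', s))) \<in> borel_measurable (Pr \<Otimes>\<^sub>M Pr)"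
    "(\<lambda>(\<omega>', \<omega>). ennreal (\<Phi> (Winf \<omega>, Tinf \<omega>', s))) \<in> borel_measurable (Pr \<Otimes>\<^sub>M Pr)" for k s
    unfolding split_beta' by measurable
  have le: "ennreal (\<Phi> (W k \<omega>, T k \<omega>', s)) \<le> ennreal B" for k \<omega> \<omega>' s
    by (intro ennreal_leI B)
  have lim: "AE \<omega>' in Pm s. AE \<omega> in Pp. (\<lambda>k. ennreal (\<Phi> (W k \<omega>, T k \<omega>', s))) \<longlonglongrightarrow> ennreal (\<Phi> (Winf \<omega>, Tinf \<omega>', s))" if "0 < s" for s
    using T_lim[OF that]
  proof eventually_elim
    fix \<omega>' assume T: "(\<lambda>n. T n \<omega>') \<longlonglongrightarrow> Tinf \<omega>'"
    show "AE \<omega> in Pp. (\<lambda>k. ennreal (\<Phi> (W k \<omega>, T k \<omega>', s))) \<longlonglongrightarrow> ennreal (\<Phi> (Winf \<omega>, Tinf \<omega>', s))"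
      using W_lim
    proof eventually_elim
      fix \<omega> assume "(\<lambda>n. W n \<omega>) \<longlonglongrightarrow> Winf \<omega>"
      then have "(\<lambda>k. (W k \<omega>, T k \<omega>', s)) \<longlonglongrightarrow> (Winf \<omega>, Tinf \<omega>', s)"
        by (intro tendsto_Pair T tendsto_const)
      then have "(\<lambda>k. \<Phi> (W k \<omega>, T k \<omega>', s)) \<longlonglongrightarrow> \<Phi> (Winf \<omega>, Tinf \<omega>', s)"
        by (rule continuous_on_tendsto_compose[OF cont]) auto
      then show "(\<lambda>k. ennreal (\<Phi> (W k \<omega>, T k \<omega>', s))) \<longlonglongrightarrow> ennreal (\<Phi> (Winf \<omega>, Tinf \<omega>', s))"
        by (rule tendsto_ennrealI)
    qed
  qed
  have ev: "eventually (\<lambda>k. (\<lambda>s. ennreal (V s) * (\<integral>\<^sup>+\<omega>'. (\<integral>\<^sup>+\<omega>. ennreal (\<Phi> (W k \<omega>, T k \<omega>', s)) \<partial>Pp) * ennreal (exp (- \<theta> * s)) \<partial>Pm s)) \<in> borel_measurable borel) sequentially"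
    using mm_pos
  proof eventually_elim
    fix k assume k: "1 \<le> mm k"
    show "(\<lambda>s. ennreal (V s) * (\<integral>\<^sup>+\<omega>'. (\<integral>\<^sup>+\<omega>. ennreal (\<Phi> (W k \<omega>, T k \<omega>', s)) \<partial>Pp) * ennreal (exp (- \<theta> * s)) \<partial>Pm s)) \<in> borel_measurable borel"
    proof (rule Rint_finite_coordinates(2)[OF k _ _ le])
      show "(\<lambda>(\<omega>, \<omega>', s). ennreal (\<Phi> (W k \<omega>, T k \<omega>', s))) \<in> borel_measurable (Pr \<Otimes>\<^sub>M Pr \<Otimes>\<^sub>M borel)"
        unfolding split_beta' by measurable
      show "depends_on_first (mm k) (\<lambda>\<omega>'. ennreal (\<Phi> (W k \<omega>, T k \<omega>', s)))" for \<omega> s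
        by (rule depends_on_first_map[OF T_dep])
    qed
  qed
  show "(\<lambda>k. Rint (\<lambda>\<omega> \<omega>' s. ennreal (\<Phi> (W k \<omega>, T k \<omega>', s)))) \<longlonglongrightarrow> Rint (\<lambda>\<omega> \<omega>' s. ennreal (\<Phi> (Winf \<omega>, Tinf \<omega>', s)))"
    by (rule Rint_lim(1)[OF m1(1) le lim m1(2) ev])
  show "(\<lambda>s. ennreal (V s) * (\<integral>\<^sup>+\<omega>'. (\<integral>\<^sup>+\<omega>. ennreal (\<Phi> (Winf \<omega>, Tinf \<omega>', s)) \<partial>Pp) * ennreal (exp (- \<theta> * s)) \<partial>Pm s)) \<in> borel_measurable borel"
    by (rule Rint_lim(2)[OF m1(1) le lim m1(2) ev])
qed

lemma liminf_lipschitz: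
  fixes \<Phi> :: "'w \<times> 't \<times> real \<Rightarrow> real"
  assumes lip: "\<And>x y. \<bar>\<Phi> x - \<Phi> y\<bar> \<le> L * dist x y" and nonneg: "\<And>z. 0 \<le> \<Phi> z" and B: "\<And>z. \<Phi> z \<le> B" and L: "0 \<le> L"
  shows "ennreal K * Rint (\<lambda>\<omega> \<omega>' s. ennreal (\<Phi> (Winf \<omega>, Tinf \<omega>', s))) \<le>
    liminf (weighted (\<lambda>\<omega> n. ennreal (\<Phi> (W n \<omega>, T n (rev_seq n \<omega>), S n \<omega>))))"
proof -
  have cont: "continuous_on UNIV \<Phi>"
    using lip L by (intro lipschitz_on_continuous_on[of L] lipschitz_onI) (auto simp: dist_real_def)
  then have [measurable]: "\<Phi> \<in> borel_measurable borel"
    by (rule borel_measurable_continuous_onI)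
  obtain C where C: "0 \<le> C" "eventually (\<lambda>n. \<forall>f. f \<in> borel_measurable Pr \<longrightarrow> depends_on_first (mm n) f \<longrightarrow> (\<forall>\<omega>. f \<omega> \<le> 1) \<longrightarrow>
    weighted (\<lambda>\<omega> n. f \<omega>) n \<le> ennreal C * (\<integral>\<^sup>+\<omega>. f \<omega> \<partial>Pp) \<and>
    weighted (\<lambda>\<omega> n. f (rev_seq n \<omega>)) n \<le> ennreal C * Rint (\<lambda>\<omega> \<omega>' s. f \<omega>')) sequentially"
    using weighted_domination by blast
  define M where "M = max B L"
  have M: "0 \<le> M" "B \<le> M" "L \<le> M" using L by (auto simp: M_def)
  define x where "x n = weighted (\<lambda>\<omega> n. ennreal (\<Phi> (W n \<omega>, T n (rev_seq n \<omega>), S n \<omega>))) n" for n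
  define y where "y k n = weighted (\<lambda>\<omega> n. ennreal (\<Phi> (W k \<omega>, T k (rev_seq n \<omega>), S n \<omega>))) n" for k n
  define err where "err k n = ennreal M * (ennreal C * (\<integral>\<^sup>+\<omega>. ennreal (cdist (W n \<omega>) (W k \<omega>)) \<partial>Pp) +
      ennreal C * Rint (\<lambda>\<omega> \<omega>' s. ennreal (cdist (T n \<omega>') (T k \<omega>'))))" for k n
  define err' where "err' k = ennreal M * (ennreal C * (\<integral>\<^sup>+\<omega>. ennreal (cdist (Winf \<omega>) (W k \<omega>)) \<partial>Pp) +
      ennreal C * Rint (\<lambda>\<omega> \<omega>' s. ennreal (cdist (Tinf \<omega>') (T k \<omega>'))))" for k
  have err_lim: "(\<lambda>n. err k n) \<longlonglongrightarrow> err' k" for k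
    unfolding err_def err'_def
    by (intro ennreal_tendsto_cmult tendsto_add W_cdist_lim(1) T_cdist_lim(1)) auto
  have "err' \<longlonglongrightarrow> ennreal M * (ennreal C * 0 + ennreal C * 0)"
    unfolding err'_def[abs_def]
    by (intro ennreal_tendsto_cmult tendsto_add W_cdist_lim(2) T_cdist_lim(2)) auto
  then have err'_lim: "err' \<longlonglongrightarrow> 0" by simp
  have compare: "eventually (\<lambda>n. y k n \<le> x n + err k n) sequentially" for k
    using C(2) eventually_ge_at_top[of k]
  proof eventually_elim
    fix n assume dom: "\<forall>f. f \<in> borel_measurable Pr \<longrightarrow> depends_on_first (mm n) f \<longrightarrow> (\<forall>\<omega>. f \<omega> \<le> 1) \<longrightarrow>
      weighted (\<lambda>\<omega> n. f \<omega>) n \<le> ennreal C * (\<integral>\<^sup>+\<omega>. f \<omega> \<partial>Pp) \<and>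
      weighted (\<lambda>\<omega> n. f (rev_seq n \<omega>)) n \<le> ennreal C * Rint (\<lambda>\<omega> \<omega>' s. f \<omega>')" and "k \<le> n"
    define f1 where "f1 \<omega> = ennreal (cdist (W n \<omega>) (W k \<omega>))" for \<omega>
    define f2 where "f2 \<omega> = ennreal (cdist (T n \<omega>) (T k \<omega>))" for \<omega>
    have "mm k \<le> mm n" using mm_mono \<open>k \<le> n\<close> by (rule monoD)
    have f1_meas [measurable]: "f1 \<in> borel_measurable Pr" and f2_meas [measurable]: "f2 \<in> borel_measurable Pr"
      unfolding f1_def[abs_def] f2_def[abs_def] cdist_def by measurable
    have f1_dep: "depends_on_first (mm n) f1"
      unfolding f1_def[abs_def] using \<open>mm k \<le> mm n\<close>
      by (intro depends_on_first_map2[where h = "\<lambda>x y. ennreal (cdist x y)"] depends_on_first_le[OF W_dep]) auto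
    have f2_dep: "depends_on_first (mm n) f2"
      unfolding f2_def[abs_def] using \<open>mm k \<le> mm n\<close>
      by (intro depends_on_first_map2[where h = "\<lambda>x y. ennreal (cdist x y)"] depends_on_first_le[OF T_dep]) auto
    have f12_le: "\<forall>\<omega>. f1 \<omega> \<le> 1" "\<forall>\<omega>. f2 \<omega> \<le> 1"
      using ennreal_leI[OF cdist_bounds(2)] by (auto simp: f1_def f2_def)
    have pt: "\<Phi> (a, b, s) \<le> \<Phi> (a', b', s) + M * (cdist a' a + cdist b' b)" for a a' b b' s
    proof (cases "dist a' a \<le> 1 \<and> dist b' b \<le> 1")
      case True
      have "dist (a, b, s) (a', b', s) \<le> dist a' a + dist b' b"
        by (simp add: dist_Pair_Pair dist_commute) (metis order_trans sqrt_sum_squares_le_sum zero_le_dist)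
      then have "L * dist (a, b, s) (a', b', s) \<le> M * (dist a' a + dist b' b)"
        using M L by (intro mult_mono) auto
      with lip[of "(a, b, s)" "(a', b', s)"] True show ?thesis
        by (simp add: cdist_def min_absorb2 abs_le_iff)
    next
      case False
      then have "1 \<le> cdist a' a + cdist b' b"
        using cdist_bounds(1)[of a' a] cdist_bounds(1)[of b' b] by (auto simp: cdist_def min_def)
      then have "M * 1 \<le> M * (cdist a' a + cdist b' b)"
        using M by (intro mult_left_mono) auto
      with B[of "(a, b, s)"] nonneg[of "(a', b', s)"] M show ?thesis by linarith
    qed
    have "y k n \<le> weighted (\<lambda>\<omega> n'. ennreal (\<Phi> (W n \<omega>, T n (rev_seq n \<omega>), S n \<omega>)) + ennreal M * (f1 \<omega> + f2 (rev_seq n \<omega>))) n"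
      unfolding y_def
    proof (rule weighted_mono)
      fix \<omega>
      have "ennreal (\<Phi> (W k \<omega>, T k (rev_seq n \<omega>), S n \<omega>)) \<le>
        ennreal (\<Phi> (W n \<omega>, T n (rev_seq n \<omega>), S n \<omega>) + M * (cdist (W n \<omega>) (W k \<omega>) + cdist (T n (rev_seq n \<omega>)) (T k (rev_seq n \<omega>))))"
        by (intro ennreal_leI pt)
      also have "\<dots> = ennreal (\<Phi> (W n \<omega>, T n (rev_seq n \<omega>), S n \<omega>)) + ennreal M * (f1 \<omega> + f2 (rev_seq n \<omega>))"
        using nonneg M by (simp add: f1_def f2_def cdist_bounds ennreal_mult)
      finally show "ennreal (\<Phi> (W k \<omega>, T k (rev_seq n \<omega>), S n \<omega>)) \<le> \<dots>" .
    qed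
    also have "\<dots> = x n + ennreal M * (weighted (\<lambda>\<omega> n'. f1 \<omega>) n + weighted (\<lambda>\<omega> n'. f2 (rev_seq n \<omega>)) n)"
    proof -
      have "weighted (\<lambda>\<omega> n'. ennreal (\<Phi> (W n \<omega>, T n (rev_seq n \<omega>), S n \<omega>)) + ennreal M * (f1 \<omega> + f2 (rev_seq n \<omega>))) n =
        weighted (\<lambda>\<omega> n'. ennreal (\<Phi> (W n \<omega>, T n (rev_seq n \<omega>), S n \<omega>))) n + weighted (\<lambda>\<omega> n'. ennreal M * (f1 \<omega> + f2 (rev_seq n \<omega>))) n"
        by (rule weighted_add) measurable
      also have "weighted (\<lambda>\<omega> n'. ennreal M * (f1 \<omega> + f2 (rev_seq n \<omega>))) n = ennreal M * weighted (\<lambda>\<omega> n'. f1 \<omega> + f2 (rev_seq n \<omega>)) n"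
        by (rule weighted_cmult) measurable
      also have "weighted (\<lambda>\<omega> n'. f1 \<omega> + f2 (rev_seq n \<omega>)) n = weighted (\<lambda>\<omega> n'. f1 \<omega>) n + weighted (\<lambda>\<omega> n'. f2 (rev_seq n \<omega>)) n"
        by (rule weighted_add) measurable
      also have "weighted (\<lambda>\<omega> n'. ennreal (\<Phi> (W n \<omega>, T n (rev_seq n \<omega>), S n \<omega>))) n = x n"
        by (simp add: x_def weighted_def)
      finally show ?thesis .
    qed
    also have "weighted (\<lambda>\<omega> n'. f2 (rev_seq n \<omega>)) n = weighted (\<lambda>\<omega> n'. f2 (rev_seq n' \<omega>)) n"
      by (simp add: weighted_def)
    also have "x n + ennreal M * (weighted (\<lambda>\<omega> n'. f1 \<omega>) n + weighted (\<lambda>\<omega> n'. f2 (rev_seq n' \<omega>)) n) \<le> x n + err k n"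
      unfolding err_def f1_def[symmetric] f2_def[symmetric]
      using dom[rule_format, OF f1_meas f1_dep] dom[rule_format, OF f2_meas f2_dep] f12_le
      by (intro add_left_mono mult_left_mono add_mono) auto
    finally show "y k n \<le> x n + err k n" .
  qed
  have y_liminf: "ennreal K * Rint (\<lambda>\<omega> \<omega>' s. ennreal (\<Phi> (W k \<omega>, T k \<omega>', s))) \<le> liminf (y k)" if "1 \<le> mm k" for k
    unfolding y_def[abs_def] using liminf_fixed_functionals[OF that cont nonneg B] .
  have R_lim: "(\<lambda>k. ennreal K * Rint (\<lambda>\<omega> \<omega>' s. ennreal (\<Phi> (W k \<omega>, T k \<omega>', s)))) \<longlonglongrightarrow>
      ennreal K * Rint (\<lambda>\<omega> \<omega>' s. ennreal (\<Phi> (Winf \<omega>, Tinf \<omega>', s)))"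
    by (intro ennreal_tendsto_cmult Rint_functionals_lim(1)[OF cont B]) simp
  show ?thesis
    unfolding x_def[abs_def, symmetric] le_Liminf_iff
  proof (intro allI impI)
    fix r assume r: "r < ennreal K * Rint (\<lambda>\<omega> \<omega>' s. ennreal (\<Phi> (Winf \<omega>, Tinf \<omega>', s)))"
    then obtain r' where r': "r < r'" "r' < ennreal K * Rint (\<lambda>\<omega> \<omega>' s. ennreal (\<Phi> (Winf \<omega>, Tinf \<omega>', s)))"
      using dense by blast
    have "(\<lambda>k. r + err' k) \<longlonglongrightarrow> r + 0"
      by (intro tendsto_add tendsto_const err'_lim)
    then have "eventually (\<lambda>k. r + err' k < r') sequentially"
      using r'(1) by (intro order_tendstoD(2)) auto
    then have "eventually (\<lambda>k. r + err' k < r' \<and> r' < ennreal K * Rint (\<lambda>\<omega> \<omega>' s. ennreal (\<Phi> (W k \<omega>, T k \<omega>', s))) \<and> 1 \<le> mm k) sequentially"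
      using order_tendstoD(1)[OF R_lim r'(2)] mm_pos by eventually_elim auto
    then obtain k where k: "r + err' k < r'" "r' < ennreal K * Rint (\<lambda>\<omega> \<omega>' s. ennreal (\<Phi> (W k \<omega>, T k \<omega>', s)))" "1 \<le> mm k"
      unfolding eventually_sequentially by blast
    have "(\<lambda>n. r + err k n) \<longlonglongrightarrow> r + err' k"
      by (intro tendsto_add tendsto_const err_lim)
    then have "eventually (\<lambda>n. r + err k n < r') sequentially"
      using k(1) by (rule order_tendstoD(2))
    moreover have "eventually (\<lambda>n. r' < y k n) sequentially"
      using y_liminf[OF k(3)] k(2) unfolding le_Liminf_iff by blast
    ultimately show "eventually (\<lambda>n. r < x n) sequentially"
      using compare[of k]
    proof eventually_elim
      fix n assume "r + err k n < r'" "r' < y k n" "y k n \<le> x n + err k n"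
      then have "r + err k n < x n + err k n" by order
      then show "r < x n"
        by (meson add_right_mono not_le)
    qed
  qed
qed

end

lemma eventually_less_of_le_liminf:
  fixes x :: "nat \<Rightarrow> real"
  assumes "ennreal l \<le> liminf (\<lambda>n. ennreal (x n))" "eventually (\<lambda>n. 0 \<le> x n) sequentially" "0 < \<epsilon>"
  shows "eventually (\<lambda>n. l - \<epsilon> < x n) sequentially"
proof (cases "l - \<epsilon> < 0")
  case True
  from assms(2) show ?thesis
    by eventually_elim (use True in linarith)
next
  case False
  then have "ennreal (l - \<epsilon>) < ennreal l"
    using assms(3) by (subst ennreal_less_iff) auto
  with assms(1) have "eventually (\<lambda>n. ennreal (l - \<epsilon>) < ennreal (x n)) sequentially"
    unfolding le_Liminf_iff by blast
  then show ?thesis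
    using False by (auto simp: ennreal_less_iff elim: eventually_mono)
qed

context oscillating_walk
begin

lemma U_0: "U 0 = 1"
proof -
  have "u 0 k = 0" if "k \<noteq> 0" for k
  proof -
    have "\<not> (0 \<le> S k \<omega> \<and> stay_below 0 k \<omega>)" for \<omega>
      using that by (auto simp: stay_below_def not_le)
    then have "{\<omega> \<in> space Pr. - 0 \<le> S k \<omega> \<and> stay_below 0 k \<omega>} = {}" by auto
    then show ?thesis unfolding u_def by (simp only: measure_empty)
  qed
  then have "U 0 = (\<Sum>k\<in>{0}. u 0 k)"
    unfolding U_def by (intro suminf_finite) auto
  also have "\<dots> = 1"
    by (simp add: u_def stay_below_def seq.P.prob_space)
  finally show ?thesis .
qed

end

context conditioned_limits
begin

lemma liminf_continuous:
  fixes \<Phi> :: "'w \<times> 't \<times> real \<Rightarrow> real"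
  assumes cont: "continuous_on UNIV \<Phi>" and nonneg: "\<And>z. 0 \<le> \<Phi> z" and B: "\<And>z. \<Phi> z \<le> B"
  shows "ennreal K * Rint (\<lambda>\<omega> \<omega>' s. ennreal (\<Phi> (Winf \<omega>, Tinf \<omega>', s))) \<le>
    liminf (weighted (\<lambda>\<omega> n. ennreal (\<Phi> (W n \<omega>, T n (rev_seq n \<omega>), S n \<omega>))))"
proof -
  have "ennreal (\<Phi> x) \<le> liminf (\<lambda>n. ennreal (\<Phi> (s n)))" if "s \<longlonglongrightarrow> x" for x s
  proof -
    have "(\<lambda>n. \<Phi> (s n)) \<longlonglongrightarrow> \<Phi> x"
      using that by (rule continuous_on_tendsto_compose[OF cont]) auto
    then have "liminf (\<lambda>n. ennreal (\<Phi> (s n))) = ennreal (\<Phi> x)"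
      by (intro lim_imp_Liminf tendsto_ennrealI) auto
    then show ?thesis by simp
  qed
  then obtain F where F: "\<And>j x. 0 \<le> F j x" "\<And>j x. F j x \<le> \<Phi> x"
    "\<And>j x y. \<bar>F j x - F j y\<bar> \<le> real j * dist x y" "\<And>x. (\<lambda>j. F j x) \<longlonglongrightarrow> \<Phi> x"
    using inf_convolution_approx[of \<Phi>, OF nonneg] by blast
  have F_B: "F j z \<le> B" for j z
    using F(2)[of j z] B[of z] by linarith
  have F_cont: "continuous_on UNIV (F j)" for j
    using F(3) by (intro lipschitz_on_continuous_on[of "real j"] lipschitz_onI) (auto simp: dist_real_def)
  then have [measurable]: "F j \<in> borel_measurable borel" for j
    by (rule borel_measurable_continuous_onI)
  have [measurable]: "\<Phi> \<in> borel_measurable borel"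
    using cont by (rule borel_measurable_continuous_onI)
  have "(\<lambda>j. Rint (\<lambda>\<omega> \<omega>' s. ennreal (F j (Winf \<omega>, Tinf \<omega>', s)))) \<longlonglongrightarrow> Rint (\<lambda>\<omega> \<omega>' s. ennreal (\<Phi> (Winf \<omega>, Tinf \<omega>', s)))"
  proof (rule Rint_lim(1)[where B = B])
    show "(\<lambda>(\<omega>', \<omega>). ennreal (F j (Winf \<omega>, Tinf \<omega>', s))) \<in> borel_measurable (Pr \<Otimes>\<^sub>M Pr)"
      "(\<lambda>(\<omega>', \<omega>). ennreal (\<Phi> (Winf \<omega>, Tinf \<omega>', s))) \<in> borel_measurable (Pr \<Otimes>\<^sub>M Pr)" for j s
      unfolding split_beta' by measurable
    show "ennreal (F j (Winf \<omega>, Tinf \<omega>', s)) \<le> ennreal B" for j \<omega> \<omega>' s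
      by (intro ennreal_leI F_B)
    show "AE \<omega>' in Pm s. AE \<omega> in Pp. (\<lambda>j. ennreal (F j (Winf \<omega>, Tinf \<omega>', s))) \<longlonglongrightarrow> ennreal (\<Phi> (Winf \<omega>, Tinf \<omega>', s))" for s
      by (intro AE_I2 tendsto_ennrealI F(4))
    show "eventually (\<lambda>j. (\<lambda>s. ennreal (V s) * (\<integral>\<^sup>+\<omega>'. (\<integral>\<^sup>+\<omega>. ennreal (F j (Winf \<omega>, Tinf \<omega>', s)) \<partial>Pp) * ennreal (exp (- \<theta> * s)) \<partial>Pm s)) \<in> borel_measurable borel) sequentially"
      by (intro always_eventually allI Rint_functionals_lim(2)[OF F_cont F_B])
  qed
  then have "(\<lambda>j. ennreal K * Rint (\<lambda>\<omega> \<omega>' s. ennreal (F j (Winf \<omega>, Tinf \<omega>', s)))) \<longlonglongrightarrow> ennreal K * Rint (\<lambda>\<omega> \<omega>' s. ennreal (\<Phi> (Winf \<omega>, Tinf \<omega>', s)))"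
    by (intro ennreal_tendsto_cmult) simp
  then show ?thesis
  proof (rule LIMSEQ_le_const2)
    have "ennreal K * Rint (\<lambda>\<omega> \<omega>' s. ennreal (F j (Winf \<omega>, Tinf \<omega>', s))) \<le>
      liminf (weighted (\<lambda>\<omega> n. ennreal (\<Phi> (W n \<omega>, T n (rev_seq n \<omega>), S n \<omega>))))" for j
    proof -
      have "ennreal K * Rint (\<lambda>\<omega> \<omega>' s. ennreal (F j (Winf \<omega>, Tinf \<omega>', s))) \<le>
        liminf (weighted (\<lambda>\<omega> n. ennreal (F j (W n \<omega>, T n (rev_seq n \<omega>), S n \<omega>))))"
        by (rule liminf_lipschitz[OF F(3) F(1) F_B]) simp
      also have "\<dots> \<le> liminf (weighted (\<lambda>\<omega> n. ennreal (\<Phi> (W n \<omega>, T n (rev_seq n \<omega>), S n \<omega>))))"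
        by (intro Liminf_mono always_eventually allI weighted_mono ennreal_leI F(2))
      finally show ?thesis .
    qed
    then show "\<exists>N. \<forall>j\<ge>N. ennreal K * Rint (\<lambda>\<omega> \<omega>' s. ennreal (F j (Winf \<omega>, Tinf \<omega>', s))) \<le>
      liminf (weighted (\<lambda>\<omega> n. ennreal (\<Phi> (W n \<omega>, T n (rev_seq n \<omega>), S n \<omega>))))"
      by blast
  qed
qed

theorem conditioned_limit:
  fixes \<phi> :: "'w \<times> 't \<times> real \<Rightarrow> real"
  assumes cont: "continuous_on (UNIV \<times> UNIV \<times> {0..}) \<phi>"
    and bound: "\<And>x y z. 0 \<le> z \<Longrightarrow> \<bar>\<phi> (x, y, z)\<bar> * exp (\<theta> * z) \<le> C"
  shows "(\<lambda>n. D n * (\<integral>\<omega>. (if stay_nonneg 0 n \<omega> then \<phi> (W n \<omega>, T n (rev_seq n \<omega>), S n \<omega>) else 0) \<partial>Pr)) \<longlonglongrightarrow>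
    K * (\<integral>s. (\<integral>\<omega>'. (\<integral>\<omega>. \<phi> (Winf \<omega>, Tinf \<omega>', s) \<partial>Pp) \<partial>Pm s) * V s \<partial>lborel)"
proof -
  define \<psi> where "\<psi> z = \<phi> (fst z, fst (snd z), max 0 (snd (snd z))) * exp (\<theta> * max 0 (snd (snd z)))" for z
  have \<psi>_cont: "continuous_on UNIV \<psi>"
    unfolding \<psi>_def[abs_def]
    by (intro continuous_intros continuous_on_compose2[OF cont]) auto
  then have [measurable]: "\<psi> \<in> borel_measurable borel"
    by (rule borel_measurable_continuous_onI)
  have \<psi>_le: "\<bar>\<psi> z\<bar> \<le> C" for z
    using bound[of "max 0 (snd (snd z))" "fst z" "fst (snd z)"] by (simp add: \<psi>_def abs_mult)
  have C0: "0 \<le> C"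
    using \<psi>_le[of undefined] by linarith
  have \<phi>_eq: "\<phi> (x, y, s) = \<psi> (x, y, s) * exp (- \<theta> * s)" if "0 \<le> s" for x y s
    using that by (simp add: \<psi>_def max_def exp_minus)
  define E where "E n \<omega> = (if stay_nonneg 0 n \<omega> then exp (- \<theta> * S n \<omega>) else 0)" for n \<omega>
  define F where "F n \<omega> = (if stay_nonneg 0 n \<omega> then \<phi> (W n \<omega>, T n (rev_seq n \<omega>), S n \<omega>) else 0)" for n \<omega>
  have F_eq: "F n \<omega> = \<psi> (W n \<omega>, T n (rev_seq n \<omega>), S n \<omega>) * E n \<omega>" for n \<omega>
    using \<phi>_eq[of "S n \<omega>"] by (auto simp: F_def E_def stay_nonneg_def)
  have E_meas [measurable]: "E n \<in> borel_measurable Pr" for n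
    unfolding E_def[abs_def] by measurable
  have F_meas [measurable]: "F n \<in> borel_measurable Pr" for n
    unfolding F_eq[abs_def] by measurable
  have E_bounds: "0 \<le> E n \<omega>" "E n \<omega> \<le> 1" for n \<omega>
    using \<theta> by (auto simp: E_def stay_nonneg_def)
  have F_le: "\<bar>F n \<omega>\<bar> \<le> C * E n \<omega>" for n \<omega>
    unfolding F_eq abs_mult using \<psi>_le E_bounds(1)[of n \<omega>] by (simp add: mult_right_mono)
  have E_int: "integrable Pr (E n)" for n
    using E_bounds by (intro seq.P.integrable_const_bound[of _ 1]) auto
  have F_int: "integrable Pr (F n)" for n
    by (rule Bochner_Integration.integrable_bound[OF integrable_mult_right[OF E_int, of C]])
      (use F_le C0 E_bounds in \<open>auto simp: abs_mult\<close>)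
  define A where "A n = D n * (\<integral>\<omega>. E n \<omega> \<partial>Pr)" for n
  define Bn where "Bn n = D n * (\<integral>\<omega>. F n \<omega> \<partial>Pr)" for n
  define JJ where "JJ = (\<integral>s. exp (- \<theta> * s) * V s \<partial>lborel)"
  have A_lim: "A \<longlonglongrightarrow> K * JJ"
    using K_lim[OF \<theta> order_refl] unfolding A_def[abs_def] E_def JJ_def D_def by (simp add: U_0 cong: if_cong)
  define h where "h s = (\<integral>\<omega>'. (\<integral>\<omega>. \<phi> (Winf \<omega>, Tinf \<omega>', s) \<partial>Pp) \<partial>Pm s) * V s" for s
  have weighted_eq: "weighted (\<lambda>\<omega> n. ennreal (C + \<sigma> * \<psi> (W n \<omega>, T n (rev_seq n \<omega>), S n \<omega>))) n = ennreal (C * A n + \<sigma> * Bn n)"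
    and nonneg_n: "0 \<le> C * A n + \<sigma> * Bn n" if \<sigma>: "\<bar>\<sigma>\<bar> = 1" and n: "1 \<le> n" for \<sigma> n
  proof -
    have nn: "0 \<le> C + \<sigma> * \<psi> z" for z
      using \<psi>_le[of z] \<sigma> by (auto simp: abs_if split: if_splits)
    have nn2: "0 \<le> C * E n \<omega> + \<sigma> * F n \<omega>" for \<omega>
    proof -
      have "C * E n \<omega> + \<sigma> * F n \<omega> = (C + \<sigma> * \<psi> (W n \<omega>, T n (rev_seq n \<omega>), S n \<omega>)) * E n \<omega>"
        by (simp add: F_eq algebra_simps)
      then show ?thesis using nn E_bounds(1)[of n \<omega>] by simp
    qed
    have "weighted (\<lambda>\<omega> n. ennreal (C + \<sigma> * \<psi> (W n \<omega>, T n (rev_seq n \<omega>), S n \<omega>))) n =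
        ennreal (D n) * (\<integral>\<^sup>+\<omega>. ennreal (C * E n \<omega> + \<sigma> * F n \<omega>) \<partial>Pr)"
    proof -
      have "(if stay_nonneg 0 n \<omega> then ennreal (C + \<sigma> * \<psi> (W n \<omega>, T n (rev_seq n \<omega>), S n \<omega>)) * ennreal (exp (- \<theta> * S n \<omega>)) else 0) =
          ennreal (C * E n \<omega> + \<sigma> * F n \<omega>)" for \<omega>
        unfolding F_eq E_def using nn by (auto simp: ennreal_mult'[symmetric] algebra_simps)
      then show ?thesis by (simp add: weighted_def)
    qed
    also have "(\<integral>\<^sup>+\<omega>. ennreal (C * E n \<omega> + \<sigma> * F n \<omega>) \<partial>Pr) = ennreal (\<integral>\<omega>. C * E n \<omega> + \<sigma> * F n \<omega> \<partial>Pr)"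
      using E_int F_int nn2 by (intro nn_integral_eq_integral) auto
    also have "(\<integral>\<omega>. C * E n \<omega> + \<sigma> * F n \<omega> \<partial>Pr) = C * (\<integral>\<omega>. E n \<omega> \<partial>Pr) + \<sigma> * (\<integral>\<omega>. F n \<omega> \<partial>Pr)"
      using E_int F_int by simp
    finally show "weighted (\<lambda>\<omega> n. ennreal (C + \<sigma> * \<psi> (W n \<omega>, T n (rev_seq n \<omega>), S n \<omega>))) n = ennreal (C * A n + \<sigma> * Bn n)"
      using D_pos[OF n] by (simp add: ennreal_mult'[symmetric] A_def Bn_def algebra_simps)
    have "0 \<le> (\<integral>\<omega>. C * E n \<omega> + \<sigma> * F n \<omega> \<partial>Pr)"
      using nn2 by (intro Bochner_Integration.integral_nonneg) auto
    then have "0 \<le> D n * (C * (\<integral>\<omega>. E n \<omega> \<partial>Pr) + \<sigma> * (\<integral>\<omega>. F n \<omega> \<partial>Pr))"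
      using D_pos[OF n] E_int F_int by simp
    then show "0 \<le> C * A n + \<sigma> * Bn n"
      by (simp add: A_def Bn_def algebra_simps)
  qed
  have Rint_eq: "ennreal (V s) * (\<integral>\<^sup>+\<omega>'. (\<integral>\<^sup>+\<omega>. ennreal (C + \<sigma> * \<psi> (Winf \<omega>, Tinf \<omega>', s)) \<partial>Pp) * ennreal (exp (- \<theta> * s)) \<partial>Pm s) =
      ennreal (C * (exp (- \<theta> * s) * V s) + \<sigma> * h s)" 
    and h_le: "\<bar>h s\<bar> \<le> C * (exp (- \<theta> * s) * V s)" if \<sigma>: "\<bar>\<sigma>\<bar> = 1" for \<sigma> s
  proof -
    have "ennreal (V s) * (\<integral>\<^sup>+\<omega>'. (\<integral>\<^sup>+\<omega>. ennreal (C + \<sigma> * \<psi> (Winf \<omega>, Tinf \<omega>', s)) \<partial>Pp) * ennreal (exp (- \<theta> * s)) \<partial>Pm s) =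
        ennreal (C * (exp (- \<theta> * s) * V s) + \<sigma> * h s) \<and> \<bar>h s\<bar> \<le> C * (exp (- \<theta> * s) * V s)"
    proof (cases "0 < s")
      case True
      interpret Pms: prob_space "Pm s" by (rule Pm_prob[OF True])
      note [measurable_cong] = Pm_sets[OF True]
      have nn: "0 \<le> C + \<sigma> * \<psi> z" for z
        using \<psi>_le[of z] \<sigma> by (auto simp: abs_if split: if_splits)
      have int_P: "integrable Pp (\<lambda>\<omega>. \<psi> (Winf \<omega>, Tinf \<omega>', s))" for \<omega>'
        using \<psi>_le by (intro Pp.integrable_const_bound[of _ C]) auto
      define q where "q \<omega>' = (\<integral>\<omega>. \<psi> (Winf \<omega>, Tinf \<omega>', s) \<partial>Pp)" for \<omega>'
      have q_meas [measurable]: "q \<in> borel_measurable (Pm s)"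
        unfolding q_def[abs_def] by measurable
      have q_le: "\<bar>q \<omega>'\<bar> \<le> C" for \<omega>'
      proof -
        have "\<bar>q \<omega>'\<bar> \<le> (\<integral>\<omega>. \<bar>\<psi> (Winf \<omega>, Tinf \<omega>', s)\<bar> \<partial>Pp)"
          unfolding q_def by (rule integral_abs_bound)
        also have "\<dots> \<le> C"
          using \<psi>_le int_P by (intro Pp.integral_le_const) auto
        finally show ?thesis .
      qed
      have q_int: "integrable (Pm s) q"
        using q_le by (intro Pms.integrable_const_bound[of _ C]) auto
      have inner: "(\<integral>\<^sup>+\<omega>. ennreal (C + \<sigma> * \<psi> (Winf \<omega>, Tinf \<omega>', s)) \<partial>Pp) = ennreal (C + \<sigma> * q \<omega>')" for \<omega>'
      proof -
        have "(\<integral>\<^sup>+\<omega>. ennreal (C + \<sigma> * \<psi> (Winf \<omega>, Tinf \<omega>', s)) \<partial>Pp) = ennreal (\<integral>\<omega>. C + \<sigma> * \<psi> (Winf \<omega>, Tinf \<omega>', s) \<partial>Pp)"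
          using int_P nn by (intro nn_integral_eq_integral) auto
        then show ?thesis
          using int_P by (simp add: q_def Pp.prob_space)
      qed
      have nq: "0 \<le> C + \<sigma> * q \<omega>'" for \<omega>'
        using q_le[of \<omega>'] \<sigma> by (auto simp: abs_if split: if_splits)
      have "(\<integral>\<^sup>+\<omega>'. ennreal (C + \<sigma> * q \<omega>') * ennreal (exp (- \<theta> * s)) \<partial>Pm s) = (\<integral>\<^sup>+\<omega>'. ennreal ((C + \<sigma> * q \<omega>') * exp (- \<theta> * s)) \<partial>Pm s)"
        using nq by (simp add: ennreal_mult')
      also have "\<dots> = ennreal (\<integral>\<omega>'. (C + \<sigma> * q \<omega>') * exp (- \<theta> * s) \<partial>Pm s)"
        using q_int nq by (intro nn_integral_eq_integral) auto
      also have "(\<integral>\<omega>'. (C + \<sigma> * q \<omega>') * exp (- \<theta> * s) \<partial>Pm s) = (C + \<sigma> * (\<integral>\<omega>'. q \<omega>' \<partial>Pm s)) * exp (- \<theta> * s)"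
        using q_int by (simp add: Pms.prob_space)
      finally have int: "(\<integral>\<^sup>+\<omega>'. ennreal (C + \<sigma> * q \<omega>') * ennreal (exp (- \<theta> * s)) \<partial>Pm s) = ennreal ((C + \<sigma> * (\<integral>\<omega>'. q \<omega>' \<partial>Pm s)) * exp (- \<theta> * s))" .
      have "(\<integral>\<omega>. \<phi> (Winf \<omega>, Tinf \<omega>', s) \<partial>Pp) = q \<omega>' * exp (- \<theta> * s)" for \<omega>'
        using \<phi>_eq[of s] True by (simp add: q_def)
      then have h_eq: "h s = (\<integral>\<omega>'. q \<omega>' \<partial>Pm s) * exp (- \<theta> * s) * V s"
        by (simp add: h_def)
      have "ennreal (V s) * (\<integral>\<^sup>+\<omega>'. ennreal (C + \<sigma> * q \<omega>') * ennreal (exp (- \<theta> * s)) \<partial>Pm s) = ennreal (V s * ((C + \<sigma> * (\<integral>\<omega>'. q \<omega>' \<partial>Pm s)) * exp (- \<theta> * s)))"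
        unfolding int by (intro ennreal_mult'[symmetric]) simp
      also have "V s * ((C + \<sigma> * (\<integral>\<omega>'. q \<omega>' \<partial>Pm s)) * exp (- \<theta> * s)) = C * (exp (- \<theta> * s) * V s) + \<sigma> * h s"
        by (simp add: h_eq algebra_simps)
      finally have "ennreal (V s) * (\<integral>\<^sup>+\<omega>'. ennreal (C + \<sigma> * q \<omega>') * ennreal (exp (- \<theta> * s)) \<partial>Pm s) = ennreal (C * (exp (- \<theta> * s) * V s) + \<sigma> * h s)" .
      moreover have "\<bar>\<integral>\<omega>'. q \<omega>' \<partial>Pm s\<bar> \<le> C"
      proof -
        have "\<bar>\<integral>\<omega>'. q \<omega>' \<partial>Pm s\<bar> \<le> (\<integral>\<omega>'. \<bar>q \<omega>'\<bar> \<partial>Pm s)"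
          by (rule integral_abs_bound)
        also have "\<dots> \<le> C"
          using q_le q_int by (intro Pms.integral_le_const) auto
        finally show ?thesis .
      qed
      then have "\<bar>h s\<bar> \<le> C * exp (- \<theta> * s) * V s"
        unfolding h_eq by (simp add: abs_mult mult_right_mono)
      ultimately show ?thesis
        unfolding inner by (simp add: mult.assoc)
    next
      case False
      then show ?thesis by (simp add: V_nonpos h_def)
    qed
    then show "ennreal (V s) * (\<integral>\<^sup>+\<omega>'. (\<integral>\<^sup>+\<omega>. ennreal (C + \<sigma> * \<psi> (Winf \<omega>, Tinf \<omega>', s)) \<partial>Pp) * ennreal (exp (- \<theta> * s)) \<partial>Pm s) =
      ennreal (C * (exp (- \<theta> * s) * V s) + \<sigma> * h s)" "\<bar>h s\<bar> \<le> C * (exp (- \<theta> * s) * V s)"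
      by auto
  qed
  have \<Phi>: "continuous_on UNIV (\<lambda>z. C + \<sigma> * \<psi> z)" "\<And>z. 0 \<le> C + \<sigma> * \<psi> z" "\<And>z. C + \<sigma> * \<psi> z \<le> 2 * C" if "\<bar>\<sigma>\<bar> = 1" for \<sigma>
  proof -
    show "continuous_on UNIV (\<lambda>z. C + \<sigma> * \<psi> z)"
      by (intro continuous_intros \<psi>_cont)
    show "0 \<le> C + \<sigma> * \<psi> z" "C + \<sigma> * \<psi> z \<le> 2 * C" for z
      using \<psi>_le[of z] that by (auto simp: abs_if split: if_splits)
  qed
  have h_meas [measurable]: "h \<in> borel_measurable borel"
  proof -
    have "(\<lambda>s. ennreal (C * (exp (- \<theta> * s) * V s) + 1 * h s)) \<in> borel_measurable borel"
      using Rint_functionals_lim(2)[OF \<Phi>(1)[OF abs_one] \<Phi>(3)[OF abs_one]] unfolding Rint_eq[OF abs_one] .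
    then have "(\<lambda>s. enn2real (ennreal (C * (exp (- \<theta> * s) * V s) + h s)) - C * (exp (- \<theta> * s) * V s)) \<in> borel_measurable borel"
      by simp
    moreover have "enn2real (ennreal (C * (exp (- \<theta> * s) * V s) + h s)) - C * (exp (- \<theta> * s) * V s) = h s" for s
      using h_le[of 1 s] by (subst enn2real_ennreal) (auto simp: abs_le_iff)
    ultimately show ?thesis by simp
  qed
  have eV_int: "integrable lborel (\<lambda>s. exp (- \<theta> * s) * V s)"
    by (rule integrable_exp_V[OF \<theta>])
  have h_int: "integrable lborel h"
    by (rule Bochner_Integration.integrable_bound[OF integrable_mult_right[OF eV_int, of C]])
      (use h_le[of 1] C0 in \<open>auto simp: abs_mult\<close>)
  define I where "I = (\<integral>s. h s \<partial>lborel)"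
  have liminf: "ennreal (K * (C * JJ + \<sigma> * I)) \<le> liminf (\<lambda>n. ennreal (C * A n + \<sigma> * Bn n))" if \<sigma>: "\<bar>\<sigma>\<bar> = 1" for \<sigma>
  proof -
    have nn: "0 \<le> C * (exp (- \<theta> * s) * V s) + \<sigma> * h s" for s
      using h_le[OF \<sigma>, of s] \<sigma> by (auto simp: abs_if split: if_splits)
    have "Rint (\<lambda>\<omega> \<omega>' s. ennreal (C + \<sigma> * \<psi> (Winf \<omega>, Tinf \<omega>', s))) = (\<integral>\<^sup>+s. ennreal (C * (exp (- \<theta> * s) * V s) + \<sigma> * h s) \<partial>lborel)"
      unfolding Rint_def Rint_eq[OF \<sigma>] ..
    also have "\<dots> = ennreal (\<integral>s. C * (exp (- \<theta> * s) * V s) + \<sigma> * h s \<partial>lborel)"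
      using eV_int h_int nn by (intro nn_integral_eq_integral) auto
    also have "(\<integral>s. C * (exp (- \<theta> * s) * V s) + \<sigma> * h s \<partial>lborel) = C * JJ + \<sigma> * I"
      using eV_int h_int by (simp add: JJ_def I_def)
    finally have R: "Rint (\<lambda>\<omega> \<omega>' s. ennreal (C + \<sigma> * \<psi> (Winf \<omega>, Tinf \<omega>', s))) = ennreal (C * JJ + \<sigma> * I)" .
    have "ennreal (K * (C * JJ + \<sigma> * I)) = ennreal K * Rint (\<lambda>\<omega> \<omega>' s. ennreal (C + \<sigma> * \<psi> (Winf \<omega>, Tinf \<omega>', s)))"
      unfolding R using K_pos by (intro ennreal_mult') simp
    also have "\<dots> \<le> liminf (weighted (\<lambda>\<omega> n. ennreal (C + \<sigma> * \<psi> (W n \<omega>, T n (rev_seq n \<omega>), S n \<omega>))))"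
      by (rule liminf_continuous[OF \<Phi>[OF \<sigma>]])
    also have "\<dots> = liminf (\<lambda>n. ennreal (C * A n + \<sigma> * Bn n))"
      by (intro Liminf_eq eventually_sequentiallyI[of 1] weighted_eq \<sigma>)
    finally show ?thesis .
  qed
  have "Bn \<longlonglongrightarrow> K * I"
  proof (rule LIMSEQ_I)
    fix r :: real assume r: "0 < r"
    have ev: "eventually (\<lambda>n. K * (C * JJ + \<sigma> * I) - r / 2 < C * A n + \<sigma> * Bn n) sequentially" if "\<bar>\<sigma>\<bar> = 1" for \<sigma>
      using r nonneg_n[OF that] by (intro eventually_less_of_le_liminf liminf that eventually_sequentiallyI[of 1]) auto
    have ev1: "eventually (\<lambda>n. K * (C * JJ + 1 * I) - r / 2 < C * A n + 1 * Bn n) sequentially"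
      by (rule ev) simp
    have ev2: "eventually (\<lambda>n. K * (C * JJ + - 1 * I) - r / 2 < C * A n + - 1 * Bn n) sequentially"
      by (rule ev) simp
    have "(\<lambda>n. C * A n) \<longlonglongrightarrow> C * (K * JJ)"
      by (intro tendsto_intros A_lim)
    from tendstoD[OF this, of "r / 2"] r
    have "eventually (\<lambda>n. \<bar>C * A n - C * (K * JJ)\<bar> < r / 2) sequentially"
      by (simp only: dist_real_def half_gt_zero)
    then have "eventually (\<lambda>n. \<bar>Bn n - K * I\<bar> < r) sequentially"
      using ev1 ev2
    proof eventually_elim
      fix n assume *: "\<bar>C * A n - C * (K * JJ)\<bar> < r / 2" "K * (C * JJ + 1 * I) - r / 2 < C * A n + 1 * Bn n"
        "K * (C * JJ + - 1 * I) - r / 2 < C * A n + - 1 * Bn n"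
      have "K * (C * JJ) = C * (K * JJ)" by simp
      with * show "\<bar>Bn n - K * I\<bar> < r"
        unfolding distrib_left abs_less_iff by (simp add: algebra_simps)
    qed
    then show "\<exists>no. \<forall>n\<ge>no. norm (Bn n - K * I) < r"
      by (auto simp: eventually_sequentially)
  qed
  then show ?thesis
    unfolding Bn_def[abs_def] F_def I_def h_def .
qed

end

section \<open>Random environments\<close>

lemma space_Delta [simp]: "space Delta = UNIV"
  by (simp add: Delta_def)

lemma pmf_measurable_Delta [measurable]: "(\<lambda>p. pmf p j) \<in> borel_measurable Delta"
  unfolding borel_measurable_iff_greater
proof
  fix r :: real
  interpret Metric_space UNIV tv_dist by (rule Metric_space_tv_dist)
  have "openin mtopology {p. r < pmf p j}"
    unfolding openin_mtopology
  proof (intro conjI allI impI)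
    fix p assume p: "p \<in> {p. r < pmf p j}"
    show "\<exists>\<epsilon>>0. mball p \<epsilon> \<subseteq> {p. r < pmf p j}"
    proof (intro exI[of _ "pmf p j - r"] conjI subsetI CollectI)
      fix q assume "q \<in> mball p (pmf p j - r)"
      then have "tv_dist p q < pmf p j - r" by simp
      moreover have "\<bar>pmf p j - pmf q j\<bar> \<le> tv_dist p q"
        using tv_dist_upper[of p "{j}" q] by (simp add: measure_pmf_single)
      ultimately show "r < pmf q j" by linarith
    qed (use p in simp)
  qed simp
  then show "{p \<in> space Delta. r < pmf p j} \<in> sets Delta"
    by (simp add: Delta_def)
qed

lemma log_mean_measurable [measurable]: "log_mean \<in> borel_measurable Delta"
  unfolding log_mean_def[abs_def] offspring_mean_def[abs_def] by measurable

lemma tilted_env_law_cylinder: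
  assumes Q: "prob_space Q" "sets Q = sets Delta" and P: "tilted_env_law Q \<kappa> P"
    and F: "\<And>i. F i \<in> sets Delta"
  shows "measure P {\<omega> \<in> space P. \<forall>i<n. \<omega> i \<in> F i} =
    (\<Prod>i<n. (\<integral>p. indicator (F i) p * exp (\<kappa> * log_mean p) \<partial>Q) / (\<integral>p. exp (\<kappa> * log_mean p) \<partial>Q))"
proof -
  interpret Q: prob_space Q by fact
  interpret P: prob_space P using P by (simp add: tilted_env_law_def)
  interpret QQ: product_prob_space "\<lambda>_. Q" "UNIV :: nat set" ..
  have [measurable_cong]: "sets Q = sets Delta" by fact
  have [measurable_cong]: "sets P = sets (\<Pi>\<^sub>M i\<in>(UNIV::nat set). Delta)"
    using P by (simp add: tilted_env_law_def env_space_def)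
  note [measurable] = F
  define \<gamma> where "\<gamma> = (\<integral>p. exp (\<kappa> * log_mean p) \<partial>Q)"
  have tilt: "(\<integral>\<omega>. \<psi> (env_prefix n \<omega>) \<partial>P) = 1 / \<gamma> ^ n * (\<integral>\<omega>. \<psi> (env_prefix n \<omega>) * exp (\<kappa> * (\<Sum>i<n. log_mean (\<omega> i))) \<partial>iid_env Q)"
    if "\<psi> \<in> borel_measurable (prefix_space n)" "bounded (\<psi> ` space (prefix_space n))" for \<psi> n
    using P that unfolding tilted_env_law_def \<gamma>_def by blast
  have "\<gamma> \<noteq> 0"
  proof
    assume "\<gamma> = 0"
    have "bounded ((\<lambda>_. 1 :: real) ` space (prefix_space 1))"
      by (rule boundedI[of _ 1]) auto
    with tilt[of "\<lambda>_. 1" 1] \<open>\<gamma> = 0\<close> show False by (simp add: P.prob_space)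
  qed
  then have w_int: "integrable Q (\<lambda>p. exp (\<kappa> * log_mean p))"
    unfolding \<gamma>_def using not_integrable_integral_eq by blast
  have Fw_int: "integrable Q (\<lambda>p. indicator (F i) p * exp (\<kappa> * log_mean p))" for i
    by (rule Bochner_Integration.integrable_bound[OF w_int]) (auto simp: indicator_def)
  define \<psi> where "\<psi> \<eta> = (\<Prod>i<n. indicator (F i) (\<eta> i) :: real)" for \<eta> :: env
  have \<psi>_meas: "\<psi> \<in> borel_measurable (prefix_space n)"
    unfolding \<psi>_def[abs_def]
  proof (rule borel_measurable_prod)
    fix i assume "i \<in> {..<n}"
    then have [measurable]: "(\<lambda>\<eta>. \<eta> i) \<in> prefix_space n \<rightarrow>\<^sub>M Delta"
      by (rule measurable_component_singleton)
    show "(\<lambda>\<eta>. indicator (F i) (\<eta> i) :: real) \<in> borel_measurable (prefix_space n)"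
      by measurable
  qed
  have \<psi>_01: "\<psi> \<eta> = (if \<forall>i<n. \<eta> i \<in> F i then 1 else 0)" for \<eta>
    unfolding \<psi>_def by (auto simp: indicator_def)
  have "bounded (\<psi> ` space (prefix_space n))"
    by (rule boundedI[of _ 1]) (auto simp: \<psi>_01)
  note tilt = tilt[OF \<psi>_meas this]
  have \<psi>_prefix: "\<psi> (env_prefix n \<omega>) = \<psi> \<omega>" for \<omega>
    unfolding \<psi>_def env_prefix_def by (intro prod.cong) auto
  have "measure P {\<omega> \<in> space P. \<forall>i<n. \<omega> i \<in> F i} = (\<integral>\<omega>. indicator {\<omega> \<in> space P. \<forall>i<n. \<omega> i \<in> F i} \<omega> \<partial>P)"
    by simp
  also have "\<dots> = (\<integral>\<omega>. \<psi> (env_prefix n \<omega>) \<partial>P)"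
    unfolding \<psi>_prefix unfolding \<psi>_01
    by (intro Bochner_Integration.integral_cong) (auto simp: indicator_def)
  also have "\<dots> = 1 / \<gamma> ^ n * (\<integral>\<omega>. \<psi> (env_prefix n \<omega>) * exp (\<kappa> * (\<Sum>i<n. log_mean (\<omega> i))) \<partial>iid_env Q)"
    by (rule tilt)
  also have "(\<integral>\<omega>. \<psi> (env_prefix n \<omega>) * exp (\<kappa> * (\<Sum>i<n. log_mean (\<omega> i))) \<partial>iid_env Q) =
      (\<integral>\<omega>. (\<Prod>i<n. indicator (F i) (restrict \<omega> {..<n} i) * exp (\<kappa> * log_mean (restrict \<omega> {..<n} i))) \<partial>(\<Pi>\<^sub>M i\<in>UNIV. Q))"
    unfolding iid_env_def \<psi>_prefix unfolding \<psi>_def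
    by (intro Bochner_Integration.integral_cong) (auto simp: sum_distrib_left exp_sum prod.distrib)
  also have "\<dots> = (\<integral>\<eta>. (\<Prod>i<n. indicator (F i) (\<eta> i) * exp (\<kappa> * log_mean (\<eta> i))) \<partial>distr (\<Pi>\<^sub>M i\<in>UNIV. Q) (\<Pi>\<^sub>M i\<in>{..<n}. Q) (\<lambda>\<omega>. restrict \<omega> {..<n}))"
  proof (rule integral_distr[symmetric])
    show "(\<lambda>\<omega>. restrict \<omega> {..<n}) \<in> (\<Pi>\<^sub>M i\<in>UNIV. Q) \<rightarrow>\<^sub>M (\<Pi>\<^sub>M i\<in>{..<n}. Q)"
      by (rule measurable_restrict_subset) simp
    show "(\<lambda>\<eta>. \<Prod>i<n. indicator (F i) (\<eta> i) * exp (\<kappa> * log_mean (\<eta> i))) \<in> borel_measurable (\<Pi>\<^sub>M i\<in>{..<n}. Q)"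
    proof (rule borel_measurable_prod)
      fix i assume "i \<in> {..<n}"
      then have [measurable]: "(\<lambda>\<eta>. \<eta> i) \<in> (\<Pi>\<^sub>M i\<in>{..<n}. Q) \<rightarrow>\<^sub>M Q"
        by (rule measurable_component_singleton)
      have "(\<lambda>p. indicator (F i) p * exp (\<kappa> * log_mean p) :: real) \<in> borel_measurable Q"
        by measurable
      then show "(\<lambda>\<eta>. indicator (F i) (\<eta> i) * exp (\<kappa> * log_mean (\<eta> i)) :: real) \<in> borel_measurable (\<Pi>\<^sub>M i\<in>{..<n}. Q)"
        by (rule measurable_compose[rotated]) measurable
    qed
  qed
  also have "distr (\<Pi>\<^sub>M i\<in>UNIV. Q) (\<Pi>\<^sub>M i\<in>{..<n}. Q) (\<lambda>\<omega>. restrict \<omega> {..<n}) = (\<Pi>\<^sub>M i\<in>{..<n}. Q)"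
    by (rule QQ.distr_PiM_restrict_finite) auto
  also have "(\<integral>\<eta>. (\<Prod>i<n. indicator (F i) (\<eta> i) * exp (\<kappa> * log_mean (\<eta> i))) \<partial>(\<Pi>\<^sub>M i\<in>{..<n}. Q)) =
      (\<Prod>i<n. \<integral>p. indicator (F i) p * exp (\<kappa> * log_mean p) \<partial>Q)"
    by (rule QQ.product_integral_prod) (auto intro: Fw_int)
  finally show ?thesis
    by (simp add: \<gamma>_def prod_dividef)
qed

lemma tilted_env_law_iid:
  assumes Q: "prob_space Q" "sets Q = sets Delta" and P: "tilted_env_law Q \<kappa> P"
  shows "P = (\<Pi>\<^sub>M i\<in>UNIV. distr P Delta (\<lambda>\<omega>. \<omega> 0))"
proof -
  interpret P: prob_space P using P by (simp add: tilted_env_law_def)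
  have P_sets [measurable_cong]: "sets P = sets (\<Pi>\<^sub>M i\<in>(UNIV::nat set). Delta)"
    using P by (simp add: tilted_env_law_def env_space_def)
  have P_space: "space P = UNIV"
    using sets_eq_imp_space_eq[OF P_sets] by (simp add: space_PiM)
  define Q' where "Q' = distr P Delta (\<lambda>\<omega>. \<omega> 0)"
  interpret Q': prob_space Q'
    unfolding Q'_def by (rule P.prob_space_distr) measurable
  interpret Q'Q': product_prob_space "\<lambda>_. Q'" "UNIV :: nat set" ..
  note cyl = tilted_env_law_cylinder[OF Q P]
  have sets_Q': "sets Q' = sets Delta" by (simp add: Q'_def)
  have Q'_eq: "measure Q' A = (\<integral>p. indicator A p * exp (\<kappa> * log_mean p) \<partial>Q) / (\<integral>p. exp (\<kappa> * log_mean p) \<partial>Q)"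
    if [measurable]: "A \<in> sets Delta" for A
  proof -
    have "measure Q' A = measure P {\<omega> \<in> space P. \<forall>i<1. \<omega> i \<in> A}"
      unfolding Q'_def by (subst measure_distr) (auto intro!: arg_cong[where f = "measure P"])
    also have "\<dots> = (\<integral>p. indicator A p * exp (\<kappa> * log_mean p) \<partial>Q) / (\<integral>p. exp (\<kappa> * log_mean p) \<partial>Q)"
      using cyl[of "\<lambda>_. A" 1] that by simp
    finally show ?thesis .
  qed
  have "P = (\<Pi>\<^sub>M i\<in>UNIV. Q')"
  proof (rule Q'Q'.PiM_eq)
    show "sets P = sets (\<Pi>\<^sub>M i\<in>UNIV. Q')"
      unfolding P_sets by (rule sets_PiM_cong) (auto simp: sets_Q')
    fix J and F :: "nat \<Rightarrow> nat pmf set"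
    assume J: "finite J" and F: "\<And>j. j \<in> J \<Longrightarrow> F j \<in> sets Q'"
    obtain n where n: "J \<subseteq> {..<n}"
      using finite_nat_bounded[OF J] by auto
    define F' where "F' i = (if i \<in> J then F i else UNIV)" for i
    have F': "F' i \<in> sets Delta" for i
      using F[of i] sets.top[of Delta] by (auto simp: F'_def sets_Q')
    have "prod_emb UNIV (\<lambda>_. Q') J (\<Pi>\<^sub>E j\<in>J. F j) = {\<omega> \<in> space P. \<forall>i<n. \<omega> i \<in> F' i}"
    proof -
      have "i < n" if "i \<in> J" for i using n that by auto
      then show ?thesis by (auto simp: prod_emb_def P_space F'_def PiE_iff Q'_def)
    qed
    then have "emeasure P (prod_emb UNIV (\<lambda>_. Q') J (\<Pi>\<^sub>E j\<in>J. F j)) = ennreal (\<Prod>i<n. measure Q' (F' i))"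
      using cyl[of F' n, OF F'] Q'_eq[OF F'] by (simp add: P.emeasure_eq_measure)
    also have "(\<Prod>i<n. measure Q' (F' i)) = (\<Prod>j\<in>J. measure Q' (F j))"
      using n J Q'.prob_space by (intro prod.mono_neutral_cong_right) (auto simp: F'_def Q'_def)
    also have "ennreal (\<Prod>j\<in>J. measure Q' (F j)) = (\<Prod>j\<in>J. emeasure Q' (F j))"
      by (simp add: Q'.emeasure_eq_measure prod_ennreal)
    finally show "emeasure P (prod_emb UNIV (\<lambda>_. Q') J (\<Pi>\<^sub>E j\<in>J. F j)) = (\<Prod>j\<in>J. emeasure Q' (F j))" .
  qed
  then show ?thesis by (simp add: Q'_def)
qed

lemma env_reversed_eq: "k \<le> n \<Longrightarrow> env_reversed n k \<omega> = env_prefix k (rev_seq n \<omega>)"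
  by (auto simp: env_reversed_def env_prefix_def rev_seq_def)

locale env_walk = oscillating_walk Q log_mean e for Q :: "nat pmf measure" and e +
  assumes sets_Q [measurable_cong]: "sets Q = sets Delta"
begin

lemma sets_Pr: "sets Pr = sets env_space"
  unfolding env_space_def by (rule sets_PiM_cong) (auto simp: sets_Q)

lemma walk_eq: "walk x n \<omega> = x + S n \<omega>"
  by (simp add: walk_def S_def)

lemma walk_min_nonneg: "0 \<le> walk_min x n \<omega> \<longleftrightarrow> stay_nonneg x n \<omega>"
  unfolding walk_min_def stay_nonneg_def walk_eq by (subst Min_ge_iff) auto

lemma walk_max_neg: "1 \<le> n \<Longrightarrow> walk_max x n \<omega> < 0 \<longleftrightarrow> stay_below (- x) n \<omega>"
  unfolding walk_max_def stay_below_def walk_eq by (subst Max_less_iff) (auto simp: less_minus_iff add.commute minus_less_iff)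

lemma renewal_U_eq: "0 \<le> x \<Longrightarrow> renewal_U Pr x = U x"
proof -
  assume "0 \<le> x"
  have "u x 0 = 1"
    using \<open>0 \<le> x\<close> by (simp add: u_def stay_below_def seq.P.prob_space)
  moreover have "(\<Sum>n. u x (Suc n)) = U x - u x 0"
    unfolding U_def by (rule suminf_split_head[OF summable_u])
  moreover have "measure Pr {\<omega> \<in> space Pr. - x \<le> walk 0 (Suc n) \<omega> \<and> walk_max 0 (Suc n) \<omega> < 0} = u x (Suc n)" for n
    using walk_max_neg[of "Suc n" 0] by (simp add: u_def walk_eq)
  ultimately show ?thesis
    using \<open>0 \<le> x\<close> by (simp add: renewal_U_def)
qed

lemma renewal_V_eq: "z < 0 \<Longrightarrow> renewal_V Pr z = V (- z)"
proof -
  assume "z < 0"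
  have "v (- z) 0 = 1"
    using \<open>z < 0\<close> by (simp add: v_def stay_nonneg_def seq.P.prob_space)
  moreover have "(\<Sum>n. v (- z) (Suc n)) = V (- z) - v (- z) 0"
    unfolding V_def using \<open>z < 0\<close> by (simp add: suminf_split_head[OF summable_v])
  moreover have "measure Pr {\<omega> \<in> space Pr. walk 0 (Suc n) \<omega> < - z \<and> 0 \<le> walk_min 0 (Suc n) \<omega>} = v (- z) (Suc n)" for n
    by (simp add: v_def walk_eq walk_min_nonneg)
  ultimately show ?thesis
    using \<open>z < 0\<close> by (simp add: renewal_V_def)
qed

lemma conditioned_nn_integral:
  assumes P': "prob_space P'" "sets P' = sets Pr" and w0: "0 < w0"
    and g [measurable]: "g \<in> borel_measurable Pr" and g0: "\<And>\<omega>. 0 \<le> g \<omega>"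
    and eq: "\<And>\<psi>. \<psi> \<in> borel_measurable (prefix_space m) \<Longrightarrow> bounded (\<psi> ` space (prefix_space m)) \<Longrightarrow>
      (\<integral>\<omega>. \<psi> (env_prefix m \<omega>) \<partial>P') = 1 / w0 * (\<integral>\<omega>. \<psi> (env_prefix m \<omega>) * g \<omega> \<partial>Pr)"
    and f [measurable]: "f \<in> borel_measurable Pr" and dep: "depends_on_first m f" and B: "\<And>\<omega>. f \<omega> \<le> ennreal B"
  shows "ennreal w0 * (\<integral>\<^sup>+\<omega>. f \<omega> \<partial>P') = (\<integral>\<^sup>+\<omega>. f \<omega> * ennreal (g \<omega>) \<partial>Pr)"
proof -
  interpret P': prob_space P' by fact
  note [measurable_cong] = P'(2)
  have B0: "0 \<le> max B 0" by simp
  have B': "f \<omega> \<le> ennreal (max B 0)" for \<omega>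
    using B[of \<omega>] by (auto intro: order_trans ennreal_leI)
  have fin: "ennreal (enn2real (f \<omega>)) = f \<omega>" for \<omega>
    using B[of \<omega>] by (intro ennreal_enn2real) (auto intro: le_less_trans)
  have real_le: "enn2real (f \<omega>) \<le> max B 0" for \<omega>
    by (rule enn2real_leI[OF B0 B'])
  define \<psi> where "\<psi> \<eta> = enn2real (f (\<lambda>i. if i < m then \<eta> i else return_pmf 0))" for \<eta> :: env
  have \<psi>_eq: "\<psi> (env_prefix m \<omega>) = enn2real (f \<omega>)" for \<omega>
  proof -
    have "f (\<lambda>i. if i < m then env_prefix m \<omega> i else return_pmf 0) = f \<omega>"
      using dep unfolding depends_on_first_def by (auto simp: env_prefix_def)
    then show ?thesis by (simp add: \<psi>_def)
  qed
  have "(\<lambda>\<eta>. \<lambda>i. if i < m then \<eta> i else return_pmf 0) \<in> prefix_space m \<rightarrow>\<^sub>M Pr"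
  proof (rule measurable_PiM_single')
    show "(\<lambda>\<eta>. if i < m then \<eta> i else return_pmf 0) \<in> prefix_space m \<rightarrow>\<^sub>M Q" for i
    proof (cases "i < m")
      case True
      then have "(\<lambda>\<eta>. \<eta> i) \<in> prefix_space m \<rightarrow>\<^sub>M Delta"
        by (intro measurable_component_singleton) auto
      with True show ?thesis by (simp add: measurable_cong_sets[OF refl sets_Q])
    next
      case False
      then show ?thesis
        using sets_eq_imp_space_eq[OF sets_Q] by simp
    qed
  qed (use sets_eq_imp_space_eq[OF sets_Q] in auto)
  from measurable_compose[OF this f] have \<psi>_meas: "\<psi> \<in> borel_measurable (prefix_space m)"
    unfolding \<psi>_def[abs_def] by measurable
  have \<psi>_bdd: "bounded (\<psi> ` space (prefix_space m))"
    by (rule boundedI[of _ "max B 0"]) (auto simp: \<psi>_def real_le)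
  have "(\<integral>\<omega>. 1 \<partial>P') = 1 / w0 * (\<integral>\<omega>. 1 * g \<omega> \<partial>Pr)"
  proof (rule eq)
    show "bounded ((\<lambda>_. 1 :: real) ` space (prefix_space m))"
      by (rule boundedI[of _ 1]) auto
  qed simp
  then have "(\<integral>\<omega>. g \<omega> \<partial>Pr) \<noteq> 0"
    by (auto simp: P'.prob_space)
  then have g_int: "integrable Pr g"
    using not_integrable_integral_eq by blast
  have fg_int: "integrable Pr (\<lambda>\<omega>. enn2real (f \<omega>) * g \<omega>)"
    by (rule Bochner_Integration.integrable_bound[OF integrable_mult_right[OF g_int, of "max B 0"]])
      (auto simp: abs_mult g0 intro!: mult_right_mono real_le)
  have f_int: "integrable P' (\<lambda>\<omega>. enn2real (f \<omega>))"
    by (rule P'.integrable_const_bound[of _ "max B 0"]) (auto simp: real_le)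
  have "(\<integral>\<^sup>+\<omega>. f \<omega> \<partial>P') = (\<integral>\<^sup>+\<omega>. ennreal (enn2real (f \<omega>)) \<partial>P')"
    by (simp add: fin)
  also have "\<dots> = ennreal (\<integral>\<omega>. enn2real (f \<omega>) \<partial>P')"
    using f_int by (intro nn_integral_eq_integral) auto
  also have "(\<integral>\<omega>. enn2real (f \<omega>) \<partial>P') = 1 / w0 * (\<integral>\<omega>. enn2real (f \<omega>) * g \<omega> \<partial>Pr)"
    using eq[OF \<psi>_meas \<psi>_bdd] by (simp add: \<psi>_eq)
  finally have "ennreal w0 * (\<integral>\<^sup>+\<omega>. f \<omega> \<partial>P') = ennreal (w0 * (1 / w0 * (\<integral>\<omega>. enn2real (f \<omega>) * g \<omega> \<partial>Pr)))"
    using w0 by (simp only: ennreal_mult'[OF less_imp_le[OF w0]])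
  also have "\<dots> = ennreal (\<integral>\<omega>. enn2real (f \<omega>) * g \<omega> \<partial>Pr)"
    using w0 by simp
  also have "\<dots> = (\<integral>\<^sup>+\<omega>. ennreal (enn2real (f \<omega>) * g \<omega>) \<partial>Pr)"
    using fg_int g0 by (intro nn_integral_eq_integral[symmetric]) auto
  also have "\<dots> = (\<integral>\<^sup>+\<omega>. f \<omega> * ennreal (g \<omega>) \<partial>Pr)"
    using g0 by (simp add: ennreal_mult fin)
  finally show ?thesis .
qed

lemma conditioned_nonneg_nn_integral:
  assumes P': "conditioned_nonneg Pr 0 P'" and m: "1 \<le> m"
    and f: "f \<in> borel_measurable Pr" "depends_on_first m f" "\<And>\<omega>. f \<omega> \<le> ennreal B"
  shows "(\<integral>\<^sup>+\<omega>. f \<omega> \<partial>P') = (\<integral>\<^sup>+\<omega>. (if stay_nonneg 0 m \<omega> then f \<omega> * ennreal (U (S m \<omega>)) else 0) \<partial>Pr)"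
proof -
  define g where "g \<omega> = (if stay_nonneg 0 m \<omega> then U (S m \<omega>) else 0)" for \<omega>
  have "ennreal 1 * (\<integral>\<^sup>+\<omega>. f \<omega> \<partial>P') = (\<integral>\<^sup>+\<omega>. f \<omega> * ennreal (g \<omega>) \<partial>Pr)"
  proof (rule conditioned_nn_integral[OF _ _ _ _ _ _ f])
    show "prob_space P'" "sets P' = sets Pr"
      using P' by (auto simp: conditioned_nonneg_def sets_Pr)
    show "g \<in> borel_measurable Pr"
      unfolding g_def[abs_def] by measurable
    fix \<psi> :: "env \<Rightarrow> real" assume \<psi>: "\<psi> \<in> borel_measurable (prefix_space m)" "bounded (\<psi> ` space (prefix_space m))"
    have "(\<integral>\<omega>. \<psi> (env_prefix m \<omega>) \<partial>P') = 1 / renewal_U Pr 0 *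
        (LINT \<omega>:{\<omega>. 0 \<le> walk_min 0 m \<omega>}|Pr. \<psi> (env_prefix m \<omega>) * renewal_U Pr (walk 0 m \<omega>))"
      using P' m \<psi> unfolding conditioned_nonneg_def by blast
    also have "(LINT \<omega>:{\<omega>. 0 \<le> walk_min 0 m \<omega>}|Pr. \<psi> (env_prefix m \<omega>) * renewal_U Pr (walk 0 m \<omega>)) =
        (\<integral>\<omega>. \<psi> (env_prefix m \<omega>) * g \<omega> \<partial>Pr)"
      unfolding set_lebesgue_integral_def
    proof (intro Bochner_Integration.integral_cong refl)
      fix \<omega>
      have "stay_nonneg 0 m \<omega> \<Longrightarrow> 0 \<le> S m \<omega>" by (auto simp: stay_nonneg_def)
      then show "indicator {\<omega>. 0 \<le> walk_min 0 m \<omega>} \<omega> *\<^sub>R (\<psi> (env_prefix m \<omega>) * renewal_U Pr (walk 0 m \<omega>)) = \<psi> (env_prefix m \<omega>) * g \<omega>"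
        by (simp add: g_def walk_min_nonneg walk_eq renewal_U_eq indicator_def)
    qed
    finally show "(\<integral>\<omega>. \<psi> (env_prefix m \<omega>) \<partial>P') = 1 / 1 * (\<integral>\<omega>. \<psi> (env_prefix m \<omega>) * g \<omega> \<partial>Pr)"
      by (simp add: renewal_U_eq U_0)
  qed (auto simp: g_def)
  also have "\<dots> = (\<integral>\<^sup>+\<omega>. (if stay_nonneg 0 m \<omega> then f \<omega> * ennreal (U (S m \<omega>)) else 0) \<partial>Pr)"
    by (intro nn_integral_cong) (simp add: g_def)
  finally show ?thesis by simp
qed

lemma conditioned_neg_nn_integral:
  assumes P': "conditioned_neg Pr (- s) P'" and s: "0 < s" and m: "1 \<le> m"
    and f: "f \<in> borel_measurable Pr" "depends_on_first m f" "\<And>\<omega>. f \<omega> \<le> ennreal B"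
  shows "ennreal (V s) * (\<integral>\<^sup>+\<omega>. f \<omega> \<partial>P') = (\<integral>\<^sup>+\<omega>. (if \<forall>j\<le>m. S j \<omega> < s then f \<omega> * ennreal (V (s - S m \<omega>)) else 0) \<partial>Pr)"
proof -
  define g where "g \<omega> = (if \<forall>j\<le>m. S j \<omega> < s then V (s - S m \<omega>) else 0)" for \<omega>
  have below: "stay_below s m \<omega> \<longleftrightarrow> (\<forall>j\<le>m. S j \<omega> < s)" for \<omega>
  proof
    assume *: "stay_below s m \<omega>"
    show "\<forall>j\<le>m. S j \<omega> < s"
    proof (intro allI impI)
      fix j assume "j \<le> m"
      with * s show "S j \<omega> < s" by (cases "j = 0") (auto simp: stay_below_def)
    qed
  qed (auto simp: stay_below_def)
  have "ennreal (V s) * (\<integral>\<^sup>+\<omega>. f \<omega> \<partial>P') = (\<integral>\<^sup>+\<omega>. f \<omega> * ennreal (g \<omega>) \<partial>Pr)"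
  proof (rule conditioned_nn_integral[OF _ _ _ _ _ _ f])
    show "prob_space P'" "sets P' = sets Pr"
      using P' by (auto simp: conditioned_neg_def sets_Pr)
    show "g \<in> borel_measurable Pr"
      unfolding g_def[abs_def] by measurable
    show "0 < V s" using one_le_V[OF s] by simp
    fix \<psi> :: "env \<Rightarrow> real" assume \<psi>: "\<psi> \<in> borel_measurable (prefix_space m)" "bounded (\<psi> ` space (prefix_space m))"
    have "(\<integral>\<omega>. \<psi> (env_prefix m \<omega>) \<partial>P') = 1 / renewal_V Pr (- s) *
        (LINT \<omega>:{\<omega>. walk_max (- s) m \<omega> < 0}|Pr. \<psi> (env_prefix m \<omega>) * renewal_V Pr (walk (- s) m \<omega>))"
      using P' m \<psi> unfolding conditioned_neg_def by blast
    also have "(LINT \<omega>:{\<omega>. walk_max (- s) m \<omega> < 0}|Pr. \<psi> (env_prefix m \<omega>) * renewal_V Pr (walk (- s) m \<omega>)) =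
        (\<integral>\<omega>. \<psi> (env_prefix m \<omega>) * g \<omega> \<partial>Pr)"
      unfolding set_lebesgue_integral_def
    proof (intro Bochner_Integration.integral_cong refl)
      fix \<omega>
      show "indicator {\<omega>. walk_max (- s) m \<omega> < 0} \<omega> *\<^sub>R (\<psi> (env_prefix m \<omega>) * renewal_V Pr (walk (- s) m \<omega>)) = \<psi> (env_prefix m \<omega>) * g \<omega>"
      proof (cases "\<forall>j\<le>m. S j \<omega> < s")
        case True
        then have "S m \<omega> < s" by simp
        then have "renewal_V Pr (walk (- s) m \<omega>) = V (s - S m \<omega>)"
          by (simp add: walk_eq renewal_V_eq)
        with True below[of \<omega>] walk_max_neg[OF m, of "- s" \<omega>] show ?thesis
          by (simp add: g_def)
      next
        case False
        with below[of \<omega>] walk_max_neg[OF m, of "- s" \<omega>] show ?thesis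
          unfolding g_def if_not_P[OF False] by simp
      qed
    qed
    finally show "(\<integral>\<omega>. \<psi> (env_prefix m \<omega>) \<partial>P') = 1 / V s * (\<integral>\<omega>. \<psi> (env_prefix m \<omega>) * g \<omega> \<partial>Pr)"
      using s by (simp add: renewal_V_eq)
  qed (auto simp: g_def)
  also have "\<dots> = (\<integral>\<^sup>+\<omega>. (if \<forall>j\<le>m. S j \<omega> < s then f \<omega> * ennreal (V (s - S m \<omega>)) else 0) \<partial>Pr)"
  proof (intro nn_integral_cong)
    have if_mult: "r * ennreal (if A then t else 0) = (if A then r * ennreal t else 0)" for r A t
      by simp
    show "f \<omega> * ennreal (g \<omega>) = (if \<forall>j\<le>m. S j \<omega> < s then f \<omega> * ennreal (V (s - S m \<omega>)) else 0)" for \<omega>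
      unfolding g_def by (rule if_mult)
  qed
  finally show ?thesis .
qed

lemma reflect_renewal_V:
  "(\<integral>z. indicator {..0} z * (G (- z) * renewal_V Pr z) \<partial>lborel) = (\<integral>y. G y * V y \<partial>lborel)"
proof -
  have "(\<integral>z. indicator {..0} z * (G (- z) * renewal_V Pr z) \<partial>lborel) =
      (\<integral>y. indicator {..0} (0 + (- 1) * y) * (G (- (0 + (- 1) * y)) * renewal_V Pr (0 + (- 1) * y)) \<partial>lborel)"
    by (subst lborel_integral_real_affine[where c = "- 1" and t = 0]) auto
  also have "\<dots> = (\<integral>y. G y * V y + indicator {0} y * (G 0 * renewal_V Pr 0) \<partial>lborel)"
  proof (intro Bochner_Integration.integral_cong refl)
    fix y :: real
    consider "y < 0" | "y = 0" | "0 < y" by linarith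
    then show "indicator {..0} (0 + (- 1) * y) * (G (- (0 + (- 1) * y)) * renewal_V Pr (0 + (- 1) * y)) =
        G y * V y + indicator {0} y * (G 0 * renewal_V Pr 0)"
      by cases (auto simp: V_def renewal_V_eq)
  qed
  also have "\<dots> = (\<integral>y. G y * V y \<partial>lborel)"
  proof -
    have null: "integrable lborel (\<lambda>y. indicator {0} y * r :: real)" "(\<integral>y. indicator {0} y * r \<partial>lborel) = 0" for r
      by auto
    show ?thesis
    proof (cases "integrable lborel (\<lambda>y. G y * V y)")
      case True
      then show ?thesis
        by (subst Bochner_Integration.integral_add[OF True null(1)]) (simp only: null(2) add_0_right)
    next
      case False
      have "\<not> integrable lborel (\<lambda>y. G y * V y + indicator {0} y * (G 0 * renewal_V Pr 0))"
      proof
        assume "integrable lborel (\<lambda>y. G y * V y + indicator {0} y * (G 0 * renewal_V Pr 0))"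
        from Bochner_Integration.integrable_diff[OF this null(1), of "G 0 * renewal_V Pr 0"] False show False
          by simp
      qed
      then show ?thesis
        unfolding not_integrable_integral_eq[OF False] by (rule not_integrable_integral_eq)
    qed
  qed
  finally show ?thesis .
qed

end

lemma (in prob_space) centered_oscillates:
  fixes Y :: "'a \<Rightarrow> real"
  assumes Y: "integrable M Y" "expectation Y = 0" "\<not> (AE x in M. Y x = 0)"
  shows "\<exists>e>0. 0 < \<P>(x in M. e \<le> Y x) \<and> 0 < \<P>(x in M. Y x \<le> - e)"
proof -
  have pos: "\<exists>e>0. 0 < \<P>(x in M. e \<le> Z x)" if Z: "integrable M Z" "expectation Z = 0" "\<not> (AE x in M. Z x = 0)"
    for Z :: "'a \<Rightarrow> real"
  proof (rule ccontr)
    assume not: "\<not> ?thesis"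
    have [measurable]: "Z \<in> borel_measurable M"
      using Z(1) by simp
    have "AE x in M. \<not> inverse (real (Suc n)) \<le> Z x" for n
    proof -
      have "\<P>(x in M. inverse (real (Suc n)) \<le> Z x) = 0"
        using not measure_nonneg[of M "{x \<in> space M. inverse (real (Suc n)) \<le> Z x}"]
        by (metis inverse_positive_iff_positive of_nat_0_less_iff order_le_less zero_less_Suc)
      then show ?thesis
        by (subst (asm) prob_eq_0) (auto simp: AE_conj_iff)
    qed
    then have "AE x in M. \<forall>n. \<not> inverse (real (Suc n)) \<le> Z x"
      by (simp add: AE_all_countable)
    then have "AE x in M. 0 \<le> - Z x"
    proof eventually_elim
      fix x assume *: "\<forall>n. \<not> inverse (real (Suc n)) \<le> Z x"
      show "0 \<le> - Z x"
      proof (rule ccontr)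
        assume "\<not> 0 \<le> - Z x"
        then have "0 < Z x" by simp
        from reals_Archimedean[OF this] * show False
          by (meson less_imp_le)
      qed
    qed
    moreover have "(\<integral>x. - Z x \<partial>M) = 0"
      using Z(2) by simp
    ultimately have "AE x in M. - Z x = 0"
      using Z(1) by (subst (asm) integral_nonneg_eq_0_iff_AE) auto
    with Z(3) show False by simp
  qed
  have "\<not> (AE x in M. - Y x = 0)"
    using Y(3) by simp
  with Y obtain e1 e2 where e: "0 < e1" "0 < \<P>(x in M. e1 \<le> Y x)" "0 < e2" "0 < \<P>(x in M. e2 \<le> - Y x)"
    using pos[of Y] pos[of "\<lambda>x. - Y x"] by auto
  have [measurable]: "Y \<in> borel_measurable M"
    using Y(1) by simp
  have "\<P>(x in M. e1 \<le> Y x) \<le> \<P>(x in M. min e1 e2 \<le> Y x)"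
    "\<P>(x in M. e2 \<le> - Y x) \<le> \<P>(x in M. Y x \<le> - min e1 e2)"
    by (intro finite_measure_mono; force)+
  with e show ?thesis
    by (intro exI[of _ "min e1 e2"]) auto
qed

context env_walk
begin

lemma constant_K_lim:
  assumes K: "is_constant_K Pr c K" and norming: "stable_norming \<alpha> c" and \<theta>: "0 < \<theta>"
  shows "integrable lborel (\<lambda>y. exp (- \<theta> * y) * V y)"
    and "0 \<le> x \<Longrightarrow> (\<lambda>n. real n * c n * (\<integral>\<omega>. (if stay_nonneg x n \<omega> then exp (- \<theta> * (x + S n \<omega>)) else 0) \<partial>Pr))
      \<longlonglongrightarrow> K * U x * (\<integral>y. exp (- \<theta> * y) * V y \<partial>lborel)"
proof -
  define f where "f x n = (\<integral>\<omega>. (if stay_nonneg x n \<omega> then exp (- \<theta> * (x + S n \<omega>)) else 0) \<partial>Pr)" for x n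
  define I where "I = (\<integral>y. exp (- \<theta> * y) * V y \<partial>lborel)"
  have asymp: "f x \<sim>[sequentially] (\<lambda>n. K / (real n * c n) * U x * I)" if "0 \<le> x" for x
  proof -
    have "(LINT \<omega>:{\<omega>. 0 \<le> walk_min x n \<omega>}|Pr. exp (- \<theta> * walk x n \<omega>)) = f x n" for n
      unfolding set_lebesgue_integral_def f_def
      by (intro Bochner_Integration.integral_cong) (auto simp: walk_min_nonneg walk_eq indicator_def)
    moreover have "(LINT z:{..0}|lborel. exp (\<theta> * z) * renewal_V Pr z) = I"
      using reflect_renewal_V[of "\<lambda>y. exp (- \<theta> * y)"] by (simp add: set_lebesgue_integral_def I_def)
    moreover have "(\<lambda>n. LINT \<omega>:{\<omega>. 0 \<le> walk_min x n \<omega>}|Pr. exp (- \<theta> * walk x n \<omega>)) \<sim>[sequentially]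
        (\<lambda>n. K / (real n * c n) * renewal_U Pr x * (LINT z:{..0}|lborel. exp (\<theta> * z) * renewal_V Pr z))"
      using K \<theta> that unfolding is_constant_K_def by blast
    ultimately show ?thesis
      using that by (simp add: renewal_U_eq)
  qed
  have "f 0 n \<noteq> 0" for n
  proof
    assume "f 0 n = 0"
    have le1: "\<bar>if stay_nonneg 0 n \<omega> then exp (- \<theta> * (0 + S n \<omega>)) else 0\<bar> \<le> 1" for \<omega>
      using \<theta> by (auto simp: stay_nonneg_def)
    have "integrable Pr (\<lambda>\<omega>. if stay_nonneg 0 n \<omega> then exp (- \<theta> * (0 + S n \<omega>)) else 0)"
      by (rule seq.P.integrable_const_bound[of _ 1]) (use le1 in auto)
    with \<open>f 0 n = 0\<close> have "AE \<omega> in Pr. (if stay_nonneg 0 n \<omega> then exp (- \<theta> * (0 + S n \<omega>)) else 0) = 0"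
      unfolding f_def by (subst (asm) integral_nonneg_eq_0_iff_AE) auto
    then have "AE \<omega> in Pr. \<not> stay_nonneg 0 n \<omega>"
      by eventually_elim (auto split: if_splits)
    then have "a n = 0"
      unfolding a_def by (subst seq.P.prob_eq_0) auto
    with a_b_pos(1)[of n] show False by simp
  qed
  have "I \<noteq> 0"
  proof
    assume "I = 0"
    with asymp_equivD[OF asymp[OF order_refl]] \<open>\<And>n. f 0 n \<noteq> 0\<close>
    have "(\<lambda>n. 0 :: real) \<longlonglongrightarrow> 1" by simp
    then show False
      using LIMSEQ_unique[OF tendsto_const] by fastforce
  qed
  then show "integrable lborel (\<lambda>y. exp (- \<theta> * y) * V y)"
    unfolding I_def using not_integrable_integral_eq by blast
  assume x: "0 \<le> x"
  have nz: "K * U x * I \<noteq> 0"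
    using K \<open>I \<noteq> 0\<close> one_le_U[OF x] by (auto simp: is_constant_K_def)
  have g_nz: "K / (real n * c n) * U x * I \<noteq> 0" if "1 \<le> n" for n
    using nz stable_norming_pos[OF norming that] that by auto
  have "(\<lambda>n. (if f x n = 0 \<and> K / (real n * c n) * U x * I = 0 then 1 else f x n / (K / (real n * c n) * U x * I)) * (K * U x * I))
      \<longlonglongrightarrow> 1 * (K * U x * I)"
    by (intro tendsto_mult tendsto_const asymp_equivD asymp x)
  moreover have "eventually (\<lambda>n. (if f x n = 0 \<and> K / (real n * c n) * U x * I = 0 then 1 else f x n / (K / (real n * c n) * U x * I)) * (K * U x * I)
      = real n * c n * f x n) sequentially"
  proof (rule eventually_sequentiallyI[of 1])
    fix n :: nat assume n: "1 \<le> n"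
    have "real n * c n \<noteq> 0"
      using stable_norming_pos[OF norming n] n by simp
    with g_nz[OF n] nz show "(if f x n = 0 \<and> K / (real n * c n) * U x * I = 0 then 1 else f x n / (K / (real n * c n) * U x * I)) * (K * U x * I)
      = real n * c n * f x n"
      by simp
  qed
  ultimately have "(\<lambda>n. real n * c n * f x n) \<longlonglongrightarrow> 1 * (K * U x * I)"
    by (rule Lim_transform_eventually)
  then show "(\<lambda>n. real n * c n * (\<integral>\<omega>. (if stay_nonneg x n \<omega> then exp (- \<theta> * (x + S n \<omega>)) else 0) \<partial>Pr))
      \<longlonglongrightarrow> K * U x * (\<integral>y. exp (- \<theta> * y) * V y \<partial>lborel)"
    unfolding f_def I_def by simp
qed

theorem env_limit:
  fixes Pplus :: "env measure" and Pminus :: "real \<Rightarrow> env measure"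
    and w :: "nat \<Rightarrow> env \<Rightarrow> 'w::polish_space" and t :: "nat \<Rightarrow> env \<Rightarrow> 't::polish_space"
    and \<phi> :: "'w \<times> 't \<times> real \<Rightarrow> real"
  assumes \<alpha>: "1 < \<alpha>" "\<alpha> \<le> 2" and attraction: "two_sided_stable_attraction Pr \<alpha> c"
    and Pplus: "conditioned_nonneg Pr 0 Pplus"
    and Pminus: "\<And>x. x \<le> 0 \<Longrightarrow> conditioned_neg Pr x (Pminus x)"
    and K: "is_constant_K Pr c K" and delta: "0 < \<delta>" "\<delta> < 1"
    and w_meas: "\<And>n. 1 \<le> n \<Longrightarrow> w n \<in> prefix_space (nat \<lfloor>\<delta> * real n\<rfloor>) \<rightarrow>\<^sub>M borel"
    and W_meas: "Winf \<in> env_space \<rightarrow>\<^sub>M borel"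
    and W_conv: "AE \<omega> in Pplus. (\<lambda>n. w n (env_prefix (nat \<lfloor>\<delta> * real n\<rfloor>) \<omega>)) \<longlonglongrightarrow> Winf \<omega>"
    and t_meas: "\<And>n. 1 \<le> n \<Longrightarrow> t n \<in> prefix_space (nat \<lfloor>\<delta> * real n\<rfloor>) \<rightarrow>\<^sub>M borel"
    and T_meas: "Tinf \<in> env_space \<rightarrow>\<^sub>M borel"
    and T_conv: "\<And>x. x \<le> 0 \<Longrightarrow> AE \<omega> in Pminus x. (\<lambda>n. t n (env_prefix (nat \<lfloor>\<delta> * real n\<rfloor>) \<omega>)) \<longlonglongrightarrow> Tinf \<omega>"
    and phi_cont: "continuous_on (UNIV \<times> UNIV \<times> {0..}) \<phi>" and theta: "0 < \<theta>"
    and phi_bound: "bdd_above ((\<lambda>(u, v, z). \<bar>\<phi> (u, v, z)\<bar> * exp (\<theta> * z)) ` (UNIV \<times> UNIV \<times> {0..}))"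
  shows "(\<lambda>n. real n * c n * (LINT \<omega>:{\<omega>. 0 \<le> walk_min 0 n \<omega>}|Pr.
      \<phi> (w n (env_prefix (nat \<lfloor>\<delta> * real n\<rfloor>) \<omega>), t n (env_reversed n (nat \<lfloor>\<delta> * real n\<rfloor>) \<omega>), walk 0 n \<omega>)))
    \<longlonglongrightarrow> K * (LINT z:{..0}|lborel. (LINT v|distr (Pminus z) borel Tinf. LINT u|distr Pplus borel Winf. \<phi> (u, v, - z)) * renewal_V Pr z)"
proof -
  obtain \<mu> where \<mu>: "stable_norming \<alpha> c" "stable_law \<alpha> \<mu>" "weak_conv_m (\<lambda>n. distr Pr borel (\<lambda>\<omega>. walk 0 n \<omega> / c n)) \<mu>"
    using attraction unfolding two_sided_stable_attraction_def by blast
  define mm where "mm n = nat \<lfloor>\<delta> * real n\<rfloor>" for n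
  define W where "W n \<omega> = (if n = 0 then undefined else w n (env_prefix (mm n) \<omega>))" for n \<omega>
  define T where "T n \<omega> = (if n = 0 then undefined else t n (env_prefix (mm n) \<omega>))" for n \<omega>
  have prefix_meas: "env_prefix m \<in> Pr \<rightarrow>\<^sub>M prefix_space m" for m
    unfolding env_prefix_def
    by (rule measurable_restrict) (auto simp: measurable_cong_sets[OF refl sets_Q, symmetric])
  have prefix_cong: "env_prefix m \<omega> = env_prefix m \<omega>'" if "\<forall>i<m. \<omega> i = \<omega>' i" for m and \<omega> \<omega>' :: env
    using that by (auto simp: env_prefix_def)
  have mm_le_n: "mm n \<le> n" and mm_real: "real (mm n) \<le> \<delta> * real n" for n
  proof -
    show "real (mm n) \<le> \<delta> * real n"
      unfolding mm_def using delta by (simp add: of_nat_nat)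
    also have "\<dots> \<le> 1 * real n"
      using delta by (intro mult_right_mono) auto
    finally show "mm n \<le> n" by simp
  qed
  interpret conditioned_limits Q log_mean e c \<alpha> K \<mu> Pplus "\<lambda>s. Pminus (- s)" \<theta> mm W Winf T Tinf
  proof (intro conditioned_limits.intro stable_walk.intro conditioned_limits_axioms.intro stable_walk_axioms.intro)
    show "weak_conv_m (\<lambda>n. distr Pr borel (\<lambda>\<omega>. S n \<omega> / c n)) \<mu>"
      using \<mu>(3) by (simp add: walk_eq)
    show "0 < K" using K by (simp add: is_constant_K_def)
    show "integrable lborel (\<lambda>y. exp (- \<theta> * y) * V y)" if "0 < \<theta>" for \<theta>
      by (rule constant_K_lim(1)[OF K \<mu>(1) that])
    show "(\<lambda>n. real n * c n * (\<integral>\<omega>. (if stay_nonneg x n \<omega> then exp (- \<theta> * (x + S n \<omega>)) else 0) \<partial>Pr))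
        \<longlonglongrightarrow> K * U x * (\<integral>y. exp (- \<theta> * y) * V y \<partial>lborel)" if "0 < \<theta>" "0 \<le> x" for \<theta> x
      by (rule constant_K_lim(2)[OF K \<mu>(1) that])
    show "prob_space Pplus" "sets Pplus = sets Pr"
      using Pplus by (auto simp: conditioned_nonneg_def sets_Pr)
    show "(\<integral>\<^sup>+\<omega>. f \<omega> \<partial>Pplus) = (\<integral>\<^sup>+\<omega>. (if stay_nonneg 0 m \<omega> then f \<omega> * ennreal (U (S m \<omega>)) else 0) \<partial>Pr)"
      if "1 \<le> m" "f \<in> borel_measurable Pr" "depends_on_first m f" "\<And>\<omega>. f \<omega> \<le> ennreal B" for m f B
      by (rule conditioned_nonneg_nn_integral[OF Pplus that])
    show "prob_space (Pminus (- s))" "sets (Pminus (- s)) = sets Pr" if "0 < s" for s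
      using Pminus[of "- s"] that by (auto simp: conditioned_neg_def sets_Pr)
    show "ennreal (V s) * (\<integral>\<^sup>+\<omega>. f \<omega> \<partial>Pminus (- s)) = (\<integral>\<^sup>+\<omega>. (if \<forall>j\<le>m. S j \<omega> < s then f \<omega> * ennreal (V (s - S m \<omega>)) else 0) \<partial>Pr)"
      if "0 < s" "1 \<le> m" "f \<in> borel_measurable Pr" "depends_on_first m f" "\<And>\<omega>. f \<omega> \<le> ennreal B" for s m f B
      by (rule conditioned_neg_nn_integral[OF Pminus that]) (use that(1) in simp)
    show "mono mm"
      unfolding mm_def using delta by (intro monoI nat_mono floor_mono mult_left_mono) auto
    show "eventually (\<lambda>n. 1 \<le> mm n) sequentially"
    proof (rule eventually_sequentiallyI[of "nat \<lceil>1 / \<delta>\<rceil>"])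
      fix n assume "nat \<lceil>1 / \<delta>\<rceil> \<le> n"
      then have "1 / \<delta> \<le> real n" by linarith
      then have "1 \<le> \<delta> * real n" using delta by (simp add: field_simps)
      then have "1 \<le> \<lfloor>\<delta> * real n\<rfloor>" by simp
      then show "1 \<le> mm n" unfolding mm_def by linarith
    qed
    obtain p :: nat where p: "1 / (1 - \<delta>) < 2 ^ p"
      using real_arch_pow[of 2 "1 / (1 - \<delta>)"] by auto
    have "n \<le> 2 ^ p * (n - mm n)" for n
    proof -
      have "1 \<le> 2 ^ p * (1 - \<delta>)"
        using p delta by (simp add: field_simps)
      then have "1 * real n \<le> 2 ^ p * (1 - \<delta>) * real n"
        by (intro mult_right_mono) auto
      also have "\<dots> = 2 ^ p * (real n - \<delta> * real n)" by (simp add: algebra_simps)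
      also have "\<dots> \<le> 2 ^ p * (real n - real (mm n))"
        using mm_real[of n] by (intro mult_left_mono) auto
      also have "\<dots> = real (2 ^ p * (n - mm n))"
        using mm_le_n[of n] by (simp add: of_nat_diff)
      finally show ?thesis by (simp only: mult_1 of_nat_le_iff)
    qed
    then show "\<exists>p. eventually (\<lambda>n. n \<le> 2 ^ p * (n - mm n)) sequentially"
      by (intro exI[of _ p] always_eventually allI)
    show "W n \<in> borel_measurable Pr" "T n \<in> borel_measurable Pr" for n
      using measurable_compose[OF prefix_meas w_meas[of n]] measurable_compose[OF prefix_meas t_meas[of n]]
      by (cases "n = 0"; simp add: W_def[abs_def] T_def[abs_def] mm_def)+
    show "Winf \<in> borel_measurable Pr" "Tinf \<in> borel_measurable Pr"
      using W_meas T_meas by (simp_all add: measurable_cong_sets[OF sets_Pr refl])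
    show "depends_on_first (mm n) (W n)" "depends_on_first (mm n) (T n)" for n
      unfolding depends_on_first_def W_def T_def using prefix_cong[of "mm n"] by metis+
    show "AE \<omega> in Pplus. (\<lambda>n. W n \<omega>) \<longlonglongrightarrow> Winf \<omega>"
      using W_conv
    proof eventually_elim
      fix \<omega> assume "(\<lambda>n. w n (env_prefix (nat \<lfloor>\<delta> * real n\<rfloor>) \<omega>)) \<longlonglongrightarrow> Winf \<omega>"
      then show "(\<lambda>n. W n \<omega>) \<longlonglongrightarrow> Winf \<omega>"
        by (rule Lim_transform_eventually, intro eventually_sequentiallyI[of 1]) (simp add: W_def mm_def)
    qed
    show "AE \<omega> in Pminus (- s). (\<lambda>n. T n \<omega>) \<longlonglongrightarrow> Tinf \<omega>" if "0 < s" for s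
    proof -
      have "- s \<le> 0" using that by simp
      from T_conv[OF this] show ?thesis
      proof eventually_elim
        fix \<omega> assume "(\<lambda>n. t n (env_prefix (nat \<lfloor>\<delta> * real n\<rfloor>) \<omega>)) \<longlonglongrightarrow> Tinf \<omega>"
        then show "(\<lambda>n. T n \<omega>) \<longlonglongrightarrow> Tinf \<omega>"
          by (rule Lim_transform_eventually, intro eventually_sequentiallyI[of 1]) (simp add: T_def mm_def)
      qed
    qed
  qed (use \<mu> \<alpha> theta oscillating_walk_axioms in auto)
  obtain C where C: "\<And>x y z. 0 \<le> z \<Longrightarrow> \<bar>\<phi> (x, y, z)\<bar> * exp (\<theta> * z) \<le> C"
    using phi_bound unfolding bdd_above_def by fastforce
  have lim: "(\<lambda>n. D n * (\<integral>\<omega>. (if stay_nonneg 0 n \<omega> then \<phi> (W n \<omega>, T n (rev_seq n \<omega>), S n \<omega>) else 0) \<partial>Pr)) \<longlonglongrightarrow>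
      K * (\<integral>s. (\<integral>\<omega>'. (\<integral>\<omega>. \<phi> (Winf \<omega>, Tinf \<omega>', s) \<partial>Pplus) \<partial>Pminus (- s)) * V s \<partial>lborel)"
    by (rule conditioned_limit[OF phi_cont C])
  have lhs: "eventually (\<lambda>n. D n * (\<integral>\<omega>. (if stay_nonneg 0 n \<omega> then \<phi> (W n \<omega>, T n (rev_seq n \<omega>), S n \<omega>) else 0) \<partial>Pr) =
    real n * c n * (LINT \<omega>:{\<omega>. 0 \<le> walk_min 0 n \<omega>}|Pr.
      \<phi> (w n (env_prefix (nat \<lfloor>\<delta> * real n\<rfloor>) \<omega>), t n (env_reversed n (nat \<lfloor>\<delta> * real n\<rfloor>) \<omega>), walk 0 n \<omega>))) sequentially"
  proof (rule eventually_sequentiallyI[of 1])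
    fix n :: nat assume n: "1 \<le> n"
    have "(\<integral>\<omega>. (if stay_nonneg 0 n \<omega> then \<phi> (W n \<omega>, T n (rev_seq n \<omega>), S n \<omega>) else 0) \<partial>Pr) =
      (LINT \<omega>:{\<omega>. 0 \<le> walk_min 0 n \<omega>}|Pr.
        \<phi> (w n (env_prefix (nat \<lfloor>\<delta> * real n\<rfloor>) \<omega>), t n (env_reversed n (nat \<lfloor>\<delta> * real n\<rfloor>) \<omega>), walk 0 n \<omega>))"
      unfolding set_lebesgue_integral_def mm_def[symmetric]
      using n by (intro Bochner_Integration.integral_cong refl)
        (simp add: walk_min_nonneg walk_eq indicator_def W_def T_def env_reversed_eq[OF mm_le_n])
    then show "D n * (\<integral>\<omega>. (if stay_nonneg 0 n \<omega> then \<phi> (W n \<omega>, T n (rev_seq n \<omega>), S n \<omega>) else 0) \<partial>Pr) =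
      real n * c n * (LINT \<omega>:{\<omega>. 0 \<le> walk_min 0 n \<omega>}|Pr.
        \<phi> (w n (env_prefix (nat \<lfloor>\<delta> * real n\<rfloor>) \<omega>), t n (env_reversed n (nat \<lfloor>\<delta> * real n\<rfloor>) \<omega>), walk 0 n \<omega>))"
      by (simp only: D_def)
  qed
  have inner: "(LINT v|distr (Pminus (- s)) borel Tinf. LINT u|distr Pplus borel Winf. \<phi> (u, v, s)) =
      (\<integral>\<omega>'. (\<integral>\<omega>. \<phi> (Winf \<omega>, Tinf \<omega>', s) \<partial>Pplus) \<partial>Pminus (- s))" if s: "0 < s" for s
  proof -
    note [measurable_cong] = Pm_sets[OF s]
    have "continuous_on UNIV (\<lambda>z. \<phi> (fst z, snd z, s))"
      using s by (intro continuous_on_compose2[OF phi_cont] continuous_intros) auto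
    then have "(\<lambda>z. \<phi> (fst z, snd z, s)) \<in> borel_measurable borel"
      by (rule borel_measurable_continuous_onI)
    then have phi_meas: "(\<lambda>z. \<phi> (fst z, snd z, s)) \<in> borel_measurable (borel \<Otimes>\<^sub>M borel)"
      unfolding borel_prod .
    have phi_u: "(\<lambda>u. \<phi> (u, v, s)) \<in> borel_measurable borel" for v
      using measurable_compose[OF measurable_Pair2'[of v borel borel] phi_meas] by simp
    have Winf_Pp: "Winf \<in> borel_measurable Pplus" and Tinf_Pm: "Tinf \<in> borel_measurable (Pminus (- s))"
      by measurable
    have outer: "(LINT u|distr Pplus borel Winf. \<phi> (u, v, s)) = (\<integral>\<omega>. \<phi> (Winf \<omega>, v, s) \<partial>Pplus)" for v
      by (rule integral_distr[OF Winf_Pp phi_u])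
    have "(\<lambda>v. \<integral>\<omega>. \<phi> (Winf \<omega>, v, s) \<partial>Pplus) \<in> borel_measurable borel"
    proof (rule Pp.borel_measurable_lebesgue_integral)
      have "(\<lambda>z. (Winf (snd z), fst z)) \<in> borel \<Otimes>\<^sub>M Pplus \<rightarrow>\<^sub>M borel \<Otimes>\<^sub>M borel"
        by measurable
      from measurable_compose[OF this phi_meas]
      show "(\<lambda>(v, \<omega>). \<phi> (Winf \<omega>, v, s)) \<in> borel_measurable (borel \<Otimes>\<^sub>M Pplus)"
        by (simp add: split_beta')
    qed
    then show ?thesis
      unfolding outer by (rule integral_distr[OF Tinf_Pm])
  qed
  define G where "G s = (LINT v|distr (Pminus (- s)) borel Tinf. LINT u|distr Pplus borel Winf. \<phi> (u, v, s))" for s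
  have "(LINT z:{..0}|lborel. (LINT v|distr (Pminus z) borel Tinf. LINT u|distr Pplus borel Winf. \<phi> (u, v, - z)) * renewal_V Pr z) =
      (\<integral>s. G s * V s \<partial>lborel)"
    using reflect_renewal_V[of G] by (simp add: set_lebesgue_integral_def G_def)
  also have "\<dots> = (\<integral>s. (\<integral>\<omega>'. (\<integral>\<omega>. \<phi> (Winf \<omega>, Tinf \<omega>', s) \<partial>Pplus) \<partial>Pminus (- s)) * V s \<partial>lborel)"
  proof (intro Bochner_Integration.integral_cong refl)
    show "G s * V s = (\<integral>\<omega>'. (\<integral>\<omega>. \<phi> (Winf \<omega>, Tinf \<omega>', s) \<partial>Pplus) \<partial>Pminus (- s)) * V s" for s
      using inner[of s] by (cases "0 < s") (simp_all add: G_def V_nonpos)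
  qed
  finally have rhs: "(LINT z:{..0}|lborel. (LINT v|distr (Pminus z) borel Tinf. LINT u|distr Pplus borel Winf. \<phi> (u, v, - z)) * renewal_V Pr z) = \<dots>" .
  show ?thesis
    unfolding rhs by (rule Lim_transform_eventually[OF lim lhs])
qed

end

theorem lemma8:
  fixes Q :: "nat pmf measure"
    and \<kappa> \<alpha> \<delta> \<theta> K :: real
    and P :: "env measure"
    and Pplus Pminus :: "real \<Rightarrow> env measure"
    and c :: "nat \<Rightarrow> real"
    and w :: "nat \<Rightarrow> env \<Rightarrow> 'w::polish_space"
    and Winf :: "env \<Rightarrow> 'w"
    and t :: "nat \<Rightarrow> env \<Rightarrow> 't::polish_space"
    and Tinf :: "env \<Rightarrow> 't"
    and \<phi> :: "'w \<times> 't \<times> real \<Rightarrow> real"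
  assumes Q: "prob_space Q" "sets Q = sets Delta"
    and geometric: "AE p in Q. geometric_gf p"
    and subcritical: "integrable Q log_mean" "(LINT p|Q. log_mean p) < 0"
    and kappa: "0 < \<kappa>" "\<kappa> \<le> 1"
      "integrable Q (\<lambda>p. log_mean p * exp (\<kappa> * log_mean p))"
      "(LINT p|Q. log_mean p * exp (\<kappa> * log_mean p)) = 0"
    and P: "tilted_env_law Q \<kappa> P"
    and centered: "integrable P (\<lambda>\<omega>. log_mean (\<omega> 0))" "(LINT \<omega>|P. log_mean (\<omega> 0)) = 0"
    and nonlattice: "nonlattice (distr P borel (\<lambda>\<omega>. log_mean (\<omega> 0)))"
    and alpha: "1 < \<alpha>" "\<alpha> \<le> 2"
    and attraction: "two_sided_stable_attraction P \<alpha> c"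
    and Pplus: "\<And>x. 0 \<le> x \<Longrightarrow> conditioned_nonneg P x (Pplus x)"
    and Pminus: "\<And>x. x \<le> 0 \<Longrightarrow> conditioned_neg P x (Pminus x)"
    and K: "is_constant_K P c K"
    and delta: "0 < \<delta>" "\<delta> < 1"
    and w_meas: "\<And>n. 1 \<le> n \<Longrightarrow> w n \<in> prefix_space (nat \<lfloor>\<delta> * real n\<rfloor>) \<rightarrow>\<^sub>M borel"
    and W_meas: "Winf \<in> env_space \<rightarrow>\<^sub>M borel"
    and W_conv: "AE \<omega> in Pplus 0.
        (\<lambda>n. w n (env_prefix (nat \<lfloor>\<delta> * real n\<rfloor>) \<omega>)) \<longlonglongrightarrow> Winf \<omega>"
    and t_meas: "\<And>n. 1 \<le> n \<Longrightarrow> t n \<in> prefix_space (nat \<lfloor>\<delta> * real n\<rfloor>) \<rightarrow>\<^sub>M borel"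
    and T_meas: "Tinf \<in> env_space \<rightarrow>\<^sub>M borel"
    and T_conv: "\<And>x. x \<le> 0 \<Longrightarrow> AE \<omega> in Pminus x.
        (\<lambda>n. t n (env_prefix (nat \<lfloor>\<delta> * real n\<rfloor>) \<omega>)) \<longlonglongrightarrow> Tinf \<omega>"
    and phi_cont: "continuous_on (UNIV \<times> UNIV \<times> {0..}) \<phi>"
    and theta: "0 < \<theta>"
    and phi_bound: "bdd_above ((\<lambda>(u, v, z). \<bar>\<phi> (u, v, z)\<bar> * exp (\<theta> * z)) ` (UNIV \<times> UNIV \<times> {0..}))"
  shows "(\<lambda>n. real n * c n *
            (LINT \<omega>:{\<omega>. 0 \<le> walk_min 0 n \<omega>}|P.
               \<phi> (w n (env_prefix (nat \<lfloor>\<delta> * real n\<rfloor>) \<omega>),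
                  t n (env_reversed n (nat \<lfloor>\<delta> * real n\<rfloor>) \<omega>),
                  walk 0 n \<omega>)))
         \<longlonglongrightarrow>
         K * (LINT z:{..0}|lborel.
                (LINT v|distr (Pminus z) borel Tinf.
                   LINT u|distr (Pplus 0) borel Winf. \<phi> (u, v, - z)) * renewal_V P z)"
proof -
  interpret PP: prob_space P using P by (simp add: tilted_env_law_def)
  have P_sets [measurable_cong]: "sets P = sets (\<Pi>\<^sub>M i\<in>(UNIV::nat set). Delta)"
    using P by (simp add: tilted_env_law_def env_space_def)
  define Q' where "Q' = distr P Delta (\<lambda>\<omega>. \<omega> 0)"
  have P_eq: "P = (\<Pi>\<^sub>M i\<in>UNIV. Q')"
    unfolding Q'_def by (rule tilted_env_law_iid[OF Q P])
  have sets_Q': "sets Q' = sets Delta" by (simp add: Q'_def)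
  interpret Q': prob_space Q'
    unfolding Q'_def by (rule PP.prob_space_distr) measurable
  interpret iid_walk Q' log_mean
    by unfold_locales (simp add: measurable_cong_sets[OF sets_Q' refl])
  have "\<not> (AE \<omega> in P. log_mean (\<omega> 0) = 0)"
  proof
    assume "AE \<omega> in P. log_mean (\<omega> 0) = 0"
    then have "AE x in distr P borel (\<lambda>\<omega>. log_mean (\<omega> 0)). x = 0"
      by (subst AE_distr_iff) auto
    then have "AE x in distr P borel (\<lambda>\<omega>. log_mean (\<omega> 0)). \<exists>k::int. x = 0 + 1 * of_int k"
      by eventually_elim (auto intro!: exI[of _ 0])
    with nonlattice show False
      unfolding nonlattice_def by (metis zero_less_one)
  qed
  then obtain e where e: "0 < e" "0 < \<P>(\<omega> in P. e \<le> log_mean (\<omega> 0))" "0 < \<P>(\<omega> in P. log_mean (\<omega> 0) \<le> - e)"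
    using PP.centered_oscillates[OF centered] by blast
  interpret env_walk Q' e
  proof unfold_locales
    show "0 < \<P>(\<omega> in Pr. e \<le> S 1 \<omega>)" "0 < \<P>(\<omega> in Pr. S 1 \<omega> \<le> - e)"
      using e unfolding P_eq by (simp_all add: S_def)
  qed (use e sets_Q' in auto)
  show ?thesis
    using attraction Pplus[of 0] Pminus K unfolding P_eq
    by (intro env_limit[OF alpha _ _ _ _ delta w_meas W_meas W_conv t_meas T_meas T_conv phi_cont theta phi_bound]) auto
qed

end
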